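(* Let $\lambda \in \mathbb{Z}_{>0}$ and $X = \mathbb{CP}^1$. Beilinson--Bernstein localisation, i.e. the equivalence $\Gamma(X,-) : \operatorname{Mod}_{qc}(\mathcal{D}_\lambda) \to \operatorname{Mod}(\mathfrak{sl}_2(\mathbb{C}), \chi_\lambda)$, restricts to an equivalence between: (a) the category of $\mathcal{O}$-coherent $\mathcal{D}_\lambda$-modules on $X$ with no singularities; and (b) the (full) subcategory of $\mathfrak{sl}_2(\mathbb{C})$-representations with central character $\chi_\lambda$ which is generated, via (finite) direct sums, by the irreducible finite-dimensional representation of highest weight $\lambda - 1$.
   Context: Let $\mathfrak{sl}_2(\mathbb{C})$ have the standard basis $E=\begin{pmatrix}0&1\\0&0\end{pmatrix}$, $F=\begin{pmatrix}0&0\\1&0\end{pmatrix}$, $H=\begin{pmatrix}1&0\\0&-1\end{pmatrix}$; weights are eigenvalues of $H$, and highest weight vectors are killed by $E$. The group $SL_2(\mathbb{C})$ acts on $X=\mathbb{CP}^1$ by matrix multiplication on homogeneous coordinates. Put $0=[1:0]$, $\infty=[0:1]$, $U_0=X\setminus\{\infty\}$ with coordinate $z=y/x$, and $U_\infty=X\setminus\{0\}$ with coordinate $w=x/y=z^{-1}$. For $n\in\mathbb{Z}$, $\mathcal{O}_n$ is the line bundle on $X$ trivialised on $U_0$ and $U_\infty$, whose sections are pairs $(f,g)$ of functions (on the $U_0$- and $U_\infty$-parts) with $f(z)=z^{n}g(z^{-1})$ on the overlap. The sheaf $\mathcal{D}_\lambda$ of twisted differential operators is the sheaf of differential operators from $\mathcal{O}_{\lambda-1}$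 to itself. There is an algebra homomorphism $\Phi_\lambda:U(\mathfrak{sl}_2)\to\Gamma(X,\mathcal{D}_\lambda)$ given on $U_0$ by $E\mapsto z^2\partial_z-(\lambda-1)z$, $F\mapsto-\partial_z$, $H\mapsto 2z\partial_z-(\lambda-1)$, and on $U_\infty$ by $E\mapsto-\partial_w$, $F\mapsto w^2\partial_w-(\lambda-1)w$, $H\mapsto-2w\partial_w+(\lambda-1)$. Through $\Phi_\lambda$, global sections of a $\mathcal{D}_\lambda$-module form an $\mathfrak{sl}_2$-representation. $\chi_\lambda$ denotes the character of the centre of $U(\mathfrak{sl}_2)$ by which the centre acts on the irreducible representation of highest weight $\lambda-1$ (the Casimir $EF+FE+\tfrac12H^2$ acts by $\tfrac12(\lambda^2-1)$). $\operatorname{Mod}(\mathfrak{sl}_2,\chi_\lambda)$ is the category of $\mathfrak{sl}_2$-representations on which the centre of $U(\mathfrak{sl}_2)$ acts by $\chi_\lambda$, and $\operatorname{Mod}_{qc}(\mathcal{D}_\lambda)$ is the category of quasi-coherent $\mathcal{D}_\lambda$-modules. The Beilinson--Bernstein theorem states that $\Gamma(X,-)$ is an equivalence between these categories, with inverse $\mathcal{D}_\lambda\otimes_{U(\mathfrak{sl}_2)}-$. "$\mathcal{O}$-coherent" means coherent as an $\mathcal{O}_X$-module. A point is a singularity of a holonomic $\mathcal{D}_\lambda$-module if the module is not $\mathcal{O}$-coherent in any neighbourhood of it. *)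

theory Defs
  imports
    "HOL-Analysis.Analysis"
    "HOL-Computational_Algebra.Polynomial"
    "HOL-Algebra.Module"
begin

section \<open>Categories, functors, equivalences\<close>

text \<open>Hom-sets need not be disjoint, so identities, composition and the arrow part of a functor
  take the objects involved as arguments; \<open>ccomp C X Y Z g f\<close> is \<open>g \<circ> f\<close> for
  \<open>f : X \<rightarrow> Y\<close> and \<open>g : Y \<rightarrow> Z\<close>.\<close>

record ('o, 'a) cat =
  cob :: "'o set"
  chom :: "'o \<Rightarrow> 'o \<Rightarrow> 'a set"
  cid :: "'o \<Rightarrow> 'a"
  ccomp :: "'o \<Rightarrow> 'o \<Rightarrow> 'o \<Rightarrow> 'a \<Rightarrow> 'a \<Rightarrow> 'a"

definition is_category :: "('o, 'a) cat \<Rightarrow> bool" where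
  "is_category C \<longleftrightarrow>
     (\<forall>X\<in>cob C. cid C X \<in> chom C X X) \<and>
     (\<forall>X\<in>cob C. \<forall>Y\<in>cob C. \<forall>Z\<in>cob C. \<forall>f\<in>chom C X Y. \<forall>g\<in>chom C Y Z.
        ccomp C X Y Z g f \<in> chom C X Z) \<and>
     (\<forall>X\<in>cob C. \<forall>Y\<in>cob C. \<forall>f\<in>chom C X Y.
        ccomp C X X Y f (cid C X) = f \<and> ccomp C X Y Y (cid C Y) f = f) \<and>
     (\<forall>W\<in>cob C. \<forall>X\<in>cob C. \<forall>Y\<in>cob C. \<forall>Z\<in>cob C.
        \<forall>f\<in>chom C W X. \<forall>g\<in>chom C X Y. \<forall>h\<in>chom C Y Z.
        ccomp C W X Z (ccomp C X Y Z h g) f = ccomp C W Y Z h (ccomp C W X Y g f))"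

definition full_subcat :: "('o, 'a) cat \<Rightarrow> ('o \<Rightarrow> bool) \<Rightarrow> ('o, 'a) cat" where
  "full_subcat C P = C\<lparr>cob := {X \<in> cob C. P X}\<rparr>"

definition is_iso :: "('o, 'a) cat \<Rightarrow> 'o \<Rightarrow> 'o \<Rightarrow> 'a \<Rightarrow> bool" where
  "is_iso C X Y f \<longleftrightarrow> f \<in> chom C X Y \<and>
     (\<exists>g\<in>chom C Y X. ccomp C X Y X g f = cid C X \<and> ccomp C Y X Y f g = cid C Y)"

record ('o, 'a, 'p, 'b) fctr =
  fob :: "'o \<Rightarrow> 'p"
  far :: "'o \<Rightarrow> 'o \<Rightarrow> 'a \<Rightarrow> 'b"

definition is_functor ::
  "('o, 'a) cat \<Rightarrow> ('p, 'b) cat \<Rightarrow> ('o, 'a, 'p, 'b) fctr \<Rightarrow> bool" where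
  "is_functor C D F \<longleftrightarrow>
     (\<forall>X\<in>cob C. fob F X \<in> cob D) \<and>
     (\<forall>X\<in>cob C. \<forall>Y\<in>cob C. \<forall>f\<in>chom C X Y. far F X Y f \<in> chom D (fob F X) (fob F Y)) \<and>
     (\<forall>X\<in>cob C. far F X X (cid C X) = cid D (fob F X)) \<and>
     (\<forall>X\<in>cob C. \<forall>Y\<in>cob C. \<forall>Z\<in>cob C. \<forall>f\<in>chom C X Y. \<forall>g\<in>chom C Y Z.
        far F X Z (ccomp C X Y Z g f) =
          ccomp D (fob F X) (fob F Y) (fob F Z) (far F Y Z g) (far F X Y f))"

definition id_fctr :: "('o, 'a, 'o, 'a) fctr" where
  "id_fctr = \<lparr>fob = (\<lambda>X. X), far = (\<lambda>X Y f. f)\<rparr>"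

definition comp_fctr ::
  "('p, 'b, 'q, 'c) fctr \<Rightarrow> ('o, 'a, 'p, 'b) fctr \<Rightarrow> ('o, 'a, 'q, 'c) fctr" where
  "comp_fctr G F = \<lparr>fob = (\<lambda>X. fob G (fob F X)),
     far = (\<lambda>X Y f. far G (fob F X) (fob F Y) (far F X Y f))\<rparr>"

definition naturally_isomorphic ::
  "('o, 'a) cat \<Rightarrow> ('p, 'b) cat \<Rightarrow> ('o, 'a, 'p, 'b) fctr \<Rightarrow> ('o, 'a, 'p, 'b) fctr \<Rightarrow> bool" where
  "naturally_isomorphic C D F G \<longleftrightarrow>
     (\<exists>\<eta>. (\<forall>X\<in>cob C. is_iso D (fob F X) (fob G X) (\<eta> X)) \<and>
       (\<forall>X\<in>cob C. \<forall>Y\<in>cob C. \<forall>f\<in>chom C X Y.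
          ccomp D (fob F X) (fob F Y) (fob G Y) (\<eta> Y) (far F X Y f) =
          ccomp D (fob F X) (fob G X) (fob G Y) (far G X Y f) (\<eta> X)))"

definition is_equivalence ::
  "('o, 'a) cat \<Rightarrow> ('p, 'b) cat \<Rightarrow> ('o, 'a, 'p, 'b) fctr \<Rightarrow> bool" where
  "is_equivalence C D F \<longleftrightarrow> is_category C \<and> is_category D \<and> is_functor C D F \<and>
     (\<exists>G. is_functor D C G \<and>
        naturally_isomorphic C C id_fctr (comp_fctr G F) \<and>
        naturally_isomorphic D D (comp_fctr F G) id_fctr)"


section \<open>Representations of \<open>sl\<^sub>2(\<complex>)\<close>\<close>

definition complex_ring :: "complex ring" where
  "complex_ring = \<lparr>carrier = UNIV, mult = (*), one = 1, zero = 0, add = (+)\<rparr>"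

datatype sl2_basis = gE | gF | gH

text \<open>As usual for modules in HOL-Algebra, the fields \<open>mult\<close> and \<open>one\<close> inherited from
  the ring record carry no information.\<close>

record 'v sl2rep = "(complex, 'v) module" +
  act :: "sl2_basis \<Rightarrow> 'v \<Rightarrow> 'v"

definition sl2_rep :: "'v sl2rep \<Rightarrow> bool" where
  "sl2_rep V \<longleftrightarrow> Module.module complex_ring V \<and>
     (\<forall>x. act V x \<in> carrier V \<rightarrow> carrier V) \<and>
     (\<forall>x. \<forall>v\<in>carrier V. \<forall>w\<in>carrier V. act V x (v \<oplus>\<^bsub>V\<^esub> w) = act V x v \<oplus>\<^bsub>V\<^esub> act V x w) \<and>
     (\<forall>x c. \<forall>v\<in>carrier V. act V x (c \<odot>\<^bsub>V\<^esub> v) = c \<odot>\<^bsub>V\<^esub> act V x v) \<and>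
     (\<forall>v\<in>carrier V.
        act V gE (act V gF v) \<ominus>\<^bsub>V\<^esub> act V gF (act V gE v) = act V gH v \<and>
        act V gH (act V gE v) \<ominus>\<^bsub>V\<^esub> act V gE (act V gH v) = 2 \<odot>\<^bsub>V\<^esub> act V gE v \<and>
        act V gH (act V gF v) \<ominus>\<^bsub>V\<^esub> act V gF (act V gH v) = (-2) \<odot>\<^bsub>V\<^esub> act V gF v)"

definition rep_hom :: "'v sl2rep \<Rightarrow> 'w sl2rep \<Rightarrow> ('v \<Rightarrow> 'w) set" where
  "rep_hom V W = {f \<in> carrier V \<rightarrow>\<^sub>E carrier W.
     (\<forall>v\<in>carrier V. \<forall>w\<in>carrier V. f (v \<oplus>\<^bsub>V\<^esub> w) = f v \<oplus>\<^bsub>W\<^esub> f w) \<and>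
     (\<forall>c. \<forall>v\<in>carrier V. f (c \<odot>\<^bsub>V\<^esub> v) = c \<odot>\<^bsub>W\<^esub> f v) \<and>
     (\<forall>x. \<forall>v\<in>carrier V. f (act V x v) = act W x (f v))}"

definition rep_isomorphic :: "'v sl2rep \<Rightarrow> 'w sl2rep \<Rightarrow> bool" where
  "rep_isomorphic V W \<longleftrightarrow> (\<exists>f\<in>rep_hom V W. bij_betw f (carrier V) (carrier W))"

definition finite_dim :: "'v sl2rep \<Rightarrow> bool" where
  "finite_dim V \<longleftrightarrow> (\<exists>B. finite B \<and> B \<subseteq> carrier V \<and>
     (\<forall>v\<in>carrier V. \<exists>c. v = finsum V (\<lambda>b. c b \<odot>\<^bsub>V\<^esub> b) B))"

definition irreducible_rep :: "'v sl2rep \<Rightarrow> bool" where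
  "irreducible_rep V \<longleftrightarrow> sl2_rep V \<and> carrier V \<noteq> {\<zero>\<^bsub>V\<^esub>} \<and>
     (\<forall>W. submodule W complex_ring V \<and> (\<forall>x. act V x ` W \<subseteq> W) \<longrightarrow>
        W = {\<zero>\<^bsub>V\<^esub>} \<or> W = carrier V)"

text \<open>For an irreducible representation a highest weight vector generates automatically.\<close>

definition has_highest_weight :: "'v sl2rep \<Rightarrow> complex \<Rightarrow> bool" where
  "has_highest_weight V m \<longleftrightarrow> (\<exists>v\<in>carrier V. v \<noteq> \<zero>\<^bsub>V\<^esub> \<and>
     act V gE v = \<zero>\<^bsub>V\<^esub> \<and> act V gH v = m \<odot>\<^bsub>V\<^esub> v)"

definition rep_power :: "nat \<Rightarrow> 'v sl2rep \<Rightarrow> (nat \<Rightarrow> 'v) sl2rep" where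
  "rep_power n V = \<lparr>carrier = {..<n} \<rightarrow>\<^sub>E carrier V,
     mult = undefined, one = undefined,
     zero = (\<lambda>i\<in>{..<n}. \<zero>\<^bsub>V\<^esub>),
     add = (\<lambda>f g. \<lambda>i\<in>{..<n}. f i \<oplus>\<^bsub>V\<^esub> g i),
     smult = (\<lambda>c f. \<lambda>i\<in>{..<n}. c \<odot>\<^bsub>V\<^esub> f i),
     act = (\<lambda>x f. \<lambda>i\<in>{..<n}. act V x (f i))\<rparr>"


subsection \<open>The universal enveloping algebra and its centre\<close>

text \<open>\<open>U(sl\<^sub>2)\<close> is the quotient of the terms \<open>uterm\<close> by the congruence \<open>ueq\<close> generated by the
  axioms of unital associative \<open>\<complex>\<close>-algebras and the bracket relations of \<open>sl\<^sub>2\<close>.\<close>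

datatype uterm = UConst complex | UGen sl2_basis | UAdd uterm uterm | UMul uterm uterm

inductive ueq :: "uterm \<Rightarrow> uterm \<Rightarrow> bool" where
  refl: "ueq a a"
| sym: "ueq a b \<Longrightarrow> ueq b a"
| trans: "ueq a b \<Longrightarrow> ueq b c \<Longrightarrow> ueq a c"
| add_cong: "ueq a a' \<Longrightarrow> ueq b b' \<Longrightarrow> ueq (UAdd a b) (UAdd a' b')"
| mul_cong: "ueq a a' \<Longrightarrow> ueq b b' \<Longrightarrow> ueq (UMul a b) (UMul a' b')"
| add_assoc: "ueq (UAdd (UAdd a b) c) (UAdd a (UAdd b c))"
| add_commute: "ueq (UAdd a b) (UAdd b a)"
| add_0: "ueq (UAdd (UConst 0) a) a"
| add_neg: "ueq (UAdd a (UMul (UConst (-1)) a)) (UConst 0)"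
| mul_assoc: "ueq (UMul (UMul a b) c) (UMul a (UMul b c))"
| mul_1: "ueq (UMul (UConst 1) a) a"
| distrib_left: "ueq (UMul a (UAdd b c)) (UAdd (UMul a b) (UMul a c))"
| distrib_right: "ueq (UMul (UAdd a b) c) (UAdd (UMul a c) (UMul b c))"
| const_add: "ueq (UAdd (UConst c) (UConst d)) (UConst (c + d))"
| const_mul: "ueq (UMul (UConst c) (UConst d)) (UConst (c * d))"
| const_central: "ueq (UMul (UConst c) a) (UMul a (UConst c))"
| bracket_EF: "ueq (UMul (UGen gE) (UGen gF)) (UAdd (UMul (UGen gF) (UGen gE)) (UGen gH))"
| bracket_HE: "ueq (UMul (UGen gH) (UGen gE))
    (UAdd (UMul (UGen gE) (UGen gH)) (UMul (UConst 2) (UGen gE)))"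
| bracket_HF: "ueq (UMul (UGen gH) (UGen gF))
    (UAdd (UMul (UGen gF) (UGen gH)) (UMul (UConst (-2)) (UGen gF)))"

definition ucentral :: "uterm \<Rightarrow> bool" where
  "ucentral z \<longleftrightarrow> (\<forall>a. ueq (UMul z a) (UMul a z))"

primrec uact :: "'v sl2rep \<Rightarrow> uterm \<Rightarrow> 'v \<Rightarrow> 'v" where
  "uact V (UConst c) v = c \<odot>\<^bsub>V\<^esub> v"
| "uact V (UGen x) v = act V x v"
| "uact V (UAdd a b) v = uact V a v \<oplus>\<^bsub>V\<^esub> uact V b v"
| "uact V (UMul a b) v = uact V a (uact V b v)"

text \<open>The type \<open>nat \<Rightarrow> complex\<close> contains a copy of every vector space of countable dimension,
  hence of every irreducible highest weight representation.\<close>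

definition chi :: "int \<Rightarrow> uterm \<Rightarrow> complex" where
  "chi lam z = (THE c. \<forall>L :: (nat \<Rightarrow> complex) sl2rep.
     irreducible_rep L \<and> has_highest_weight L (of_int (lam - 1)) \<longrightarrow>
       (\<forall>v\<in>carrier L. uact L z v = c \<odot>\<^bsub>L\<^esub> v))"

definition has_central_character :: "int \<Rightarrow> 'v sl2rep \<Rightarrow> bool" where
  "has_central_character lam V \<longleftrightarrow>
     (\<forall>z. ucentral z \<longrightarrow> (\<forall>v\<in>carrier V. uact V z v = chi lam z \<odot>\<^bsub>V\<^esub> v))"

definition Mod_sl2 :: "int \<Rightarrow> ('v sl2rep, 'v \<Rightarrow> 'v) cat" where
  "Mod_sl2 lam = \<lparr>cob = {V. sl2_rep V \<and> has_central_character lam V},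
     chom = rep_hom,
     cid = (\<lambda>V. \<lambda>v\<in>carrier V. v),
     ccomp = (\<lambda>U V W g f. compose (carrier U) g f)\<rparr>"

text \<open>The representations that are isomorphic to a finite (possibly empty) direct sum of copies of
  the irreducible finite-dimensional representation of highest weight \<open>lam - 1\<close>.\<close>

definition sum_of_irrep :: "int \<Rightarrow> 'v sl2rep \<Rightarrow> bool" where
  "sum_of_irrep lam V \<longleftrightarrow> (\<exists>(L :: (nat \<Rightarrow> complex) sl2rep) n.
     irreducible_rep L \<and> finite_dim L \<and> has_highest_weight L (of_int (lam - 1)) \<and>
     rep_isomorphic V (rep_power n L))"


section \<open>The projective line and its line bundles\<close>

text \<open>\<open>Aff z\<close> is \<open>[1 : z]\<close> and \<open>Infty\<close> is \<open>[0 : 1]\<close>; \<open>chart_inf w\<close> is \<open>[w : 1]\<close>.\<close>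

datatype p1 = Aff complex | Infty

definition chart_inf :: "complex \<Rightarrow> p1" where
  "chart_inf w = (if w = 0 then Infty else Aff (inverse w))"

definition part0 :: "p1 set \<Rightarrow> complex set" where
  "part0 U = {z. Aff z \<in> U}"

definition part_inf :: "p1 set \<Rightarrow> complex set" where
  "part_inf U = {w. chart_inf w \<in> U}"

definition zariski_open :: "p1 set \<Rightarrow> bool" where
  "zariski_open U \<longleftrightarrow> U = {} \<or> finite (- U)"

definition opens :: "p1 set \<Rightarrow> p1 set set" where
  "opens U = {V. zariski_open V \<and> V \<subseteq> U}"

text \<open>An open subset of the projective line is affine iff it is proper.\<close>

definition affine_open :: "p1 set \<Rightarrow> bool" where
  "affine_open U \<longleftrightarrow> zariski_open U \<and> U \<noteq> UNIV"

text \<open>Functions on a part of the line are represented by total functions vanishing outside it.\<close>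

definition regular_on :: "complex set \<Rightarrow> (complex \<Rightarrow> complex) \<Rightarrow> bool" where
  "regular_on S f \<longleftrightarrow> (\<forall>z. z \<notin> S \<longrightarrow> f z = 0) \<and>
     (\<forall>z\<in>S. \<exists>p q. poly q z \<noteq> 0 \<and> (\<forall>y\<in>S. poly q y \<noteq> 0 \<longrightarrow> f y = poly p y / poly q y))"

definition str_sheaf :: "p1 set \<Rightarrow> (p1 \<Rightarrow> complex) set" where
  "str_sheaf U = {h. regular_on (part0 U) (\<lambda>z. h (Aff z)) \<and>
     regular_on (part_inf U) (\<lambda>w. h (chart_inf w))}"

type_synonym lsec = "(complex \<Rightarrow> complex) \<times> (complex \<Rightarrow> complex)"

definition line_bundle :: "int \<Rightarrow> p1 set \<Rightarrow> lsec set" where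
  "line_bundle n U = {(f, g). regular_on (part0 U) f \<and> regular_on (part_inf U) g \<and>
     (\<forall>z\<in>part0 U. z \<noteq> 0 \<longrightarrow> f z = z powi n * g (inverse z))}"


section \<open>Twisted differential operators\<close>

text \<open>A section over \<open>U\<close> of the sheaf of differential operators from \<open>O\<^sub>n\<close> to itself, where
  \<open>n = lam - 1\<close>, is a family of operators on the sections over the open subsets of \<open>U\<close>
  which in the two trivialisations are of the form \<open>\<Sum>i<k. a\<^sub>i \<partial>\<^sup>i\<close> with regular coefficients.\<close>

type_synonym dop = "p1 set \<Rightarrow> lsec \<Rightarrow> lsec"

definition tdo_carrier :: "int \<Rightarrow> p1 set \<Rightarrow> dop set" where
  "tdo_carrier lam U =
     {P \<in> (\<Pi>\<^sub>E V\<in>opens U. line_bundle (lam - 1) V \<rightarrow>\<^sub>E line_bundle (lam - 1) V).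
       \<exists>k a b. (\<forall>i<k. regular_on (part0 U) (a i) \<and> regular_on (part_inf U) (b i)) \<and>
         (\<forall>V\<in>opens U. \<forall>s\<in>line_bundle (lam - 1) V.
            (\<forall>z\<in>part0 V. fst (P V s) z = (\<Sum>i<k. a i z * (deriv ^^ i) (fst s) z)) \<and>
            (\<forall>w\<in>part_inf V. snd (P V s) w = (\<Sum>i<k. b i w * (deriv ^^ i) (snd s) w)))}"

definition tdo :: "int \<Rightarrow> p1 set \<Rightarrow> dop ring" where
  "tdo lam U = \<lparr>carrier = tdo_carrier lam U,
     mult = (\<lambda>P Q. \<lambda>V\<in>opens U. compose (line_bundle (lam - 1) V) (P V) (Q V)),
     one = (\<lambda>V\<in>opens U. \<lambda>s\<in>line_bundle (lam - 1) V. s),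
     zero = (\<lambda>V\<in>opens U. \<lambda>s\<in>line_bundle (lam - 1) V. (\<lambda>z. 0, \<lambda>w. 0)),
     add = (\<lambda>P Q. \<lambda>V\<in>opens U. \<lambda>s\<in>line_bundle (lam - 1) V.
       (\<lambda>z. fst (P V s) z + fst (Q V s) z, \<lambda>w. snd (P V s) w + snd (Q V s) w))\<rparr>"

definition tdo_res :: "p1 set \<Rightarrow> dop \<Rightarrow> dop" where
  "tdo_res V P = restrict P (opens V)"

text \<open>Multiplication by the function \<open>h\<close>, giving the inclusion of the structure sheaf.\<close>

definition mulop :: "int \<Rightarrow> p1 set \<Rightarrow> (p1 \<Rightarrow> complex) \<Rightarrow> dop" where
  "mulop lam U h = (\<lambda>V\<in>opens U. \<lambda>s\<in>line_bundle (lam - 1) V.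
     (\<lambda>z. h (Aff z) * fst s z, \<lambda>w. h (chart_inf w) * snd s w))"

text \<open>The global operator given by the operators \<open>A\<close> and \<open>B\<close> in the two trivialisations.\<close>

definition global_op :: "int \<Rightarrow> ((complex \<Rightarrow> complex) \<Rightarrow> complex \<Rightarrow> complex) \<Rightarrow>
    ((complex \<Rightarrow> complex) \<Rightarrow> complex \<Rightarrow> complex) \<Rightarrow> dop" where
  "global_op lam A B = (\<lambda>V\<in>opens UNIV. \<lambda>s\<in>line_bundle (lam - 1) V.
     (\<lambda>z. if z \<in> part0 V then A (fst s) z else 0,
      \<lambda>w. if w \<in> part_inf V then B (snd s) w else 0))"

primrec Phi :: "int \<Rightarrow> sl2_basis \<Rightarrow> dop" where
  "Phi lam gE = global_op lam
     (\<lambda>f z. z\<^sup>2 * deriv f z - of_int (lam - 1) * z * f z)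
     (\<lambda>g w. - deriv g w)"
| "Phi lam gF = global_op lam
     (\<lambda>f z. - deriv f z)
     (\<lambda>g w. w\<^sup>2 * deriv g w - of_int (lam - 1) * w * g w)"
| "Phi lam gH = global_op lam
     (\<lambda>f z. 2 * z * deriv f z - of_int (lam - 1) * f z)
     (\<lambda>g w. - 2 * w * deriv g w + of_int (lam - 1) * g w)"


section \<open>Modules over the sheaf of twisted differential operators\<close>

definition left_module :: "('r, 'x) ring_scheme \<Rightarrow> ('r, 'm, 'y) module_scheme \<Rightarrow> bool" where
  "left_module R M \<longleftrightarrow> abelian_group M \<and>
     (\<forall>a\<in>carrier R. \<forall>m\<in>carrier M. a \<odot>\<^bsub>M\<^esub> m \<in> carrier M) \<and>
     (\<forall>a\<in>carrier R. \<forall>b\<in>carrier R. \<forall>m\<in>carrier M.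
        (a \<oplus>\<^bsub>R\<^esub> b) \<odot>\<^bsub>M\<^esub> m = a \<odot>\<^bsub>M\<^esub> m \<oplus>\<^bsub>M\<^esub> b \<odot>\<^bsub>M\<^esub> m) \<and>
     (\<forall>a\<in>carrier R. \<forall>m\<in>carrier M. \<forall>n\<in>carrier M.
        a \<odot>\<^bsub>M\<^esub> (m \<oplus>\<^bsub>M\<^esub> n) = a \<odot>\<^bsub>M\<^esub> m \<oplus>\<^bsub>M\<^esub> a \<odot>\<^bsub>M\<^esub> n) \<and>
     (\<forall>a\<in>carrier R. \<forall>b\<in>carrier R. \<forall>m\<in>carrier M.
        (a \<otimes>\<^bsub>R\<^esub> b) \<odot>\<^bsub>M\<^esub> m = a \<odot>\<^bsub>M\<^esub> (b \<odot>\<^bsub>M\<^esub> m)) \<and>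
     (\<forall>m\<in>carrier M. \<one>\<^bsub>R\<^esub> \<odot>\<^bsub>M\<^esub> m = m)"

record 'v dmod =
  secs :: "p1 set \<Rightarrow> (dop, 'v) module"
  res :: "p1 set \<Rightarrow> p1 set \<Rightarrow> 'v \<Rightarrow> 'v"

definition D_presheaf :: "int \<Rightarrow> 'v dmod \<Rightarrow> bool" where
  "D_presheaf lam M \<longleftrightarrow>
     (\<forall>U\<in>opens UNIV. left_module (tdo lam U) (secs M U)) \<and>
     (\<forall>U\<in>opens UNIV. \<forall>V\<in>opens U. res M U V \<in> carrier (secs M U) \<rightarrow> carrier (secs M V)) \<and>
     (\<forall>U\<in>opens UNIV. \<forall>V\<in>opens U. \<forall>m\<in>carrier (secs M U). \<forall>n\<in>carrier (secs M U).
        res M U V (m \<oplus>\<^bsub>secs M U\<^esub> n) = res M U V m \<oplus>\<^bsub>secs M V\<^esub> res M U V n) \<and>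
     (\<forall>U\<in>opens UNIV. \<forall>V\<in>opens U. \<forall>P\<in>carrier (tdo lam U). \<forall>m\<in>carrier (secs M U).
        res M U V (P \<odot>\<^bsub>secs M U\<^esub> m) = tdo_res V P \<odot>\<^bsub>secs M V\<^esub> res M U V m) \<and>
     (\<forall>U\<in>opens UNIV. \<forall>m\<in>carrier (secs M U). res M U U m = m) \<and>
     (\<forall>U\<in>opens UNIV. \<forall>V\<in>opens U. \<forall>W\<in>opens V. \<forall>m\<in>carrier (secs M U).
        res M V W (res M U V m) = res M U W m)"

definition sheaf_condition :: "'v dmod \<Rightarrow> bool" where
  "sheaf_condition M \<longleftrightarrow> (\<forall>\<V>\<subseteq>opens UNIV. \<forall>s.
     (\<forall>V\<in>\<V>. s V \<in> carrier (secs M V)) \<and>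
     (\<forall>V\<in>\<V>. \<forall>W\<in>\<V>. res M V (V \<inter> W) (s V) = res M W (V \<inter> W) (s W)) \<longrightarrow>
     (\<exists>!m. m \<in> carrier (secs M (\<Union>\<V>)) \<and> (\<forall>V\<in>\<V>. res M (\<Union>\<V>) V m = s V)))"

definition D_module :: "int \<Rightarrow> 'v dmod \<Rightarrow> bool" where
  "D_module lam M \<longleftrightarrow> D_presheaf lam M \<and> sheaf_condition M"

text \<open>For an affine open set \<open>U\<close>: the restriction of \<open>M\<close> to \<open>U\<close> is the sheaf associated with the
  module \<open>M(U)\<close>, i.e. for every \<open>h \<in> O(U)\<close> the canonical map from the localisation
  \<open>M(U)\<^sub>h\<close> to \<open>M(U\<^sub>h)\<close>, where \<open>U\<^sub>h\<close> is the non-vanishing locus of \<open>h\<close>, is injective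
  and surjective.\<close>

definition associated_on :: "int \<Rightarrow> 'v dmod \<Rightarrow> p1 set \<Rightarrow> bool" where
  "associated_on lam M U \<longleftrightarrow> (\<forall>h\<in>str_sheaf U. let Uh = {p\<in>U. h p \<noteq> 0} in
     (\<forall>m\<in>carrier (secs M U). res M U Uh m = \<zero>\<^bsub>secs M Uh\<^esub> \<longrightarrow>
        (\<exists>k. mulop lam U (\<lambda>p. h p ^ k) \<odot>\<^bsub>secs M U\<^esub> m = \<zero>\<^bsub>secs M U\<^esub>)) \<and>
     (\<forall>t\<in>carrier (secs M Uh). \<exists>k. \<exists>m\<in>carrier (secs M U).
        res M U Uh m = mulop lam Uh (\<lambda>p. h p ^ k) \<odot>\<^bsub>secs M Uh\<^esub> t))"

definition finitely_generated_on :: "int \<Rightarrow> 'v dmod \<Rightarrow> p1 set \<Rightarrow> bool" where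
  "finitely_generated_on lam M U \<longleftrightarrow> (\<exists>B. finite B \<and> B \<subseteq> carrier (secs M U) \<and>
     (\<forall>m\<in>carrier (secs M U). \<exists>h. (\<forall>b\<in>B. h b \<in> str_sheaf U) \<and>
        m = finsum (secs M U) (\<lambda>b. mulop lam U (h b) \<odot>\<^bsub>secs M U\<^esub> b) B))"

definition quasi_coherent :: "int \<Rightarrow> 'v dmod \<Rightarrow> bool" where
  "quasi_coherent lam M \<longleftrightarrow> (\<forall>U. affine_open U \<longrightarrow> associated_on lam M U)"

text \<open>Coherence as an \<open>O\<close>-module of the restriction of \<open>M\<close> to the open set \<open>W\<close>; the projective
  line being noetherian, coherent modules over the rings \<open>O(U)\<close> are the finitely generated ones.\<close>

definition O_coherent_on :: "int \<Rightarrow> 'v dmod \<Rightarrow> p1 set \<Rightarrow> bool" where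
  "O_coherent_on lam M W \<longleftrightarrow>
     (\<forall>U. affine_open U \<and> U \<subseteq> W \<longrightarrow> associated_on lam M U \<and> finitely_generated_on lam M U)"

definition singularity :: "int \<Rightarrow> 'v dmod \<Rightarrow> p1 \<Rightarrow> bool" where
  "singularity lam M p \<longleftrightarrow> \<not> (\<exists>W. zariski_open W \<and> p \<in> W \<and> O_coherent_on lam M W)"

definition dmod_hom :: "int \<Rightarrow> 'v dmod \<Rightarrow> 'w dmod \<Rightarrow> (p1 set \<Rightarrow> 'v \<Rightarrow> 'w) set" where
  "dmod_hom lam M N =
     {\<phi> \<in> (\<Pi>\<^sub>E U\<in>opens UNIV. carrier (secs M U) \<rightarrow>\<^sub>E carrier (secs N U)).
       (\<forall>U\<in>opens UNIV. \<forall>m\<in>carrier (secs M U). \<forall>n\<in>carrier (secs M U).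
          \<phi> U (m \<oplus>\<^bsub>secs M U\<^esub> n) = \<phi> U m \<oplus>\<^bsub>secs N U\<^esub> \<phi> U n) \<and>
       (\<forall>U\<in>opens UNIV. \<forall>P\<in>carrier (tdo lam U). \<forall>m\<in>carrier (secs M U).
          \<phi> U (P \<odot>\<^bsub>secs M U\<^esub> m) = P \<odot>\<^bsub>secs N U\<^esub> \<phi> U m) \<and>
       (\<forall>U\<in>opens UNIV. \<forall>V\<in>opens U. \<forall>m\<in>carrier (secs M U).
          \<phi> V (res M U V m) = res N U V (\<phi> U m))}"

definition Mod_qc :: "int \<Rightarrow> ('v dmod, p1 set \<Rightarrow> 'v \<Rightarrow> 'v) cat" where
  "Mod_qc lam = \<lparr>cob = {M. D_module lam M \<and> quasi_coherent lam M},
     chom = dmod_hom lam,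
     cid = (\<lambda>M. \<lambda>U\<in>opens UNIV. \<lambda>m\<in>carrier (secs M U). m),
     ccomp = (\<lambda>L M N \<psi> \<phi>. \<lambda>U\<in>opens UNIV. compose (carrier (secs L U)) (\<psi> U) (\<phi> U))\<rparr>"


section \<open>Global sections\<close>

definition global_sections :: "int \<Rightarrow> 'v dmod \<Rightarrow> 'v sl2rep" where
  "global_sections lam M = \<lparr>carrier = carrier (secs M UNIV),
     mult = undefined, one = undefined,
     zero = \<zero>\<^bsub>secs M UNIV\<^esub>,
     add = add (secs M UNIV),
     smult = (\<lambda>c m. mulop lam UNIV (\<lambda>_. c) \<odot>\<^bsub>secs M UNIV\<^esub> m),
     act = (\<lambda>x m. Phi lam x \<odot>\<^bsub>secs M UNIV\<^esub> m)\<rparr>"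

definition Gamma_functor ::
  "int \<Rightarrow> ('v dmod, p1 set \<Rightarrow> 'v \<Rightarrow> 'v, 'v sl2rep, 'v \<Rightarrow> 'v) fctr" where
  "Gamma_functor lam = \<lparr>fob = global_sections lam, far = (\<lambda>M N \<phi>. \<phi> UNIV)\<rparr>"

end

theory Submission
  imports Defs "HOL-Computational_Algebra.Fundamental_Theorem_Algebra"
begin

text \<open>On each of the two charts an \<open>O\<close>-coherent module is a module over the Weyl algebra that is finitely
  generated over \<open>\<complex>[t]\<close>. It is torsion free, since its torsion is stable under \<open>\<partial>\<close> and killed by a polynomial.
  On the overlap the Euler operators of the two charts agree up to sign and a constant, so the orbit of a
  section under \<open>t\<partial>\<close> has bounded pole order at the missing point and spans a finite-dimensional space;
  therefore \<open>\<partial>\<close> is locally nilpotent and the module has a basis of horizontal sections. A horizontal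
  section on one chart becomes horizontal on the other after multiplication by \<open>t\<^bsup>lam-1\<^esup>\<close>, so the module
  is a sum of copies of \<open>O\<^bsub>lam-1\<^esub>\<close>, whose global sections, the polynomials of degree less than \<open>lam\<close>, form
  the irreducible representation. On both sides the homomorphisms between sums of copies are the complex
  matrices, so the functor is fully faithful on these objects, and it is clearly essentially surjective.\<close>

section \<open>Rational functions on cofinite sets\<close>

text \<open>The equivalence of Beilinson and Bernstein is not invoked; the inverse functor comes
  from a general criterion for equivalences of categories. Local nilpotency of \<open>D\<close> is
  an eigenvalue argument. Some polynomial in the Euler operator kills a given section; its roots are
  split off one by one, and as \<open>D\<close> lowers eigenvalues by one, a high power of
  \<open>D\<close> leaves an eigenvalue that is not a natural number. Such an eigenvector is
  divisible by every power of the coordinate, hence zero in a finitely generated module. Natural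
  eigenvalues instead yield powers of the coordinate times horizontal sections; the passage between
  charts meets the eigenvalue \<open>lam - 1 + a\<close>, natural since \<open>lam > 0\<close>.
  Torsion-freeness makes restriction to the overlap injective, so that identities between sections
  can be checked where both coordinates are invertible. On the algebraic side \<open>chi\<close> is
  a definite description over all irreducible representations of the given highest weight, which
  forces a proof that they are isomorphic.\<close>

definition rat :: "complex set \<Rightarrow> (complex \<Rightarrow> complex) \<Rightarrow> bool" where
  "rat S f \<longleftrightarrow> (\<exists>p q. \<forall>z\<in>S. poly q z \<noteq> 0 \<and> f z = poly p z / poly q z)"

text \<open>The Zariski open subsets of the affine line.\<close>

definition cof :: "complex set \<Rightarrow> bool" where
  "cof S \<longleftrightarrow> S = {} \<or> finite (- S)"

lemma ratI: "(\<And>z. z \<in> S \<Longrightarrow> poly q z \<noteq> 0 \<and> f z = poly p z / poly q z) \<Longrightarrow> rat S f"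
  unfolding rat_def by blast

lemma rat_empty [simp]: "rat {} f"
  by (simp add: rat_def)

lemma rat_subset: "rat S f \<Longrightarrow> T \<subseteq> S \<Longrightarrow> rat T f"
  unfolding rat_def by blast

lemma rat_cong: "(\<And>z. z \<in> S \<Longrightarrow> f z = g z) \<Longrightarrow> rat S f \<longleftrightarrow> rat S g"
  unfolding rat_def by simp

lemma rat_poly: "rat S (poly p)"
  by (rule ratI[of _ 1 _ p]) simp

lemma rat_const: "rat S (\<lambda>z. k)"
  by (rule ratI[of _ 1 _ "[:k:]"]) simp

lemma rat_id: "rat S (\<lambda>z. z)"
  by (rule ratI[of _ 1 _ "[:0,1:]"]) simp

lemma rat_add:
  assumes "rat S f" "rat S g" shows "rat S (\<lambda>z. f z + g z)"
proof -
  obtain p q where 1: "\<And>z. z \<in> S \<Longrightarrow> poly q z \<noteq> 0 \<and> f z = poly p z / poly q z"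
    using assms(1) unfolding rat_def by blast
  obtain p' q' where 2: "\<And>z. z \<in> S \<Longrightarrow> poly q' z \<noteq> 0 \<and> g z = poly p' z / poly q' z"
    using assms(2) unfolding rat_def by blast
  show ?thesis
    by (rule ratI[of _ "q * q'" _ "p * q' + p' * q"]) (use 1 2 in \<open>simp add: add_frac_eq\<close>)
qed

lemma rat_mult:
  assumes "rat S f" "rat S g" shows "rat S (\<lambda>z. f z * g z)"
proof -
  obtain p q where 1: "\<And>z. z \<in> S \<Longrightarrow> poly q z \<noteq> 0 \<and> f z = poly p z / poly q z"
    using assms(1) unfolding rat_def by blast
  obtain p' q' where 2: "\<And>z. z \<in> S \<Longrightarrow> poly q' z \<noteq> 0 \<and> g z = poly p' z / poly q' z"
    using assms(2) unfolding rat_def by blast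
  show ?thesis
    by (rule ratI[of _ "q * q'" _ "p * p'"]) (use 1 2 in simp)
qed

lemma rat_uminus: "rat S f \<Longrightarrow> rat S (\<lambda>z. - f z)"
  using rat_mult[OF rat_const[of S "-1"], of f] by simp

lemma rat_diff: "rat S f \<Longrightarrow> rat S g \<Longrightarrow> rat S (\<lambda>z. f z - g z)"
  using rat_add[OF _ rat_uminus, of S f g] by simp

lemma rat_power: "rat S f \<Longrightarrow> rat S (\<lambda>z. f z ^ k)"
  by (induction k) (simp_all add: rat_const rat_mult)

lemma rat_sum: "(\<And>i. i \<in> I \<Longrightarrow> rat S (f i)) \<Longrightarrow> rat S (\<lambda>z. \<Sum>i\<in>I. f i z)"
  by (induction I rule: infinite_finite_induct) (simp_all add: rat_const rat_add)

lemma rat_inverse: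
  assumes "rat S f" "\<And>z. z \<in> S \<Longrightarrow> f z \<noteq> 0" shows "rat S (\<lambda>z. inverse (f z))"
proof -
  obtain p q where 1: "\<And>z. z \<in> S \<Longrightarrow> poly q z \<noteq> 0 \<and> f z = poly p z / poly q z"
    using assms(1) unfolding rat_def by blast
  show ?thesis
    by (rule ratI[of _ p _ q]) (use 1 assms(2) in force)
qed

lemma rat_divide:
  "\<lbrakk>rat S f; rat S g; (\<And>z. z \<in> S \<Longrightarrow> g z \<noteq> 0)\<rbrakk> \<Longrightarrow> rat S (\<lambda>z. f z / g z)"
  using rat_mult[OF _ rat_inverse, of S f g] by (simp add: divide_inverse)

lemma rat_powi: "0 \<notin> S \<Longrightarrow> rat S (\<lambda>z. z powi k)"
  by (cases "k \<ge> 0") (auto simp: power_int_def intro!: rat_power rat_id rat_inverse)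

text \<open>\<open>poly r (inverse w)\<close> is the reflected polynomial divided by
  \<open>w ^ degree r\<close>; the two monomials in the witnesses clear these powers of
  \<open>w\<close> from numerator and denominator.\<close>

lemma rat_compose_inverse:
  assumes "rat S f" "\<And>w. w \<in> T \<Longrightarrow> w \<noteq> 0 \<and> inverse w \<in> S"
  shows "rat T (\<lambda>w. f (inverse w))"
proof -
  obtain p q where 1: "\<And>z. z \<in> S \<Longrightarrow> poly q z \<noteq> 0 \<and> f z = poly p z / poly q z"
    using assms(1) unfolding rat_def by blast
  have eq: "poly r (inverse w) = poly (reflect_poly r) w / w ^ degree r" if "w \<noteq> 0" for r and w :: complex
    using that poly_reflect_poly_nz[of "inverse w" r] poly_reflect_poly_nz[of w r]
    by (simp add: field_simps)
  show ?thesis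
  proof (rule ratI[of _ "reflect_poly q * monom 1 (degree p)" _ "reflect_poly p * monom 1 (degree q)"])
    fix w assume "w \<in> T"
    then have w: "w \<noteq> 0" "inverse w \<in> S" using assms(2) by auto
    show "poly (reflect_poly q * monom 1 (degree p)) w \<noteq> 0 \<and> f (inverse w) =
       poly (reflect_poly p * monom 1 (degree q)) w / poly (reflect_poly q * monom 1 (degree p)) w"
      using 1[OF w(2)] w(1) eq[OF w(1), of p] eq[OF w(1), of q]
      by (auto simp: poly_monom field_simps)
  qed
qed

section \<open>From local to global quotients, and the identity theorem\<close>

lemma poly_eq_if_eq_infinite:
  fixes p q :: "complex poly"
  assumes "infinite S" "\<And>z. z \<in> S \<Longrightarrow> poly p z = poly q z" shows "p = q"
proof (rule ccontr)
  assume "p \<noteq> q"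
  then have "finite {z. poly (p - q) z = 0}" by (intro poly_roots_finite) simp
  moreover have "S \<subseteq> {z. poly (p - q) z = 0}" using assms(2) by auto
  ultimately show False using assms(1) finite_subset by blast
qed

lemma infinite_cofinite: "finite (- S) \<Longrightarrow> infinite (S :: complex set)"
  by (metis finite_compl infinite_UNIV_char_0)

lemma cof_open: "cof S \<Longrightarrow> open S"
  unfolding cof_def by (metis closed_def double_complement finite_imp_closed open_empty)

text \<open>Among all quotients that represent \<open>f\<close> wherever their denominator is
  nonzero, take one with denominator of least degree. If it vanished at a point \<open>z\<close> of
  \<open>S\<close>, comparison with a quotient valid near \<open>z\<close> would show that numerator
  and denominator share the factor \<open>X - z\<close>, and cancelling it would lower the
  degree.\<close>

lemma regular_on_rat:
  assumes "cof S" "regular_on S f" shows "rat S f"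
proof (cases "S = {}")
  case False
  then have "finite (- S)" using assms(1) unfolding cof_def by simp
  then have inf: "infinite S" by (rule infinite_cofinite)
  define good where "good = (\<lambda>(p, q). q \<noteq> 0 \<and> (\<forall>y\<in>S. poly q y \<noteq> 0 \<longrightarrow> f y = poly p y / poly q y))"
  obtain z1 where "z1 \<in> S" using False by blast
  then obtain p1 q1 where "poly q1 z1 \<noteq> 0" "\<forall>y\<in>S. poly q1 y \<noteq> 0 \<longrightarrow> f y = poly p1 y / poly q1 y"
    using assms(2) unfolding regular_on_def by blast
  then have "good (p1, q1)" unfolding good_def by auto
  then obtain pq where pq: "good pq" "\<And>pq'. good pq' \<Longrightarrow> degree (snd pq) \<le> degree (snd pq')"
    using ex_has_least_nat[of good _ "\<lambda>pq. degree (snd pq)"] by blast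
  obtain p q where [simp]: "pq = (p, q)" by (cases pq)
  have q: "q \<noteq> 0" "\<And>y. y \<in> S \<Longrightarrow> poly q y \<noteq> 0 \<Longrightarrow> f y = poly p y / poly q y"
    using pq(1) by (auto simp: good_def)
  have "poly q z \<noteq> 0" if z: "z \<in> S" for z
  proof
    assume qz: "poly q z = 0"
    obtain p1 q1 where 1: "poly q1 z \<noteq> 0" "\<And>y. y \<in> S \<Longrightarrow> poly q1 y \<noteq> 0 \<Longrightarrow> f y = poly p1 y / poly q1 y"
      using assms(2) z unfolding regular_on_def by blast
    have "p * q1 = p1 * q"
    proof (rule poly_eq_if_eq_infinite[of "S - {y. poly (q * q1) y = 0}"])
      have "q * q1 \<noteq> 0" using q(1) 1(1) by auto
      then show "infinite (S - {y. poly (q * q1) y = 0})"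
        using inf poly_roots_finite Diff_infinite_finite by blast
      fix y assume "y \<in> S - {y. poly (q * q1) y = 0}"
      then show "poly (p * q1) y = poly (p1 * q) y"
        using q(2)[of y] 1(2)[of y] by (auto simp: field_simps)
    qed
    moreover from this have "poly p z * poly q1 z = 0"
      using qz by (metis mult_zero_right poly_mult)
    then have "poly p z = 0" using 1(1) by simp
    ultimately obtain p2 q2 where pe: "p = [:-z, 1:] * p2" and qe: "q = [:-z, 1:] * q2"
      using qz by (metis dvdE poly_eq_0_iff_dvd)
    have eq2: "p2 * q1 = p1 * q2"
    proof -
      have "[:-z, 1:] * (p2 * q1) = [:-z, 1:] * (p1 * q2)"
        using \<open>p * q1 = p1 * q\<close> unfolding pe qe by (simp only: ac_simps)
      then show ?thesis by (subst (asm) mult_left_cancel) auto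
    qed
    have "q2 \<noteq> 0" using q(1) qe by auto
    have "good (p2, q2)"
      unfolding good_def
    proof (clarsimp simp: \<open>q2 \<noteq> 0\<close>)
      fix y assume y: "y \<in> S" "poly q2 y \<noteq> 0"
      show "f y = poly p2 y / poly q2 y"
      proof (cases "y = z")
        \<comment> \<open>At \<open>z\<close> the old quotient gives no information: the value comes
          from the quotient valid at \<open>z\<close> and the cancelled identity
          \<open>eq2\<close>.\<close>
        case True
        have "poly p2 z * poly q1 z = poly p1 z * poly q2 z"
          using eq2 by (metis poly_mult)
        then have "poly p2 z / poly q2 z = poly p1 z / poly q1 z"
          using 1(1) y True by (simp add: frac_eq_eq)
        then show ?thesis using 1(1) 1(2)[OF z] y True by simp
      next
        case False
        then have "f y = poly p y / poly q y" using q(2)[OF y(1)] y(2) qe by simp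
        also have "\<dots> = ((y - z) * poly p2 y) / ((y - z) * poly q2 y)"
          unfolding pe qe by (simp add: algebra_simps)
        also have "\<dots> = poly p2 y / poly q2 y" using False by simp
        finally show ?thesis .
      qed
    qed
    moreover have "degree q = Suc (degree q2)"
      unfolding qe using \<open>q2 \<noteq> 0\<close> by (subst degree_mult_eq) auto
    ultimately show False using pq(2)[of "(p2, q2)"] by simp
  qed
  then show ?thesis using q(2) ratI[of S q f p] by blast
qed simp

lemma regular_on_iff:
  assumes "cof S"
  shows "regular_on S f \<longleftrightarrow> rat S f \<and> (\<forall>z. z \<notin> S \<longrightarrow> f z = 0)"
  using regular_on_rat[OF assms, of f] unfolding regular_on_def rat_def by blast

text \<open>A nowhere vanishing polynomial is constant by the fundamental theorem of algebra, so no
  denominator survives on the whole line.\<close>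

lemma rat_UNIV:
  assumes "rat UNIV f" shows "\<exists>p. f = poly p"
proof -
  obtain p q where pq: "\<And>z. poly q z \<noteq> 0 \<and> f z = poly p z / poly q z"
    using assms unfolding rat_def by blast
  then have "constant (poly q)" using fundamental_theorem_of_algebra by blast
  then obtain k where k: "\<And>z. poly q z = k" unfolding constant_def by metis
  then have "f = poly (Polynomial.smult (inverse k) p)" using pq by (auto simp: divide_inverse)
  then show ?thesis by blast
qed

text \<open>Identity theorem: after cross-multiplication two polynomials agree at infinitely many
  points, hence everywhere.\<close>

lemma rat_eqI:
  assumes "rat S f" "rat S g" "infinite T" "T \<subseteq> S" "\<And>z. z \<in> T \<Longrightarrow> f z = g z" "z \<in> S"
  shows "f z = g z"
proof -
  obtain p q where 1: "\<And>z. z \<in> S \<Longrightarrow> poly q z \<noteq> 0 \<and> f z = poly p z / poly q z"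
    using assms(1) unfolding rat_def by blast
  obtain p' q' where 2: "\<And>z. z \<in> S \<Longrightarrow> poly q' z \<noteq> 0 \<and> g z = poly p' z / poly q' z"
    using assms(2) unfolding rat_def by blast
  have "p * q' = p' * q"
  proof (rule poly_eq_if_eq_infinite[OF assms(3)])
    fix y assume "y \<in> T"
    then show "poly (p * q') y = poly (p' * q) y"
      using 1[of y] 2[of y] assms(4) assms(5)[of y] by (auto simp: field_simps)
  qed
  then have "poly p z * poly q' z = poly p' z * poly q z" by (metis poly_mult)
  then show ?thesis using 1[OF assms(6)] 2[OF assms(6)] by (simp add: field_simps)
qed

section \<open>Derivatives of rational functions on open sets\<close>

lemma rat_deriv:
  assumes "cof S" "rat S f"
  shows "rat S (deriv f)" "z \<in> S \<Longrightarrow> (f has_field_derivative deriv f z) (at z)"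
proof -
  obtain p q where 1: "\<And>z. z \<in> S \<Longrightarrow> poly q z \<noteq> 0 \<and> f z = poly p z / poly q z"
    using assms(2) unfolding rat_def by blast
  have d: "(f has_field_derivative poly (pderiv p * q - p * pderiv q) z / poly (q * q) z) (at z)"
    if "z \<in> S" for z
  proof (rule DERIV_cong_ev[THEN iffD1])
    show "((\<lambda>z. poly p z / poly q z) has_field_derivative
        poly (pderiv p * q - p * pderiv q) z / poly (q * q) z) (at z)"
      using 1[OF that] by (auto intro!: derivative_eq_intros)
    show "\<forall>\<^sub>F x in nhds z. poly p x / poly q x = f x"
      using eventually_nhds_in_open[OF cof_open[OF assms(1)] that]
      by eventually_elim (use 1 in auto)
  qed auto
  then show "z \<in> S \<Longrightarrow> (f has_field_derivative deriv f z) (at z)"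
    using DERIV_imp_deriv by metis
  show "rat S (deriv f)"
    by (rule ratI[of _ "q * q" _ "pderiv p * q - p * pderiv q"])
      (use 1 d[THEN DERIV_imp_deriv] in simp)
qed

lemma rat_higher_deriv: "cof S \<Longrightarrow> rat S f \<Longrightarrow> rat S ((deriv ^^ i) f)"
  by (induction i) (simp_all add: rat_deriv)

lemma deriv_cong_on:
  assumes "open S" "\<And>z. z \<in> S \<Longrightarrow> f z = g z" "z \<in> S"
  shows "deriv f z = deriv g z"
proof (rule deriv_cong_ev)
  show "\<forall>\<^sub>F x in nhds z. f x = g x"
    using eventually_nhds_in_open[OF assms(1,3)] by eventually_elim (use assms(2) in auto)
qed simp

lemma higher_deriv_cong_on:
  assumes "open S" "\<And>z. z \<in> S \<Longrightarrow> f z = g z" "z \<in> S"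
  shows "(deriv ^^ i) f z = (deriv ^^ i) g z"
  using assms(3)
proof (induction i arbitrary: z)
  case (Suc i)
  then show ?case using deriv_cong_on[OF assms(1), of "(deriv ^^ i) f" "(deriv ^^ i) g"] by simp
qed (use assms(2) in simp)

subsection \<open>Differential operators in one variable\<close>

abbreviation dsum :: "nat \<Rightarrow> (nat \<Rightarrow> complex \<Rightarrow> complex) \<Rightarrow> (complex \<Rightarrow> complex) \<Rightarrow> complex \<Rightarrow> complex" where
  "dsum k a f z \<equiv> \<Sum>i<k. a i z * (deriv ^^ i) f z"

text \<open>The coefficients have to work on every open \<open>T\<close> inside \<open>S\<close>,
  since a section of the sheaf of operators acts on functions over all smaller open sets.\<close>

definition dcoeffs :: "complex set \<Rightarrow> ((complex \<Rightarrow> complex) \<Rightarrow> complex \<Rightarrow> complex) \<Rightarrow> nat \<Rightarrow> (nat \<Rightarrow> complex \<Rightarrow> complex) \<Rightarrow> bool" where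
  "dcoeffs S A k a \<longleftrightarrow> (\<forall>i<k. rat S (a i)) \<and> (\<forall>T f. cof T \<longrightarrow> T \<subseteq> S \<longrightarrow> rat T f \<longrightarrow>
     (\<forall>z\<in>T. A f z = dsum k a f z))"

definition diffop :: "complex set \<Rightarrow> ((complex \<Rightarrow> complex) \<Rightarrow> complex \<Rightarrow> complex) \<Rightarrow> bool" where
  "diffop S A \<longleftrightarrow> (\<exists>k a. dcoeffs S A k a)"

lemma dcoeffsD:
  assumes "dcoeffs S A k a"
  shows "i < k \<Longrightarrow> rat S (a i)" "\<lbrakk>cof T; T \<subseteq> S; rat T f; z \<in> T\<rbrakk> \<Longrightarrow> A f z = dsum k a f z"
  using assms by (auto simp: dcoeffs_def)

lemma diffopE:
  assumes "diffop S A" obtains k a where "dcoeffs S A k a"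
  using assms by (auto simp: diffop_def)

lemma diffopI:
  assumes "\<And>i. i < k \<Longrightarrow> rat S (a i)"
    "\<And>T f z. \<lbrakk>cof T; T \<subseteq> S; rat T f; z \<in> T\<rbrakk> \<Longrightarrow>
       A f z = dsum k a f z"
  shows "diffop S A"
  unfolding diffop_def dcoeffs_def by (rule exI[of _ k], rule exI[of _ a]) (simp add: assms)

lemma diffop_rat:
  assumes "diffop S A" "cof T" "T \<subseteq> S" "rat T f" shows "rat T (A f)"
proof -
  obtain k a where "dcoeffs S A k a" using assms(1) by (rule diffopE)
  note 1 = dcoeffsD[OF this]
  have "rat T (\<lambda>z. \<Sum>i<k. a i z * (deriv ^^ i) f z)"
    by (intro rat_sum rat_mult rat_higher_deriv assms) (use 1(1) rat_subset[OF _ assms(3)] in auto)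
  then show ?thesis using 1(2)[OF assms(2-4)] by (subst rat_cong) auto
qed

lemma diffop_cong:
  assumes "diffop S A" "cof T" "T \<subseteq> S" "rat T f" "\<And>z. z \<in> T \<Longrightarrow> f z = g z" "z \<in> T"
  shows "A f z = A g z"
proof -
  obtain k a where "dcoeffs S A k a" using assms(1) by (rule diffopE)
  note 1 = dcoeffsD(2)[OF this]
  have "rat T g" using assms(4,5) rat_cong by blast
  then show ?thesis using 1[OF assms(2-4,6)] 1[OF assms(2,3) _ assms(6)]
      higher_deriv_cong_on[OF cof_open[OF assms(2)] assms(5) assms(6)] by auto
qed

lemma diffop_subset:
  assumes "diffop S A" "S' \<subseteq> S" shows "diffop S' A"
proof -
  obtain k a where "dcoeffs S A k a" using assms(1) by (rule diffopE)
  note 1 = dcoeffsD[OF this]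
  show ?thesis
  proof (rule diffopI[of k _ a])
    show "rat S' (a i)" if "i < k" for i using 1(1)[OF that] assms(2) by (rule rat_subset)
    fix T f z assume "cof T" "T \<subseteq> S'" "rat T f" "z \<in> T"
    then show "A f z = dsum k a f z" using 1(2)[of T f z] assms(2) by auto
  qed
qed

lemma diffop_mult: "rat S h \<Longrightarrow> diffop S (\<lambda>f z. h z * f z)"
  by (rule diffopI[of 1 _ "\<lambda>_. h"]) auto

lemma diffop_zero: "diffop S (\<lambda>f z. 0)"
  by (rule diffopI[of 0]) auto

lemma diffop_add:
  assumes "diffop S A" "diffop S B" shows "diffop S (\<lambda>f z. A f z + B f z)"
proof -
  obtain k a where "dcoeffs S A k a" using assms(1) by (rule diffopE)
  note 1 = dcoeffsD[OF this]
  obtain k' a' where "dcoeffs S B k' a'" using assms(2) by (rule diffopE)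
  note 2 = dcoeffsD[OF this]
  have pad: "(dsum l b f z) =
      (\<Sum>i<l + l'. (if i < l then b i z else 0) * (deriv ^^ i) f z)"
    for l l' and b :: "nat \<Rightarrow> complex \<Rightarrow> complex" and f z
  proof -
    have "(dsum l b f z) = (\<Sum>i<l. (if i < l then b i z else 0) * (deriv ^^ i) f z)"
      by (intro sum.cong) auto
    also have "\<dots> = (\<Sum>i<l + l'. (if i < l then b i z else 0) * (deriv ^^ i) f z)"
      by (intro sum.mono_neutral_left) auto
    finally show ?thesis .
  qed
  show ?thesis
  proof (rule diffopI[of "k + k'" _ "\<lambda>i z. (if i < k then a i z else 0) + (if i < k' then a' i z else 0)"])
    fix i
    show "rat S (\<lambda>z. (if i < k then a i z else 0) + (if i < k' then a' i z else 0))"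
      by (cases "i < k"; cases "i < k'") (auto intro!: rat_add rat_const 1 2)
  next
    fix T f z assume *: "cof T" "T \<subseteq> S" "rat T f" "z \<in> T"
    show "A f z + B f z = (\<Sum>i<k + k'. ((if i < k then a i z else 0) + (if i < k' then a' i z else 0)) * (deriv ^^ i) f z)"
      unfolding 1(2)[OF *] 2(2)[OF *] ring_distribs sum.distrib
      using pad[where l=k and l'=k' and b=a] pad[where l=k' and l'=k and b=a'] by (simp add: add.commute)
  qed
qed

lemma diffop_sum: "(\<And>i. i \<in> I \<Longrightarrow> diffop S (A i)) \<Longrightarrow> diffop S (\<lambda>f z. \<Sum>i\<in>I. A i f z)"
  by (induction I rule: infinite_finite_induct) (simp_all add: diffop_zero diffop_add)

lemma diffop_deriv_pow: "rat S h \<Longrightarrow> diffop S (\<lambda>f z. h z * (deriv ^^ k) f z)"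
proof (rule diffopI[of "Suc k" _ "\<lambda>i. if i = k then h else (\<lambda>z. 0)"])
  fix f z
  have "(\<Sum>i<Suc k. (if i = k then h else (\<lambda>z. 0)) z * (deriv ^^ i) f z) =
      (\<Sum>i<Suc k. if i = k then h z * (deriv ^^ i) f z else 0)"
    by (intro sum.cong) auto
  then show "h z * (deriv ^^ k) f z = (\<Sum>i<Suc k. (if i = k then h else (\<lambda>z. 0)) z * (deriv ^^ i) f z)"
    by simp
qed (auto simp: rat_const)

lemma diffop_mult_left:
  assumes "rat S h" "diffop S A" shows "diffop S (\<lambda>f z. h z * A f z)"
proof -
  obtain k a where "dcoeffs S A k a" using assms(2) by (rule diffopE)
  note 1 = dcoeffsD[OF this]
  show ?thesis
    by (rule diffopI[of k _ "\<lambda>i z. h z * a i z"])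
      (auto intro!: rat_mult assms 1 simp: 1(2) sum_distrib_left mult.assoc)
qed

text \<open>By Leibniz each term contributes \<open>deriv (a i)\<close> times the i-th derivative
  and \<open>a i\<close> times the next one, again an operator of finite order. Iterating this is
  what makes composition closed.\<close>

lemma diffop_deriv_left:
  assumes "cof S" "diffop S A" shows "diffop S (\<lambda>f. deriv (A f))"
proof -
  obtain k a where "dcoeffs S A k a" using assms(2) by (rule diffopE)
  note 1 = dcoeffsD[OF this]
  define B where "B = (\<lambda>f z. \<Sum>i<k. deriv (a i) z * (deriv ^^ i) f z + a i z * (deriv ^^ Suc i) f z)"
  have eq: "deriv (A f) z = B f z" if *: "cof T" "T \<subseteq> S" "rat T f" "z \<in> T" for T f z
  proof -
    have "deriv (A f) z = deriv (\<lambda>z. \<Sum>i<k. a i z * (deriv ^^ i) f z) z"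
      using 1(2)[OF *(1-3)] *(4) by (intro deriv_cong_on[OF cof_open[OF *(1)]])
    also have "\<dots> = B f z"
    proof (rule DERIV_imp_deriv, unfold B_def, rule DERIV_sum)
      fix i assume "i \<in> {..<k}"
      then have "(a i has_field_derivative deriv (a i) z) (at z)"
        "((deriv ^^ i) f has_field_derivative deriv ((deriv ^^ i) f) z) (at z)"
        using 1(1)[of i] * rat_deriv(2)[OF *(1)] rat_subset rat_higher_deriv by blast+
      from DERIV_mult[OF this]
      show "((\<lambda>z. a i z * (deriv ^^ i) f z) has_field_derivative
         deriv (a i) z * (deriv ^^ i) f z + a i z * (deriv ^^ Suc i) f z) (at z)"
        by (simp add: mult.commute)
    qed
    finally show ?thesis .
  qed
  have "diffop S B"
    unfolding B_def
    by (intro diffop_sum diffop_add diffop_deriv_pow rat_deriv assms) (use 1(1) in auto)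
  then obtain l b where "dcoeffs S B l b" by (rule diffopE)
  note 2 = dcoeffsD[OF this]
  show ?thesis
    by (rule diffopI[of l _ b]) (use 2 eq in auto)
qed

lemma diffop_comp:
  assumes "cof S" "diffop S A" "diffop S B" shows "diffop S (\<lambda>f. A (B f))"
proof -
  obtain k a where "dcoeffs S A k a" using assms(2) by (rule diffopE)
  note 1 = dcoeffsD[OF this]
  have pw: "diffop S (\<lambda>f. (deriv ^^ i) (B f))" for i
    by (induction i) (use assms diffop_deriv_left in auto)
  have "diffop S (\<lambda>f z. \<Sum>i<k. a i z * (deriv ^^ i) (B f) z)"
    by (intro diffop_sum diffop_mult_left pw) (use 1(1) in auto)
  then obtain l b where "dcoeffs S (\<lambda>f. dsum k a (B f)) l b" by (rule diffopE)
  note 2 = dcoeffsD[OF this]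
  show ?thesis
  proof (rule diffopI[of l _ b])
    fix T f z assume *: "cof T" "T \<subseteq> S" "rat T f" "z \<in> T"
    show "A (B f) z = dsum l b f z"
      using 1(2)[OF *(1,2) diffop_rat[OF assms(3) *(1-3)] *(4)] 2(2)[OF *] by simp
  qed (use 2 in auto)
qed

section \<open>Charts and line bundles\<close>

text \<open>Everything below is uniform in the chart: \<open>c = False\<close> is the chart around \<open>0\<close> with
  coordinate \<open>z\<close>, and \<open>c = True\<close> the chart around \<open>\<infinity>\<close> with coordinate \<open>w\<close>.\<close>

definition chart :: "bool \<Rightarrow> complex \<Rightarrow> p1" where
  "chart c z = (if c then chart_inf z else Aff z)"

definition part :: "bool \<Rightarrow> p1 set \<Rightarrow> complex set" where
  "part c U = {z. chart c z \<in> U}"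

definition sel :: "bool \<Rightarrow> lsec \<Rightarrow> complex \<Rightarrow> complex" where
  "sel c s = (if c then snd s else fst s)"

definition mk_sec :: "(bool \<Rightarrow> complex \<Rightarrow> complex) \<Rightarrow> lsec" where
  "mk_sec F = (F False, F True)"

text \<open>At the point missing from the chart the value is 0, for \<open>c = True\<close> through
  \<open>inverse 0 = 0\<close>. This default makes \<open>coord_chart_other\<close> hold at
  \<open>z = 0\<close> as well.\<close>

definition coord :: "bool \<Rightarrow> p1 \<Rightarrow> complex" where
  "coord c p = (case p of Aff z \<Rightarrow> if c then inverse z else z | Infty \<Rightarrow> 0)"

definition Uc :: "bool \<Rightarrow> p1 set" where
  "Uc c = range (chart c)"

lemma part0_eq: "part0 U = part False U" and part_inf_eq: "part_inf U = part True U"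
  by (auto simp: part0_def part_inf_def part_def chart_def)

lemma sel_mk [simp]: "sel c (mk_sec F) = F c"
  by (simp add: sel_def mk_sec_def)

lemma sel_eqI:
  assumes "\<And>c z. sel c s z = sel c t z" shows "s = t"
  using assms[of True] assms[of False] by (intro prod_eqI) (auto simp: sel_def)

lemma all_bool: "(\<forall>c::bool. P c) \<longleftrightarrow> P False \<and> P True"
  by (metis (full_types))

lemma coord_chart [simp]: "coord c (chart c z) = z"
  by (auto simp: coord_def chart_def chart_inf_def)

lemma coord_chart_other [simp]: "coord (\<not> c) (chart c z) = inverse z" "coord c (chart (\<not> c) z) = inverse z"
  by (auto simp: coord_def chart_def chart_inf_def)

lemma chart_inverse: "z \<noteq> 0 \<Longrightarrow> chart (\<not> c) (inverse z) = chart c z"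
  by (auto simp: chart_def chart_inf_def)

lemma chart_inj: "chart c z = chart c w \<longleftrightarrow> z = w"
  by (metis coord_chart)

lemma chart_surj: obtains c z where "p = chart c z"
  by (cases p) (metis chart_def, metis (full_types) chart_def chart_inf_def)

lemma Uc_eq: "Uc c = - {chart (\<not> c) 0}"
proof -
  have "p \<in> Uc c \<longleftrightarrow> p \<noteq> chart (\<not> c) 0" for p
  proof (cases p)
    case (Aff z)
    then show ?thesis
      by (cases c; cases "z = 0") (auto simp: Uc_def chart_def chart_inf_def image_iff intro!: exI[of _ "inverse z"])
  next
    case Infty
    then show ?thesis
      by (cases c) (auto simp: Uc_def chart_def chart_inf_def image_iff)
  qed
  then show ?thesis by auto
qed

lemma chart_in_Uc [simp]: "chart c z \<in> Uc c"
  by (simp add: Uc_def)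

lemma chart_coord: "p \<in> Uc c \<Longrightarrow> chart c (coord c p) = p"
  by (auto simp: Uc_def)

lemma Uc_Un: "Uc c \<union> Uc (\<not> c) = UNIV"
  by (cases c) (auto simp: Uc_eq chart_def chart_inf_def)

lemma mem_part: "z \<in> part c U \<longleftrightarrow> chart c z \<in> U"
  by (simp add: part_def)

lemma part_Int [simp]: "part c (U \<inter> V) = part c U \<inter> part c V"
  by (auto simp: part_def)

lemma part_mono: "U \<subseteq> V \<Longrightarrow> part c U \<subseteq> part c V"
  by (auto simp: part_def)

lemma part_UNIV [simp]: "part c UNIV = UNIV"
  by (auto simp: part_def)

lemma part_empty [simp]: "part c {} = {}"
  by (auto simp: part_def)

lemma part_Uc [simp]: "part c (Uc c) = UNIV"
  by (auto simp: part_def)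

lemma zero_notin_part: "U \<subseteq> Uc c \<Longrightarrow> 0 \<notin> part (\<not> c) U"
  by (auto simp: part_def Uc_eq)

lemma inverse_in_part: "z \<in> part c U \<Longrightarrow> z \<noteq> 0 \<Longrightarrow> inverse z \<in> part (\<not> c) U"
  by (auto simp: part_def chart_inverse)

lemma inverse_in_part': "z \<in> part (\<not> c) U \<Longrightarrow> z \<noteq> 0 \<Longrightarrow> inverse z \<in> part c U"
  using inverse_in_part[of z "\<not> c" U] by simp

subsection \<open>Open sets\<close>

lemma opens_UNIV: "U \<in> opens UNIV \<longleftrightarrow> zariski_open U"
  by (simp add: opens_def)

lemma opens_self: "zariski_open U \<Longrightarrow> U \<in> opens U"
  by (simp add: opens_def)

lemma opens_D: "V \<in> opens U \<Longrightarrow> zariski_open V" "V \<in> opens U \<Longrightarrow> V \<subseteq> U"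
  by (auto simp: opens_def)

lemma opens_I: "zariski_open V \<Longrightarrow> V \<subseteq> U \<Longrightarrow> V \<in> opens U"
  by (auto simp: opens_def)

lemma opens_trans: "V \<in> opens U \<Longrightarrow> W \<in> opens V \<Longrightarrow> W \<in> opens U"
  by (auto simp: opens_def)

lemma opens_mono: "V \<in> opens U \<Longrightarrow> U \<subseteq> W \<Longrightarrow> V \<in> opens W"
  by (auto simp: opens_def)

lemma zariski_open_UNIV [simp]: "zariski_open UNIV"
  by (simp add: zariski_open_def)

lemma zariski_open_empty [simp]: "zariski_open {}"
  by (simp add: zariski_open_def)

lemma zariski_open_Uc [simp]: "zariski_open (Uc c)"
  by (simp add: zariski_open_def Uc_eq)

lemma zariski_open_Int: "zariski_open U \<Longrightarrow> zariski_open V \<Longrightarrow> zariski_open (U \<inter> V)"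
  by (auto simp: zariski_open_def Compl_Int)

lemma zariski_open_subset_nonempty:
  "\<lbrakk>zariski_open U; U \<noteq> {}; U \<subseteq> V\<rbrakk> \<Longrightarrow> zariski_open V"
  unfolding zariski_open_def by (metis Compl_subset_Compl_iff finite_subset)

lemma zariski_open_Union: "\<V> \<subseteq> opens UNIV \<Longrightarrow> zariski_open (\<Union>\<V>)"
proof (cases "\<exists>V\<in>\<V>. V \<noteq> {}")
  case True
  then obtain V where "V \<in> \<V>" "V \<noteq> {}" by blast
  moreover assume "\<V> \<subseteq> opens UNIV"
  ultimately show ?thesis
    by (intro zariski_open_subset_nonempty[of V "\<Union>\<V>"]) (auto simp: opens_def)
next
  case False
  then have "\<Union>\<V> = {}" by blast
  then show ?thesis by (simp only: zariski_open_empty)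
qed

lemma cof_part: "zariski_open U \<Longrightarrow> cof (part c U)"
proof -
  have "inj (chart c)" by (rule injI) (simp add: chart_inj)
  moreover have "- part c U = chart c -` (- U)" by (auto simp: part_def)
  ultimately show "zariski_open U \<Longrightarrow> cof (part c U)"
    unfolding zariski_open_def cof_def by (metis finite_vimageI part_empty)
qed

lemma infinite_part: "zariski_open U \<Longrightarrow> U \<noteq> {} \<Longrightarrow> infinite (part c U)"
proof -
  assume "zariski_open U" "U \<noteq> {}"
  then have "finite (- U)" by (simp add: zariski_open_def)
  have "inj (chart c)" by (rule injI) (simp add: chart_inj)
  moreover have "- part c U = chart c -` (- U)" by (auto simp: part_def)
  ultimately have "finite (- part c U)" using \<open>finite (- U)\<close> by (metis finite_vimageI)
  then show ?thesis by (rule infinite_cofinite)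
qed

subsection \<open>Regular functions\<close>

text \<open>Regularity without the vanishing outside \<open>U\<close> that \<open>str_sheaf\<close>
  demands, so that the same function can be used over varying open sets.\<close>

definition hreg :: "p1 set \<Rightarrow> (p1 \<Rightarrow> complex) \<Rightarrow> bool" where
  "hreg U h \<longleftrightarrow> (\<forall>c. rat (part c U) (\<lambda>z. h (chart c z)))"

lemma str_sheaf_iff:
  assumes "zariski_open U"
  shows "h \<in> str_sheaf U \<longleftrightarrow> hreg U h \<and> (\<forall>p. p \<notin> U \<longrightarrow> h p = 0)"
proof -
  have "(\<forall>c z. z \<notin> part c U \<longrightarrow> h (chart c z) = 0) \<longleftrightarrow> (\<forall>p. p \<notin> U \<longrightarrow> h p = 0)"
    by (metis chart_surj mem_part)
  moreover have "h \<in> str_sheaf U \<longleftrightarrow> (\<forall>c. regular_on (part c U) (\<lambda>z. h (chart c z)))"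
    by (simp add: str_sheaf_def all_bool part0_eq part_inf_eq chart_def)
  ultimately show ?thesis
    using regular_on_iff[OF cof_part[OF assms]] unfolding hreg_def by metis
qed

lemma hreg_cong: "(\<And>p. p \<in> U \<Longrightarrow> h p = h' p) \<Longrightarrow> hreg U h \<longleftrightarrow> hreg U h'"
  unfolding hreg_def by (intro all_cong1 rat_cong) (simp add: mem_part)

lemma hreg_subset: "hreg U h \<Longrightarrow> V \<subseteq> U \<Longrightarrow> hreg V h"
  unfolding hreg_def using rat_subset part_mono by metis

lemma hreg_const: "hreg U (\<lambda>p. k)"
  by (simp add: hreg_def rat_const)

lemma hreg_add: "hreg U h \<Longrightarrow> hreg U h' \<Longrightarrow> hreg U (\<lambda>p. h p + h' p)"
  by (simp add: hreg_def rat_add)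

lemma hreg_mult: "hreg U h \<Longrightarrow> hreg U h' \<Longrightarrow> hreg U (\<lambda>p. h p * h' p)"
  by (simp add: hreg_def rat_mult)

lemma hreg_power: "hreg U h \<Longrightarrow> hreg U (\<lambda>p. h p ^ k)"
  by (simp add: hreg_def rat_power)

text \<open>In the opposite chart \<open>coord c\<close> becomes \<open>inverse\<close>, and
  \<open>U \<subseteq> Uc c\<close> keeps 0, the parameter of the missing point, out of the
  part.\<close>

lemma hreg_coord:
  assumes "U \<subseteq> Uc c" "rat (part c U) f" shows "hreg U (\<lambda>p. f (coord c p))"
  unfolding hreg_def
proof
  fix d
  show "rat (part d U) (\<lambda>z. f (coord c (chart d z)))"
  proof (cases "d = c")
    case False
    then have d: "d = (\<not> c)" by auto
    have "rat (part (\<not> c) U) (\<lambda>w. f (inverse w))"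
      by (rule rat_compose_inverse[OF assms(2)])
        (use zero_notin_part[OF assms(1)] inverse_in_part' in metis)
    then show ?thesis by (simp add: d)
  qed (use assms in simp)
qed

subsection \<open>Sections of the line bundles\<close>

text \<open>\<open>line_bundle\<close> states the transition rule in one direction only;
  substituting \<open>inverse z\<close> gives the other, and the description becomes symmetric in
  the charts.\<close>

lemma line_bundle_iff':
  "s \<in> line_bundle n U \<longleftrightarrow> (\<forall>c. regular_on (part c U) (sel c s)) \<and>
     (\<forall>c. \<forall>z\<in>part c U. z \<noteq> 0 \<longrightarrow> sel c s z = z powi n * sel (\<not> c) s (inverse z))"
proof -
  have "(\<forall>z\<in>part True U. z \<noteq> 0 \<longrightarrow> snd s z = z powi n * fst s (inverse z))"
    if *: "\<forall>z\<in>part False U. z \<noteq> 0 \<longrightarrow> fst s z = z powi n * snd s (inverse z)"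
  proof (intro ballI impI)
    fix z assume z: "z \<in> part True U" "z \<noteq> 0"
    have "fst s (inverse z) = inverse z powi n * snd s z"
      using *[rule_format, of "inverse z"] z inverse_in_part[of z True U] by simp
    then show "snd s z = z powi n * fst s (inverse z)"
      using z(2) by (simp add: power_int_inverse)
  qed
  then show ?thesis
    by (cases s) (auto simp: line_bundle_def all_bool part0_eq part_inf_eq sel_def)
qed

lemma line_bundle_iff:
  assumes "zariski_open U"
  shows "s \<in> line_bundle n U \<longleftrightarrow> (\<forall>c. rat (part c U) (sel c s)) \<and>
     (\<forall>c z. z \<notin> part c U \<longrightarrow> sel c s z = 0) \<and>
     (\<forall>c. \<forall>z\<in>part c U. z \<noteq> 0 \<longrightarrow> sel c s z = z powi n * sel (\<not> c) s (inverse z))"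
  unfolding line_bundle_iff' using regular_on_iff[OF cof_part[OF assms]] by blast

lemma line_bundleI:
  assumes "zariski_open U" "\<And>c. rat (part c U) (sel c s)" "\<And>c z. z \<notin> part c U \<Longrightarrow> sel c s z = 0"
    "\<And>c z. z \<in> part c U \<Longrightarrow> z \<noteq> 0 \<Longrightarrow> sel c s z = z powi n * sel (\<not> c) s (inverse z)"
  shows "s \<in> line_bundle n U"
  unfolding line_bundle_iff[OF assms(1)] using assms(2-4) by blast

context
  fixes n U s assumes U: "zariski_open U" and s: "s \<in> line_bundle n U"
begin

lemma line_bundle_rat: "rat (part c U) (sel c s)"
  using s line_bundle_iff[OF U] by blast

lemma line_bundle_zero: "z \<notin> part c U \<Longrightarrow> sel c s z = 0"
  using s line_bundle_iff[OF U] by blast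

lemma line_bundle_trans: "z \<in> part c U \<Longrightarrow> z \<noteq> 0 \<Longrightarrow> sel c s z = z powi n * sel (\<not> c) s (inverse z)"
  using s line_bundle_iff[OF U] by blast

text \<open>The chain rule applied to the transition rule. It decides whether first-order formulas
  in the two charts define one operator.\<close>

lemma line_bundle_deriv_trans:
  assumes z: "z \<in> part c U" "z \<noteq> 0"
  shows "deriv (sel c s) z = z powi n * (of_int n * inverse z * sel (\<not> c) s (inverse z) -
    (inverse z)\<^sup>2 * deriv (sel (\<not> c) s) (inverse z))"
proof -
  let ?g = "sel (\<not> c) s"
  have op: "open (part c U - {0})" using cof_open[OF cof_part[OF U]] by (simp add: open_delete)
  have "deriv (sel c s) z = deriv (\<lambda>z. z powi n * ?g (inverse z)) z"
    by (rule deriv_cong_on[OF op]) (use line_bundle_trans z in auto)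
  also have "\<dots> = z powi n * (of_int n * inverse z * ?g (inverse z) - (inverse z)\<^sup>2 * deriv ?g (inverse z))"
  proof (rule DERIV_imp_deriv)
    have "(?g has_field_derivative deriv ?g (inverse z)) (at (inverse z))"
      by (rule rat_deriv(2)[OF cof_part[OF U] line_bundle_rat]) (rule inverse_in_part[OF z])
    from DERIV_chain2[OF this DERIV_inverse[OF z(2)]]
    have 1: "((\<lambda>z. ?g (inverse z)) has_field_derivative deriv ?g (inverse z) * - (inverse z ^ Suc (Suc 0))) (at z)"
      by simp
    have 2: "((\<lambda>z. z powi n) has_field_derivative of_int n * z powi (n - 1)) (at z)"
      using DERIV_power_int[OF DERIV_ident, of n z UNIV] z(2) by simp
    have 3: "z powi (n - 1) = z powi n * inverse z"
      using z(2) by (simp add: power_int_diff divide_inverse)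
    show "((\<lambda>z. z powi n * ?g (inverse z)) has_field_derivative
      z powi n * (of_int n * inverse z * ?g (inverse z) - (inverse z)\<^sup>2 * deriv ?g (inverse z))) (at z)"
      using DERIV_mult[OF 2 1] by (rule back_subst) (simp add: 3 algebra_simps power2_eq_square)
  qed
  finally show ?thesis .
qed

end

lemma line_bundle_eqI:
  assumes "zariski_open U" "s \<in> line_bundle n U" "t \<in> line_bundle n U"
    "\<And>c z. z \<in> part c U \<Longrightarrow> sel c s z = sel c t z"
  shows "s = t"
  by (rule sel_eqI) (use assms line_bundle_zero in metis)

lemma line_bundle_eqI_chart:
  assumes "zariski_open U" "U \<subseteq> Uc c" "s \<in> line_bundle n U" "t \<in> line_bundle n U"
    "\<And>z. z \<in> part c U \<Longrightarrow> sel c s z = sel c t z"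
  shows "s = t"
proof (rule line_bundle_eqI[OF assms(1,3,4)])
  fix d z assume z: "z \<in> part d U"
  show "sel d s z = sel d t z"
  proof (cases "d = c")
    case False
    then have d: "d = (\<not> c)" by auto
    then have "z \<noteq> 0" using z zero_notin_part[OF assms(2)] by auto
    then show ?thesis
      using line_bundle_trans[OF assms(1,3) z] line_bundle_trans[OF assms(1,4) z] assms(5)
        inverse_in_part[OF z] d by simp
  qed (use assms(5) z in simp)
qed

definition sadd :: "lsec \<Rightarrow> lsec \<Rightarrow> lsec" where
  "sadd s t = mk_sec (\<lambda>c z. sel c s z + sel c t z)"

definition szero :: lsec where
  "szero = mk_sec (\<lambda>c z. 0)"

definition hmul :: "(p1 \<Rightarrow> complex) \<Rightarrow> lsec \<Rightarrow> lsec" where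
  "hmul h s = mk_sec (\<lambda>c z. h (chart c z) * sel c s z)"

definition sres :: "p1 set \<Rightarrow> lsec \<Rightarrow> lsec" where
  "sres V s = mk_sec (\<lambda>c z. if z \<in> part c V then sel c s z else 0)"

lemma sel_simps [simp]:
  "sel c (sadd s t) z = sel c s z + sel c t z" "sel c szero z = 0"
  "sel c (hmul h s) z = h (chart c z) * sel c s z"
  "sel c (sres V s) z = (if z \<in> part c V then sel c s z else 0)"
  by (simp_all add: sadd_def szero_def hmul_def sres_def)

lemma sadd_closed: "\<lbrakk>zariski_open U; s \<in> line_bundle n U; t \<in> line_bundle n U\<rbrakk> \<Longrightarrow> sadd s t \<in> line_bundle n U"
  by (rule line_bundleI) (auto simp: line_bundle_zero sadd_def ring_distribs
      intro!: rat_add line_bundle_rat arg_cong2[where f="(+)"] line_bundle_trans)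

lemma szero_closed: "zariski_open U \<Longrightarrow> szero \<in> line_bundle n U"
  by (rule line_bundleI) (auto simp: szero_def rat_const)

lemma hmul_closed: "\<lbrakk>zariski_open U; hreg U h; s \<in> line_bundle n U\<rbrakk> \<Longrightarrow> hmul h s \<in> line_bundle n U"
  by (rule line_bundleI) (auto simp: line_bundle_zero hmul_def hreg_def chart_inverse line_bundle_trans
      intro!: rat_mult line_bundle_rat)

lemma sres_closed:
  assumes "zariski_open U" "V \<in> opens U" "s \<in> line_bundle n U" shows "sres V s \<in> line_bundle n V"
proof (rule line_bundleI)
  show V: "zariski_open V" using assms by (simp add: opens_def)
  have VU: "V \<subseteq> U" using assms by (simp add: opens_def)
  fix c
  have "rat (part c V) (sel c s)"
    using line_bundle_rat[OF assms(1,3)] part_mono[OF VU] by (rule rat_subset)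
  then show "rat (part c V) (sel c (sres V s))" by (subst rat_cong) auto
  fix z
  show "z \<notin> part c V \<Longrightarrow> sel c (sres V s) z = 0" by simp
  assume "z \<in> part c V" "z \<noteq> 0"
  then show "sel c (sres V s) z = z powi n * sel (\<not> c) (sres V s) (inverse z)"
    using line_bundle_trans[OF assms(1,3), of z c] part_mono[OF VU, of c] inverse_in_part[of z c V] by auto
qed

lemma sres_sres: "W \<subseteq> V \<Longrightarrow> sres W (sres V s) = sres W s"
  by (rule sel_eqI) (auto simp: mem_part)

lemma sres_id: "zariski_open U \<Longrightarrow> s \<in> line_bundle n U \<Longrightarrow> sres U s = s"
  by (rule sel_eqI) (auto simp: line_bundle_zero)

lemma sres_sadd: "sres V (sadd s t) = sadd (sres V s) (sres V t)"
  by (rule sel_eqI) auto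

text \<open>Extends a function of one chart to the other by the transition rule: over
  \<open>U\<close> inside a chart, sections of the bundle are just regular functions.\<close>

definition chart_sec :: "bool \<Rightarrow> int \<Rightarrow> p1 set \<Rightarrow> (complex \<Rightarrow> complex) \<Rightarrow> lsec" where
  "chart_sec c n U f = mk_sec (\<lambda>d z. if z \<in> part d U then
     (if d = c then f z else z powi n * f (inverse z)) else 0)"

lemma chart_sec_closed:
  assumes "zariski_open U" "U \<subseteq> Uc c" "rat (part c U) f"
  shows "chart_sec c n U f \<in> line_bundle n U"
proof (rule line_bundleI[OF assms(1)])
  fix d z
  have r: "rat (part (\<not> c) U) (\<lambda>w. w powi n * f (inverse w))"
    by (intro rat_mult rat_powi rat_compose_inverse[OF assms(3)])
      (use zero_notin_part[OF assms(2)] inverse_in_part' in metis)+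
  show "rat (part d U) (sel d (chart_sec c n U f))"
  proof (cases "d = c")
    case True
    then show ?thesis using assms(3) by (subst rat_cong[of _ _ f]) (auto simp: chart_sec_def)
  next
    case False
    then have d: "d = (\<not> c)" by auto
    show ?thesis using r unfolding d
      by (subst rat_cong[of _ _ "\<lambda>w. w powi n * f (inverse w)"]) (auto simp: chart_sec_def)
  qed
  show "z \<notin> part d U \<Longrightarrow> sel d (chart_sec c n U f) z = 0" by (simp add: chart_sec_def)
  assume z: "z \<in> part d U" "z \<noteq> 0"
  then show "sel d (chart_sec c n U f) z = z powi n * sel (\<not> d) (chart_sec c n U f) (inverse z)"
    using inverse_in_part[OF z] by (auto simp: chart_sec_def power_int_inverse)
qed

lemma sel_chart_sec [simp]: "z \<in> part c U \<Longrightarrow> sel c (chart_sec c n U f) z = f z"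
  by (simp add: chart_sec_def)

section \<open>Twisted differential operators\<close>

abbreviation lb :: "int \<Rightarrow> p1 set \<Rightarrow> lsec set" where
  "lb lam V \<equiv> line_bundle (lam - 1) V"

abbreviation opfun :: "int \<Rightarrow> p1 set \<Rightarrow> dop set" where
  "opfun lam U \<equiv> (\<Pi>\<^sub>E V\<in>opens U. lb lam V \<rightarrow>\<^sub>E lb lam V)"

lemma opfun_closed: "\<lbrakk>P \<in> opfun lam U; V \<in> opens U; s \<in> lb lam V\<rbrakk> \<Longrightarrow> P V s \<in> lb lam V"
  by (meson PiE_mem)

lemma opfun_ext:
  assumes "P \<in> opfun lam U" "Q \<in> opfun lam U" "\<And>V s. V \<in> opens U \<Longrightarrow> s \<in> lb lam V \<Longrightarrow> P V s = Q V s"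
  shows "P = Q"
  by (rule PiE_ext[OF assms(1,2)], rule PiE_ext[OF PiE_mem[OF assms(1)] PiE_mem[OF assms(2)]]) (assumption | rule assms(3))+

lemma opfun_eqI:
  assumes P: "P \<in> opfun lam U" and Q: "Q \<in> opfun lam U"
    and e: "\<And>V s c z. \<lbrakk>V \<in> opens U; s \<in> lb lam V; z \<in> part c V\<rbrakk> \<Longrightarrow> sel c (P V s) z = sel c (Q V s) z"
  shows "P = Q"
  by (rule opfun_ext[OF P Q], rule line_bundle_eqI[OF opens_D(1) opfun_closed[OF P] opfun_closed[OF Q]]) (assumption | rule e)+

lemma opfun_eqI_chart:
  assumes P: "P \<in> opfun lam U" and Q: "Q \<in> opfun lam U" and U: "U \<subseteq> Uc c"
    and e: "\<And>V s z. \<lbrakk>V \<in> opens U; s \<in> lb lam V; z \<in> part c V\<rbrakk> \<Longrightarrow> sel c (P V s) z = sel c (Q V s) z"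
  shows "P = Q"
  by (rule opfun_ext[OF P Q], rule line_bundle_eqI_chart[OF opens_D(1) order_trans[OF opens_D(2) U] opfun_closed[OF P] opfun_closed[OF Q]])
    (assumption | rule e)+

lemma tdo_carrier_opfun: "P \<in> tdo_carrier lam U \<Longrightarrow> P \<in> opfun lam U"
  by (simp add: tdo_carrier_def)

definition tcoeffs :: "int \<Rightarrow> bool \<Rightarrow> p1 set \<Rightarrow> dop \<Rightarrow> nat \<Rightarrow> (nat \<Rightarrow> complex \<Rightarrow> complex) \<Rightarrow> bool" where
  "tcoeffs lam c U P k a \<longleftrightarrow> (\<forall>i<k. rat (part c U) (a i)) \<and>
     (\<forall>V\<in>opens U. \<forall>s\<in>lb lam V. \<forall>z\<in>part c V. sel c (P V s) z = dsum k a (sel c s) z)"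

lemma tcoeffsD:
  assumes "tcoeffs lam c U P k a"
  shows "i < k \<Longrightarrow> rat (part c U) (a i)" "\<lbrakk>V \<in> opens U; s \<in> lb lam V; z \<in> part c V\<rbrakk> \<Longrightarrow> sel c (P V s) z = dsum k a (sel c s) z"
  using assms by (auto simp: tcoeffs_def)

lemma tdo_carrier_coeffs:
  assumes "zariski_open U" "P \<in> tdo_carrier lam U"
  obtains k a where "tcoeffs lam c U P k a"
proof -
  from assms(2) obtain k a b where
    *: "\<forall>i<k. regular_on (part0 U) (a i) \<and> regular_on (part_inf U) (b i)"
    "\<forall>V\<in>opens U. \<forall>s\<in>lb lam V.
        (\<forall>z\<in>part0 V. fst (P V s) z = (dsum k a (fst s) z)) \<and>
        (\<forall>w\<in>part_inf V. snd (P V s) w = (\<Sum>i<k. b i w * (deriv ^^ i) (snd s) w))"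
    unfolding tdo_carrier_def mem_Collect_eq by (elim conjE exE)
  show thesis
  proof (rule that[of k "if c then b else a"], unfold tcoeffs_def, intro conjI allI impI ballI)
    fix i assume "i < k"
    then show "rat (part c U) ((if c then b else a) i)"
      using * regular_on_rat[OF cof_part[OF assms(1)]] by (cases c) (auto simp: part0_eq part_inf_eq)
  next
    fix V s z assume "V \<in> opens U" "s \<in> lb lam V" "z \<in> part c V"
    then show "sel c (P V s) z = (\<Sum>i<k. (if c then b else a) i z * (deriv ^^ i) (sel c s) z)"
      using *(2) by (cases c) (auto simp: part0_eq part_inf_eq sel_def)
  qed
qed

text \<open>A description of an operator in one chart without explicit coefficients, so that sums
  and composites are handled by the closure properties of \<open>diffop\<close>.\<close>

definition acts_as :: "int \<Rightarrow> bool \<Rightarrow> p1 set \<Rightarrow> dop \<Rightarrow> ((complex \<Rightarrow> complex) \<Rightarrow> complex \<Rightarrow> complex) \<Rightarrow> bool" where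
  "acts_as lam c U P A \<longleftrightarrow> diffop (part c U) A \<and>
     (\<forall>V\<in>opens U. \<forall>s\<in>lb lam V. \<forall>z\<in>part c V. sel c (P V s) z = A (sel c s) z)"

lemma acts_asD:
  assumes "acts_as lam c U P A"
  shows "diffop (part c U) A" "\<lbrakk>V \<in> opens U; s \<in> lb lam V; z \<in> part c V\<rbrakk> \<Longrightarrow> sel c (P V s) z = A (sel c s) z"
  using assms by (auto simp: acts_as_def)

lemma tdo_carrierD:
  assumes "zariski_open U" "P \<in> tdo_carrier lam U" obtains A where "acts_as lam c U P A"
proof -
  obtain k a where "tcoeffs lam c U P k a" using assms by (rule tdo_carrier_coeffs)
  note * = tcoeffsD[OF this]
  show thesis
    by (rule that[of "dsum k a"], unfold acts_as_def)
      (auto simp: * intro!: diffop_sum diffop_deriv_pow)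
qed

text \<open>The carrier asks for one order bound for both charts and for coefficients vanishing
  outside the parts of \<open>U\<close>. Operators known on each chart separately are therefore
  padded with zero coefficients up to the larger order, and their coefficients are cut off.\<close>

lemma tdo_carrierI:
  assumes U: "zariski_open U" and P: "P \<in> opfun lam U"
    and ex: "\<And>c. \<exists>A. acts_as lam c U P A"
  shows "P \<in> tdo_carrier lam U"
proof -
  define Q where "Q = (\<lambda>c k a. (\<forall>i. rat (part c U) (a i)) \<and> (\<forall>i\<ge>k. a i = (\<lambda>z. 0)) \<and>
     (\<forall>V\<in>opens U. \<forall>s\<in>lb lam V. \<forall>z\<in>part c V.
       sel c (P V s) z = (dsum k a (sel c s) z)))"
  have "\<exists>k a. Q c k a" for c
  proof -
    from ex[of c] obtain A where "acts_as lam c U P A" ..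
    note A = acts_asD[OF this]
    obtain k a where "dcoeffs (part c U) A k a" using A(1) by (rule diffopE)
    note * = dcoeffsD[OF this]
    show ?thesis
      unfolding Q_def
    proof (intro exI[of _ k] exI[of _ "\<lambda>i. if i < k then a i else (\<lambda>z. 0)"] conjI ballI allI impI)
      fix V s z assume "V \<in> opens U" "s \<in> lb lam V" "z \<in> part c V"
      then show "sel c (P V s) z = (\<Sum>i<k. (if i < k then a i else (\<lambda>z. 0)) z * (deriv ^^ i) (sel c s) z)"
        using A(2) *(2)[of "part c V" "sel c s" z] line_bundle_rat[of V s] cof_part[of V c] opens_D[of V U]
          part_mono[of V U c] by simp
    qed (auto simp: * rat_const)
  qed
  then obtain k a where ka: "\<And>c. Q c (k c) (a c)" by metis
  then have ka: "\<And>c i. rat (part c U) (a c i)" "\<And>c i. i \<ge> k c \<Longrightarrow> a c i = (\<lambda>z. 0)"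
    "\<And>c V s z. \<lbrakk>V \<in> opens U; s \<in> lb lam V; z \<in> part c V\<rbrakk> \<Longrightarrow>
       sel c (P V s) z = dsum (k c) (a c) (sel c s) z"
    unfolding Q_def by simp_all
  define K where "K = max (k False) (k True)"
  define b where "b = (\<lambda>c i z. if z \<in> part c U then a c i z else 0)"
  have reg: "regular_on (part c U) (b c i)" for c i
    unfolding regular_on_iff[OF cof_part[OF U]] b_def
    using ka(1)[of c i] by (subst rat_cong[of _ _ "a c i"]) auto
  have eq: "sel c (P V s) z = dsum K (b c) (sel c s) z"
    if *: "V \<in> opens U" "s \<in> lb lam V" "z \<in> part c V" for c V s z
  proof -
    have "z \<in> part c U" using * part_mono[OF opens_D(2)] by blast
    have "sel c (P V s) z = (\<Sum>i<k c. a c i z * (deriv ^^ i) (sel c s) z)" by (rule ka(3)[OF *])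
    also have "\<dots> = dsum K (a c) (sel c s) z"
      by (rule sum.mono_neutral_left) (cases c; auto simp: K_def ka(2))+
    finally show ?thesis using \<open>z \<in> part c U\<close> by (simp add: b_def)
  qed
  have "\<exists>k a b. (\<forall>i<k. regular_on (part0 U) (a i) \<and> regular_on (part_inf U) (b i)) \<and>
         (\<forall>V\<in>opens U. \<forall>s\<in>line_bundle (lam - 1) V.
            (\<forall>z\<in>part0 V. fst (P V s) z = (dsum k a (fst s) z)) \<and>
            (\<forall>w\<in>part_inf V. snd (P V s) w = (\<Sum>i<k. b i w * (deriv ^^ i) (snd s) w)))"
    using reg[of True] reg[of False] eq[where c=True] eq[where c=False]
    by (intro exI[of _ K] exI[of _ "b False"] exI[of _ "b True"]) (simp add: part0_eq part_inf_eq sel_def)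
  then show ?thesis using P by (simp add: tdo_carrier_def)
qed

lemma tdo_carrierI':
  assumes "zariski_open U" "P \<in> opfun lam U" "\<And>c. diffop (part c U) (A c)"
    "\<And>c V s z. \<lbrakk>V \<in> opens U; s \<in> lb lam V; z \<in> part c V\<rbrakk> \<Longrightarrow> sel c (P V s) z = A c (sel c s) z"
  shows "P \<in> tdo_carrier lam U"
proof (rule tdo_carrierI[OF assms(1,2)])
  show "\<exists>A. acts_as lam c U P A" for c by (intro exI[of _ "A c"]) (simp add: acts_as_def assms(3,4))
qed

lemma tdo_simps:
  "carrier (tdo lam U) = tdo_carrier lam U"
  "V \<in> opens U \<Longrightarrow> s \<in> lb lam V \<Longrightarrow> (P \<otimes>\<^bsub>tdo lam U\<^esub> Q) V s = P V (Q V s)"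
  "V \<in> opens U \<Longrightarrow> s \<in> lb lam V \<Longrightarrow> (P \<oplus>\<^bsub>tdo lam U\<^esub> Q) V s = sadd (P V s) (Q V s)"
  "V \<in> opens U \<Longrightarrow> s \<in> lb lam V \<Longrightarrow> \<one>\<^bsub>tdo lam U\<^esub> V s = s"
  by (simp_all add: tdo_def compose_def sadd_def mk_sec_def sel_def)

lemma opfun_mult: "P \<in> opfun lam U \<Longrightarrow> Q \<in> opfun lam U \<Longrightarrow> P \<otimes>\<^bsub>tdo lam U\<^esub> Q \<in> opfun lam U"
  by (simp add: tdo_def compose_def PiE_iff Pi_iff extensional_def)

lemma opfun_add: "P \<in> opfun lam U \<Longrightarrow> Q \<in> opfun lam U \<Longrightarrow> P \<oplus>\<^bsub>tdo lam U\<^esub> Q \<in> opfun lam U"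
proof -
  assume *: "P \<in> opfun lam U" "Q \<in> opfun lam U"
  have "(P \<oplus>\<^bsub>tdo lam U\<^esub> Q) V s \<in> lb lam V" if "V \<in> opens U" "s \<in> lb lam V" for V s
    using that by (simp add: tdo_simps sadd_closed opens_D(1)[of V U] opfun_closed[OF *(1)] opfun_closed[OF *(2)])
  then show ?thesis
    by (intro PiE_I) (auto simp: tdo_def)
qed

lemma tdo_mult_closed:
  assumes U: "zariski_open U" and P: "P \<in> tdo_carrier lam U" and Q: "Q \<in> tdo_carrier lam U"
  shows "P \<otimes>\<^bsub>tdo lam U\<^esub> Q \<in> tdo_carrier lam U"
proof (rule tdo_carrierI[OF U opfun_mult[OF tdo_carrier_opfun[OF P] tdo_carrier_opfun[OF Q]]])
  fix c
  obtain A where "acts_as lam c U P A" using U P by (rule tdo_carrierD)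
  note A = acts_asD[OF this]
  obtain B where "acts_as lam c U Q B" using U Q by (rule tdo_carrierD)
  note B = acts_asD[OF this]
  show "\<exists>A. acts_as lam c U (P \<otimes>\<^bsub>tdo lam U\<^esub> Q) A"
    unfolding acts_as_def
  proof (intro exI[of _ "\<lambda>f. A (B f)"] conjI ballI)
    show "diffop (part c U) (\<lambda>f. A (B f))" by (rule diffop_comp[OF cof_part[OF U] A(1) B(1)])
    fix V s z assume V: "V \<in> opens U" and s: "s \<in> lb lam V" and z: "z \<in> part c V"
    have Qs: "Q V s \<in> lb lam V" by (rule opfun_closed[OF tdo_carrier_opfun[OF Q] V s])
    have "sel c (P V (Q V s)) z = A (sel c (Q V s)) z" by (rule A(2)[OF V Qs z])
    also have "\<dots> = A (B (sel c s)) z"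
      by (rule diffop_cong[OF A(1) cof_part[OF opens_D(1)[OF V]] part_mono[OF opens_D(2)[OF V]]])
        (use line_bundle_rat[OF opens_D(1)[OF V] Qs] B(2)[OF V s] z in auto)
    finally show "sel c ((P \<otimes>\<^bsub>tdo lam U\<^esub> Q) V s) z = A (B (sel c s)) z"
      using V s by (simp add: tdo_simps)
  qed
qed

lemma tdo_add_closed:
  assumes U: "zariski_open U" and P: "P \<in> tdo_carrier lam U" and Q: "Q \<in> tdo_carrier lam U"
  shows "P \<oplus>\<^bsub>tdo lam U\<^esub> Q \<in> tdo_carrier lam U"
proof (rule tdo_carrierI[OF U opfun_add[OF tdo_carrier_opfun[OF P] tdo_carrier_opfun[OF Q]]])
  fix c
  obtain A where "acts_as lam c U P A" using U P by (rule tdo_carrierD)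
  note A = acts_asD[OF this]
  obtain B where "acts_as lam c U Q B" using U Q by (rule tdo_carrierD)
  note B = acts_asD[OF this]
  show "\<exists>A. acts_as lam c U (P \<oplus>\<^bsub>tdo lam U\<^esub> Q) A"
    unfolding acts_as_def
    by (intro exI[of _ "\<lambda>f z. A f z + B f z"] conjI ballI diffop_add A B) (simp add: tdo_simps A B)
qed

lemma mulop_apply [simp]: "V \<in> opens U \<Longrightarrow> s \<in> lb lam V \<Longrightarrow> mulop lam U h V s = hmul h s"
  by (simp add: mulop_def hmul_def mk_sec_def sel_def chart_def)

lemma mulop_opfun: "hreg U h \<Longrightarrow> mulop lam U h \<in> opfun lam U"
proof -
  assume h: "hreg U h"
  have "mulop lam U h V s \<in> lb lam V" if "V \<in> opens U" "s \<in> lb lam V" for V s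
    using that h by (simp add: hmul_closed opens_D(1)[of V U] hreg_subset[OF h] opens_D(2))
  then show ?thesis by (intro PiE_I) (auto simp: mulop_def)
qed

lemma mulop_closed: "zariski_open U \<Longrightarrow> hreg U h \<Longrightarrow> mulop lam U h \<in> tdo_carrier lam U"
  by (rule tdo_carrierI'[of _ _ _ "\<lambda>c f z. h (chart c z) * f z"])
    (auto simp: mulop_opfun hreg_def intro!: diffop_mult)

lemma mulop_cong:
  assumes "hreg U h" "\<And>p. p \<in> U \<Longrightarrow> h p = h' p" shows "mulop lam U h = mulop lam U h'"
proof (rule opfun_eqI)
  show "mulop lam U h \<in> opfun lam U" by (rule mulop_opfun[OF assms(1)])
  show "mulop lam U h' \<in> opfun lam U"
    by (rule mulop_opfun) (use hreg_cong[of U h h', OF assms(2)] assms(1) in simp)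
  fix V s c z assume "V \<in> opens U" "s \<in> lb lam V" "z \<in> part c V"
  then show "sel c (mulop lam U h V s) z = sel c (mulop lam U h' V s) z"
    using assms(2)[of "chart c z"] opens_D(2)[of V U] by (auto simp: mem_part)
qed

lemma tdo_res_apply [simp]: "W \<in> opens V \<Longrightarrow> tdo_res V P W s = P W s"
  by (simp add: tdo_res_def)

lemma tdo_res_closed:
  assumes "zariski_open U" "V \<in> opens U" "P \<in> tdo_carrier lam U"
  shows "tdo_res V P \<in> tdo_carrier lam V"
proof -
  have V: "zariski_open V" "V \<subseteq> U" using assms(2) by (auto simp: opens_def)
  have sub: "W \<in> opens V \<Longrightarrow> W \<in> opens U" for W using assms(2) opens_trans by blast
  have op: "tdo_res V P \<in> opfun lam V"
    using tdo_carrier_opfun[OF assms(3)] sub by (auto simp: tdo_res_def PiE_iff)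
  show ?thesis
  proof (rule tdo_carrierI[OF V(1) op])
    fix c
    obtain A where "acts_as lam c U P A" using assms(1,3) by (rule tdo_carrierD)
    note A = acts_asD[OF this]
    show "\<exists>A. acts_as lam c V (tdo_res V P) A"
      unfolding acts_as_def
      by (intro exI[of _ A] conjI ballI diffop_subset[OF A(1)] part_mono V) (simp add: A(2) sub)
  qed
qed

lemma tdo_res_mulop: "V \<in> opens U \<Longrightarrow> tdo_res V (mulop lam U h) = mulop lam V h"
  by (rule ext) (auto simp: tdo_res_def mulop_def restrict_def dest: opens_trans)

text \<open>Additivity is not part of \<open>tdo_carrier\<close>; it is read off the chart
  coefficients, higher derivatives being additive on rational functions.\<close>

lemma tdo_apply_sadd:
  assumes U: "zariski_open U" and P: "P \<in> tdo_carrier lam U" and V: "V \<in> opens U"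
    and s: "s \<in> lb lam V" and t: "t \<in> lb lam V"
  shows "P V (sadd s t) = sadd (P V s) (P V t)"
proof (rule line_bundle_eqI[OF opens_D(1)[OF V], where n = "lam - 1"])
  have V': "zariski_open V" by (rule opens_D(1)[OF V])
  show "P V (sadd s t) \<in> lb lam V" "sadd (P V s) (P V t) \<in> lb lam V"
    using opfun_closed[OF tdo_carrier_opfun[OF P] V] sadd_closed V' s t by auto
  fix c z assume z: "z \<in> part c V"
  obtain k a where "tcoeffs lam c U P k a" using U P by (rule tdo_carrier_coeffs)
  note * = tcoeffsD[OF this]
  have "(deriv ^^ i) (sel c (sadd s t)) z = (deriv ^^ i) (sel c s) z + (deriv ^^ i) (sel c t) z" if "z \<in> part c V" for i z
    using that
  proof (induction i arbitrary: z)
    case (Suc i)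
    have "deriv ((deriv ^^ i) (sel c (sadd s t))) z = deriv (\<lambda>z. (deriv ^^ i) (sel c s) z + (deriv ^^ i) (sel c t) z) z"
      by (rule deriv_cong_on[OF cof_open[OF cof_part[OF V']] Suc.IH Suc.prems])
    also have "\<dots> = deriv ((deriv ^^ i) (sel c s)) z + deriv ((deriv ^^ i) (sel c t)) z"
      by (intro DERIV_imp_deriv DERIV_add rat_deriv(2)[OF cof_part[OF V', of c]]
          rat_higher_deriv line_bundle_rat[OF V' s] line_bundle_rat[OF V' t] cof_part V' Suc.prems)
    finally show ?case by (simp only: funpow.simps comp_apply)
  qed simp
  then show "sel c (P V (sadd s t)) z = sel c (sadd (P V s) (P V t)) z"
    using z by (simp add: *(2) V s t sadd_closed[OF V'] ring_distribs sum.distrib)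
qed

lemma tdo_apply_const:
  assumes U: "zariski_open U" and P: "P \<in> tdo_carrier lam U" and V: "V \<in> opens U"
    and s: "s \<in> lb lam V"
  shows "P V (hmul (\<lambda>_. x) s) = hmul (\<lambda>_. x) (P V s)"
proof (rule line_bundle_eqI[OF opens_D(1)[OF V], where n = "lam - 1"])
  have V': "zariski_open V" by (rule opens_D(1)[OF V])
  have hs: "hmul (\<lambda>_. x) s \<in> lb lam V" using hmul_closed V' s hreg_const by blast
  show "P V (hmul (\<lambda>_. x) s) \<in> lb lam V" "hmul (\<lambda>_. x) (P V s) \<in> lb lam V"
    using opfun_closed[OF tdo_carrier_opfun[OF P] V] hmul_closed hreg_const V' s hs by auto
  fix c z assume z: "z \<in> part c V"
  obtain k a where "tcoeffs lam c U P k a" using U P by (rule tdo_carrier_coeffs)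
  note * = tcoeffsD[OF this]
  have "(deriv ^^ i) (sel c (hmul (\<lambda>_. x) s)) z = x * (deriv ^^ i) (sel c s) z" if "z \<in> part c V" for i z
    using that
  proof (induction i arbitrary: z)
    case (Suc i)
    have "deriv ((deriv ^^ i) (sel c (hmul (\<lambda>_. x) s))) z = deriv (\<lambda>z. x * (deriv ^^ i) (sel c s) z) z"
      by (rule deriv_cong_on[OF cof_open[OF cof_part[OF V']] Suc.IH Suc.prems])
    also have "\<dots> = x * deriv ((deriv ^^ i) (sel c s)) z"
      by (intro DERIV_imp_deriv DERIV_cmult rat_deriv(2)[OF cof_part[OF V', of c]]
          rat_higher_deriv line_bundle_rat[OF V' s] cof_part V' Suc.prems)
    finally show ?case by (simp only: funpow.simps comp_apply)
  qed simp
  then show "sel c (P V (hmul (\<lambda>_. x) s)) z = sel c (hmul (\<lambda>_. x) (P V s)) z"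
    using z by (simp add: *(2) V s hs sum_distrib_left algebra_simps)
qed

text \<open>Compatibility with restriction is not part of \<open>tdo_carrier\<close> either. It
  holds because the same coefficients serve all open subsets and derivatives are local.\<close>

lemma tdo_apply_sres:
  assumes U: "zariski_open U" and P: "P \<in> tdo_carrier lam U" and V: "V \<in> opens U" and W: "W \<in> opens V"
    and s: "s \<in> lb lam V"
  shows "P W (sres W s) = sres W (P V s)"
proof (rule line_bundle_eqI[OF opens_D(1)[OF W], where n = "lam - 1"])
  have V': "zariski_open V" by (rule opens_D(1)[OF V])
  have W': "zariski_open W" by (rule opens_D(1)[OF W])
  have WU: "W \<in> opens U" using V W by (rule opens_trans)
  have rs: "sres W s \<in> lb lam W" using sres_closed[OF V' W s] .
  show "P W (sres W s) \<in> lb lam W" "sres W (P V s) \<in> lb lam W"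
    using opfun_closed[OF tdo_carrier_opfun[OF P]] sres_closed[OF V' W] WU V s rs by auto
  fix c z assume z: "z \<in> part c W"
  then have zV: "z \<in> part c V" using part_mono[OF opens_D(2)[OF W]] by blast
  obtain k a where "tcoeffs lam c U P k a" using U P by (rule tdo_carrier_coeffs)
  note * = tcoeffsD[OF this]
  have "(deriv ^^ i) (sel c (sres W s)) z = (deriv ^^ i) (sel c s) z" for i
    by (rule higher_deriv_cong_on[OF cof_open[OF cof_part[OF W']] _ z]) simp
  then show "sel c (P W (sres W s)) z = sel c (sres W (P V s)) z"
    using z zV by (simp add: *(2) V WU s rs)
qed

subsection \<open>The coordinate vector fields\<close>

lemma diffop_first_order: "diffop S (\<lambda>f z. poly p z * f z + poly q z * deriv f z)"
  using diffop_deriv_pow[OF rat_poly, of S q 1] by (intro diffop_add diffop_mult rat_poly) simp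

text \<open>The hypothesis \<open>tr\<close> is the gluing condition for the two chart formulas,
  with formal values \<open>f\<close>, \<open>g\<close> of a section and \<open>f'\<close>,
  \<open>g'\<close> of its derivative related as in \<open>line_bundle_deriv_trans\<close>; for
  given polynomials it is a mere field identity.\<close>

lemma first_order_closed:
  assumes U: "zariski_open U"
    and tr: "\<And>c z f f' g g'. \<lbrakk>z \<noteq> 0; f = z powi (lam - 1) * g;
      f' = z powi (lam - 1) * (of_int (lam - 1) * inverse z * g - (inverse z)\<^sup>2 * g')\<rbrakk> \<Longrightarrow>
      poly (p c) z * f + poly (q c) z * f' =
      z powi (lam - 1) * (poly (p (\<not> c)) (inverse z) * g + poly (q (\<not> c)) (inverse z) * g')"
  shows "(\<lambda>V\<in>opens U. \<lambda>s\<in>lb lam V. mk_sec (\<lambda>c z. if z \<in> part c V then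
     poly (p c) z * sel c s z + poly (q c) z * deriv (sel c s) z else 0)) \<in> tdo_carrier lam U"
    (is "?P \<in> _")
proof (rule tdo_carrierI'[OF U, of _ _ "\<lambda>c f z. poly (p c) z * f z + poly (q c) z * deriv f z"])
  have "?P V s \<in> lb lam V" if V: "V \<in> opens U" and s: "s \<in> lb lam V" for V s
  proof (rule line_bundleI)
    show V': "zariski_open V" by (rule opens_D(1)[OF V])
    fix c
    have "rat (part c V) (\<lambda>z. poly (p c) z * sel c s z + poly (q c) z * deriv (sel c s) z)"
      by (intro rat_add rat_mult rat_poly line_bundle_rat[OF V' s] rat_deriv cof_part[OF V'])
    then show "rat (part c V) (sel c (?P V s))" using V s by (subst rat_cong) auto
    fix z
    show "z \<notin> part c V \<Longrightarrow> sel c (?P V s) z = 0" using V s by simp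
    assume z: "z \<in> part c V" "z \<noteq> 0"
    show "sel c (?P V s) z = z powi (lam - 1) * sel (\<not> c) (?P V s) (inverse z)"
      using tr[OF z(2) line_bundle_trans[OF V' s z] line_bundle_deriv_trans[OF V' s z], of c] z
        inverse_in_part[OF z] V s by simp
  qed
  then show "?P \<in> opfun lam U" by (intro PiE_I) auto
qed (auto intro!: diffop_first_order)

text \<open>\<open>Dop lam U c\<close> is \<open>\<partial>/\<partial>t\<close> for the coordinate \<open>t\<close> of the chart \<open>c\<close>.  It extends to all of
  \<open>X\<close>: it is \<open>-F\<close> for \<open>c = False\<close> and \<open>-E\<close> for \<open>c = True\<close>.\<close>

definition Dop :: "int \<Rightarrow> p1 set \<Rightarrow> bool \<Rightarrow> dop" where
  "Dop lam U c = (\<lambda>V\<in>opens U. \<lambda>s\<in>lb lam V. mk_sec (\<lambda>d z. if z \<in> part d V then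
     poly (if d = c then 0 else [:0, of_int (lam - 1):]) z * sel d s z +
     poly (if d = c then 1 else [:0, 0, -1:]) z * deriv (sel d s) z else 0))"

lemma Dop_closed:
  assumes "zariski_open U" shows "Dop lam U c \<in> tdo_carrier lam U"
  unfolding Dop_def
proof (rule first_order_closed[OF assms], goal_cases)
  case (1 d z f f' g g')
  show ?case unfolding 1(2) 1(3) using 1(1) by (auto simp: field_simps power2_eq_square)
qed

lemma sel_Dop:
  "\<lbrakk>V \<in> opens U; s \<in> lb lam V; z \<in> part d V\<rbrakk> \<Longrightarrow> sel d (Dop lam U c V s) z =
    (if d = c then deriv (sel d s) z else of_int (lam - 1) * z * sel d s z - z\<^sup>2 * deriv (sel d s) z)"
  by (simp add: Dop_def power2_eq_square algebra_simps)

lemma tdo_res_Dop: "V \<in> opens U \<Longrightarrow> tdo_res V (Dop lam U c) = Dop lam V c"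
  by (rule ext) (auto simp: tdo_res_def Dop_def restrict_def dest: opens_trans)

text \<open>The chart formulas of \<open>Phi\<close> as pairs of polynomials, order zero and order
  one, so that \<open>first_order_closed\<close> covers all three generators.\<close>

definition phi_coeffs :: "int \<Rightarrow> sl2_basis \<Rightarrow> bool \<Rightarrow> complex poly \<times> complex poly" where
  "phi_coeffs lam x c = (case x of
      gE \<Rightarrow> if c then (0, [:-1:]) else ([:0, - of_int (lam - 1):], [:0, 0, 1:])
    | gF \<Rightarrow> if c then ([:0, - of_int (lam - 1):], [:0, 0, 1:]) else (0, [:-1:])
    | gH \<Rightarrow> if c then ([:of_int (lam - 1):], [:0, -2:]) else ([:- of_int (lam - 1):], [:0, 2:]))"

lemma Phi_eq: "Phi lam x = (\<lambda>V\<in>opens UNIV. \<lambda>s\<in>lb lam V. mk_sec (\<lambda>c z. if z \<in> part c V then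
     poly (fst (phi_coeffs lam x c)) z * sel c s z + poly (snd (phi_coeffs lam x c)) z * deriv (sel c s) z else 0))"
  by (cases x) (auto simp: global_op_def phi_coeffs_def mk_sec_def sel_def part0_eq part_inf_eq
      fun_eq_iff restrict_def power2_eq_square algebra_simps)

lemma Phi_closed: "Phi lam x \<in> tdo_carrier lam UNIV"
  unfolding Phi_eq
proof (rule first_order_closed, goal_cases)
  case (2 d z f f' g g')
  show ?case unfolding 2(2) 2(3) using 2(1)
    by (cases x) (auto simp: phi_coeffs_def field_simps power2_eq_square)
qed simp

abbreviation cpow :: "bool \<Rightarrow> nat \<Rightarrow> p1 \<Rightarrow> complex" where
  "cpow c k \<equiv> \<lambda>q. coord c q ^ k"

abbreviation cpoly :: "bool \<Rightarrow> complex poly \<Rightarrow> p1 \<Rightarrow> complex" where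
  "cpoly c p \<equiv> \<lambda>q. poly p (coord c q)"

section \<open>Modules over the Weyl algebra\<close>

lemma ex_antiderivative: "\<exists>P. pderiv P = (p :: complex poly)"
proof -
  have "pderiv (\<Sum>i\<le>degree p. monom (coeff p i / of_nat (Suc i)) (Suc i)) =
      (\<Sum>i\<le>degree p. monom (coeff p i) i)"
    unfolding higher_pderiv_sum[of 1, simplified] by (rule sum.cong) (simp_all add: pderiv_monom del: of_nat_Suc)
  also have "\<dots> = p" by (rule poly_as_sum_of_monoms)
  finally show ?thesis by blast
qed

text \<open>Finitely many linear conditions on the infinite-dimensional space of finitely supported
  sequences, coded as polynomials. Requiring the first \<open>M\<close> coefficients to vanish
  strengthens the induction: it provides two solutions for \<open>I\<close> that stay independent
  when they are combined to meet the condition at \<open>y\<close>.\<close>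

lemma common_kernel:
  fixes v :: "nat \<Rightarrow> 'x \<Rightarrow> complex"
  assumes "finite I"
  shows "\<exists>q. q \<noteq> 0 \<and> (\<forall>i<M. coeff q i = 0) \<and> (\<forall>x\<in>I. (\<Sum>j\<le>degree q. coeff q j * v j x) = 0)"
  using assms
proof (induction I arbitrary: M rule: finite_induct)
  case empty
  show ?case by (rule exI[of _ "monom 1 M"]) simp
next
  case (insert y I)
  define L where "L = (\<lambda>x q. \<Sum>j\<le>degree q. coeff q j * v j x)"
  have L: "L x q = (\<Sum>j\<le>K. coeff q j * v j x)" if "degree q \<le> K" for x q K
    unfolding L_def using that by (intro sum.mono_neutral_left) (auto simp: coeff_eq_0)
  have lin: "L x (Polynomial.smult a p - Polynomial.smult b q) = a * L x p - b * L x q" for x a b p q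
  proof -
    define K where "K = max (degree p) (degree q)"
    have "degree (Polynomial.smult a p - Polynomial.smult b q) \<le> K"
      unfolding K_def by (intro degree_diff_le le_trans[OF degree_smult_le]) auto
    moreover have "degree p \<le> K" "degree q \<le> K" by (auto simp: K_def)
    ultimately show ?thesis
      by (simp add: L sum_subtractf sum_distrib_left algebra_simps)
  qed
  obtain q1 where q1: "q1 \<noteq> 0" "\<And>i. i < M \<Longrightarrow> coeff q1 i = 0" "\<And>x. x \<in> I \<Longrightarrow> L x q1 = 0"
    using insert.IH[of M] unfolding L_def by blast
  \<comment> \<open>This solution starts beyond the degree of \<open>q1\<close>, so its leading
    coefficient cannot cancel in the combination \<open>q\<close> below.\<close>
  obtain q2 where q2: "q2 \<noteq> 0" "\<And>i. i < Suc (max M (degree q1)) \<Longrightarrow> coeff q2 i = 0" "\<And>x. x \<in> I \<Longrightarrow> L x q2 = 0"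
    using insert.IH[of "Suc (max M (degree q1))"] unfolding L_def by blast
  show ?case
  proof (cases "L y q1 = 0")
    case True
    then show ?thesis using q1 unfolding L_def by blast
  next
    case False
    define q where "q = Polynomial.smult (L y q2) q1 - Polynomial.smult (L y q1) q2"
    have "coeff q (degree q2) \<noteq> 0"
    proof -
      have "\<not> degree q2 < Suc (max M (degree q1))" using q2(1) q2(2)[of "degree q2"] by auto
      then have "degree q2 > degree q1" by simp
      then show ?thesis using False q2(1) by (simp add: q_def coeff_eq_0)
    qed
    then have "q \<noteq> 0" by auto
    moreover have "\<forall>i<M. coeff q i = 0" using q1(2) q2(2) by (auto simp: q_def)
    moreover have "\<forall>x\<in>insert y I. L x q = 0" using q1(3) q2(3) by (auto simp: q_def lin)
    ultimately show ?thesis unfolding L_def by blast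
  qed
qed

text \<open>Modules over the Weyl algebra of polynomial differential operators on the line; complex
  scalars are the constant polynomials.\<close>

locale wmod = abelian_group G for G (structure) +
  fixes pm :: "complex poly \<Rightarrow> 'a \<Rightarrow> 'a" and D :: "'a \<Rightarrow> 'a"
  assumes pm_closed [simp, intro]: "m \<in> carrier G \<Longrightarrow> pm p m \<in> carrier G"
    and pm_add: "m \<in> carrier G \<Longrightarrow> pm (p + q) m = pm p m \<oplus> pm q m"
    and pm_addr: "m \<in> carrier G \<Longrightarrow> m' \<in> carrier G \<Longrightarrow> pm p (m \<oplus> m') = pm p m \<oplus> pm p m'"
    and pm_mult: "m \<in> carrier G \<Longrightarrow> pm (p * q) m = pm p (pm q m)"
    and pm_1: "m \<in> carrier G \<Longrightarrow> pm 1 m = m"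
    and D_closed [simp, intro]: "m \<in> carrier G \<Longrightarrow> D m \<in> carrier G"
    and D_add: "m \<in> carrier G \<Longrightarrow> m' \<in> carrier G \<Longrightarrow> D (m \<oplus> m') = D m \<oplus> D m'"
    and D_pm: "m \<in> carrier G \<Longrightarrow> D (pm p m) = pm (pderiv p) m \<oplus> pm p (D m)"
begin

lemma pm_one [simp]: "m \<in> carrier G \<Longrightarrow> pm [:1:] m = m"
  using pm_1 by (simp add: one_pCons)

lemma add_left_cancel:
  assumes "a \<in> carrier G" "b \<in> carrier G" "c \<in> carrier G" "a \<oplus> b = a \<oplus> c" shows "b = c"
proof -
  have "\<ominus> a \<oplus> (a \<oplus> b) = \<ominus> a \<oplus> (a \<oplus> c)" using assms(4) by simp
  then show ?thesis using assms(1-3) by (simp add: a_assoc[symmetric] l_neg)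
qed

lemma eq_self_add: "x \<in> carrier G \<Longrightarrow> x \<oplus> x = x \<Longrightarrow> x = \<zero>"
  by (metis add.r_cancel_one')

lemma pm_0 [simp]: "m \<in> carrier G \<Longrightarrow> pm 0 m = \<zero>"
  by (rule eq_self_add) (simp_all flip: pm_add)

lemma pm_zero [simp]: "pm p \<zero> = \<zero>"
  by (rule eq_self_add) (simp_all flip: pm_addr)

lemma D_zero [simp]: "D \<zero> = \<zero>"
  by (rule eq_self_add) (simp_all flip: D_add)

lemma add_eq_zeroD:
  assumes "a \<in> carrier G" "b \<in> carrier G" "a \<oplus> b = \<zero>"
  shows "a = \<ominus> b" "b = \<ominus> a"
proof -
  show "a = \<ominus> b" using minus_equality[OF assms(3,2,1)] by simp
  have "b \<oplus> a = \<zero>" using assms by (simp add: a_comm)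
  from minus_equality[OF this assms(1,2)] show "b = \<ominus> a" by simp
qed

lemma pm_uminus: "m \<in> carrier G \<Longrightarrow> pm (- p) m = \<ominus> pm p m"
  using pm_add[of m p "- p"] by (intro add_eq_zeroD(2)) simp_all

lemma D_uminus: "m \<in> carrier G \<Longrightarrow> D (\<ominus> m) = \<ominus> D m"
  using D_add[of m "\<ominus> m"] by (intro add_eq_zeroD(2)) (simp_all add: r_neg)

lemma pm_comm: "m \<in> carrier G \<Longrightarrow> pm p (pm q m) = pm q (pm p m)"
  by (metis mult.commute pm_mult)

lemma pm_comm3: "m \<in> carrier G \<Longrightarrow> pm p (pm q (pm r m)) = pm (q * r) (pm p m)"
  using pm_mult[of m q r] pm_comm[of m p "q * r"] by simp

lemma pm_const_inverse: "m \<in> carrier G \<Longrightarrow> a \<noteq> 0 \<Longrightarrow> pm [:inverse a:] (pm [:a:] m) = m"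
  using pm_mult[of m "[:inverse a:]" "[:a:]"] pm_1 by (simp add: one_pCons)

lemma D_const: "m \<in> carrier G \<Longrightarrow> D (pm [:a:] m) = pm [:a:] (D m)"
  by (simp add: D_pm)

lemma additive_finsum:
  assumes T: "\<And>m. m \<in> carrier G \<Longrightarrow> T m \<in> carrier G" "T \<zero> = \<zero>"
    "\<And>m n. m \<in> carrier G \<Longrightarrow> n \<in> carrier G \<Longrightarrow> T (m \<oplus> n) = T m \<oplus> T n"
    and "f \<in> I \<rightarrow> carrier G"
  shows "T (finsum G f I) = finsum G (\<lambda>i. T (f i)) I"
  using assms(4)
proof (induction I rule: infinite_finite_induct)
  case (insert i I)
  then have "f i \<in> carrier G" "f \<in> I \<rightarrow> carrier G" by auto
  moreover have "(\<lambda>i. T (f i)) \<in> I \<rightarrow> carrier G" using insert.prems T(1) by auto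
  ultimately show ?case
    using insert T by (simp add: finsum_insert)
qed (auto simp: T(2))

lemma pm_finsum: "f \<in> I \<rightarrow> carrier G \<Longrightarrow> pm p (finsum G f I) = finsum G (\<lambda>i. pm p (f i)) I"
  by (rule additive_finsum) (auto simp: pm_addr)

lemma D_finsum: "f \<in> I \<rightarrow> carrier G \<Longrightarrow> D (finsum G f I) = finsum G (\<lambda>i. D (f i)) I"
  by (rule additive_finsum) (auto simp: D_add)

subsection \<open>Linear combinations\<close>

definition lc :: "('i \<Rightarrow> complex poly) \<Rightarrow> ('i \<Rightarrow> 'a) \<Rightarrow> 'i set \<Rightarrow> 'a" where
  "lc h x I = finsum G (\<lambda>i. pm (h i) (x i)) I"

definition gen :: "('i \<Rightarrow> 'a) \<Rightarrow> 'i set \<Rightarrow> bool" where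
  "gen x I \<longleftrightarrow> finite I \<and> x \<in> I \<rightarrow> carrier G \<and> (\<forall>m\<in>carrier G. \<exists>h. m = lc h x I)"

definition indep :: "('i \<Rightarrow> 'a) \<Rightarrow> 'i set \<Rightarrow> bool" where
  "indep x I \<longleftrightarrow> (\<forall>h. lc h x I = \<zero> \<longrightarrow> (\<forall>i\<in>I. h i = 0))"

lemma lc_fun: "x \<in> I \<rightarrow> carrier G \<Longrightarrow> (\<lambda>i. pm (h i) (x i)) \<in> I \<rightarrow> carrier G"
  by auto

lemma lc_closed [simp, intro]: "x \<in> I \<rightarrow> carrier G \<Longrightarrow> lc h x I \<in> carrier G"
  unfolding lc_def by (rule finsum_closed[OF lc_fun])

lemma lc_add: "x \<in> I \<rightarrow> carrier G \<Longrightarrow> lc (\<lambda>i. h i + h' i) x I = lc h x I \<oplus> lc h' x I"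
proof -
  assume x: "x \<in> I \<rightarrow> carrier G"
  have "lc (\<lambda>i. h i + h' i) x I = finsum G (\<lambda>i. pm (h i) (x i) \<oplus> pm (h' i) (x i)) I"
    unfolding lc_def using x by (intro finsum_cong') (auto simp: pm_add Pi_iff)
  also have "\<dots> = lc h x I \<oplus> lc h' x I" unfolding lc_def using x by (intro finsum_addf) auto
  finally show ?thesis .
qed

lemma pm_lc: "x \<in> I \<rightarrow> carrier G \<Longrightarrow> pm p (lc h x I) = lc (\<lambda>i. p * h i) x I"
  unfolding lc_def
  by (subst pm_finsum) (auto intro!: finsum_cong' simp: pm_mult Pi_iff)

lemma lc_uminus: "x \<in> I \<rightarrow> carrier G \<Longrightarrow> lc (\<lambda>i. - h i) x I = \<ominus> lc h x I"
  using pm_lc[of x I "- 1" h] by (simp add: pm_uminus pm_1)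

lemma lc_cong: "x \<in> I \<rightarrow> carrier G \<Longrightarrow> (\<And>i. i \<in> I \<Longrightarrow> h i = h' i) \<Longrightarrow> lc h x I = lc h' x I"
  unfolding lc_def by (rule finsum_cong') (auto simp: Pi_iff)

lemma lc_0: "x \<in> I \<rightarrow> carrier G \<Longrightarrow> (\<And>i. i \<in> I \<Longrightarrow> h i = 0) \<Longrightarrow> lc h x I = \<zero>"
  unfolding lc_def by (subst finsum_cong'[of I I "\<lambda>_. \<zero>"]) (auto simp: Pi_iff)

lemma lc_insert: "\<lbrakk>finite I; i \<notin> I; x \<in> insert i I \<rightarrow> carrier G\<rbrakk> \<Longrightarrow>
    lc h x (insert i I) = pm (h i) (x i) \<oplus> lc h x I"
  unfolding lc_def by (rule finsum_insert) auto

lemma lc_mono: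
  assumes "finite J" "I \<subseteq> J" "x \<in> J \<rightarrow> carrier G"
  shows "lc h x I = lc (\<lambda>i. if i \<in> I then h i else 0) x J"
proof -
  have "lc (\<lambda>i. if i \<in> I then h i else 0) x J = lc (\<lambda>i. if i \<in> I then h i else 0) x I"
    unfolding lc_def
    by (rule add.finprod_mono_neutral_cong_right) (use assms in \<open>auto simp: Pi_iff\<close>)
  also have "\<dots> = lc h x I" using assms by (intro lc_cong) auto
  finally show ?thesis by simp
qed

lemma lc_delta:
  assumes "finite I" "i \<in> I" "x \<in> I \<rightarrow> carrier G"
  shows "lc (\<lambda>j. if j = i then p else 0) x I = pm p (x i)"
proof -
  have "lc (\<lambda>_. p) x {i} = lc (\<lambda>j. if j \<in> {i} then p else 0) x I"
    using assms by (intro lc_mono) auto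
  moreover have "lc (\<lambda>_. p) x {i} = pm p (x i)"
    using assms lc_insert[of "{}" i x "\<lambda>_. p"] by (auto simp: lc_def Pi_iff)
  ultimately show ?thesis by simp
qed

lemma finsum_lc:
  assumes "finite A" "x \<in> I \<rightarrow> carrier G"
  shows "finsum G (\<lambda>a. lc (P a) x I) A = lc (\<lambda>i. \<Sum>a\<in>A. P a i) x I"
  using assms
proof (induction A rule: finite_induct)
  case (insert a A)
  then show ?case by (simp add: finsum_insert lc_add)
qed (simp add: lc_0)

lemma lc_lc:
  assumes "finite A" "x \<in> I \<rightarrow> carrier G"
  shows "lc q (\<lambda>a. lc (P a) x I) A = lc (\<lambda>i. \<Sum>a\<in>A. q a * P a i) x I"
  unfolding lc_def[of q] using assms by (simp add: pm_lc finsum_lc)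

lemma lc_eq_iff:
  assumes "indep x I" "x \<in> I \<rightarrow> carrier G" "lc h x I = lc h' x I" "i \<in> I"
  shows "h i = h' i"
proof -
  have "lc (\<lambda>i. h i + - h' i) x I = \<zero>"
    unfolding lc_add[OF assms(2)] lc_uminus[OF assms(2)] using assms(2,3) by (simp add: r_neg)
  then show ?thesis using assms(1,4) unfolding indep_def by (metis add.right_inverse add_right_cancel)
qed

lemma D_lc_ker:
  assumes "x \<in> I \<rightarrow> carrier G" "\<And>i. i \<in> I \<Longrightarrow> D (x i) = \<zero>"
  shows "D (lc h x I) = lc (\<lambda>i. pderiv (h i)) x I"
  unfolding lc_def
  by (subst D_finsum) (use assms in \<open>auto intro!: finsum_cong' simp: D_pm Pi_iff\<close>)

subsection \<open>Torsion\<close>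

text \<open>Take a maximal independent subfamily \<open>J\<close> of the generators. Adding a
  further generator creates a relation in which its own coefficient is nonzero, so a multiple of it
  lies in the span of \<open>J\<close>; the product of these finitely many factors serves as
  \<open>d\<close>.\<close>

lemma gen_free_multiple:
  assumes "gen x I"
  obtains J d where "J \<subseteq> I" "indep x J" "d \<noteq> 0" "\<And>m. m \<in> carrier G \<Longrightarrow> \<exists>h. pm d m = lc h x J"
proof -
  have I: "finite I" "x \<in> I \<rightarrow> carrier G" using assms by (auto simp: gen_def)
  have ne: "{J. J \<subseteq> I \<and> indep x J} \<noteq> {}" by (auto simp: indep_def intro!: exI[of _ "{}"])
  have fin: "finite {J. J \<subseteq> I \<and> indep x J}" using I(1) by simp
  from finite_has_maximal[OF fin ne] obtain J where J0: "J \<in> {J. J \<subseteq> I \<and> indep x J}"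
    and mx: "\<forall>J'\<in>{J. J \<subseteq> I \<and> indep x J}. J \<subseteq> J' \<longrightarrow> J = J'" by (rule bexE)
  have J: "J \<subseteq> I" "indep x J" using J0 by simp_all
  have max: "J = J'" if "J' \<subseteq> I" "indep x J'" "J \<subseteq> J'" for J' using mx that by simp
  have xJ: "x \<in> J \<rightarrow> carrier G" and finJ: "finite J" using I J finite_subset by auto
  have "\<exists>d h. d \<noteq> 0 \<and> pm d (x i) = lc h x J" if i: "i \<in> I" for i
  proof (cases "i \<in> J")
    case True
    then show ?thesis using lc_delta[OF finJ True xJ, of 1] by (metis one_neq_zero)
  next
    case False
    have xi: "x i \<in> carrier G" "x \<in> insert i J \<rightarrow> carrier G" using i I xJ by auto
    have "\<not> indep x (insert i J)" using max[of "insert i J"] False J i by auto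
    then obtain h j where h: "lc h x (insert i J) = \<zero>" "j \<in> insert i J" "h j \<noteq> 0"
      unfolding indep_def by blast
    have eq: "pm (h i) (x i) \<oplus> lc h x J = \<zero>"
      using h(1) lc_insert[OF finJ False xi(2)] by simp
    have "h i \<noteq> 0"
    proof
      assume "h i = 0"
      then have "lc h x J = \<zero>" using eq xi xJ by simp
      then have "\<forall>j\<in>J. h j = 0" using J(2) unfolding indep_def by blast
      then show False using h \<open>h i = 0\<close> by auto
    qed
    moreover have "pm (h i) (x i) = lc (\<lambda>j. - h j) x J"
      using add_eq_zeroD(1)[OF _ _ eq] xi xJ by (simp add: lc_uminus)
    ultimately show ?thesis by blast
  qed
  then obtain d h where dh: "\<And>i. i \<in> I \<Longrightarrow> d i \<noteq> 0 \<and> pm (d i) (x i) = lc (h i) x J" by metis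
  define e where "e = prod d I"
  have "e \<noteq> 0" unfolding e_def using I(1) dh by (simp add: prod_zero_iff)
  moreover have "\<exists>h. pm e m = lc h x J" if m: "m \<in> carrier G" for m
  proof -
    obtain g where g: "m = lc g x I" using assms m unfolding gen_def by blast
    have ei: "pm e (x i) = lc (\<lambda>j. prod d (I - {i}) * h i j) x J" if "i \<in> I" for i
    proof -
      have "e = prod d (I - {i}) * d i" unfolding e_def using that I(1) by (simp add: prod.remove mult.commute)
      then show ?thesis using that I dh xJ by (auto simp: pm_mult pm_lc Pi_iff)
    qed
    have "pm e m = finsum G (\<lambda>i. pm e (pm (g i) (x i))) I"
      unfolding g lc_def using I by (intro pm_finsum) auto
    also have "\<dots> = finsum G (\<lambda>i. pm (g i) (lc (\<lambda>j. prod d (I - {i}) * h i j) x J)) I"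
      using I xJ by (intro finsum_cong') (auto simp: pm_comm[of _ e] ei Pi_iff)
    also have "\<dots> = lc (\<lambda>j. \<Sum>i\<in>I. g i * (prod d (I - {i}) * h i j)) x J"
      using lc_lc[OF I(1) xJ, of g "\<lambda>i j. prod d (I - {i}) * h i j"] by (simp add: lc_def[of g])
    finally show ?thesis by blast
  qed
  ultimately show thesis using that J by blast
qed

text \<open>The torsion submodule is stable under \<open>D\<close> and killed by a single polynomial \<open>d\<close>, hence also
  by the derivative of \<open>d\<close>, and finally by a nonzero constant.\<close>

theorem torsion_free:
  assumes "gen x I" "m \<in> carrier G" "p \<noteq> 0" "pm p m = \<zero>"
  shows "m = \<zero>"
proof -
  define tor where "tor = (\<lambda>m. m \<in> carrier G \<and> (\<exists>p. p \<noteq> 0 \<and> pm p m = \<zero>))"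
  obtain J d where J: "J \<subseteq> I" "indep x J" and d: "d \<noteq> 0" "\<And>m. m \<in> carrier G \<Longrightarrow> \<exists>h. pm d m = lc h x J"
    using gen_free_multiple[OF assms(1)] by blast
  have xJ: "x \<in> J \<rightarrow> carrier G" using assms(1) J unfolding gen_def by auto
  \<comment> \<open>The coordinates of \<open>pm d m\<close> in the independent family
    \<open>J\<close> are annihilated by \<open>p\<close>, and polynomials have no zero
    divisors.\<close>
  have kill: "pm d m = \<zero>" if tm: "tor m" for m
  proof -
    obtain p where p: "p \<noteq> 0" "pm p m = \<zero>" and m: "m \<in> carrier G" using tm unfolding tor_def by blast
    obtain h where h: "pm d m = lc h x J" using d m by blast
    have "lc (\<lambda>j. p * h j) x J = pm p (pm d m)" using h xJ by (simp add: pm_lc)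
    also have "\<dots> = \<zero>" using p m by (simp add: pm_comm[of m p d])
    finally have "\<forall>j\<in>J. p * h j = 0" using J(2) unfolding indep_def by blast
    then show ?thesis unfolding h using p xJ by (intro lc_0) auto
  qed
  have tD: "tor (D m)" if tm: "tor m" for m
  proof -
    obtain p where p: "p \<noteq> 0" "pm p m = \<zero>" and m: "m \<in> carrier G" using tm unfolding tor_def by blast
    \<comment> \<open>The square is taken because the terms from the derivative of
      \<open>p * p\<close> still contain a factor \<open>p\<close> and vanish, leaving
      \<open>p * p\<close> applied to \<open>D m\<close>.\<close>
    have "\<zero> = D (pm (p * p) m)" using p m by (simp add: pm_mult)
    also have "\<dots> = pm (p * pderiv p) m \<oplus> pm (p * pderiv p) m \<oplus> pm (p * p) (D m)"
      by (simp only: D_pm[OF m] pderiv_mult pm_add[OF m])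
    also have "pm (p * pderiv p) m = \<zero>" using p m by (simp add: pm_mult pm_comm[of m p])
    finally show ?thesis using p m unfolding tor_def by (intro conjI exI[of _ "p * p"]) auto
  qed
  have "\<forall>m. tor m \<longrightarrow> m = \<zero>" if "d \<noteq> 0" "\<And>m. tor m \<Longrightarrow> pm d m = \<zero>" for d
    using that
  proof (induction "degree d" arbitrary: d rule: less_induct)
    case less
    show ?case
    proof (cases "degree d = 0")
      case True
      then obtain a where a: "d = [:a:]" by (metis degree_eq_zeroE)
      with less.prems(1) have "a \<noteq> 0" by auto
      show ?thesis
      proof (intro allI impI)
        fix m assume "tor m"
        then show "m = \<zero>"
          using less.prems(2)[of m] pm_const_inverse[of m a] \<open>a \<noteq> 0\<close> a by (auto simp: tor_def)
      qed
    next
      case False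
      have "pm (pderiv d) m = \<zero>" if m: "tor m" for m
      proof -
        have mc: "m \<in> carrier G" using m by (simp add: tor_def)
        have "\<zero> = D (pm d m)" using less.prems(2)[OF m] by simp
        also have "\<dots> = pm (pderiv d) m \<oplus> pm d (D m)" by (rule D_pm[OF mc])
        also have "pm d (D m) = \<zero>" using less.prems(2)[OF tD[OF m]] .
        finally show ?thesis using mc by simp
      qed
      moreover have "pderiv d \<noteq> 0" "degree (pderiv d) < degree d"
        using False by (auto simp: pderiv_eq_0_iff degree_pderiv)
      ultimately show ?thesis using less.hyps by blast
    qed
  qed
  then show ?thesis using kill d(1) assms unfolding tor_def by blast
qed

text \<open>Krull intersection for the powers of the coordinate: up to the factor \<open>d\<close>
  the section has polynomial coordinates in an independent family, and a nonzero coordinate is not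
  divisible by a power of \<open>X\<close> beyond its degree.\<close>

lemma divisible_zero:
  assumes "gen x I" "m \<in> carrier G" "\<And>k. \<exists>m'\<in>carrier G. m = pm (monom 1 k) m'"
  shows "m = \<zero>"
proof -
  obtain J d where J: "J \<subseteq> I" "indep x J" and d: "d \<noteq> 0" "\<And>m. m \<in> carrier G \<Longrightarrow> \<exists>h. pm d m = lc h x J"
    using gen_free_multiple[OF assms(1)] by blast
  have xJ: "x \<in> J \<rightarrow> carrier G" using assms(1) J unfolding gen_def by auto
  obtain h where h: "pm d m = lc h x J" using d assms(2) by blast
  have "h j = 0" if j: "j \<in> J" for j
  proof (rule ccontr)
    assume nz: "h j \<noteq> 0"
    obtain m' where m': "m' \<in> carrier G" "m = pm (monom 1 (Suc (degree (h j)))) m'" using assms(3) by blast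
    obtain h' where h': "pm d m' = lc h' x J" using d m' by blast
    have "lc h x J = lc (\<lambda>j'. monom 1 (Suc (degree (h j))) * h' j') x J"
      using h m' h' xJ by (simp add: pm_comm[of m' d] pm_lc)
    from lc_eq_iff[OF J(2) xJ this j] have eq: "h j = monom 1 (Suc (degree (h j))) * h' j" .
    then have "h' j \<noteq> 0" using nz by auto
    then have "degree (h j) = Suc (degree (h j)) + degree (h' j)"
      by (subst eq) (simp add: degree_mult_eq degree_monom_eq monom_eq_0_iff)
    then show False by simp
  qed
  then have "pm d m = \<zero>" unfolding h using xJ by (intro lc_0)
  then show ?thesis using torsion_free[OF assms(1,2) d(1)] by simp
qed

subsection \<open>The Euler operator\<close>

definition \<theta> :: "'a \<Rightarrow> 'a" where
  "\<theta> m = pm [:0, 1:] (D m)"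

lemma theta_closed [simp, intro]: "m \<in> carrier G \<Longrightarrow> \<theta> m \<in> carrier G"
  by (simp add: \<theta>_def)

lemma theta_add: "m \<in> carrier G \<Longrightarrow> m' \<in> carrier G \<Longrightarrow> \<theta> (m \<oplus> m') = \<theta> m \<oplus> \<theta> m'"
  by (simp add: \<theta>_def D_add pm_addr)

lemma theta_zero [simp]: "\<theta> \<zero> = \<zero>"
  by (simp add: \<theta>_def)

lemma theta_const: "m \<in> carrier G \<Longrightarrow> \<theta> (pm [:a:] m) = pm [:a:] (\<theta> m)"
  by (simp add: \<theta>_def D_const pm_comm)

lemma D_theta: "m \<in> carrier G \<Longrightarrow> D (\<theta> m) = D m \<oplus> \<theta> (D m)"
  by (simp add: \<theta>_def D_pm pderiv_pCons pm_1)

lemma funpow_closed [simp, intro]: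
  "m \<in> carrier G \<Longrightarrow> (D ^^ k) m \<in> carrier G" "m \<in> carrier G \<Longrightarrow> (\<theta> ^^ k) m \<in> carrier G"
  by (induction k) auto

lemma Dpow_add: "m \<in> carrier G \<Longrightarrow> m' \<in> carrier G \<Longrightarrow> (D ^^ k) (m \<oplus> m') = (D ^^ k) m \<oplus> (D ^^ k) m'"
  by (induction k) (auto simp: D_add)

lemma Dpow_const: "m \<in> carrier G \<Longrightarrow> (D ^^ k) (pm [:a:] m) = pm [:a:] ((D ^^ k) m)"
  by (induction k) (auto simp: D_const)

lemma Dpow_zero [simp]: "(D ^^ k) \<zero> = \<zero>"
  by (induction k) auto

text \<open>Each of the \<open>k\<close> factors \<open>D\<close> moved past \<open>\<theta>\<close>
  adds 1 to it, by \<open>D_theta\<close>.\<close>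

lemma Dpow_theta: "m \<in> carrier G \<Longrightarrow> (D ^^ k) (\<theta> m) = pm [:of_nat k:] ((D ^^ k) m) \<oplus> \<theta> ((D ^^ k) m)"
proof (induction k)
  case (Suc k)
  have "[:of_nat (Suc k):] = [:of_nat k:] + (1 :: complex poly)" by (simp add: one_pCons)
  with Suc show ?case
    by (simp add: D_add D_const D_theta pm_add pm_1 a_assoc del: of_nat_Suc)
qed simp

lemma theta_eigen_D:
  assumes "u \<in> carrier G" "\<theta> u = pm [:\<mu>:] u"
  shows "\<theta> (D u) = pm [:\<mu> - 1:] (D u)"
proof -
  have u: "D u \<in> carrier G" using assms(1) by simp
  have "D u \<oplus> \<theta> (D u) = D (pm [:\<mu>:] u)"
    unfolding assms(2)[symmetric] by (rule D_theta[OF assms(1), symmetric])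
  also have "\<dots> = pm ([:1:] + [:\<mu> - 1:]) (D u)" using assms(1) by (simp add: D_const)
  also have "\<dots> = D u \<oplus> pm [:\<mu> - 1:] (D u)" unfolding pm_add[OF u] using u by simp
  finally have "D u \<oplus> \<theta> (D u) = D u \<oplus> pm [:\<mu> - 1:] (D u)" .
  from add_left_cancel[OF u _ _ this] show ?thesis using u by simp
qed

text \<open>Since \<open>\<mu> \<noteq> 0\<close>, \<open>u\<close> is the coordinate times
  \<open>D u / \<mu>\<close>, and \<open>D u\<close> satisfies the eigenvector equation for
  \<open>\<mu> - 1\<close>, again not natural. The descent never stops, so every power of the
  coordinate divides \<open>u\<close>.\<close>

lemma theta_eigen_nonnat:
  assumes "gen x I" "u \<in> carrier G" "\<theta> u = pm [:\<mu>:] u" "\<mu> \<notin> \<nat>"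
  shows "u = \<zero>"
proof (rule divisible_zero[OF assms(1,2)])
  fix k
  show "\<exists>m'\<in>carrier G. u = pm (monom 1 k) m'"
    using assms(2-4)
  proof (induction k arbitrary: u \<mu>)
    case 0
    then show ?case using pm_1 by (intro bexI[of _ u]) auto
  next
    case (Suc k)
    have "\<mu> \<noteq> 0" "\<mu> - 1 \<notin> \<nat>"
      using Suc.prems(3) by (auto, metis Nats_1 Nats_add diff_add_cancel)
    then obtain v where v: "v \<in> carrier G" "D u = pm (monom 1 k) v"
      using Suc.IH[of "D u" "\<mu> - 1"] theta_eigen_D[OF Suc.prems(1,2)] Suc.prems by blast
    have "u = pm [:inverse \<mu>:] (\<theta> u)" using pm_const_inverse[of u \<mu>] Suc.prems \<open>\<mu> \<noteq> 0\<close> by simp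
    also have "\<dots> = pm ([:0, 1:] * monom 1 k) (pm [:inverse \<mu>:] v)"
      unfolding \<theta>_def v(2) by (rule pm_comm3[OF v(1)])
    also have "[:0, 1:] * monom 1 k = monom (1::complex) (Suc k)" by (simp add: monom_Suc)
    finally show ?case using v by blast
  qed
qed

text \<open>The same descent as for other eigenvalues, but it stops at eigenvalue 0, where the
  coordinate kills \<open>D u\<close> and torsion-freeness gives
  \<open>D u = \<zero>\<close>.\<close>

lemma theta_eigen_nat:
  assumes "gen x I" "u \<in> carrier G" "\<theta> u = pm [:of_nat l:] u"
  shows "\<exists>v\<in>carrier G. D v = \<zero> \<and> u = pm (monom 1 l) v"
  using assms(2,3)
proof (induction l arbitrary: u)
  case 0
  then have "pm [:0, 1:] (D u) = \<zero>" by (simp add: \<theta>_def)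
  then have "D u = \<zero>" using torsion_free[OF assms(1), of "D u" "[:0, 1:]"] 0 by simp
  then show ?case using 0 pm_1 by (intro bexI[of _ u]) auto
next
  case (Suc l)
  have "\<theta> (D u) = pm [:of_nat l:] (D u)" using theta_eigen_D[OF Suc.prems] by simp
  then obtain v where v: "v \<in> carrier G" "D v = \<zero>" "D u = pm (monom 1 l) v"
    using Suc.IH[of "D u"] Suc.prems by blast
  let ?a = "of_nat (Suc l) :: complex"
  have nz: "?a \<noteq> 0" using of_nat_neq_0 by blast
  have "u = pm [:inverse ?a:] (\<theta> u)"
    using pm_const_inverse[of u ?a] Suc.prems nz by (simp del: of_nat_Suc)
  also have "\<dots> = pm ([:0, 1:] * monom 1 l) (pm [:inverse ?a:] v)"
    unfolding \<theta>_def v(3) by (rule pm_comm3[OF v(1)])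
  also have "[:0, 1:] * monom 1 l = monom (1::complex) (Suc l)" by (simp add: monom_Suc)
  finally show ?case using v by (intro bexI[of _ "pm [:inverse ?a:] v"]) (simp_all add: D_const)
qed

text \<open>\<open>D ^^ M\<close> with \<open>M \<ge> N\<close> turns the hypothesis into an
  eigenvector equation for \<open>(D ^^ M) m\<close> with eigenvalue \<open>\<mu> - M\<close>. Once
  \<open>M\<close> exceeds \<open>norm \<mu>\<close> this is not a natural number.\<close>

lemma theta_nilpotent_step:
  assumes "gen x I" "m \<in> carrier G" "(D ^^ N) (\<theta> m \<oplus> pm [:- \<mu>:] m) = \<zero>"
  shows "\<exists>N. (D ^^ N) m = \<zero>"
proof -
  obtain K where K: "norm \<mu> < real K" using reals_Archimedean2 by blast
  define M where "M = N + K"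
  have "(D ^^ M) y = (D ^^ K) ((D ^^ N) y)" for y
    by (simp add: M_def add.commute[of N] funpow_add)
  then have "(D ^^ M) (\<theta> m \<oplus> pm [:- \<mu>:] m) = \<zero>" using assms(3) by simp
  then have "pm [:of_nat M:] ((D ^^ M) m) \<oplus> \<theta> ((D ^^ M) m) \<oplus> pm [:- \<mu>:] ((D ^^ M) m) = \<zero>"
    using assms(2) by (simp add: Dpow_add Dpow_theta Dpow_const)
  then have "\<theta> ((D ^^ M) m) \<oplus> pm [:of_nat M - \<mu>:] ((D ^^ M) m) = \<zero>"
    using assms(2) pm_add[of "(D ^^ M) m" "[:of_nat M:]" "[:- \<mu>:]"]
    by (simp add: a_assoc a_comm a_lcomm)
  then have "\<theta> ((D ^^ M) m) = pm (- [:of_nat M - \<mu>:]) ((D ^^ M) m)"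
    using add_eq_zeroD(1)[of "\<theta> ((D ^^ M) m)"] assms(2) by (subst pm_uminus) simp_all
  then have "\<theta> ((D ^^ M) m) = pm [:\<mu> - of_nat M:] ((D ^^ M) m)" by simp
  moreover have "\<mu> - of_nat M \<notin> \<nat>"
  proof
    assume "\<mu> - of_nat M \<in> \<nat>"
    then obtain j where "\<mu> = of_nat (M + j)" unfolding Nats_def by (auto simp: algebra_simps)
    then have "norm \<mu> = real (M + j)" by (metis norm_of_nat)
    then show False using K by (simp add: M_def)
  qed
  ultimately have "(D ^^ M) m = \<zero>" using theta_eigen_nonnat[OF assms(1)] assms(2) by blast
  then show ?thesis by blast
qed

text \<open>The action of \<open>q\<close> evaluated at \<open>\<theta>\<close>. The summation bound
  \<open>N\<close> is independent of \<open>degree q\<close>, so that polynomials of different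
  degrees can be added under one bound.\<close>

definition qact :: "nat \<Rightarrow> complex poly \<Rightarrow> 'a \<Rightarrow> 'a" where
  "qact N q m = finsum G (\<lambda>i. pm [:coeff q i:] ((\<theta> ^^ i) m)) {..N}"

lemma qact_closed [simp]: "m \<in> carrier G \<Longrightarrow> qact N q m \<in> carrier G"
  unfolding qact_def by (rule finsum_closed) auto

lemma qact_Suc: "m \<in> carrier G \<Longrightarrow> degree q \<le> N \<Longrightarrow> qact (Suc N) q m = qact N q m"
  unfolding qact_def by (subst finsum_Suc) (auto simp: coeff_eq_0)

lemma qact_add: "m \<in> carrier G \<Longrightarrow> qact N (p + q) m = qact N p m \<oplus> qact N q m"
proof -
  have "[:a + b:] = [:a:] + [:b:]" for a b :: complex by simp
  then show "m \<in> carrier G \<Longrightarrow> qact N (p + q) m = qact N p m \<oplus> qact N q m"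
    unfolding qact_def
    by (subst finsum_addf[symmetric]) (auto intro!: finsum_cong' simp: pm_add simp del: add_pCons)
qed

lemma theta_pow_const: "m \<in> carrier G \<Longrightarrow> (\<theta> ^^ k) (pm [:a:] m) = pm [:a:] ((\<theta> ^^ k) m)"
  by (induction k) (auto simp: theta_const)

lemma theta_pow_add: "m \<in> carrier G \<Longrightarrow> m' \<in> carrier G \<Longrightarrow> (\<theta> ^^ k) (m \<oplus> m') = (\<theta> ^^ k) m \<oplus> (\<theta> ^^ k) m'"
  by (induction k) (auto simp: theta_add)

lemma qact_smult: "m \<in> carrier G \<Longrightarrow> qact N (Polynomial.smult a q) m = qact N q (pm [:a:] m)"
proof -
  have "[:a * b:] = [:b:] * [:a:]" for b by simp
  then show "m \<in> carrier G \<Longrightarrow> qact N (Polynomial.smult a q) m = qact N q (pm [:a:] m)"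
    unfolding qact_def
    by (intro finsum_cong') (auto simp: theta_pow_const pm_mult simp del: mult_pCons_left mult_pCons_right)
qed

lemma qact_addr: "m \<in> carrier G \<Longrightarrow> m' \<in> carrier G \<Longrightarrow> qact N q (m \<oplus> m') = qact N q m \<oplus> qact N q m'"
  unfolding qact_def
  by (subst finsum_addf[symmetric]) (auto intro!: finsum_cong' simp: theta_pow_add pm_addr)

lemma qact_pCons_0: "m \<in> carrier G \<Longrightarrow> qact (Suc N) (pCons 0 q) m = qact N q (\<theta> m)"
  unfolding qact_def
  by (subst finsum_Suc2) (auto intro!: finsum_cong' simp: funpow_swap1)

text \<open>Split off a root \<open>\<mu>\<close>: \<open>q = (X - \<mu>) q1\<close> makes
  \<open>q1\<close> kill \<open>\<theta> m - \<mu> m\<close>, which is therefore nilpotent under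
  \<open>D\<close> by induction; \<open>theta_nilpotent_step\<close> returns to
  \<open>m\<close>.\<close>

lemma qact_nilpotent:
  assumes "gen x I" "m \<in> carrier G" "q \<noteq> 0" "degree q \<le> N" "qact N q m = \<zero>"
  shows "\<exists>k. (D ^^ k) m = \<zero>"
  using assms(2-)
proof (induction N arbitrary: q m)
  case 0
  then obtain a where a: "q = [:a:]" by (metis degree_eq_zeroE le_zero_eq)
  then have "a \<noteq> 0" "pm [:a:] m = \<zero>" using 0 by (auto simp: qact_def)
  then have "m = \<zero>" using pm_const_inverse[of m a] 0 by simp
  then show ?case by (intro exI[of _ 0]) simp
next
  case (Suc N)
  show ?case
  proof (cases "degree q \<le> N")
    case True
    then show ?thesis using Suc qact_Suc by metis
  next
    case False
    then have dq: "degree q = Suc N" using Suc.prems by simp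
    then have "\<not> constant (poly q)" by (simp add: constant_degree)
    then obtain \<mu> where "poly q \<mu> = 0" using fundamental_theorem_of_algebra by blast
    then obtain q1 where q1: "q = [:- \<mu>, 1:] * q1" by (metis dvdE poly_eq_0_iff_dvd)
    then have nz: "q1 \<noteq> 0" using Suc.prems by auto
    have "degree q = Suc (degree q1)" unfolding q1 using nz by (subst degree_mult_eq) auto
    then have d1: "degree q1 = N" using dq by simp
    have "q = pCons 0 q1 + Polynomial.smult (- \<mu>) q1" unfolding q1 by simp
    then have "qact (Suc N) q m = qact N q1 (\<theta> m) \<oplus> qact (Suc N) q1 (pm [:- \<mu>:] m)"
      using Suc.prems by (simp add: qact_add qact_pCons_0 qact_smult del: smult_minus_left)
    also have "\<dots> = qact N q1 (\<theta> m \<oplus> pm [:- \<mu>:] m)"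
      using Suc.prems d1 by (simp add: qact_Suc qact_addr)
    finally have "qact N q1 (\<theta> m \<oplus> pm [:- \<mu>:] m) = \<zero>" using Suc.prems by simp
    then obtain k where "(D ^^ k) (\<theta> m \<oplus> pm [:- \<mu>:] m) = \<zero>"
      using Suc.IH[of "\<theta> m \<oplus> pm [:- \<mu>:] m" q1] nz d1 Suc.prems by auto
    then show ?thesis using theta_nilpotent_step[OF assms(1)] Suc.prems by blast
  qed
qed

text \<open>The hypothesis says that the \<open>\<theta>\<close>-orbit of \<open>m\<close> has bounded pole order at infinity; it
  forces the orbit to span a finite-dimensional space.\<close>

theorem bounded_orbit_nilpotent:
  assumes gen: "gen x I" and m: "m \<in> carrier G" and Y: "finite Y" "y \<in> Y \<rightarrow> carrier G"
    and orbit: "\<And>j. \<exists>Q q. (\<forall>i\<in>Y. degree (q i) \<le> N + Q) \<and> pm (monom 1 Q) ((\<theta> ^^ j) m) = lc q y Y"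
  shows "\<exists>k. (D ^^ k) m = \<zero>"
proof -
  obtain J d where J: "J \<subseteq> I" "indep x J" and d: "d \<noteq> 0" "\<And>m. m \<in> carrier G \<Longrightarrow> \<exists>h. pm d m = lc h x J"
    using gen_free_multiple[OF gen] by blast
  have xJ: "x \<in> J \<rightarrow> carrier G" and finJ: "finite J" using gen J finite_subset unfolding gen_def by auto
  have "\<forall>j. \<exists>h. pm d ((\<theta> ^^ j) m) = lc h x J" using d(2) m by auto
  then obtain p where p: "\<And>j. pm d ((\<theta> ^^ j) m) = lc (p j) x J" by metis
  have "\<forall>i\<in>Y. \<exists>h. pm d (y i) = lc h x J" using d(2) Y(2) by auto
  then obtain P where P: "\<And>i. i \<in> Y \<Longrightarrow> pm d (y i) = lc (P i) x J" by metis
  \<comment> \<open>A bound for the degrees of the \<open>y i\<close> in coordinates relative to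
    \<open>J\<close>, after multiplication by \<open>d\<close>.\<close>
  define K where "K = (\<Sum>i\<in>Y. \<Sum>b\<in>J. degree (P i b))"
  have K: "degree (P i b) \<le> K" if "i \<in> Y" "b \<in> J" for i b
  proof -
    have "degree (P i b) \<le> (\<Sum>b\<in>J. degree (P i b))" using finJ that by (intro member_le_sum) auto
    also have "\<dots> \<le> K" unfolding K_def using Y(1) that by (intro member_le_sum[of i Y "\<lambda>i. \<Sum>b\<in>J. degree (P i b)"]) auto
    finally show ?thesis .
  qed
  \<comment> \<open>In \<open>J\<close>-coordinates, \<open>X^Q\<close> times \<open>p j b\<close>
    is the sum of the \<open>q i * P i b\<close>. The exponent \<open>Q\<close> occurs on both sides
    of the degree estimate and cancels, which makes the bound independent of
    \<open>j\<close>.\<close>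
  have bound: "degree (p j b) \<le> N + K" if b: "b \<in> J" for j b
  proof (cases "p j b = 0")
    case False
    obtain Q q where q: "\<And>i. i \<in> Y \<Longrightarrow> degree (q i) \<le> N + Q" "pm (monom 1 Q) ((\<theta> ^^ j) m) = lc q y Y"
      using orbit[of j] by blast
    have "lc (\<lambda>b. monom 1 Q * p j b) x J = pm d (pm (monom 1 Q) ((\<theta> ^^ j) m))"
      using m xJ by (simp add: pm_comm[of _ d] p pm_lc)
    also have "\<dots> = finsum G (\<lambda>i. pm d (pm (q i) (y i))) Y"
      unfolding q(2) lc_def using Y by (intro pm_finsum) auto
    also have "\<dots> = lc q (\<lambda>i. lc (P i) x J) Y"
      unfolding lc_def[of q] using Y xJ by (intro finsum_cong') (auto simp: pm_comm[of _ d] P Pi_iff)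
    also have "\<dots> = lc (\<lambda>b. \<Sum>i\<in>Y. q i * P i b) x J" by (rule lc_lc[OF Y(1) xJ])
    finally have eq: "monom 1 Q * p j b = (\<Sum>i\<in>Y. q i * P i b)"
      using lc_eq_iff[OF J(2) xJ _ b] by blast
    have "degree (\<Sum>i\<in>Y. q i * P i b) \<le> N + Q + K"
      by (rule degree_sum_le[OF Y(1)]) (use q(1) K b degree_mult_le in \<open>meson add_mono order_trans\<close>)
    then have "Q + degree (p j b) \<le> N + Q + K"
      using False by (simp add: eq[symmetric] degree_mult_eq degree_monom_eq monom_eq_0_iff)
    then show ?thesis by simp
  qed simp
  \<comment> \<open>Bounded degrees leave only the finitely many coefficients indexed by
    \<open>J \<times> {..N + K}\<close>, while the orbit is infinite; hence a nontrivial relation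
    among its members.\<close>
  obtain q where q: "q \<noteq> 0" "\<And>b t. b \<in> J \<Longrightarrow> t \<le> N + K \<Longrightarrow> (\<Sum>j\<le>degree q. coeff q j * coeff (p j b) t) = 0"
    using common_kernel[of "J \<times> {..N + K}" 0 "\<lambda>j (b, t). coeff (p j b) t"] finJ by auto
  have zero: "(\<Sum>j\<le>degree q. [:coeff q j:] * p j b) = 0" if b: "b \<in> J" for b
  proof (rule poly_eqI)
    fix t
    show "coeff (\<Sum>j\<le>degree q. [:coeff q j:] * p j b) t = coeff 0 t"
    proof (cases "t \<le> N + K")
      case True
      then show ?thesis using q(2)[OF b True] by (simp add: coeff_sum)
    next
      case False
      then have "coeff (p j b) t = 0" for j using bound[OF b, of j] by (intro coeff_eq_0) auto
      then show ?thesis by (simp add: coeff_sum)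
    qed
  qed
  have "pm d (qact (degree q) q m) = finsum G (\<lambda>j. pm d (pm [:coeff q j:] ((\<theta> ^^ j) m))) {..degree q}"
    unfolding qact_def using m by (intro pm_finsum) auto
  also have "\<dots> = lc (\<lambda>j. [:coeff q j:]) (\<lambda>j. lc (p j) x J) {..degree q}"
    unfolding lc_def[of "\<lambda>j. [:coeff q j:]"] using m xJ by (intro finsum_cong') (auto simp: pm_comm[of _ d] p)
  also have "\<dots> = lc (\<lambda>b. \<Sum>j\<le>degree q. [:coeff q j:] * p j b) x J" by (rule lc_lc[OF _ xJ]) simp
  also have "\<dots> = \<zero>" using xJ zero by (intro lc_0)
  finally have "qact (degree q) q m = \<zero>" using torsion_free[OF gen _ d(1)] m by simp
  then show ?thesis using qact_nilpotent[OF gen m q(1)] by blast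
qed

subsection \<open>Modules generated by horizontal sections\<close>

definition kspan :: "'a set" where
  "kspan = {m. \<exists>B h. finite B \<and> B \<subseteq> {k \<in> carrier G. D k = \<zero>} \<and> m = lc h (\<lambda>b. b) B}"

text \<open>If \<open>D m\<close> is a combination of horizontal sections, integrating its
  coefficients gives \<open>m'\<close> with \<open>D m' = D m\<close>; the difference of
  \<open>m\<close> and \<open>m'\<close> is horizontal and joins the spanning set.\<close>

lemma nilpotent_kspan:
  assumes "m \<in> carrier G" "(D ^^ k) m = \<zero>" shows "m \<in> kspan"
  using assms
proof (induction k arbitrary: m)
  case 0
  then have "m = lc (\<lambda>_. 0) (\<lambda>b. b) {}" by (simp add: lc_def)
  then show ?case unfolding kspan_def by blast
next
  case (Suc k)
  then have "D m \<in> kspan" using Suc.IH[of "D m"] by (simp add: funpow_swap1)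
  then obtain B h where B: "finite B" "B \<subseteq> {k \<in> carrier G. D k = \<zero>}" and h: "D m = lc h (\<lambda>b. b) B"
    unfolding kspan_def by blast
  have xB: "(\<lambda>b. b) \<in> B \<rightarrow> carrier G" using B by auto
  have "\<forall>b. \<exists>P. pderiv P = h b" using ex_antiderivative by blast
  then obtain P where P: "\<And>b. pderiv (P b) = h b" by metis
  define m' where "m' = lc P (\<lambda>b. b) B"
  have m': "m' \<in> carrier G" using xB by (simp add: m'_def)
  have "D m' = D m" unfolding h m'_def using B xB by (subst D_lc_ker) (auto simp: P)
  define k0 where "k0 = m \<ominus> m'"
  have k0: "k0 \<in> carrier G" "D k0 = \<zero>"
    using Suc.prems m' \<open>D m' = D m\<close> by (auto simp: k0_def a_minus_def D_add D_uminus r_neg)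
  have m: "m = k0 \<oplus> m'" using Suc.prems m' by (simp add: k0_def a_minus_def a_assoc l_neg)
  have xB': "(\<lambda>b. b) \<in> insert k0 B \<rightarrow> carrier G" using xB k0 by auto
  have "lc P (\<lambda>b. b) B = lc (\<lambda>b. if b \<in> B then P b else 0) (\<lambda>b. b) (insert k0 B)"
    using B xB' by (intro lc_mono) auto
  moreover have "k0 = lc (\<lambda>b. if b = k0 then 1 else 0) (\<lambda>b. b) (insert k0 B)"
    using lc_delta[of "insert k0 B" k0 "\<lambda>b. b" 1] B xB' k0 pm_1 by simp
  ultimately have "m = lc (\<lambda>b. (if b = k0 then 1 else 0) + (if b \<in> B then P b else 0)) (\<lambda>b. b) (insert k0 B)"
    using m xB' unfolding m'_def by (simp add: lc_add)
  then show ?case unfolding kspan_def using B k0 by blast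
qed

text \<open>Take a horizontal generating set with fewest elements and, if it is dependent, a
  relation of least total degree. Applying \<open>D\<close> only differentiates the coefficients, so
  minimality makes them constant; a nonzero constant is invertible, and its generator could be
  dropped.\<close>

theorem horizontal_basis:
  assumes gen: "gen x I" and nil: "\<And>m. m \<in> carrier G \<Longrightarrow> \<exists>k. (D ^^ k) m = \<zero>"
  obtains B where "B \<subseteq> {k \<in> carrier G. D k = \<zero>}" "gen (\<lambda>b. b) B" "indep (\<lambda>b. b) B"
proof -
  define good where "good = (\<lambda>B. B \<subseteq> {k \<in> carrier G. D k = \<zero>} \<and> gen (\<lambda>b. b) B)"
  have "\<exists>B. good B"
  proof -
    have fI: "finite I" "x \<in> I \<rightarrow> carrier G" using gen by (auto simp: gen_def)
    define R where "R = (\<lambda>m B h. finite B \<and> B \<subseteq> {k \<in> carrier G. D k = \<zero>} \<and> m = lc h (\<lambda>b. b) B)"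
    have "\<exists>B h. R (x i) B h" if "i \<in> I" for i
    proof -
      have xi: "x i \<in> carrier G" using fI(2) that by auto
      from nil[OF xi] obtain k where "(D ^^ k) (x i) = \<zero>" by (rule exE)
      from nilpotent_kspan[OF xi this] show ?thesis unfolding kspan_def R_def by simp
    qed
    then obtain B h where "\<And>i. i \<in> I \<Longrightarrow> R (x i) (B i) (h i)" by metis
    then have Bh: "\<And>i. i \<in> I \<Longrightarrow> finite (B i) \<and> B i \<subseteq> {k \<in> carrier G. D k = \<zero>} \<and> x i = lc (h i) (\<lambda>b. b) (B i)"
      unfolding R_def .
    define C where "C = (\<Union>i\<in>I. B i)"
    have C: "finite C" "C \<subseteq> {k \<in> carrier G. D k = \<zero>}" using Bh fI(1) by (auto simp: C_def)
    have xC: "(\<lambda>b. b) \<in> C \<rightarrow> carrier G" using C by auto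
    have xi: "x i = lc (\<lambda>b. if b \<in> B i then h i b else 0) (\<lambda>b. b) C" if "i \<in> I" for i
      using Bh[OF that] lc_mono[OF C(1) _ xC, of "B i" "h i"] that by (auto simp: C_def)
    have "\<exists>g. m = lc g (\<lambda>b. b) C" if m: "m \<in> carrier G" for m
    proof -
      obtain q where "m = lc q x I" using gen m unfolding gen_def by blast
      also have "\<dots> = lc q (\<lambda>i. lc (\<lambda>b. if b \<in> B i then h i b else 0) (\<lambda>b. b) C) I"
        unfolding lc_def[of q] using xi fI xC by (intro finsum_cong') auto
      also have "\<dots> = lc (\<lambda>b. \<Sum>i\<in>I. q i * (if b \<in> B i then h i b else 0)) (\<lambda>b. b) C"
        by (rule lc_lc[OF fI(1) xC])
      finally show ?thesis by blast
    qed
    then show ?thesis using C xC unfolding good_def gen_def by blast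
  qed
  then obtain B where B: "good B" and min: "\<And>B'. good B' \<Longrightarrow> card B \<le> card B'"
    using ex_has_least_nat[of good _ card] by blast
  have Bk: "B \<subseteq> {k \<in> carrier G. D k = \<zero>}" and Bg: "gen (\<lambda>b. b) B" and finB: "finite B"
    and xB: "(\<lambda>b. b) \<in> B \<rightarrow> carrier G" using B by (auto simp: good_def gen_def)
  have "indep (\<lambda>b. b) B"
  proof (rule ccontr)
    assume "\<not> indep (\<lambda>b. b) B"
    define rel where "rel = (\<lambda>h. lc h (\<lambda>b. b) B = \<zero> \<and> (\<exists>b\<in>B. h b \<noteq> 0))"
    have "\<exists>h. rel h" using \<open>\<not> indep (\<lambda>b. b) B\<close> unfolding indep_def rel_def by blast
    then obtain h where h: "rel h" and hmin: "\<And>h'. rel h' \<Longrightarrow> (\<Sum>b\<in>B. degree (h b)) \<le> (\<Sum>b\<in>B. degree (h' b))"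
      using ex_has_least_nat[of rel _ "\<lambda>h. \<Sum>b\<in>B. degree (h b)"] by blast
    have const: "degree (h b) = 0" if b: "b \<in> B" for b
    proof (rule ccontr)
      assume pos: "degree (h b) \<noteq> 0"
      have "lc (\<lambda>b. pderiv (h b)) (\<lambda>b. b) B = D (lc h (\<lambda>b. b) B)"
        using Bk xB by (subst D_lc_ker) auto
      also have "\<dots> = \<zero>" using h by (simp add: rel_def)
      finally have "rel (\<lambda>b. pderiv (h b))"
        unfolding rel_def using b pos by (auto simp: pderiv_eq_0_iff)
      moreover have "(\<Sum>b\<in>B. degree (pderiv (h b))) < (\<Sum>b\<in>B. degree (h b))"
        using finB b pos by (intro sum_strict_mono_ex1) (auto simp: degree_pderiv intro!: bexI[of _ b])
      ultimately show False using hmin by fastforce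
    qed
    obtain b0 where b0: "b0 \<in> B" "h b0 \<noteq> 0" using h by (auto simp: rel_def)
    then obtain a where a: "h b0 = [:a:]" "a \<noteq> 0" using const[OF b0(1)] by (metis degree_eq_zeroE pCons_0_0)
    define B' where "B' = B - {b0}"
    have BB: "B = insert b0 B'" "b0 \<notin> B'" "finite B'" using b0 finB by (auto simp: B'_def)
    have xB': "(\<lambda>b. b) \<in> B' \<rightarrow> carrier G" "b0 \<in> carrier G" using xB BB by auto
    have "pm [:a:] b0 \<oplus> lc h (\<lambda>b. b) B' = \<zero>"
      using h lc_insert[OF BB(3,2), of "\<lambda>b. b" h] xB BB(1) a by (simp add: rel_def)
    then have "pm [:a:] b0 = lc (\<lambda>b. - h b) (\<lambda>b. b) B'"
      using add_eq_zeroD(1)[of "pm [:a:] b0"] xB' by (subst lc_uminus) simp_all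
    then have b0e: "b0 = lc (\<lambda>b. [:inverse a:] * - h b) (\<lambda>b. b) B'"
      using pm_const_inverse[OF xB'(2) a(2)] pm_lc[OF xB'(1)] by metis
    have "\<exists>g. m = lc g (\<lambda>b. b) B'" if m: "m \<in> carrier G" for m
    proof -
      obtain q where "m = lc q (\<lambda>b. b) B" using Bg m unfolding gen_def by blast
      also have "\<dots> = pm (q b0) b0 \<oplus> lc q (\<lambda>b. b) B'"
        using lc_insert[OF BB(3,2), of "\<lambda>b. b" q] xB BB(1) by simp
      also have "pm (q b0) b0 = lc (\<lambda>b. q b0 * ([:inverse a:] * - h b)) (\<lambda>b. b) B'"
        using b0e pm_lc[OF xB'(1)] by metis
      also have "\<dots> \<oplus> lc q (\<lambda>b. b) B' = lc (\<lambda>b. q b0 * ([:inverse a:] * - h b) + q b) (\<lambda>b. b) B'"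
        by (rule lc_add[OF xB'(1), symmetric])
      finally show ?thesis by blast
    qed
    then have "good B'" using Bk BB xB' unfolding good_def gen_def by auto
    from min[OF this] show False using BB by simp
  qed
  then show thesis using that Bk Bg by blast
qed

end

section \<open>Presheaves of modules over the twisted differential operators\<close>

lemma mulop_add:
  assumes "hreg U h" "hreg U h'"
  shows "mulop lam U (\<lambda>p. h p + h' p) = mulop lam U h \<oplus>\<^bsub>tdo lam U\<^esub> mulop lam U h'"
  by (rule opfun_eqI[OF mulop_opfun[OF hreg_add[OF assms]] opfun_add[OF mulop_opfun[OF assms(1)] mulop_opfun[OF assms(2)]]])
    (simp add: tdo_simps ring_distribs)

lemma hmul_closed_opens: "\<lbrakk>V \<in> opens U; hreg U h; s \<in> line_bundle n V\<rbrakk> \<Longrightarrow> hmul h s \<in> line_bundle n V"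
  using hmul_closed opens_D hreg_subset by metis

lemma mulop_mult:
  assumes "hreg U h" "hreg U h'"
  shows "mulop lam U (\<lambda>p. h p * h' p) = mulop lam U h \<otimes>\<^bsub>tdo lam U\<^esub> mulop lam U h'"
  by (rule opfun_eqI[OF mulop_opfun[OF hreg_mult[OF assms]] opfun_mult[OF mulop_opfun[OF assms(1)] mulop_opfun[OF assms(2)]]])
    (simp add: tdo_simps hmul_closed_opens[OF _ assms(2)])

lemma mulop_one: "mulop lam U (\<lambda>p. 1) = \<one>\<^bsub>tdo lam U\<^esub>"
  by (rule opfun_eqI[OF mulop_opfun[OF hreg_const]]) (auto simp: tdo_def)

text \<open>The Leibniz rule as an identity of operators; it supplies \<open>D_pm\<close> for the
  Weyl algebra module on a chart. As \<open>U\<close> lies in chart \<open>c\<close>, comparison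
  there suffices.\<close>

lemma Dop_mulop:
  assumes U: "zariski_open U" "U \<subseteq> Uc c" and f: "rat (part c U) f"
  shows "Dop lam U c \<otimes>\<^bsub>tdo lam U\<^esub> mulop lam U (\<lambda>p. f (coord c p)) =
    mulop lam U (\<lambda>p. deriv f (coord c p)) \<oplus>\<^bsub>tdo lam U\<^esub>
    (mulop lam U (\<lambda>p. f (coord c p)) \<otimes>\<^bsub>tdo lam U\<^esub> Dop lam U c)"
    (is "?D \<otimes>\<^bsub>_\<^esub> ?f = ?f' \<oplus>\<^bsub>_\<^esub> (_ \<otimes>\<^bsub>_\<^esub> _)")
proof -
  have h: "hreg U (\<lambda>p. f (coord c p))" by (rule hreg_coord[OF U(2) f])
  have h': "hreg U (\<lambda>p. deriv f (coord c p))"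
    by (rule hreg_coord[OF U(2) rat_deriv(1)[OF cof_part[OF U(1)] f]])
  have D: "?D \<in> opfun lam U" by (rule tdo_carrier_opfun[OF Dop_closed[OF U(1)]])
  show ?thesis
  proof (rule opfun_eqI_chart[OF _ _ U(2)])
    show "?D \<otimes>\<^bsub>tdo lam U\<^esub> ?f \<in> opfun lam U" by (rule opfun_mult[OF D mulop_opfun[OF h]])
    show "?f' \<oplus>\<^bsub>tdo lam U\<^esub> (?f \<otimes>\<^bsub>tdo lam U\<^esub> ?D) \<in> opfun lam U"
      by (rule opfun_add[OF mulop_opfun[OF h'] opfun_mult[OF mulop_opfun[OF h] D]])
    fix V s z assume V: "V \<in> opens U" and s: "s \<in> lb lam V" and z: "z \<in> part c V"
    have V': "zariski_open V" by (rule opens_D(1)[OF V])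
    have "part c V \<subseteq> part c U" by (rule part_mono[OF opens_D(2)[OF V]])
    then have fV: "rat (part c V) f" using f rat_subset by blast
    have hs: "hmul (\<lambda>p. f (coord c p)) s \<in> lb lam V" by (rule hmul_closed_opens[OF V h s])
    have "sel c (hmul (\<lambda>p. f (coord c p)) s) = (\<lambda>z. f z * sel c s z)" by (rule ext) simp
    then have "deriv (sel c (hmul (\<lambda>p. f (coord c p)) s)) z = deriv f z * sel c s z + deriv (sel c s) z * f z"
      using DERIV_imp_deriv[OF DERIV_mult[OF rat_deriv(2)[OF cof_part[OF V'] fV z]
          rat_deriv(2)[OF cof_part[OF V'] line_bundle_rat[OF V' s] z]]] by simp
    then show "sel c ((?D \<otimes>\<^bsub>tdo lam U\<^esub> ?f) V s) z = sel c ((?f' \<oplus>\<^bsub>tdo lam U\<^esub> (?f \<otimes>\<^bsub>tdo lam U\<^esub> ?D)) V s) z"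
      using V s z by (simp add: tdo_simps sel_Dop hs opfun_closed[OF D V s])
  qed
qed

text \<open>In chart \<open>c\<close> the vector field of the other coordinate reads
  \<open>n z - z^2 d/dz\<close> with \<open>n = lam - 1\<close>; times \<open>inverse z\<close> this
  is \<open>n\<close> minus the Euler operator of \<open>c\<close>.\<close>

lemma Euler_relation:
  assumes U: "zariski_open U" "U \<subseteq> Uc c" "U \<subseteq> Uc (\<not> c)"
  shows "(mulop lam U (coord c) \<otimes>\<^bsub>tdo lam U\<^esub> Dop lam U c) \<oplus>\<^bsub>tdo lam U\<^esub>
     (mulop lam U (coord (\<not> c)) \<otimes>\<^bsub>tdo lam U\<^esub> Dop lam U (\<not> c)) = mulop lam U (\<lambda>_. of_int (lam - 1))"
proof (rule opfun_eqI_chart[OF _ _ U(2)])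
  have h: "hreg U (coord d)" for d
    using hreg_coord[of U d "\<lambda>z. z"] U(2,3) rat_id by (cases "d = c") auto
  have D: "Dop lam U d \<in> opfun lam U" for d by (rule tdo_carrier_opfun[OF Dop_closed[OF U(1)]])
  show "(mulop lam U (coord c) \<otimes>\<^bsub>tdo lam U\<^esub> Dop lam U c) \<oplus>\<^bsub>tdo lam U\<^esub>
     (mulop lam U (coord (\<not> c)) \<otimes>\<^bsub>tdo lam U\<^esub> Dop lam U (\<not> c)) \<in> opfun lam U"
    by (intro opfun_add opfun_mult mulop_opfun h D)
  show "mulop lam U (\<lambda>_. of_int (lam - 1)) \<in> opfun lam U" by (rule mulop_opfun[OF hreg_const])
  fix V s z assume V: "V \<in> opens U" and s: "s \<in> lb lam V" and z: "z \<in> part c V"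
  have "z \<noteq> 0"
    using z opens_D(2)[OF V] U(3) zero_notin_part[of V "\<not> c"] by auto
  then show "sel c (((mulop lam U (coord c) \<otimes>\<^bsub>tdo lam U\<^esub> Dop lam U c) \<oplus>\<^bsub>tdo lam U\<^esub>
     (mulop lam U (coord (\<not> c)) \<otimes>\<^bsub>tdo lam U\<^esub> Dop lam U (\<not> c))) V s) z =
     sel c (mulop lam U (\<lambda>_. of_int (lam - 1)) V s) z"
    using V s z by (simp add: tdo_simps sel_Dop opfun_closed[OF D V s]) (simp add: field_simps power2_eq_square)
qed

section \<open>Sections of a presheaf of modules: multiplication, vector fields, restriction\<close>

locale Dmod =
  fixes lam :: int and M :: "'v dmod"
  assumes presheaf: "D_presheaf lam M"
begin

abbreviation S :: "p1 set \<Rightarrow> (dop, 'v) module" where "S \<equiv> secs M"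

abbreviation Z :: "p1 set \<Rightarrow> 'v" where "Z U \<equiv> \<zero>\<^bsub>S U\<^esub>"

abbreviation CM :: "p1 set \<Rightarrow> 'v set" where "CM U \<equiv> carrier (S U)"

definition mm :: "p1 set \<Rightarrow> (p1 \<Rightarrow> complex) \<Rightarrow> 'v \<Rightarrow> 'v" where
  "mm U h m = mulop lam U h \<odot>\<^bsub>S U\<^esub> m"

definition dd :: "p1 set \<Rightarrow> bool \<Rightarrow> 'v \<Rightarrow> 'v" where
  "dd U c m = Dop lam U c \<odot>\<^bsub>S U\<^esub> m"

lemma left_module_secs: "zariski_open U \<Longrightarrow> left_module (tdo lam U) (S U)"
  using presheaf by (simp add: D_presheaf_def opens_UNIV)

lemma abelian_secs: "zariski_open U \<Longrightarrow> abelian_group (S U)"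
  using left_module_secs by (simp add: left_module_def)

context
  fixes U assumes U: "zariski_open U"
begin

lemma smul_closed: "P \<in> tdo_carrier lam U \<Longrightarrow> m \<in> CM U \<Longrightarrow> P \<odot>\<^bsub>S U\<^esub> m \<in> CM U"
  using left_module_secs[OF U] by (simp add: left_module_def tdo_simps(1))

lemma smul_add: "\<lbrakk>P \<in> tdo_carrier lam U; Q \<in> tdo_carrier lam U; m \<in> CM U\<rbrakk> \<Longrightarrow>
    (P \<oplus>\<^bsub>tdo lam U\<^esub> Q) \<odot>\<^bsub>S U\<^esub> m = P \<odot>\<^bsub>S U\<^esub> m \<oplus>\<^bsub>S U\<^esub> Q \<odot>\<^bsub>S U\<^esub> m"
  using left_module_secs[OF U] by (simp add: left_module_def tdo_simps(1))

lemma smul_addr: "\<lbrakk>P \<in> tdo_carrier lam U; m \<in> CM U; m' \<in> CM U\<rbrakk> \<Longrightarrow>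
    P \<odot>\<^bsub>S U\<^esub> (m \<oplus>\<^bsub>S U\<^esub> m') = P \<odot>\<^bsub>S U\<^esub> m \<oplus>\<^bsub>S U\<^esub> P \<odot>\<^bsub>S U\<^esub> m'"
  using left_module_secs[OF U] by (simp add: left_module_def tdo_simps(1))

lemma smul_mult: "\<lbrakk>P \<in> tdo_carrier lam U; Q \<in> tdo_carrier lam U; m \<in> CM U\<rbrakk> \<Longrightarrow>
    (P \<otimes>\<^bsub>tdo lam U\<^esub> Q) \<odot>\<^bsub>S U\<^esub> m = P \<odot>\<^bsub>S U\<^esub> (Q \<odot>\<^bsub>S U\<^esub> m)"
  using left_module_secs[OF U] by (simp add: left_module_def tdo_simps(1))

lemma smul_one: "m \<in> CM U \<Longrightarrow> \<one>\<^bsub>tdo lam U\<^esub> \<odot>\<^bsub>S U\<^esub> m = m"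
  using left_module_secs[OF U] by (simp add: left_module_def)

lemma mm_closed: "hreg U h \<Longrightarrow> m \<in> CM U \<Longrightarrow> mm U h m \<in> CM U"
  unfolding mm_def by (rule smul_closed[OF mulop_closed[OF U]])

lemma mm_add: "\<lbrakk>hreg U h; hreg U h'; m \<in> CM U\<rbrakk> \<Longrightarrow>
    mm U (\<lambda>p. h p + h' p) m = mm U h m \<oplus>\<^bsub>S U\<^esub> mm U h' m"
  unfolding mm_def by (subst mulop_add) (auto intro!: smul_add mulop_closed U)

lemma mm_addr: "\<lbrakk>hreg U h; m \<in> CM U; m' \<in> CM U\<rbrakk> \<Longrightarrow>
    mm U h (m \<oplus>\<^bsub>S U\<^esub> m') = mm U h m \<oplus>\<^bsub>S U\<^esub> mm U h m'"
  unfolding mm_def by (rule smul_addr[OF mulop_closed[OF U]])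

lemma mm_mult: "\<lbrakk>hreg U h; hreg U h'; m \<in> CM U\<rbrakk> \<Longrightarrow>
    mm U (\<lambda>p. h p * h' p) m = mm U h (mm U h' m)"
  unfolding mm_def by (subst mulop_mult) (auto intro!: smul_mult mulop_closed U)

lemma mm_one: "m \<in> CM U \<Longrightarrow> mm U (\<lambda>p. 1) m = m"
  unfolding mm_def mulop_one by (rule smul_one)

lemma mm_cong: "hreg U h \<Longrightarrow> (\<And>p. p \<in> U \<Longrightarrow> h p = h' p) \<Longrightarrow> mm U h m = mm U h' m"
  unfolding mm_def using mulop_cong[of U h h' lam] by simp

lemma dd_closed: "m \<in> CM U \<Longrightarrow> dd U c m \<in> CM U"
  unfolding dd_def by (rule smul_closed[OF Dop_closed[OF U]])

lemma dd_add: "m \<in> CM U \<Longrightarrow> m' \<in> CM U \<Longrightarrow>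
    dd U c (m \<oplus>\<^bsub>S U\<^esub> m') = dd U c m \<oplus>\<^bsub>S U\<^esub> dd U c m'"
  unfolding dd_def by (rule smul_addr[OF Dop_closed[OF U]])

lemma dd_mm:
  assumes "U \<subseteq> Uc c" "rat (part c U) f" "m \<in> CM U"
  shows "dd U c (mm U (\<lambda>p. f (coord c p)) m) =
    mm U (\<lambda>p. deriv f (coord c p)) m \<oplus>\<^bsub>S U\<^esub> mm U (\<lambda>p. f (coord c p)) (dd U c m)"
proof -
  have h: "hreg U (\<lambda>p. f (coord c p))" by (rule hreg_coord[OF assms(1,2)])
  have h': "hreg U (\<lambda>p. deriv f (coord c p))"
    by (rule hreg_coord[OF assms(1) rat_deriv(1)[OF cof_part[OF U] assms(2)]])
  note cl = mulop_closed[OF U h] mulop_closed[OF U h'] Dop_closed[OF U]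
  show ?thesis
    unfolding mm_def dd_def smul_mult[OF cl(3,1) assms(3), symmetric] Dop_mulop[OF U assms(1,2)]
    by (simp only: smul_add[OF cl(2) tdo_mult_closed[OF U cl(1,3)] assms(3)] smul_mult[OF cl(1,3) assms(3)])
qed

lemma Euler_mm:
  assumes "U \<subseteq> Uc c" "U \<subseteq> Uc (\<not> c)" "m \<in> CM U"
  shows "mm U (coord c) (dd U c m) \<oplus>\<^bsub>S U\<^esub> mm U (coord (\<not> c)) (dd U (\<not> c) m) =
    mm U (\<lambda>_. of_int (lam - 1)) m"
proof -
  have h: "hreg U (coord d)" for d
    using hreg_coord[of U d "\<lambda>z. z"] assms(1,2) rat_id by (cases "d = c") auto
  note cl = mulop_closed[OF U h] Dop_closed[OF U]
  show ?thesis
    unfolding mm_def dd_def Euler_relation[OF U assms(1,2), symmetric]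
    by (simp only: smul_add[OF tdo_mult_closed[OF U cl] tdo_mult_closed[OF U cl] assms(3)] smul_mult[OF cl assms(3)])
qed

end

lemma res_closed: "\<lbrakk>zariski_open U; V \<in> opens U; m \<in> CM U\<rbrakk> \<Longrightarrow> res M U V m \<in> CM V"
  using presheaf by (simp add: D_presheaf_def opens_UNIV Pi_iff)

lemma res_add: "\<lbrakk>zariski_open U; V \<in> opens U; m \<in> CM U; m' \<in> CM U\<rbrakk> \<Longrightarrow>
    res M U V (m \<oplus>\<^bsub>S U\<^esub> m') = res M U V m \<oplus>\<^bsub>S V\<^esub> res M U V m'"
  using presheaf by (simp add: D_presheaf_def opens_UNIV)

lemma res_smul: "\<lbrakk>zariski_open U; V \<in> opens U; P \<in> tdo_carrier lam U; m \<in> CM U\<rbrakk> \<Longrightarrow>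
    res M U V (P \<odot>\<^bsub>S U\<^esub> m) = tdo_res V P \<odot>\<^bsub>S V\<^esub> res M U V m"
  using presheaf by (simp add: D_presheaf_def opens_UNIV tdo_simps(1))

lemma res_id: "zariski_open U \<Longrightarrow> m \<in> CM U \<Longrightarrow> res M U U m = m"
  using presheaf by (simp add: D_presheaf_def opens_UNIV)

lemma res_res: "\<lbrakk>zariski_open U; V \<in> opens U; W \<in> opens V; m \<in> CM U\<rbrakk> \<Longrightarrow>
    res M V W (res M U V m) = res M U W m"
  using presheaf by (simp add: D_presheaf_def opens_UNIV)

lemma res_mm: "\<lbrakk>zariski_open U; V \<in> opens U; hreg U h; m \<in> CM U\<rbrakk> \<Longrightarrow>
    res M U V (mm U h m) = mm V h (res M U V m)"
  unfolding mm_def by (simp add: res_smul mulop_closed tdo_res_mulop)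

lemma res_dd: "\<lbrakk>zariski_open U; V \<in> opens U; m \<in> CM U\<rbrakk> \<Longrightarrow>
    res M U V (dd U c m) = dd V c (res M U V m)"
  unfolding dd_def by (simp add: res_smul Dop_closed tdo_res_Dop)

lemma zero_closed: "zariski_open U \<Longrightarrow> Z U \<in> CM U"
  by (rule abelian_monoid.zero_closed[OF abelian_group.axioms(1)[OF abelian_secs]])

lemma additive_zero:
  assumes "zariski_open U" "zariski_open V" "\<And>m. m \<in> CM U \<Longrightarrow> T m \<in> CM V"
    "\<And>m n. m \<in> CM U \<Longrightarrow> n \<in> CM U \<Longrightarrow> T (m \<oplus>\<^bsub>S U\<^esub> n) = T m \<oplus>\<^bsub>S V\<^esub> T n"
  shows "T (Z U) = Z V"
proof -
  interpret A: abelian_group "S U" by (rule abelian_secs[OF assms(1)])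
  interpret B: abelian_group "S V" by (rule abelian_secs[OF assms(2)])
  have "T (Z U) = T (Z U) \<oplus>\<^bsub>S V\<^esub> T (Z U)"
    using assms(4)[OF A.zero_closed A.zero_closed] A.l_zero[OF A.zero_closed] by simp
  then show ?thesis using assms(3)[OF A.zero_closed] B.add.r_cancel_one' by metis
qed

lemma additive_finsum:
  assumes "zariski_open U" "zariski_open V" "\<And>m. m \<in> CM U \<Longrightarrow> T m \<in> CM V"
    "\<And>m n. m \<in> CM U \<Longrightarrow> n \<in> CM U \<Longrightarrow> T (m \<oplus>\<^bsub>S U\<^esub> n) = T m \<oplus>\<^bsub>S V\<^esub> T n"
    and "f \<in> I \<rightarrow> CM U"
  shows "T (finsum (S U) f I) = finsum (S V) (\<lambda>i. T (f i)) I"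
proof -
  interpret A: abelian_group "S U" by (rule abelian_secs[OF assms(1)])
  interpret B: abelian_group "S V" by (rule abelian_secs[OF assms(2)])
  show ?thesis using assms(5)
  proof (induction I rule: infinite_finite_induct)
    case (insert i I)
    then have 1: "f i \<in> CM U" "f \<in> I \<rightarrow> CM U" by auto
    have 2: "(\<lambda>i. T (f i)) \<in> I \<rightarrow> CM V" using 1 assms(3) by auto
    show ?case
      using insert.IH[OF 1(2)] assms(3)[OF 1(1)] insert.hyps
      by (simp add: A.finsum_insert[OF insert.hyps 1(2,1)] B.finsum_insert[OF insert.hyps 2] assms(4)[OF 1(1) A.finsum_closed[OF 1(2)]])
  qed (simp_all add: additive_zero[OF assms(1-4)])
qed

lemma res_finsum: "\<lbrakk>zariski_open U; V \<in> opens U; f \<in> I \<rightarrow> CM U\<rbrakk> \<Longrightarrow>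
    res M U V (finsum (S U) f I) = finsum (S V) (\<lambda>i. res M U V (f i)) I"
  by (rule additive_finsum) (auto simp: res_closed res_add opens_D(1))

lemma mm_finsum: "\<lbrakk>zariski_open U; hreg U h; f \<in> I \<rightarrow> CM U\<rbrakk> \<Longrightarrow>
    mm U h (finsum (S U) f I) = finsum (S U) (\<lambda>i. mm U h (f i)) I"
  by (rule additive_finsum) (auto simp: mm_closed mm_addr)

lemma res_zero: "zariski_open U \<Longrightarrow> V \<in> opens U \<Longrightarrow> res M U V (Z U) = Z V"
  by (rule additive_zero) (auto simp: res_closed res_add opens_D(1))

lemma mm_zero: "zariski_open U \<Longrightarrow> hreg U h \<Longrightarrow> mm U h (Z U) = Z U"
  by (rule additive_zero) (auto simp: mm_closed mm_addr)

lemma smul_finsum: "\<lbrakk>zariski_open U; P \<in> tdo_carrier lam U; f \<in> I \<rightarrow> CM U\<rbrakk> \<Longrightarrow>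
    P \<odot>\<^bsub>S U\<^esub> (finsum (S U) f I) = finsum (S U) (\<lambda>i. P \<odot>\<^bsub>S U\<^esub> f i) I"
  by (rule additive_finsum) (auto simp: smul_closed smul_addr)

definition pm :: "bool \<Rightarrow> complex poly \<Rightarrow> 'v \<Rightarrow> 'v" where
  "pm c p m = mm (Uc c) (cpoly c p) m"

lemma hreg_poly: "V \<subseteq> Uc c \<Longrightarrow> hreg V (cpoly c p)"
  by (rule hreg_coord) (auto simp: rat_poly)

lemma deriv_poly: "deriv (poly p) = poly (pderiv p)"
  by (rule ext) (intro DERIV_imp_deriv poly_DERIV)

lemma wmod_chart: "wmod (S (Uc c)) (pm c) (dd (Uc c) c)"
proof (intro wmod.intro wmod_axioms.intro abelian_secs zariski_open_Uc)
  fix m m' p q assume m: "m \<in> CM (Uc c)"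
  note U = zariski_open_Uc[of c] and h = hreg_poly[of "Uc c" c, OF order_refl]
  show "pm c p m \<in> CM (Uc c)" unfolding pm_def by (rule mm_closed[OF U h m])
  show "pm c (p + q) m = pm c p m \<oplus>\<^bsub>S (Uc c)\<^esub> pm c q m"
    unfolding pm_def poly_add by (rule mm_add[OF U h h m])
  show "pm c (p * q) m = pm c p (pm c q m)"
    unfolding pm_def poly_mult by (rule mm_mult[OF U h h m])
  show "pm c 1 m = m" unfolding pm_def poly_1 by (rule mm_one[OF U m])
  show "dd (Uc c) c m \<in> CM (Uc c)" by (rule dd_closed[OF U m])
  show "dd (Uc c) c (pm c p m) = pm c (pderiv p) m \<oplus>\<^bsub>S (Uc c)\<^esub> pm c p (dd (Uc c) c m)"
    using dd_mm[OF U order_refl rat_poly m] unfolding pm_def deriv_poly .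
  assume m': "m' \<in> CM (Uc c)"
  show "pm c p (m \<oplus>\<^bsub>S (Uc c)\<^esub> m') = pm c p m \<oplus>\<^bsub>S (Uc c)\<^esub> pm c p m'"
    unfolding pm_def by (rule mm_addr[OF U h m m'])
  show "dd (Uc c) c (m \<oplus>\<^bsub>S (Uc c)\<^esub> m') = dd (Uc c) c m \<oplus>\<^bsub>S (Uc c)\<^esub> dd (Uc c) c m'"
    by (rule dd_add[OF U m m'])
qed

lemma res_pm: "V \<in> opens (Uc c) \<Longrightarrow> m \<in> CM (Uc c) \<Longrightarrow>
    res M (Uc c) V (pm c p m) = mm V (cpoly c p) (res M (Uc c) V m)"
  unfolding pm_def by (rule res_mm) (auto simp: hreg_poly)

end

section \<open>Horizontal sections of coherent modules\<close>

lemma poly_X_power: "poly ([:0, 1:] ^ k) x = (x :: complex) ^ k"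
  by (simp add: poly_power)

lemma affine_Uc: "affine_open (Uc c)"
  by (simp add: affine_open_def) (auto simp: Uc_eq)

lemma overlap_coord: "p \<in> Uc c \<Longrightarrow> p \<in> Uc (\<not> c) \<Longrightarrow> coord c p \<noteq> 0 \<and> coord (\<not> c) p = inverse (coord c p)"
  by (auto simp: Uc_def[of c]) (auto simp: Uc_eq)

section \<open>The overlap of the two charts\<close>

definition Uov :: "p1 set" where
  "Uov = Uc False \<inter> Uc True"

lemma Uov_eq: "Uov = Uc c \<inter> Uc (\<not> c)"
  by (cases c) (auto simp: Uov_def)

lemma Uov_opens [simp]: "Uov \<in> opens (Uc c)"
  by (auto simp: opens_def Uov_eq[of c] intro: zariski_open_Int)

lemma Uov_subset: "Uov \<subseteq> Uc c"
  by (auto simp: Uov_eq[of c])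

lemma zariski_open_Uov [simp]: "zariski_open Uov"
  using Uov_opens opens_D(1) by blast

lemma part_Uov: "part c Uov = - {0}"
  by (auto simp: Uov_eq[of c] mem_part) (auto simp: Uc_eq chart_inj)

lemma Uov_ne: "Uov \<noteq> {}"
proof -
  have "1 \<in> part False Uov" by (simp add: part_Uov)
  then show ?thesis by (auto simp: mem_part)
qed

lemma Uov_coord: "p \<in> Uov \<Longrightarrow> coord c p \<noteq> 0" "p \<in> Uov \<Longrightarrow> coord (\<not> c) p = inverse (coord c p)"
  using overlap_coord[of p c] Uov_eq[of c] by auto

lemma hreg_Uov_power: "hreg Uov (cpow c k)"
  using hreg_coord[of Uov c "\<lambda>z. z ^ k"] Uov_subset rat_power[OF rat_id] by blast

lemma hreg_Uov_coord: "hreg Uov (coord c)"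
  using hreg_Uov_power[of c 1] by simp

lemma hreg_Uov_poly: "hreg Uov (cpoly c p)"
  by (rule hreg_coord[OF Uov_subset rat_poly])

text \<open>Every open subset of a chart is principal, so the localisation property
  \<open>associated_on\<close>, stated for non-vanishing loci, applies to all of them.\<close>

lemma open_as_nonvanishing:
  assumes "V \<in> opens (Uc c)" shows "\<exists>h. \<forall>z. poly h z \<noteq> 0 \<longleftrightarrow> z \<in> part c V"
proof (cases "V = {}")
  case True
  then show ?thesis by (intro exI[of _ 0]) simp
next
  case False
  have "finite (- part c V)"
    using cof_part[OF opens_D(1)[OF assms], of c] infinite_part[OF opens_D(1)[OF assms] False, of c]
    unfolding cof_def by auto
  then have "poly (\<Prod>a\<in>- part c V. [:- a, 1:]) z \<noteq> 0 \<longleftrightarrow> z \<in> part c V" for z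
    by (simp add: poly_prod prod_zero_iff)
  then show ?thesis by blast
qed

lemma (in Dmod) mm_mm: "\<lbrakk>zariski_open U; hreg U h; hreg U h'; m \<in> CM U;
    (\<And>p. p \<in> U \<Longrightarrow> h p * h' p = k p)\<rbrakk> \<Longrightarrow> mm U h (mm U h' m) = mm U k m"
  using mm_mult[of U h h' m] mm_cong[of U "\<lambda>p. h p * h' p" k] hreg_mult[of U h h'] by simp

section \<open>Coherent modules: generators on charts, localisation, injectivity of
  restriction\<close>

locale Omod = Dmod lam M for lam and M :: "'v dmod" +
  assumes sheaf: "sheaf_condition M"
    and coherent: "\<And>U. affine_open U \<Longrightarrow> associated_on lam M U \<and> finitely_generated_on lam M U"
    and lam_pos: "lam > 0"
begin

definition nn :: nat where "nn = nat (lam - 1)"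

lemma of_nat_nn: "of_nat nn = (of_int (lam - 1) :: complex)"
  using lam_pos by (simp add: nn_def)

abbreviation LC where "LC c \<equiv> wmod.lc (S (Uc c)) (pm c)"
abbreviation GEN where "GEN c \<equiv> wmod.gen (S (Uc c)) (pm c)"
abbreviation INDEP where "INDEP c \<equiv> wmod.indep (S (Uc c)) (pm c)"
abbreviation r\<^sub>c where "r\<^sub>c c \<equiv> res M (Uc c) Uov"

text \<open>Regular functions on a whole chart are polynomials by \<open>rat_UNIV\<close>, so
  generation over \<open>str_sheaf\<close> turns into generation over the polynomial ring.\<close>

lemma gen_chart: "\<exists>B. GEN c (\<lambda>b. b) B"
proof -
  interpret W: wmod "S (Uc c)" "pm c" "dd (Uc c) c" by (rule wmod_chart)
  have "finitely_generated_on lam M (Uc c)" using coherent[OF affine_Uc] by simp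
  then obtain B where B: "finite B" "B \<subseteq> CM (Uc c)"
    and g: "\<forall>m\<in>CM (Uc c). \<exists>h. (\<forall>b\<in>B. h b \<in> str_sheaf (Uc c)) \<and>
        m = finsum (S (Uc c)) (\<lambda>b. mulop lam (Uc c) (h b) \<odot>\<^bsub>S (Uc c)\<^esub> b) B"
    unfolding finitely_generated_on_def by (elim exE conjE)
  have "\<exists>h. m = W.lc h (\<lambda>b. b) B" if m: "m \<in> CM (Uc c)" for m
  proof -
    from bspec[OF g m] obtain h where h: "\<And>b. b \<in> B \<Longrightarrow> h b \<in> str_sheaf (Uc c)"
      and me: "m = finsum (S (Uc c)) (\<lambda>b. mulop lam (Uc c) (h b) \<odot>\<^bsub>S (Uc c)\<^esub> b) B"
      by auto
    have hr: "hreg (Uc c) (h b)" if "b \<in> B" for b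
      using h[OF that] by (simp add: str_sheaf_iff)
    have "\<exists>p. (\<lambda>z. h b (chart c z)) = poly p" if "b \<in> B" for b
      using hr[OF that] rat_UNIV[of "\<lambda>z. h b (chart c z)"] unfolding hreg_def by (metis part_Uc)
    then obtain p where p: "\<And>b. b \<in> B \<Longrightarrow> (\<lambda>z. h b (chart c z)) = poly (p b)" by metis
    have e: "mm (Uc c) (h b) b = pm c (p b) b" if "b \<in> B" for b
      unfolding pm_def
    proof (rule mm_cong[OF zariski_open_Uc hr[OF that]])
      fix q assume "q \<in> Uc c"
      then show "h b q = poly (p b) (coord c q)" using fun_cong[OF p[OF that], of "coord c q"] by (simp add: chart_coord)
    qed
    have "m = finsum (S (Uc c)) (\<lambda>b. mm (Uc c) (h b) b) B" using me by (simp add: mm_def)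
    also have "\<dots> = W.lc p (\<lambda>b. b) B"
      unfolding W.lc_def using e B by (intro W.finsum_cong') (auto intro!: W.pm_closed)
    finally show ?thesis by blast
  qed
  then have "W.gen (\<lambda>b. b) B" unfolding W.gen_def using B by blast
  then show ?thesis by blast
qed

context
  fixes c V h assumes V: "V \<in> opens (Uc c)" and h: "\<And>z. poly h z \<noteq> 0 \<longleftrightarrow> z \<in> part c V"
begin

text \<open>\<open>str_sheaf\<close> wants the value 0 at the point missing from the chart, where
  \<open>poly h (coord c p)\<close> would be \<open>poly h 0\<close>.\<close>

private definition "H = (\<lambda>p. if p \<in> Uc c then poly h (coord c p) else 0)"

private lemma H_sheaf: "H \<in> str_sheaf (Uc c)"
proof -
  have "hreg (Uc c) H"
    using hreg_poly[of "Uc c" c h] by (subst hreg_cong[of _ H "\<lambda>q. poly h (coord c q)"]) (auto simp: H_def)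
  then show ?thesis by (simp add: str_sheaf_iff H_def)
qed

private lemma H_locus: "{p \<in> Uc c. H p \<noteq> 0} = V"
proof -
  have "p \<in> Uc c \<and> H p \<noteq> 0 \<longleftrightarrow> p \<in> V" for p
  proof (cases "p \<in> Uc c")
    case True
    then show ?thesis using h[of "coord c p"] by (simp add: H_def mem_part chart_coord)
  qed (use opens_D(2)[OF V] in auto)
  then show ?thesis by blast
qed

private lemma H_pow: "U \<subseteq> Uc c \<Longrightarrow> mulop lam U (\<lambda>p. H p ^ k) \<odot>\<^bsub>S U\<^esub> m = mm U (cpoly c (h ^ k)) m"
  unfolding mm_def by (subst mulop_cong[of U "\<lambda>q. poly (h ^ k) (coord c q)" "\<lambda>p. H p ^ k"])
    (use hreg_poly[of U c "h ^ k"] in \<open>auto simp: H_def\<close>)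

lemma loc_inj:
  assumes "m \<in> CM (Uc c)" "res M (Uc c) V m = Z V"
  shows "\<exists>k. pm c (h ^ k) m = Z (Uc c)"
  using coherent[OF affine_Uc, of c, THEN conjunct1, unfolded associated_on_def Let_def, rule_format, OF H_sheaf, THEN conjunct1]
    assms unfolding H_locus H_pow[OF order_refl] pm_def[symmetric] by simp

lemma loc_surj:
  assumes "t \<in> CM V"
  shows "\<exists>k. \<exists>m\<in>CM (Uc c). res M (Uc c) V m = mm V (cpoly c (h ^ k)) t"
  using coherent[OF affine_Uc, of c, THEN conjunct1, unfolded associated_on_def Let_def, rule_format, OF H_sheaf, THEN conjunct2]
    assms unfolding H_locus H_pow[OF opens_D(2)[OF V]] by simp

end

text \<open>With \<open>h\<close> cutting out the complement of \<open>V\<close>, a section that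
  restricts to zero is killed by a power of \<open>h\<close> according to \<open>loc_inj\<close>;
  torsion-freeness finishes.\<close>

lemma res_inj0:
  assumes V: "V \<in> opens (Uc c)" "V \<noteq> {}" and m: "m \<in> CM (Uc c)" "res M (Uc c) V m = Z V"
  shows "m = Z (Uc c)"
proof -
  interpret W: wmod "S (Uc c)" "pm c" "dd (Uc c) c" by (rule wmod_chart)
  obtain h where h: "\<And>z. poly h z \<noteq> 0 \<longleftrightarrow> z \<in> part c V" using open_as_nonvanishing[OF V(1)] by blast
  have "infinite (part c V)" by (rule infinite_part[OF opens_D(1)[OF V(1)] V(2)])
  then obtain z where "z \<in> part c V" using infinite_imp_nonempty by blast
  then have "h \<noteq> 0" using h[of z] by auto
  obtain k where "pm c (h ^ k) m = Z (Uc c)" using loc_inj[OF V(1) h m] by blast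
  moreover obtain B where "W.gen (\<lambda>b. b) B" using gen_chart by blast
  ultimately show ?thesis using W.torsion_free[of "\<lambda>b. b" B m "h ^ k"] m \<open>h \<noteq> 0\<close> by simp
qed

lemma res_inj:
  assumes V: "V \<in> opens (Uc c)" "V \<noteq> {}" and m: "m \<in> CM (Uc c)" "m' \<in> CM (Uc c)"
    "res M (Uc c) V m = res M (Uc c) V m'"
  shows "m = m'"
proof -
  interpret W: wmod "S (Uc c)" "pm c" "dd (Uc c) c" by (rule wmod_chart)
  have cl: "\<ominus>\<^bsub>S (Uc c)\<^esub> m' \<in> CM (Uc c)" using m by simp
  have "res M (Uc c) V (m \<oplus>\<^bsub>S (Uc c)\<^esub> \<ominus>\<^bsub>S (Uc c)\<^esub> m') =
      res M (Uc c) V (m' \<oplus>\<^bsub>S (Uc c)\<^esub> \<ominus>\<^bsub>S (Uc c)\<^esub> m')"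
    using m cl by (simp only: res_add[OF zariski_open_Uc V(1)])
  also have "\<dots> = Z V" using m by (simp add: W.r_neg res_zero[OF zariski_open_Uc V(1)])
  finally have "m \<oplus>\<^bsub>S (Uc c)\<^esub> \<ominus>\<^bsub>S (Uc c)\<^esub> m' = Z (Uc c)"
    using res_inj0[OF V] m cl by simp
  from W.add_eq_zeroD(1)[OF m(1) cl this] show ?thesis using m by simp
qed

lemma r_closed: "m \<in> CM (Uc c) \<Longrightarrow> r\<^sub>c c m \<in> CM Uov"
  by (rule res_closed) auto

lemma r_pm: "m \<in> CM (Uc c) \<Longrightarrow> r\<^sub>c c (pm c p m) = mm Uov (cpoly c p) (r\<^sub>c c m)"
  by (rule res_pm) auto

lemma r_dd: "m \<in> CM (Uc c) \<Longrightarrow> r\<^sub>c c (dd (Uc c) d m) = dd Uov d (r\<^sub>c c m)"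
  by (rule res_dd) auto

lemma r_add: "m \<in> CM (Uc c) \<Longrightarrow> m' \<in> CM (Uc c) \<Longrightarrow>
    r\<^sub>c c (m \<oplus>\<^bsub>S (Uc c)\<^esub> m') = r\<^sub>c c m \<oplus>\<^bsub>S Uov\<^esub> r\<^sub>c c m'"
  by (rule res_add) auto

lemma r_inj: "\<lbrakk>m \<in> CM (Uc c); m' \<in> CM (Uc c); r\<^sub>c c m = r\<^sub>c c m'\<rbrakk> \<Longrightarrow> m = m'"
  by (rule res_inj[OF Uov_opens Uov_ne])

lemma r_lc: "finite I \<Longrightarrow> x \<in> I \<rightarrow> CM (Uc c) \<Longrightarrow>
    r\<^sub>c c (LC c h x I) = finsum (S Uov) (\<lambda>i. mm Uov (cpoly c (h i)) (r\<^sub>c c (x i))) I"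
proof -
  interpret W: wmod "S (Uc c)" "pm c" "dd (Uc c) c" by (rule wmod_chart)
  interpret A: abelian_group "S Uov" by (rule abelian_secs) simp
  assume I: "finite I" "x \<in> I \<rightarrow> CM (Uc c)"
  have "r\<^sub>c c (LC c h x I) = finsum (S Uov) (\<lambda>i. r\<^sub>c c (pm c (h i) (x i))) I"
    unfolding W.lc_def using I by (intro res_finsum) auto
  also have "\<dots> = finsum (S Uov) (\<lambda>i. mm Uov (cpoly c (h i)) (r\<^sub>c c (x i))) I"
    using I by (intro A.finsum_cong') (auto simp: r_pm Pi_iff intro!: mm_closed hreg_Uov_poly r_closed)
  finally show ?thesis .
qed

lemma r_surj: "t \<in> CM Uov \<Longrightarrow> \<exists>a. \<exists>m\<in>CM (Uc c). r\<^sub>c c m = mm Uov (cpow c a) t"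
  using loc_surj[OF Uov_opens, of "[:0, 1:]" c t] part_Uov[of c] unfolding poly_X_power by simp

text \<open>With \<open>z\<close> the coordinate of \<open>c\<close> and \<open>w\<close> the
  opposite one, the Euler relation and the Leibniz rule give
  \<open>w^a (z d/dz v) = (nn + a - w d/dw) (w^a v)\<close>. Hence applying the Euler operator of
  \<open>c\<close> does not raise the power of \<open>w\<close> needed to extend a section.\<close>

lemma euler_shift:
  assumes v: "v \<in> CM Uov" and x: "x \<in> CM (Uc (\<not> c))"
    and eq: "r\<^sub>c (\<not> c) x = mm Uov (cpow (\<not> c) a) v"
  shows "r\<^sub>c (\<not> c) (pm (\<not> c) [:of_nat (nn + a):] x \<oplus>\<^bsub>S (Uc (\<not> c))\<^esub>
      pm (\<not> c) [:-1:] (wmod.\<theta> (pm (\<not> c)) (dd (Uc (\<not> c)) (\<not> c)) x)) =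
    mm Uov (cpow (\<not> c) a) (mm Uov (coord c) (dd Uov c v))"
proof -
  let ?d = "\<not> c"
  let ?w = "\<lambda>q. coord ?d q ^ a"
  interpret W: wmod "S (Uc ?d)" "pm ?d" "dd (Uc ?d) ?d" by (rule wmod_chart)
  interpret A: abelian_group "S Uov" by (rule abelian_secs) simp
  note O = zariski_open_Uov
  note hw = hreg_Uov_power[of ?d] and hz = hreg_Uov_coord
  define dv where "dv = dd Uov ?d v"
  define dc where "dc = dd Uov c v"
  have dv: "dv \<in> CM Uov" and dc: "dc \<in> CM Uov" unfolding dv_def dc_def by (intro dd_closed O v)+
  define P where "P = mm Uov ?w (mm Uov (coord c) dc)"
  define B where "B = mm Uov (\<lambda>q. coord ?d q * coord ?d q ^ a) dv"
  have P: "P \<in> CM Uov" and B: "B \<in> CM Uov" unfolding P_def B_def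
    by (intro mm_closed O hw hz dc dv hreg_mult)+
  have PB: "P \<oplus>\<^bsub>S Uov\<^esub> B = mm Uov (\<lambda>q. of_nat nn * coord ?d q ^ a) v"
  proof -
    have "mm Uov (coord c) dc \<oplus>\<^bsub>S Uov\<^esub> mm Uov (coord ?d) dv = mm Uov (\<lambda>_. of_nat nn) v"
      using Euler_mm[OF O Uov_subset Uov_subset v, of c] unfolding dv_def dc_def of_nat_nn .
    then have "mm Uov ?w (mm Uov (coord c) dc \<oplus>\<^bsub>S Uov\<^esub> mm Uov (coord ?d) dv) = mm Uov ?w (mm Uov (\<lambda>_. of_nat nn) v)"
      by simp
    moreover have "mm Uov ?w (mm Uov (\<lambda>_. of_nat nn) v) = mm Uov (\<lambda>q. of_nat nn * coord ?d q ^ a) v"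
      by (rule mm_mm[OF O hw hreg_const v]) simp
    moreover have "mm Uov ?w (mm Uov (coord ?d) dv) = B"
      unfolding B_def by (rule mm_mm[OF O hw hz dv]) simp
    ultimately show ?thesis
      by (simp add: P_def mm_addr[OF O hw mm_closed[OF O hz dc] mm_closed[OF O hz dv]])
  qed
  have dy: "mm Uov (coord ?d) (dd Uov ?d (mm Uov ?w v)) = mm Uov (\<lambda>q. of_nat a * coord ?d q ^ a) v \<oplus>\<^bsub>S Uov\<^esub> B"
  proof -
    have e: "poly (monom 1 a) = (\<lambda>z::complex. z ^ a)" by (rule ext) (simp add: poly_monom)
    have "dd Uov ?d (mm Uov ?w v) = mm Uov (cpoly ?d (pderiv (monom 1 a))) v \<oplus>\<^bsub>S Uov\<^esub> mm Uov ?w dv"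
      using dd_mm[OF O Uov_subset rat_poly v, of ?d "monom 1 a"]
      unfolding deriv_poly dv_def unfolding e .
    moreover have "mm Uov (coord ?d) (mm Uov (cpoly ?d (pderiv (monom 1 a))) v) = mm Uov (\<lambda>q. of_nat a * coord ?d q ^ a) v"
      by (rule mm_mm[OF O hz hreg_Uov_poly v]) (cases a; simp add: pderiv_monom poly_monom)
    moreover have "mm Uov (coord ?d) (mm Uov ?w dv) = B"
      unfolding B_def by (rule mm_mm[OF O hz hw dv]) simp
    ultimately show ?thesis
      by (simp add: mm_addr[OF O hz mm_closed[OF O hreg_Uov_poly v] mm_closed[OF O hw dv]])
  qed
  have cm: "(cpoly ?d [:k:]) = (\<lambda>q. k)" for k by simp
  have X: "(cpoly ?d [:0, 1:]) = coord ?d" by (rule ext) simp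
  \<comment> \<open>The Leibniz rule produces \<open>- a\<close>, which cancels against
    \<open>nn + a\<close>; the remaining \<open>nn\<close> multiple is \<open>P \<oplus> B\<close>
    by \<open>PB\<close>, and \<open>B\<close> cancels.\<close>
  have "r\<^sub>c ?d (pm ?d [:of_nat (nn + a):] x \<oplus>\<^bsub>S (Uc ?d)\<^esub> pm ?d [:-1:] (W.\<theta> x)) =
      mm Uov (\<lambda>q. of_nat (nn + a)) (mm Uov ?w v) \<oplus>\<^bsub>S Uov\<^esub>
      mm Uov (\<lambda>q. -1) (mm Uov (coord ?d) (dd Uov ?d (mm Uov ?w v)))"
    unfolding r_add[OF W.pm_closed[OF x] W.pm_closed[OF W.theta_closed[OF x]]] r_pm[OF x]
      r_pm[OF W.theta_closed[OF x]]
    unfolding W.\<theta>_def r_pm[OF W.D_closed[OF x]] r_dd[OF x] eq cm X ..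
  also have "mm Uov (\<lambda>q. of_nat (nn + a)) (mm Uov ?w v) = mm Uov (\<lambda>q. of_nat (nn + a) * coord ?d q ^ a) v"
    by (rule mm_mm[OF O hreg_const hw v]) simp
  also have "mm Uov (\<lambda>q. -1) (mm Uov (coord ?d) (dd Uov ?d (mm Uov ?w v))) =
      mm Uov (\<lambda>q. - of_nat a * coord ?d q ^ a) v \<oplus>\<^bsub>S Uov\<^esub> mm Uov (\<lambda>q. -1) B"
  proof -
    have ha: "hreg Uov (\<lambda>q. of_nat a * coord ?d q ^ a)" by (intro hreg_mult hreg_const hw)
    have "mm Uov (\<lambda>q. -1) (mm Uov (\<lambda>q. of_nat a * coord ?d q ^ a) v) = mm Uov (\<lambda>q. - of_nat a * coord ?d q ^ a) v"
      by (rule mm_mm[OF O hreg_const ha v]) simp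
    then show ?thesis unfolding dy by (simp add: mm_addr[OF O hreg_const mm_closed[OF O ha v] B])
  qed
  also have "mm Uov (\<lambda>q. of_nat (nn + a) * coord ?d q ^ a) v \<oplus>\<^bsub>S Uov\<^esub>
      (mm Uov (\<lambda>q. - of_nat a * coord ?d q ^ a) v \<oplus>\<^bsub>S Uov\<^esub> mm Uov (\<lambda>q. -1) B) =
      (P \<oplus>\<^bsub>S Uov\<^esub> B) \<oplus>\<^bsub>S Uov\<^esub> mm Uov (\<lambda>q. -1) B"
  proof -
    have h1: "hreg Uov (\<lambda>q. of_nat (nn + a) * coord ?d q ^ a)" and h2: "hreg Uov (\<lambda>q. - of_nat a * coord ?d q ^ a)"
      by (intro hreg_mult hreg_const hw)+
    have "mm Uov (\<lambda>q. of_nat (nn + a) * coord ?d q ^ a + - of_nat a * coord ?d q ^ a) v = mm Uov (\<lambda>q. of_nat nn * coord ?d q ^ a) v"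
      by (rule mm_cong[OF O hreg_add[OF h1 h2]]) (simp add: algebra_simps)
    then show ?thesis
      unfolding PB mm_add[OF O h1 h2 v]
      by (simp only: A.a_assoc[OF mm_closed[OF O h1 v] mm_closed[OF O h2 v] mm_closed[OF O hreg_const B], symmetric])
  qed
  also have "\<dots> = P \<oplus>\<^bsub>S Uov\<^esub> (B \<oplus>\<^bsub>S Uov\<^esub> mm Uov (\<lambda>q. -1) B)"
    by (rule A.a_assoc[OF P B mm_closed[OF O hreg_const B]])
  also have "B \<oplus>\<^bsub>S Uov\<^esub> mm Uov (\<lambda>q. -1) B = Z Uov"
  proof -
    have "mm Uov (\<lambda>q. 0) B = B \<oplus>\<^bsub>S Uov\<^esub> mm Uov (\<lambda>q. -1) B"
      using mm_add[OF O hreg_const[of _ 1] hreg_const[of _ "-1"] B] mm_one[OF O B] by simp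
    moreover have "mm Uov (\<lambda>q. 0) B \<oplus>\<^bsub>S Uov\<^esub> mm Uov (\<lambda>q. 0) B = mm Uov (\<lambda>q. 0) B"
      using mm_add[OF O hreg_const[of _ 0] hreg_const[of _ 0] B] by simp
    ultimately show ?thesis using A.add.r_cancel_one' mm_closed[OF O hreg_const B, of 0] by metis
  qed
  finally show ?thesis using P by (simp add: P_def dc_def)
qed

text \<open>Checks the hypothesis of \<open>bounded_orbit_nilpotent\<close>. By
  \<open>euler_shift\<close> one power \<open>a\<close> of the opposite coordinate extends all
  iterates of \<open>m\<close> across the missing point. Expressed there in finitely many generators
  and rewritten in the coordinate of \<open>c\<close>, they have numerators whose degrees exceed the
  cleared denominator by at most \<open>a\<close>.\<close>

lemma nilpotent:
  assumes m: "m \<in> CM (Uc c)" shows "\<exists>k. (dd (Uc c) c ^^ k) m = Z (Uc c)"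
proof -
  let ?d = "\<not> c"
  interpret W: wmod "S (Uc c)" "pm c" "dd (Uc c) c" by (rule wmod_chart)
  interpret V: wmod "S (Uc ?d)" "pm ?d" "dd (Uc ?d) ?d" by (rule wmod_chart)
  interpret A: abelian_group "S Uov" by (rule abelian_secs) simp
  note O = zariski_open_Uov
  note hp = hreg_Uov_power
  obtain B0 where B0: "W.gen (\<lambda>b. b) B0" using gen_chart by blast
  obtain B1 where B1: "V.gen (\<lambda>b. b) B1" using gen_chart by blast
  then have fin1: "finite B1" and sub1: "\<And>b. b \<in> B1 \<Longrightarrow> b \<in> CM (Uc ?d)" by (auto simp: V.gen_def)
  obtain a m1 where m1: "m1 \<in> CM (Uc ?d)" "r\<^sub>c ?d m1 = mm Uov (cpow ?d a) (r\<^sub>c c m)"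
    using r_surj[OF r_closed[OF m], of ?d] by blast
  have X: "(cpoly c [:0, 1:]) = coord c" by (rule ext) simp
  have orb: "\<exists>x\<in>CM (Uc ?d). r\<^sub>c ?d x = mm Uov (cpow ?d a) (r\<^sub>c c ((W.\<theta> ^^ j) m))" for j
  proof (induction j)
    case 0
    then show ?case using m1 by auto
  next
    case (Suc j)
    then obtain x where x: "x \<in> CM (Uc ?d)" "r\<^sub>c ?d x = mm Uov (cpow ?d a) (r\<^sub>c c ((W.\<theta> ^^ j) m))" by blast
    have u: "(W.\<theta> ^^ j) m \<in> CM (Uc c)" using m by simp
    have e: "r\<^sub>c c ((W.\<theta> ^^ Suc j) m) = mm Uov (coord c) (dd Uov c (r\<^sub>c c ((W.\<theta> ^^ j) m)))"
      by (simp only: funpow.simps comp_apply W.\<theta>_def[of "(W.\<theta> ^^ j) m"] r_pm[OF W.D_closed[OF u]] r_dd[OF u] X)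
    show ?case
      unfolding e using euler_shift[OF r_closed[OF u] x]
        V.a_closed[OF V.pm_closed[OF x(1)] V.pm_closed[OF V.theta_closed[OF x(1)]]] by (rule bexI)
  qed
  have "\<exists>e y. y \<in> CM (Uc c) \<and> r\<^sub>c c y = mm Uov (cpow c e) (r\<^sub>c ?d b)" if "b \<in> B1" for b
    using r_surj[OF r_closed[OF sub1[OF that]], of c] by blast
  then obtain e y where ey: "\<And>b. b \<in> B1 \<Longrightarrow> y b \<in> CM (Uc c) \<and> r\<^sub>c c (y b) = mm Uov (\<lambda>q. coord c q ^ e b) (r\<^sub>c ?d b)"
    by metis
  \<comment> \<open>A common exponent: the power \<open>E\<close> of the coordinate of
    \<open>c\<close> extends every generator of the opposite chart.\<close>
  define E where "E = (\<Sum>b\<in>B1. e b)"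
  have eE: "e b \<le> E" if "b \<in> B1" for b unfolding E_def using fin1 that by (intro member_le_sum) auto
  define y' where "y' = (\<lambda>b. pm c (monom 1 (E - e b)) (y b))"
  have y': "y' b \<in> CM (Uc c)" "r\<^sub>c c (y' b) = mm Uov (cpow c E) (r\<^sub>c ?d b)" if b: "b \<in> B1" for b
  proof -
    show "y' b \<in> CM (Uc c)" using ey[OF b] by (simp add: y'_def)
    have "r\<^sub>c c (y' b) = mm Uov (cpoly c (monom 1 (E - e b))) (mm Uov (\<lambda>q. coord c q ^ e b) (r\<^sub>c ?d b))"
      using ey[OF b] by (simp add: y'_def r_pm)
    also have "\<dots> = mm Uov (cpow c E) (r\<^sub>c ?d b)"
      by (rule mm_mm[OF O hreg_Uov_poly hp r_closed[OF sub1[OF b]]])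
        (use eE[OF b] in \<open>simp add: poly_monom power_add[symmetric]\<close>)
    finally show "r\<^sub>c c (y' b) = mm Uov (cpow c E) (r\<^sub>c ?d b)" .
  qed
  show ?thesis
  \<comment> \<open>The exponent \<open>a\<close> plays the part of the uniform bound; for the
    iterate \<open>j\<close> the criterion is met with \<open>Q + E\<close>, where only
    \<open>Q\<close> depends on \<open>j\<close>.\<close>
  proof (rule W.bounded_orbit_nilpotent[OF B0 m fin1, of y' a])
    show "y' \<in> B1 \<rightarrow> CM (Uc c)" using y' by auto
    fix j
    obtain x where x: "x \<in> CM (Uc ?d)" "r\<^sub>c ?d x = mm Uov (cpow ?d a) (r\<^sub>c c ((W.\<theta> ^^ j) m))"
      using orb[of j] by blast
    obtain q where q: "x = V.lc q (\<lambda>b. b) B1" using B1 x(1) unfolding V.gen_def by blast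
    have u: "(W.\<theta> ^^ j) m \<in> CM (Uc c)" using m by simp
    define Q where "Q = (\<Sum>b\<in>B1. degree (q b))"
    have dQ: "degree (q b) \<le> Q" if "b \<in> B1" for b unfolding Q_def using fin1 that by (intro member_le_sum) auto
    \<comment> \<open>As a function of \<open>z\<close>, \<open>g b\<close> is
      \<open>z^(a + Q)\<close> times \<open>q b\<close> evaluated at \<open>inverse z\<close>;
      \<open>dQ\<close> keeps the subtraction in the exponent from being truncated.\<close>
    define g where "g = (\<lambda>b. monom 1 (a + Q - degree (q b)) * reflect_poly (q b))"
    have deg: "degree (g b) \<le> a + (Q + E)" if b: "b \<in> B1" for b
    proof -
      have "degree (g b) \<le> degree (monom (1::complex) (a + Q - degree (q b))) + degree (reflect_poly (q b))"
        unfolding g_def by (rule degree_mult_le)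
      also have "\<dots> \<le> (a + Q - degree (q b)) + degree (q b)"
        by (intro add_mono degree_monom_le degree_reflect_poly_le)
      finally show ?thesis using dQ[OF b] by simp
    qed
    have xs: "r\<^sub>c ?d x = finsum (S Uov) (\<lambda>b. mm Uov (cpoly ?d (q b)) (r\<^sub>c ?d b)) B1"
      unfolding q using fin1 sub1 by (intro r_lc) auto
    have F: "(\<lambda>b. mm Uov (cpoly ?d (q b)) (r\<^sub>c ?d b)) \<in> B1 \<rightarrow> CM Uov"
      using sub1 by (auto intro!: mm_closed hreg_Uov_poly r_closed)
    have "r\<^sub>c c (pm c (monom 1 (Q + E)) ((W.\<theta> ^^ j) m)) = mm Uov (cpow c (Q + E)) (r\<^sub>c c ((W.\<theta> ^^ j) m))"
      using u by (simp add: r_pm poly_monom)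
    also have "\<dots> = mm Uov (cpow c (Q + E + a)) (r\<^sub>c ?d x)"
      unfolding x(2) by (rule mm_mm[OF O hp hp r_closed[OF u], symmetric])
        (simp add: Uov_coord(2)[of _ c] Uov_coord(1)[of _ c] power_add field_simps)
    also have "\<dots> = finsum (S Uov) (\<lambda>b. mm Uov (cpow c (Q + E + a)) (mm Uov (cpoly ?d (q b)) (r\<^sub>c ?d b))) B1"
      unfolding xs by (rule mm_finsum[OF O hp F])
    also have "\<dots> = finsum (S Uov) (\<lambda>b. mm Uov (cpoly c (g b)) (r\<^sub>c c (y' b))) B1"
    proof (rule A.finsum_cong'[OF HOL.refl])
      show "(\<lambda>b. mm Uov (cpoly c (g b)) (r\<^sub>c c (y' b))) \<in> B1 \<rightarrow> CM Uov"
        using y' by (auto intro!: mm_closed hreg_Uov_poly r_closed)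
      fix b assume b: "b \<in> B1"
      have rb: "r\<^sub>c ?d b \<in> CM Uov" by (rule r_closed[OF sub1[OF b]])
      have "mm Uov (cpow c (Q + E + a)) (mm Uov (cpoly ?d (q b)) (r\<^sub>c ?d b)) =
         mm Uov (\<lambda>p. poly (g b) (coord c p) * coord c p ^ E) (r\<^sub>c ?d b)"
      proof (rule mm_mm[OF O hp hreg_Uov_poly rb])
        fix p assume p: "p \<in> Uov"
        let ?z = "coord c p"
        have z: "?z \<noteq> 0" "coord ?d p = inverse ?z" using Uov_coord[OF p] by auto
        have "poly (g b) ?z = ?z ^ (a + Q - degree (q b)) * (?z ^ degree (q b) * poly (q b) (inverse ?z))"
          by (simp add: g_def poly_monom poly_reflect_poly_nz[OF z(1)])
        also have "\<dots> = ?z ^ (a + Q) * poly (q b) (inverse ?z)"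
          using dQ[OF b] by (simp add: mult.assoc[symmetric] power_add[symmetric])
        finally show "?z ^ (Q + E + a) * poly (q b) (coord ?d p) = poly (g b) ?z * ?z ^ E"
          by (simp add: z(2) power_add algebra_simps)
      qed
      also have "\<dots> = mm Uov (cpoly c (g b)) (mm Uov (cpow c E) (r\<^sub>c ?d b))"
        by (rule mm_mult[OF O hreg_Uov_poly hp rb])
      finally show "mm Uov (cpow c (Q + E + a)) (mm Uov (cpoly ?d (q b)) (r\<^sub>c ?d b)) =
         mm Uov (cpoly c (g b)) (r\<^sub>c c (y' b))" using y'(2)[OF b] by simp
    qed
    also have "\<dots> = r\<^sub>c c (W.lc g y' B1)" using fin1 y' by (intro r_lc[symmetric]) auto
    finally have "r\<^sub>c c (pm c (monom 1 (Q + E)) ((W.\<theta> ^^ j) m)) = r\<^sub>c c (W.lc g y' B1)" .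
    moreover have "W.lc g y' B1 \<in> CM (Uc c)" using y' by (intro W.lc_closed) auto
    ultimately have "pm c (monom 1 (Q + E)) ((W.\<theta> ^^ j) m) = W.lc g y' B1"
      using r_inj[OF W.pm_closed[OF u]] by simp
    then show "\<exists>Q q. (\<forall>i\<in>B1. degree (q i) \<le> a + Q) \<and> pm c (monom 1 Q) ((W.\<theta> ^^ j) m) = W.lc q y' B1"
      using deg by (intro exI[of _ "Q + E"] exI[of _ g]) auto
  qed
qed

text \<open>For horizontal \<open>k\<close> the right side of \<open>euler_shift\<close> is zero, so
  the extension of \<open>w^a k\<close>, with \<open>w\<close> the opposite coordinate, is an
  eigenvector of the Euler operator for \<open>nn + a\<close>. By \<open>theta_eigen_nat\<close> it
  is \<open>w^(nn + a)\<close> times a horizontal section, which therefore restricts to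
  \<open>w^(-nn) k\<close>.\<close>

lemma horizontal_transfer:
  assumes k: "k \<in> CM (Uc c)" "dd (Uc c) c k = Z (Uc c)"
  shows "\<exists>k'\<in>CM (Uc (\<not> c)). dd (Uc (\<not> c)) (\<not> c) k' = Z (Uc (\<not> c)) \<and>
     r\<^sub>c (\<not> c) k' = mm Uov (cpow c nn) (r\<^sub>c c k)"
proof -
  let ?d = "\<not> c"
  interpret V: wmod "S (Uc ?d)" "pm ?d" "dd (Uc ?d) ?d" by (rule wmod_chart)
  note O = zariski_open_Uov
  note hp = hreg_Uov_power
  have rk: "r\<^sub>c c k \<in> CM Uov" by (rule r_closed[OF k(1)])
  obtain a m1 where m1: "m1 \<in> CM (Uc ?d)" "r\<^sub>c ?d m1 = mm Uov (cpow ?d a) (r\<^sub>c c k)"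
    using r_surj[OF rk, of ?d] by blast
  have "dd Uov c (r\<^sub>c c k) = Z Uov"
    using r_dd[OF k(1), of c] k(2) res_zero[OF zariski_open_Uc Uov_opens, of c] by simp
  then have "r\<^sub>c ?d (pm ?d [:of_nat (nn + a):] m1 \<oplus>\<^bsub>S (Uc ?d)\<^esub> pm ?d [:-1:] (V.\<theta> m1)) = Z Uov"
    using euler_shift[OF rk m1] by (simp add: mm_zero[OF O hreg_Uov_coord] mm_zero[OF O hp])
  then have "pm ?d [:of_nat (nn + a):] m1 \<oplus>\<^bsub>S (Uc ?d)\<^esub> pm ?d [:-1:] (V.\<theta> m1) = Z (Uc ?d)"
    by (rule res_inj0[OF Uov_opens Uov_ne V.a_closed[OF V.pm_closed[OF m1(1)] V.pm_closed[OF V.theta_closed[OF m1(1)]]]])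
  moreover have "pm ?d [:-1:] (V.\<theta> m1) = \<ominus>\<^bsub>S (Uc ?d)\<^esub> V.\<theta> m1"
    using V.pm_uminus[of "V.\<theta> m1" "[:1:]"] m1(1) by simp
  ultimately have "pm ?d [:of_nat (nn + a):] m1 \<oplus>\<^bsub>S (Uc ?d)\<^esub> \<ominus>\<^bsub>S (Uc ?d)\<^esub> V.\<theta> m1 = Z (Uc ?d)"
    by simp
  then have "pm ?d [:of_nat (nn + a):] m1 = V.\<theta> m1"
    using V.add_eq_zeroD(1)[of "pm ?d [:of_nat (nn + a):] m1" "\<ominus>\<^bsub>S (Uc ?d)\<^esub> V.\<theta> m1"] m1(1) by simp
  moreover obtain B1 where "V.gen (\<lambda>b. b) B1" using gen_chart by blast
  ultimately obtain k' where k': "k' \<in> CM (Uc ?d)" "dd (Uc ?d) ?d k' = Z (Uc ?d)"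
    "m1 = pm ?d (monom 1 (nn + a)) k'"
    using V.theta_eigen_nat[of "\<lambda>b. b" B1 m1 "nn + a"] m1(1) by metis
  have rk': "r\<^sub>c ?d k' \<in> CM Uov" by (rule r_closed[OF k'(1)])
  have e: "mm Uov (cpow ?d (nn + a)) (r\<^sub>c ?d k') = mm Uov (cpow ?d a) (r\<^sub>c c k)"
    using m1(2) k' by (simp add: r_pm poly_monom)
  have "r\<^sub>c ?d k' = mm Uov (cpow c (nn + a)) (mm Uov (cpow ?d (nn + a)) (r\<^sub>c ?d k'))"
    by (subst mm_mm[OF O hp hp rk', of _ _ _ _ "\<lambda>_. 1"])
      (auto simp: Uov_coord(2)[of _ c] Uov_coord(1)[of _ c] field_simps mm_one[OF O rk'])
  also have "\<dots> = mm Uov (cpow c nn) (r\<^sub>c c k)"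
    unfolding e by (rule mm_mm[OF O hp hp rk])
      (simp add: Uov_coord(2)[of _ c] Uov_coord(1)[of _ c] power_add field_simps)
  finally show ?thesis using k' by blast
qed

text \<open>Generation: sections are spanned by horizontal ones because of \<open>nilpotent\<close>,
  and a horizontal section carried back by \<open>horizontal_transfer\<close> has constant
  coordinates in the old frame. Independence: a relation multiplied by a high power of the
  coordinate of \<open>c\<close> becomes one in the old frame.\<close>

lemma frame_transfer:
  fixes k0 k1 :: "nat \<Rightarrow> 'v"
  assumes k0: "\<And>i. i < r \<Longrightarrow> k0 i \<in> CM (Uc c) \<and> dd (Uc c) c (k0 i) = Z (Uc c)"
    and frame: "GEN c k0 {..<r}" "INDEP c k0 {..<r}"
    and k1: "\<And>i. i < r \<Longrightarrow> k1 i \<in> CM (Uc (\<not> c))"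
      "\<And>i. i < r \<Longrightarrow> r\<^sub>c (\<not> c) (k1 i) = mm Uov (cpow c nn) (r\<^sub>c c (k0 i))"
  shows "GEN (\<not> c) k1 {..<r}" "INDEP (\<not> c) k1 {..<r}"
proof -
  let ?d = "\<not> c"
  interpret W: wmod "S (Uc c)" "pm c" "dd (Uc c) c" by (rule wmod_chart)
  interpret V: wmod "S (Uc ?d)" "pm ?d" "dd (Uc ?d) ?d" by (rule wmod_chart)
  interpret A: abelian_group "S Uov" by (rule abelian_secs) simp
  note O = zariski_open_Uov
  note hp = hreg_Uov_power
  have x0: "k0 \<in> {..<r} \<rightarrow> CM (Uc c)" and x1: "k1 \<in> {..<r} \<rightarrow> CM (Uc ?d)" using k0 k1 by auto
  have rk0: "r\<^sub>c c (k0 i) \<in> CM Uov" if "i < r" for i using r_closed k0[OF that] by simp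
  have hor: "\<exists>g. b = V.lc g k1 {..<r}" if b: "b \<in> CM (Uc ?d)" "dd (Uc ?d) ?d b = Z (Uc ?d)" for b
  proof -
    have "\<exists>k\<in>CM (Uc c). dd (Uc c) c k = Z (Uc c) \<and> r\<^sub>c c k = mm Uov (cpow ?d nn) (r\<^sub>c ?d b)"
      using horizontal_transfer[OF b] by simp
    then obtain k where k: "k \<in> CM (Uc c)" "dd (Uc c) c k = Z (Uc c)"
      "r\<^sub>c c k = mm Uov (cpow ?d nn) (r\<^sub>c ?d b)" by blast
    obtain p where p: "k = W.lc p k0 {..<r}" using frame(1) k(1) unfolding W.gen_def by blast
    \<comment> \<open>Both \<open>k\<close> and the frame are horizontal, so differentiation only
      hits the coordinates and independence makes them constant.\<close>
    have "W.lc (\<lambda>i. pderiv (p i)) k0 {..<r} = Z (Uc c)"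
      using W.D_lc_ker[OF x0, of p] k0 k(2) unfolding p by simp
    then have "pderiv (p i) = 0" if "i < r" for i
      using frame(2) that unfolding W.indep_def by blast
    then have "\<exists>a. p i = [:a:]" if "i < r" for i using that by (metis degree_eq_zeroE pderiv_eq_0_iff)
    then obtain a where a: "\<And>i. i < r \<Longrightarrow> p i = [:a i:]" by metis
    have rb: "r\<^sub>c ?d b \<in> CM Uov" by (rule r_closed[OF b(1)])
    have "r\<^sub>c ?d b = mm Uov (cpow c nn) (r\<^sub>c c k)"
      unfolding k(3) by (subst mm_mm[OF O hp hp rb, of _ _ _ _ "\<lambda>_. 1"])
        (auto simp: Uov_coord(2)[of _ c] Uov_coord(1)[of _ c] field_simps mm_one[OF O rb])
    also have "\<dots> = mm Uov (cpow c nn) (finsum (S Uov) (\<lambda>i. mm Uov (cpoly c (p i)) (r\<^sub>c c (k0 i))) {..<r})"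
      unfolding p using r_lc[OF _ x0, of p] by simp
    also have "\<dots> = finsum (S Uov) (\<lambda>i. mm Uov (cpow c nn) (mm Uov (cpoly c (p i)) (r\<^sub>c c (k0 i)))) {..<r}"
      using rk0 by (intro mm_finsum[OF O hp]) (auto intro!: mm_closed hreg_Uov_poly)
    \<comment> \<open>A constant polynomial takes the same value on either coordinate, so
      \<open>p i\<close> may be evaluated in the opposite chart.\<close>
    also have "\<dots> = finsum (S Uov) (\<lambda>i. mm Uov (cpoly ?d (p i)) (r\<^sub>c ?d (k1 i))) {..<r}"
    proof (rule A.finsum_cong'[OF HOL.refl])
      show "(\<lambda>i. mm Uov (cpoly ?d (p i)) (r\<^sub>c ?d (k1 i))) \<in> {..<r} \<rightarrow> CM Uov"
        using k1 by (auto intro!: mm_closed hreg_Uov_poly r_closed)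
      fix i assume "i \<in> {..<r}"
      then have i: "i < r" by simp
      have "mm Uov (cpow c nn) (mm Uov (cpoly c (p i)) (r\<^sub>c c (k0 i))) =
          mm Uov (\<lambda>q. coord c q ^ nn * a i) (r\<^sub>c c (k0 i))"
        by (rule mm_mm[OF O hp hreg_Uov_poly rk0[OF i]]) (simp add: a[OF i])
      also have "\<dots> = mm Uov (cpoly ?d (p i)) (mm Uov (cpow c nn) (r\<^sub>c c (k0 i)))"
        by (rule mm_mm[OF O hreg_Uov_poly hp rk0[OF i], symmetric]) (simp add: a[OF i])
      finally show "mm Uov (cpow c nn) (mm Uov (cpoly c (p i)) (r\<^sub>c c (k0 i))) =
          mm Uov (cpoly ?d (p i)) (r\<^sub>c ?d (k1 i))"
        by (simp only: k1(2)[OF i])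
    qed
    also have "\<dots> = r\<^sub>c ?d (V.lc p k1 {..<r})" using r_lc[OF _ x1, of p] by simp
    finally have "b = V.lc p k1 {..<r}" using r_inj[OF b(1) V.lc_closed[OF x1]] by simp
    then show ?thesis by blast
  qed
  have "\<exists>h. m = V.lc h k1 {..<r}" if m: "m \<in> CM (Uc ?d)" for m
  proof -
    obtain j where "(dd (Uc ?d) ?d ^^ j) m = Z (Uc ?d)" using nilpotent[OF m] by blast
    then have "m \<in> V.kspan" by (rule V.nilpotent_kspan[OF m])
    then obtain B h where B: "finite B" "B \<subseteq> {k \<in> CM (Uc ?d). dd (Uc ?d) ?d k = Z (Uc ?d)}"
      and mh: "m = V.lc h (\<lambda>b. b) B"
      unfolding V.kspan_def by blast
    have "\<exists>g. b = V.lc g k1 {..<r}" if "b \<in> B" for b using hor[of b] B(2) that by blast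
    then obtain g where g: "\<And>b. b \<in> B \<Longrightarrow> b = V.lc (g b) k1 {..<r}" by metis
    have "m = V.lc h (\<lambda>b. V.lc (g b) k1 {..<r}) B"
      unfolding mh V.lc_def[of h]
    proof (rule V.finsum_cong'[OF HOL.refl])
      show "(\<lambda>i. pm ?d (h i) (V.lc (g i) k1 {..<r})) \<in> B \<rightarrow> CM (Uc ?d)" using x1 by auto
      fix b assume "b \<in> B"
      then show "pm ?d (h b) b = pm ?d (h b) (V.lc (g b) k1 {..<r})" using g[of b] by simp
    qed
    also have "\<dots> = V.lc (\<lambda>i. \<Sum>b\<in>B. h b * g b i) k1 {..<r}" by (rule V.lc_lc[OF B(1) x1])
    finally show ?thesis by blast
  qed
  then show "V.gen k1 {..<r}" unfolding V.gen_def using x1 by blast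
  have "q i = 0" if z: "V.lc q k1 {..<r} = Z (Uc ?d)" and i: "i < r" for q i
  proof -
    define Q where "Q = (\<Sum>i<r. degree (q i))"
    have dQ: "degree (q j) \<le> Q" if "j < r" for j unfolding Q_def using that by (intro member_le_sum) auto
    \<comment> \<open>The relation \<open>q\<close> times \<open>coord c ^ Q\<close>, with the frame
      change \<open>coord c ^ nn\<close> absorbed, written as polynomials in the coordinate of
      \<open>c\<close>.\<close>
    define g where "g = (\<lambda>i. monom 1 (nn + Q - degree (q i)) * reflect_poly (q i))"
    have F: "(\<lambda>i. mm Uov (cpoly ?d (q i)) (r\<^sub>c ?d (k1 i))) \<in> {..<r} \<rightarrow> CM Uov"
      using k1 by (auto intro!: mm_closed hreg_Uov_poly r_closed)
    have "r\<^sub>c c (W.lc g k0 {..<r}) = finsum (S Uov) (\<lambda>i. mm Uov (cpoly c (g i)) (r\<^sub>c c (k0 i))) {..<r}"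
      using r_lc[OF _ x0, of g] by simp
    also have "\<dots> = finsum (S Uov) (\<lambda>i. mm Uov (cpow c Q) (mm Uov (cpoly ?d (q i)) (r\<^sub>c ?d (k1 i)))) {..<r}"
    proof (rule A.finsum_cong'[OF HOL.refl])
      show "(\<lambda>i. mm Uov (cpow c Q) (mm Uov (cpoly ?d (q i)) (r\<^sub>c ?d (k1 i)))) \<in> {..<r} \<rightarrow> CM Uov"
        using F by (intro Pi_I mm_closed[OF O hp]) (rule funcset_mem)
      fix j assume "j \<in> {..<r}"
      then have j: "j < r" by simp
      have hg: "hreg Uov (\<lambda>p. poly (q j) (coord ?d p) * coord c p ^ nn)" by (intro hreg_mult hreg_Uov_poly hp)
      have "mm Uov (cpoly c (g j)) (r\<^sub>c c (k0 j)) =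
          mm Uov (cpow c Q) (mm Uov (\<lambda>p. poly (q j) (coord ?d p) * coord c p ^ nn) (r\<^sub>c c (k0 j)))"
      proof (rule mm_mm[OF O hp hg rk0[OF j], symmetric])
        fix p assume p: "p \<in> Uov"
        let ?z = "coord c p"
        have z: "?z \<noteq> 0" "coord ?d p = inverse ?z" using Uov_coord[OF p] by auto
        have "poly (g j) ?z = ?z ^ (nn + Q - degree (q j)) * (?z ^ degree (q j) * poly (q j) (inverse ?z))"
          by (simp add: g_def poly_monom poly_reflect_poly_nz[OF z(1)])
        also have "\<dots> = ?z ^ (nn + Q) * poly (q j) (inverse ?z)"
          using dQ[OF j] by (simp add: mult.assoc[symmetric] power_add[symmetric])
        finally show "?z ^ Q * (poly (q j) (coord ?d p) * ?z ^ nn) = poly (g j) ?z"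
          by (simp add: z(2) power_add algebra_simps)
      qed
      also have "mm Uov (\<lambda>p. poly (q j) (coord ?d p) * coord c p ^ nn) (r\<^sub>c c (k0 j)) =
          mm Uov (cpoly ?d (q j)) (mm Uov (cpow c nn) (r\<^sub>c c (k0 j)))"
        by (rule mm_mult[OF O hreg_Uov_poly hp rk0[OF j]])
      finally show "mm Uov (cpoly c (g j)) (r\<^sub>c c (k0 j)) =
          mm Uov (cpow c Q) (mm Uov (cpoly ?d (q j)) (r\<^sub>c ?d (k1 j)))"
        by (simp only: k1(2)[OF j])
    qed
    also have "\<dots> = mm Uov (cpow c Q) (r\<^sub>c ?d (V.lc q k1 {..<r}))"
      using r_lc[OF _ x1, of q] mm_finsum[OF O hp F] by simp
    also have "\<dots> = Z Uov"
      unfolding z by (simp add: res_zero[OF zariski_open_Uc Uov_opens] mm_zero[OF O hp])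
    finally have "W.lc g k0 {..<r} = Z (Uc c)"
      using res_inj0[OF Uov_opens Uov_ne W.lc_closed[OF x0]] by simp
    then have "g i = 0" using frame(2) i unfolding W.indep_def by blast
    then show ?thesis by (simp add: g_def monom_eq_0_iff)
  qed
  then show "V.indep k1 {..<r}" unfolding V.indep_def by blast
qed

text \<open>One frame is obtained on chart \<open>False\<close>, the other is its transfer. Since
  the coordinates are inverse to each other on the overlap, the same power \<open>nn\<close> relates
  the frames in both directions.\<close>

theorem horizontal_frame:
  obtains r and k :: "bool \<Rightarrow> nat \<Rightarrow> 'v" where
    "\<And>c i. i < r \<Longrightarrow> k c i \<in> CM (Uc c)"
    "\<And>c i. i < r \<Longrightarrow> dd (Uc c) c (k c i) = Z (Uc c)"
    "\<And>c. GEN c (k c) {..<r}" "\<And>c. INDEP c (k c) {..<r}"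
    "\<And>c i. i < r \<Longrightarrow> r\<^sub>c (\<not> c) (k (\<not> c) i) = mm Uov (cpow c nn) (r\<^sub>c c (k c i))"
proof -
  let ?c = False
  interpret W: wmod "S (Uc ?c)" "pm ?c" "dd (Uc ?c) ?c" by (rule wmod_chart)
  note O = zariski_open_Uov
  obtain B0 where B0: "W.gen (\<lambda>b. b) B0" using gen_chart by blast
  obtain B where B: "B \<subseteq> {k \<in> CM (Uc ?c). dd (Uc ?c) ?c k = Z (Uc ?c)}" "W.gen (\<lambda>b. b) B" "W.indep (\<lambda>b. b) B"
    by (rule W.horizontal_basis[OF B0 nilpotent]) (assumption, rule that)
  have "finite B" using B(2) by (simp add: W.gen_def)
  then obtain k0 where k0: "bij_betw k0 {0..<card B} B" using ex_bij_betw_nat_finite by blast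
  define r where "r = card B"
  have im: "k0 ` {..<r} = B" and inj: "inj_on k0 {..<r}"
    using k0 by (auto simp: bij_betw_def r_def lessThan_atLeast0)
  have k0B: "k0 i \<in> B" if "i < r" for i using im that by auto
  have hor0: "k0 i \<in> CM (Uc ?c) \<and> dd (Uc ?c) ?c (k0 i) = Z (Uc ?c)" if "i < r" for i
    using k0B[OF that] B(1) by blast
  have x0: "k0 \<in> {..<r} \<rightarrow> CM (Uc ?c)" using hor0 by auto
  have lcB: "W.lc h (\<lambda>b. b) B = W.lc (\<lambda>i. h (k0 i)) k0 {..<r}" for h
    unfolding W.lc_def im[symmetric] using x0 by (intro W.finsum_reindex[OF _ inj]) auto
  have gen0: "W.gen k0 {..<r}"
    unfolding W.gen_def
  proof (intro conjI ballI)
    fix m assume "m \<in> CM (Uc ?c)"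
    then obtain h where "m = W.lc h (\<lambda>b. b) B" using B(2) unfolding W.gen_def by blast
    then show "\<exists>h. m = W.lc h k0 {..<r}" unfolding lcB by blast
  qed (use x0 in auto)
  have ind0: "W.indep k0 {..<r}"
    unfolding W.indep_def
  proof (intro allI impI ballI)
    fix h i assume z: "W.lc h k0 {..<r} = Z (Uc ?c)" and i: "i \<in> {..<r}"
    have "W.lc (\<lambda>b. h (the_inv_into {..<r} k0 b)) (\<lambda>b. b) B = W.lc h k0 {..<r}"
      unfolding lcB using x0 by (intro W.lc_cong) (auto simp: the_inv_into_f_f[OF inj])
    then have "h (the_inv_into {..<r} k0 (k0 i)) = 0" using B(3) z k0B i unfolding W.indep_def by (metis lessThan_iff)
    then show "h i = 0" using the_inv_into_f_f[OF inj i] by simp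
  qed
  have "\<exists>k'. k' \<in> CM (Uc True) \<and> dd (Uc True) True k' = Z (Uc True) \<and>
     r\<^sub>c True k' = mm Uov (cpow False nn) (r\<^sub>c False (k0 i))" if "i < r" for i
    using horizontal_transfer[of "k0 i" False] hor0[OF that] by auto
  then obtain k1 where k1: "\<And>i. i < r \<Longrightarrow> k1 i \<in> CM (Uc True) \<and> dd (Uc True) True (k1 i) = Z (Uc True) \<and>
     r\<^sub>c True (k1 i) = mm Uov (cpow False nn) (r\<^sub>c False (k0 i))" by metis
  have frame1: "GEN True k1 {..<r}" "INDEP True k1 {..<r}"
    using frame_transfer[OF hor0 gen0 ind0, of k1] k1 by auto
  define k where "k = (\<lambda>c. if c then k1 else k0)"
  have bwd: "r\<^sub>c False (k0 i) = mm Uov (cpow True nn) (r\<^sub>c True (k1 i))" if i: "i < r" for i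
  proof -
    have rk: "r\<^sub>c False (k0 i) \<in> CM Uov" using r_closed hor0[OF i] by blast
    have "mm Uov (cpow True nn) (mm Uov (cpow False nn) (r\<^sub>c False (k0 i))) = mm Uov (\<lambda>_. 1) (r\<^sub>c False (k0 i))"
      by (rule mm_mm[OF O hreg_Uov_power hreg_Uov_power rk])
        (simp add: Uov_coord(2)[of _ False, simplified] Uov_coord(1)[of _ False] field_simps)
    then show ?thesis using k1[OF i] mm_one[OF O rk] by simp
  qed
  show thesis
  proof (rule that[of r k])
    fix c i
    show "GEN c (k c) {..<r}" "INDEP c (k c) {..<r}" using frame1 gen0 ind0 by (cases c; simp add: k_def)+
    assume i: "i < r"
    show "k c i \<in> CM (Uc c)" "dd (Uc c) c (k c i) = Z (Uc c)"
      using hor0[OF i] k1[OF i] by (cases c; simp add: k_def)+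
    show "r\<^sub>c (\<not> c) (k (\<not> c) i) = mm Uov (cpow c nn) (r\<^sub>c c (k c i))"
    proof (cases c)
      case True
      then show ?thesis using bwd[OF i] by (simp add: k_def)
    next
      case False
      then show ?thesis using k1[OF i] by (simp add: k_def)
    qed
  qed
qed

end

section \<open>Sums of copies of the line bundle\<close>

definition Model :: "int \<Rightarrow> nat \<Rightarrow> (nat \<Rightarrow> lsec) dmod" where
  "Model lam r = \<lparr>secs = (\<lambda>U. \<lparr>carrier = {..<r} \<rightarrow>\<^sub>E lb lam U, mult = undefined, one = undefined,
       zero = (\<lambda>i\<in>{..<r}. szero), add = (\<lambda>s t. \<lambda>i\<in>{..<r}. sadd (s i) (t i)),
       smult = (\<lambda>P s. \<lambda>i\<in>{..<r}. P U (s i))\<rparr>),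
     res = (\<lambda>U V s. \<lambda>i\<in>{..<r}. sres V (s i))\<rparr>"

lemma Model_simps:
  "carrier (secs (Model lam r) U) = {..<r} \<rightarrow>\<^sub>E lb lam U"
  "\<zero>\<^bsub>secs (Model lam r) U\<^esub> = (\<lambda>i\<in>{..<r}. szero)"
  "s \<oplus>\<^bsub>secs (Model lam r) U\<^esub> t = (\<lambda>i\<in>{..<r}. sadd (s i) (t i))"
  "P \<odot>\<^bsub>secs (Model lam r) U\<^esub> s = (\<lambda>i\<in>{..<r}. P U (s i))"
  "res (Model lam r) U V s = (\<lambda>i\<in>{..<r}. sres V (s i))"
  by (simp_all add: Model_def)

abbreviation SM :: "int \<Rightarrow> nat \<Rightarrow> p1 set \<Rightarrow> (dop, nat \<Rightarrow> lsec) module" where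
  "SM lam r U \<equiv> secs (Model lam r) U"

abbreviation RM :: "int \<Rightarrow> nat \<Rightarrow> p1 set \<Rightarrow> p1 set \<Rightarrow> (nat \<Rightarrow> lsec) \<Rightarrow> nat \<Rightarrow> lsec" where
  "RM lam r \<equiv> res (Model lam r)"

abbreviation CN :: "int \<Rightarrow> nat \<Rightarrow> p1 set \<Rightarrow> (nat \<Rightarrow> lsec) set" where
  "CN lam r U \<equiv> carrier (SM lam r U)"

lemma CN_mem: "s \<in> CN lam r U \<Longrightarrow> i < r \<Longrightarrow> s i \<in> lb lam U"
  by (auto simp: Model_simps)

lemma CN_I: "(\<And>i. i < r \<Longrightarrow> s i \<in> lb lam U) \<Longrightarrow> (\<lambda>i\<in>{..<r}. s i) \<in> CN lam r U"
  by (auto simp: Model_simps)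

lemma CN_eqI: "\<lbrakk>s \<in> CN lam r U; t \<in> CN lam r U; (\<And>i. i < r \<Longrightarrow> s i = t i)\<rbrakk> \<Longrightarrow> s = t"
  unfolding Model_simps by (rule PiE_ext) auto

lemma Model_res_closed: "\<lbrakk>zariski_open U; V \<in> opens U; s \<in> CN lam r U\<rbrakk> \<Longrightarrow> RM lam r U V s \<in> CN lam r V"
  unfolding Model_simps(5) by (rule CN_I) (rule sres_closed, auto dest: CN_mem)

lemma Model_smul_closed: "\<lbrakk>zariski_open U; P \<in> tdo_carrier lam U; s \<in> CN lam r U\<rbrakk> \<Longrightarrow>
    P \<odot>\<^bsub>SM lam r U\<^esub> s \<in> CN lam r U"
  unfolding Model_simps(4) by (rule CN_I) (rule opfun_closed[OF tdo_carrier_opfun opens_self], auto dest: CN_mem)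

lemma Model_add_closed: "\<lbrakk>zariski_open U; s \<in> CN lam r U; t \<in> CN lam r U\<rbrakk> \<Longrightarrow>
    s \<oplus>\<^bsub>SM lam r U\<^esub> t \<in> CN lam r U"
  unfolding Model_simps(3) by (rule CN_I) (rule sadd_closed, auto dest: CN_mem)

subsection \<open>Operators acting on multiples of a horizontal section\<close>

primrec Dpow :: "int \<Rightarrow> p1 set \<Rightarrow> bool \<Rightarrow> nat \<Rightarrow> dop" where
  "Dpow lam U c 0 = mulop lam U (\<lambda>_. 1)"
| "Dpow lam U c (Suc k) = Dop lam U c \<otimes>\<^bsub>tdo lam U\<^esub> Dpow lam U c k"

lemma Dpow_closed: "zariski_open U \<Longrightarrow> Dpow lam U c k \<in> tdo_carrier lam U"
  by (induction k) (simp_all add: mulop_closed hreg_const tdo_mult_closed Dop_closed)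

lemma sel_Dpow:
  assumes U: "zariski_open U" and V: "V \<in> opens U" and s: "s \<in> lb lam V" and z: "z \<in> part c V"
  shows "sel c (Dpow lam U c k V s) z = (deriv ^^ k) (sel c s) z"
  using z
proof (induction k arbitrary: z)
  case (Suc k)
  have Ds: "Dpow lam U c k V s \<in> lb lam V" by (rule opfun_closed[OF tdo_carrier_opfun[OF Dpow_closed[OF U]] V s])
  have "deriv (sel c (Dpow lam U c k V s)) z = deriv ((deriv ^^ k) (sel c s)) z"
    by (rule deriv_cong_on[OF cof_open[OF cof_part[OF opens_D(1)[OF V]]] Suc.IH Suc.prems])
  then show ?case using Suc.prems by (simp add: tdo_simps(2)[OF V s] sel_Dop[OF V Ds])
qed (simp add: V s)

context Dmod
begin

lemma dd_horizontal:
  assumes V: "zariski_open V" "V \<subseteq> Uc c" and k: "k \<in> CM V" "dd V c k = Z V"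
    and f: "rat (part c V) f"
  shows "dd V c (mm V (\<lambda>p. f (coord c p)) k) = mm V (\<lambda>p. deriv f (coord c p)) k"
proof -
  interpret A: abelian_group "S V" by (rule abelian_secs[OF V(1)])
  have h': "hreg V (\<lambda>p. deriv f (coord c p))" by (rule hreg_coord[OF V(2) rat_deriv(1)[OF cof_part[OF V(1)] f]])
  show ?thesis
    unfolding dd_mm[OF V f k(1)] k(2) mm_zero[OF V(1) hreg_coord[OF V(2) f]]
    by (rule A.r_zero[OF mm_closed[OF V(1) h' k(1)]])
qed

lemma Dpow_horizontal:
  assumes V: "zariski_open V" "V \<subseteq> Uc c" and k: "k \<in> CM V" "dd V c k = Z V"
    and f: "rat (part c V) f"
  shows "Dpow lam V c j \<odot>\<^bsub>S V\<^esub> mm V (\<lambda>p. f (coord c p)) k = mm V (\<lambda>p. (deriv ^^ j) f (coord c p)) k"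
proof (induction j)
  case 0
  show ?case
    using mm_one[OF V(1) mm_closed[OF V(1) hreg_coord[OF V(2) f] k(1)]] by (simp add: mm_def)
next
  case (Suc j)
  have cl: "mm V (\<lambda>p. f (coord c p)) k \<in> CM V" by (rule mm_closed[OF V(1) hreg_coord[OF V(2) f] k(1)])
  have "Dpow lam V c (Suc j) \<odot>\<^bsub>S V\<^esub> mm V (\<lambda>p. f (coord c p)) k = dd V c (mm V (\<lambda>p. (deriv ^^ j) f (coord c p)) k)"
    unfolding dd_def Suc[symmetric] Dpow.simps by (rule smul_mult[OF V(1) Dop_closed[OF V(1)] Dpow_closed[OF V(1)] cl])
  also have "\<dots> = mm V (\<lambda>p. (deriv ^^ Suc j) f (coord c p)) k"
    using dd_horizontal[OF V k rat_higher_deriv[OF cof_part[OF V(1)] f]] by simp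
  finally show ?case .
qed

text \<open>Induction on the number of terms: the top term \<open>R\<close>, a coefficient times a
  power of the coordinate field, is itself an operator on \<open>V\<close>, and \<open>P'\<close>,
  which is \<open>P\<close> minus \<open>R\<close>, has one term less. The equality of
  \<open>P\<close> with the sum holds because one chart determines an operator on
  \<open>V \<subseteq> Uc c\<close>.\<close>

lemma smul_horizontal_coeffs:
  assumes V: "zariski_open V" "V \<subseteq> Uc c" and k: "k \<in> CM V" "dd V c k = Z V"
    and f: "rat (part c V) f"
    and P: "P \<in> tdo_carrier lam V" and a: "\<And>i. i < N \<Longrightarrow> rat (part c V) (a i)"
    and Pa: "\<And>W s z. \<lbrakk>W \<in> opens V; s \<in> lb lam W; z \<in> part c W\<rbrakk> \<Longrightarrow>
       sel c (P W s) z = dsum N a (sel c s) z"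
  shows "P \<odot>\<^bsub>S V\<^esub> mm V (\<lambda>p. f (coord c p)) k =
    mm V (\<lambda>p. \<Sum>i<N. a i (coord c p) * (deriv ^^ i) f (coord c p)) k"
  using P a Pa
proof (induction N arbitrary: P)
  case 0
  have "P = mulop lam V (\<lambda>_. 0)"
    by (rule opfun_eqI_chart[OF tdo_carrier_opfun[OF 0(1)] mulop_opfun[OF hreg_const] V(2)]) (simp add: 0(3))
  then have "P \<odot>\<^bsub>S V\<^esub> mm V (\<lambda>p. f (coord c p)) k = mm V (\<lambda>_. 0) (mm V (\<lambda>p. f (coord c p)) k)"
    by (simp add: mm_def)
  also have "\<dots> = mm V (\<lambda>_. 0) k"
    by (rule mm_mm[OF V(1) hreg_const hreg_coord[OF V(2) f] k(1)]) simp
  finally show ?case by simp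
next
  case (Suc N)
  let ?T = "tdo lam V"
  have aN: "rat (part c V) (a N)" using Suc.prems(2) by simp
  have hN: "hreg V (\<lambda>p. a N (coord c p))" by (rule hreg_coord[OF V(2) aN])
  define R where "R = mulop lam V (\<lambda>p. a N (coord c p)) \<otimes>\<^bsub>?T\<^esub> Dpow lam V c N"
  define P' where "P' = P \<oplus>\<^bsub>?T\<^esub> (mulop lam V (\<lambda>_. -1) \<otimes>\<^bsub>?T\<^esub> R)"
  have Rc: "R \<in> tdo_carrier lam V"
    unfolding R_def by (intro tdo_mult_closed mulop_closed Dpow_closed V hN)
  have P'c: "P' \<in> tdo_carrier lam V"
    unfolding P'_def by (intro tdo_add_closed tdo_mult_closed mulop_closed V hreg_const Rc Suc.prems(1))
  have Rs: "sel c (R W s) z = a N z * (deriv ^^ N) (sel c s) z" if W: "W \<in> opens V" and s: "s \<in> lb lam W" and z: "z \<in> part c W" for W s z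
    using sel_Dpow[OF V(1) W s z] opfun_closed[OF tdo_carrier_opfun[OF Dpow_closed[OF V(1)]] W s]
    by (simp add: R_def tdo_simps(2)[OF W s] W)
  have P's: "sel c (P' W s) z = dsum N a (sel c s) z"
    if W: "W \<in> opens V" and s: "s \<in> lb lam W" and z: "z \<in> part c W" for W s z
    using Rs[OF W s z] Suc.prems(3)[OF W s z] opfun_closed[OF tdo_carrier_opfun[OF Rc] W s]
    by (simp add: P'_def tdo_simps(2,3)[OF W s] W)
  have PR: "P = P' \<oplus>\<^bsub>?T\<^esub> R"
    by (rule opfun_eqI_chart[OF tdo_carrier_opfun[OF Suc.prems(1)] tdo_carrier_opfun[OF tdo_add_closed[OF V(1) P'c Rc]] V(2)])
      (simp add: Suc.prems(3) tdo_simps(3) P's Rs)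
  have cl: "mm V (\<lambda>p. f (coord c p)) k \<in> CM V" by (rule mm_closed[OF V(1) hreg_coord[OF V(2) f] k(1)])
  have rN: "rat (part c V) ((deriv ^^ N) f)" by (rule rat_higher_deriv[OF cof_part[OF V(1)] f])
  have "R \<odot>\<^bsub>S V\<^esub> mm V (\<lambda>p. f (coord c p)) k = mm V (\<lambda>p. a N (coord c p)) (mm V (\<lambda>p. (deriv ^^ N) f (coord c p)) k)"
    unfolding R_def smul_mult[OF V(1) mulop_closed[OF V(1) hN] Dpow_closed[OF V(1)] cl] Dpow_horizontal[OF V k f]
    by (simp add: mm_def)
  also have "\<dots> = mm V (\<lambda>p. a N (coord c p) * (deriv ^^ N) f (coord c p)) k"
    by (rule mm_mm[OF V(1) hN hreg_coord[OF V(2) rN] k(1) HOL.refl])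
  finally have Rk: "R \<odot>\<^bsub>S V\<^esub> mm V (\<lambda>p. f (coord c p)) k = mm V (\<lambda>p. a N (coord c p) * (deriv ^^ N) f (coord c p)) k" .
  have "P' \<odot>\<^bsub>S V\<^esub> mm V (\<lambda>p. f (coord c p)) k =
     mm V (\<lambda>p. \<Sum>i<N. a i (coord c p) * (deriv ^^ i) f (coord c p)) k"
    by (rule Suc.IH[OF P'c]) (use Suc.prems(2) P's in auto)
  moreover have r1: "rat (part c V) (\<lambda>z. \<Sum>i<N. a i z * (deriv ^^ i) f z)"
    by (intro rat_sum rat_mult rat_higher_deriv cof_part V(1) f) (use Suc.prems(2) in auto)
  moreover have r2: "rat (part c V) (\<lambda>z. a N z * (deriv ^^ N) f z)" by (intro rat_mult aN rN)
  ultimately show ?case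
    unfolding PR smul_add[OF V(1) P'c Rc cl] Rk
    using mm_add[OF V(1) hreg_coord[OF V(2) r1] hreg_coord[OF V(2) r2] k(1)] by simp
qed

text \<open>For horizontal \<open>k\<close>, sending a section \<open>s\<close> of the line bundle
  to \<open>s\<close> times \<open>k\<close> commutes with all operators; each horizontal section
  thus defines a homomorphism from the line bundle.\<close>

lemma smul_horizontal:
  assumes V: "zariski_open V" "V \<subseteq> Uc c" and k: "k \<in> CM V" "dd V c k = Z V"
    and P: "P \<in> tdo_carrier lam V" and s: "s \<in> lb lam V"
  shows "P \<odot>\<^bsub>S V\<^esub> mm V (\<lambda>p. sel c s (coord c p)) k = mm V (\<lambda>p. sel c (P V s) (coord c p)) k"
proof -
  obtain N a where "tcoeffs lam c V P N a" using V(1) P by (rule tdo_carrier_coeffs)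
  note a = tcoeffsD[OF this]
  have Ps: "P V s \<in> lb lam V" by (rule opfun_closed[OF tdo_carrier_opfun[OF P] opens_self[OF V(1)] s])
  have "P \<odot>\<^bsub>S V\<^esub> mm V (\<lambda>p. sel c s (coord c p)) k =
      mm V (\<lambda>p. \<Sum>i<N. a i (coord c p) * (deriv ^^ i) (sel c s) (coord c p)) k"
    using V k line_bundle_rat[OF V(1) s] P a by (rule smul_horizontal_coeffs)
  also have "\<dots> = mm V (\<lambda>p. sel c (P V s) (coord c p)) k"
  proof (rule mm_cong[OF V(1), symmetric])
    show "hreg V (\<lambda>p. sel c (P V s) (coord c p))" by (rule hreg_coord[OF V(2) line_bundle_rat[OF V(1) Ps]])
    fix p assume "p \<in> V"
    then have "coord c p \<in> part c V" using V(2) chart_coord[of p c] by (auto simp: mem_part)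
    then show "sel c (P V s) (coord c p) = (\<Sum>i<N. a i (coord c p) * (deriv ^^ i) (sel c s) (coord c p))"
      by (rule a(2)[OF opens_self[OF V(1)] s])
  qed
  finally show ?thesis .
qed

end

subsection \<open>Trivialisation by a horizontal frame\<close>

lemma rat_common_denominator:
  assumes "finite I" "\<And>i. i \<in> I \<Longrightarrow> rat S (f i)"
  shows "\<exists>q p. \<forall>z\<in>S. poly q z \<noteq> 0 \<and> (\<forall>i\<in>I. f i z = poly (p i) z / poly q z)"
  using assms
proof (induction I rule: finite_induct)
  case empty
  show ?case by (intro exI[of _ 1]) simp
next
  case (insert i I)
  then obtain q p where qp: "\<And>z. z \<in> S \<Longrightarrow> poly q z \<noteq> 0" "\<And>z j. z \<in> S \<Longrightarrow> j \<in> I \<Longrightarrow> f j z = poly (p j) z / poly q z"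
    by blast
  obtain p' q' where pq': "\<And>z. z \<in> S \<Longrightarrow> poly q' z \<noteq> 0 \<and> f i z = poly p' z / poly q' z"
    using insert.prems[of i] unfolding rat_def by auto
  have "f j z = poly ((\<lambda>j. if j = i then p' * q else p j * q') j) z / poly (q * q') z" if "z \<in> S" "j \<in> insert i I" for z j
    using that qp[of z] qp(2)[of z j] pq'[of z] by auto
  then show ?case using qp(1) pq' by (intro exI[of _ "q * q'"] exI[of _ "\<lambda>j. if j = i then p' * q else p j * q'"]) auto
qed

locale framed = Omod lam M for lam and M :: "'v dmod" +
  fixes r :: nat and k :: "bool \<Rightarrow> nat \<Rightarrow> 'v"
  assumes k_closed: "\<And>c i. i < r \<Longrightarrow> k c i \<in> CM (Uc c)"
    and k_horizontal: "\<And>c i. i < r \<Longrightarrow> dd (Uc c) c (k c i) = Z (Uc c)"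
    and k_gen: "\<And>c. GEN c (k c) {..<r}" and k_indep: "\<And>c. INDEP c (k c) {..<r}"
    and k_overlap: "\<And>c i. i < r \<Longrightarrow> r\<^sub>c (\<not> c) (k (\<not> c) i) = mm Uov (cpow c nn) (r\<^sub>c c (k c i))"
begin

definition kr :: "bool \<Rightarrow> p1 set \<Rightarrow> nat \<Rightarrow> 'v" where
  "kr c V i = res M (Uc c) V (k c i)"

text \<open>The section with coordinate functions \<open>f\<close> in the frame of chart
  \<open>c\<close>. Plain functions are allowed so that coordinates can be multiplied and divided by
  polynomials; \<open>ps\<close> specialises to tuples of line bundle sections.\<close>

definition psf :: "bool \<Rightarrow> p1 set \<Rightarrow> (nat \<Rightarrow> complex \<Rightarrow> complex) \<Rightarrow> 'v" where
  "psf c V f = finsum (S V) (\<lambda>i. mm V (\<lambda>p. f i (coord c p)) (kr c V i)) {..<r}"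

definition ps :: "bool \<Rightarrow> p1 set \<Rightarrow> (nat \<Rightarrow> lsec) \<Rightarrow> 'v" where
  "ps c V s = psf c V (\<lambda>i. sel c (s i))"

context
  fixes c V assumes V: "V \<in> opens (Uc c)"
begin

private lemma V': "zariski_open V" "V \<subseteq> Uc c"
  using V by (auto simp: opens_def)

private lemma coord_in: "p \<in> V \<Longrightarrow> coord c p \<in> part c V"
  using V'(2) chart_coord[of p c] by (auto simp: mem_part)

lemma kr_closed: "i < r \<Longrightarrow> kr c V i \<in> CM V"
  unfolding kr_def by (rule res_closed[OF zariski_open_Uc V k_closed])

lemma kr_horizontal: "i < r \<Longrightarrow> dd V c (kr c V i) = Z V"
  unfolding kr_def res_dd[OF zariski_open_Uc V k_closed, symmetric] k_horizontal
  by (rule res_zero[OF zariski_open_Uc V])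

lemma kr_res: "W \<in> opens V \<Longrightarrow> i < r \<Longrightarrow> res M V W (kr c V i) = kr c W i"
  unfolding kr_def by (rule res_res[OF zariski_open_Uc V _ k_closed])

context
  fixes f assumes f: "\<And>i. i < r \<Longrightarrow> rat (part c V) (f i)"
begin

lemma psf_fun: "(\<lambda>i. mm V (\<lambda>p. f i (coord c p)) (kr c V i)) \<in> {..<r} \<rightarrow> CM V"
  by (auto intro!: mm_closed[OF V'(1)] hreg_coord[OF V'(2)] f kr_closed)

lemma psf_closed: "psf c V f \<in> CM V"
proof -
  interpret A: abelian_group "S V" by (rule abelian_secs[OF V'(1)])
  show ?thesis unfolding psf_def by (rule A.finsum_closed[OF psf_fun])
qed

lemma psf_mm: "rat (part c V) g \<Longrightarrow> mm V (\<lambda>p. g (coord c p)) (psf c V f) = psf c V (\<lambda>i z. g z * f i z)"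
proof -
  interpret A: abelian_group "S V" by (rule abelian_secs[OF V'(1)])
  assume g: "rat (part c V) g"
  show ?thesis
    unfolding psf_def mm_finsum[OF V'(1) hreg_coord[OF V'(2) g] psf_fun]
    by (rule A.finsum_cong'[OF HOL.refl])
      (auto intro!: mm_closed[OF V'(1)] hreg_coord[OF V'(2)] rat_mult f g kr_closed mm_mm[OF V'(1)])
qed

lemma psf_cong: "(\<And>i z. i < r \<Longrightarrow> z \<in> part c V \<Longrightarrow> g i z = f i z) \<Longrightarrow> psf c V g = psf c V f"
proof -
  interpret A: abelian_group "S V" by (rule abelian_secs[OF V'(1)])
  assume e: "\<And>i z. i < r \<Longrightarrow> z \<in> part c V \<Longrightarrow> g i z = f i z"
  show ?thesis
    unfolding psf_def
  proof (rule A.finsum_cong'[OF HOL.refl psf_fun])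
    fix i assume "i \<in> {..<r}"
    then have i: "i < r" by simp
    show "mm V (\<lambda>p. g i (coord c p)) (kr c V i) = mm V (\<lambda>p. f i (coord c p)) (kr c V i)"
      by (rule mm_cong[OF V'(1) hreg_coord[OF V'(2) f[OF i]], symmetric]) (simp add: e[OF i] coord_in)
  qed
qed

lemma psf_add: "(\<And>i. i < r \<Longrightarrow> rat (part c V) (g i)) \<Longrightarrow>
    psf c V (\<lambda>i z. f i z + g i z) = psf c V f \<oplus>\<^bsub>S V\<^esub> psf c V g"
proof -
  interpret A: abelian_group "S V" by (rule abelian_secs[OF V'(1)])
  assume g: "\<And>i. i < r \<Longrightarrow> rat (part c V) (g i)"
  have gf: "(\<lambda>i. mm V (\<lambda>p. g i (coord c p)) (kr c V i)) \<in> {..<r} \<rightarrow> CM V"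
    by (auto intro!: mm_closed[OF V'(1)] hreg_coord[OF V'(2)] g kr_closed)
  have "psf c V (\<lambda>i z. f i z + g i z) = finsum (S V) (\<lambda>i. mm V (\<lambda>p. f i (coord c p)) (kr c V i) \<oplus>\<^bsub>S V\<^esub> mm V (\<lambda>p. g i (coord c p)) (kr c V i)) {..<r}"
    unfolding psf_def
  proof (rule A.finsum_cong'[OF HOL.refl])
    show "(\<lambda>i. mm V (\<lambda>p. f i (coord c p)) (kr c V i) \<oplus>\<^bsub>S V\<^esub> mm V (\<lambda>p. g i (coord c p)) (kr c V i)) \<in> {..<r} \<rightarrow> CM V"
      using psf_fun gf by (intro Pi_I A.a_closed) (rule funcset_mem; assumption)+
    fix i assume "i \<in> {..<r}"
    then have i: "i < r" by simp
    show "mm V (\<lambda>p. f i (coord c p) + g i (coord c p)) (kr c V i) =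
        mm V (\<lambda>p. f i (coord c p)) (kr c V i) \<oplus>\<^bsub>S V\<^esub> mm V (\<lambda>p. g i (coord c p)) (kr c V i)"
      by (rule mm_add[OF V'(1) hreg_coord[OF V'(2) f[OF i]] hreg_coord[OF V'(2) g[OF i]] kr_closed[OF i]])
  qed
  also have "\<dots> = psf c V f \<oplus>\<^bsub>S V\<^esub> psf c V g" unfolding psf_def by (rule A.finsum_addf[OF psf_fun gf])
  finally show ?thesis .
qed

lemma psf_res: "W \<in> opens V \<Longrightarrow> res M V W (psf c V f) = psf c W f"
proof -
  assume W: "W \<in> opens V"
  interpret A: abelian_group "S W" by (rule abelian_secs[OF opens_D(1)[OF W]])
  have Wc: "W \<subseteq> Uc c" using opens_D(2)[OF W] V'(2) by blast
  have fW: "rat (part c W) (f i)" if "i < r" for i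
    using f[OF that] part_mono[OF opens_D(2)[OF W]] by (rule rat_subset)
  show ?thesis
    unfolding psf_def res_finsum[OF V'(1) W psf_fun]
  proof (rule A.finsum_cong'[OF HOL.refl])
    have krW: "kr c W i \<in> CM W" if "i < r" for i
      using res_closed[OF V'(1) W kr_closed[OF that]] kr_res[OF W that] by simp
    show "(\<lambda>i. mm W (\<lambda>p. f i (coord c p)) (kr c W i)) \<in> {..<r} \<rightarrow> CM W"
      by (auto intro!: mm_closed[OF opens_D(1)[OF W]] hreg_coord[OF Wc] fW krW)
    fix i assume "i \<in> {..<r}"
    then have i: "i < r" by simp
    show "res M V W (mm V (\<lambda>p. f i (coord c p)) (kr c V i)) = mm W (\<lambda>p. f i (coord c p)) (kr c W i)"
      unfolding res_mm[OF V'(1) W hreg_coord[OF V'(2) f[OF i]] kr_closed[OF i]] kr_res[OF W i] ..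
  qed
qed

end

lemma psf_poly: "psf c V (\<lambda>i. poly (p i)) = res M (Uc c) V (LC c p (k c) {..<r})"
proof -
  interpret W: wmod "S (Uc c)" "pm c" "dd (Uc c) c" by (rule wmod_chart)
  interpret A: abelian_group "S V" by (rule abelian_secs[OF V'(1)])
  have x: "k c \<in> {..<r} \<rightarrow> CM (Uc c)" using k_closed by auto
  have "res M (Uc c) V (LC c p (k c) {..<r}) = finsum (S V) (\<lambda>i. res M (Uc c) V (pm c (p i) (k c i))) {..<r}"
    unfolding W.lc_def using x by (intro res_finsum[OF zariski_open_Uc V]) auto
  also have "\<dots> = psf c V (\<lambda>i. poly (p i))"
    unfolding psf_def using psf_fun[of "\<lambda>i. poly (p i)"]
    by (intro A.finsum_cong'[OF HOL.refl]) (auto simp: rat_poly res_pm[OF V] k_closed kr_def)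
  finally show ?thesis by simp
qed

text \<open>Clearing a common denominator turns the relation over \<open>V\<close> into one with
  polynomial coefficients, which holds on the whole chart by \<open>res_inj0\<close>; there the
  frame is independent.\<close>

lemma psf_zero:
  assumes f: "\<And>i. i < r \<Longrightarrow> rat (part c V) (f i)" and z: "psf c V f = Z V"
    and i: "i < r" and x: "x \<in> part c V"
  shows "f i x = 0"
proof -
  interpret W: wmod "S (Uc c)" "pm c" "dd (Uc c) c" by (rule wmod_chart)
  have ne: "V \<noteq> {}" using x by auto
  have "\<exists>q p. \<forall>z\<in>part c V. poly q z \<noteq> 0 \<and> (\<forall>i\<in>{..<r}. f i z = poly (p i) z / poly q z)"
    by (rule rat_common_denominator) (auto simp: f)
  then obtain q p where "\<forall>z\<in>part c V. poly q z \<noteq> 0 \<and> (\<forall>i\<in>{..<r}. f i z = poly (p i) z / poly q z)"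
    by (elim exE)
  then have qp: "\<And>z. z \<in> part c V \<Longrightarrow> poly q z \<noteq> 0 \<and> (\<forall>i\<in>{..<r}. f i z = poly (p i) z / poly q z)"
    by (rule bspec)
  have "res M (Uc c) V (LC c p (k c) {..<r}) = psf c V (\<lambda>i. poly (p i))" by (rule psf_poly[symmetric])
  also have "\<dots> = psf c V (\<lambda>i z. poly q z * f i z)"
    by (rule psf_cong[OF rat_mult[OF rat_poly f]]) (use qp in auto)
  also have "\<dots> = mm V (cpoly c q) (psf c V f)"
    by (rule psf_mm[OF f rat_poly, symmetric])
  also have "\<dots> = Z V" unfolding z by (rule mm_zero[OF V'(1) hreg_poly[OF V'(2)]])
  finally have "res M (Uc c) V (LC c p (k c) {..<r}) = Z V" .
  moreover have "LC c p (k c) {..<r} \<in> CM (Uc c)" using k_closed by (intro W.lc_closed) auto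
  ultimately have "LC c p (k c) {..<r} = Z (Uc c)" using res_inj0[OF V ne] by simp
  then have "p i = 0" using k_indep[of c] i unfolding W.indep_def by blast
  then show ?thesis using qp[OF x] i by simp
qed

text \<open>Localisation extends \<open>m\<close>, multiplied by a power of the polynomial cutting
  out \<open>V\<close>, to the whole chart, where the frame generates; that power is invertible on
  \<open>V\<close>.\<close>

lemma psf_surj:
  assumes m: "m \<in> CM V"
  shows "\<exists>f. (\<forall>i<r. rat (part c V) (f i)) \<and> m = psf c V f"
proof -
  interpret W: wmod "S (Uc c)" "pm c" "dd (Uc c) c" by (rule wmod_chart)
  obtain h where h: "\<And>z. poly h z \<noteq> 0 \<longleftrightarrow> z \<in> part c V" using open_as_nonvanishing[OF V] by blast
  obtain j m' where m': "m' \<in> CM (Uc c)" "res M (Uc c) V m' = mm V (cpoly c (h ^ j)) m"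
    using loc_surj[OF V h m] by blast
  obtain p where p: "m' = LC c p (k c) {..<r}" using k_gen[of c] m'(1) unfolding W.gen_def by blast
  let ?g = "\<lambda>z. inverse (poly (h ^ j) z)"
  have g: "rat (part c V) ?g" by (rule rat_inverse[OF rat_poly]) (simp add: h)
  have "mm V (\<lambda>p. ?g (coord c p)) (mm V (cpoly c (h ^ j)) m) = mm V (\<lambda>_. 1) m"
  proof (rule mm_mm[OF V'(1) hreg_coord[OF V'(2) g] hreg_poly[OF V'(2)] m])
    fix p assume "p \<in> V"
    then have "poly h (coord c p) \<noteq> 0" using coord_in h by simp
    then show "?g (coord c p) * poly (h ^ j) (coord c p) = 1" by simp
  qed
  then have "m = mm V (\<lambda>p. ?g (coord c p)) (mm V (cpoly c (h ^ j)) m)"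
    using mm_one[OF V'(1) m] by simp
  also have "\<dots> = mm V (\<lambda>p. ?g (coord c p)) (psf c V (\<lambda>i. poly (p i)))"
    unfolding m'(2)[symmetric] p psf_poly ..
  also have "\<dots> = psf c V (\<lambda>i z. ?g z * poly (p i) z)" by (rule psf_mm[OF rat_poly g])
  finally have "m = psf c V (\<lambda>i z. ?g z * poly (p i) z)" .
  then show ?thesis using rat_mult[OF g rat_poly] by (intro exI[of _ "\<lambda>i z. ?g z * poly (p i) z"] conjI allI impI)
qed

lemma ps_rat: "s \<in> CN lam r V \<Longrightarrow> i < r \<Longrightarrow> rat (part c V) (sel c (s i))"
  by (rule line_bundle_rat[OF V'(1) CN_mem])

lemma ps_closed: "s \<in> CN lam r V \<Longrightarrow> ps c V s \<in> CM V"
  unfolding ps_def by (rule psf_closed[OF ps_rat])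

lemma ps_add:
  assumes s: "s \<in> CN lam r V" and t: "t \<in> CN lam r V"
  shows "ps c V (s \<oplus>\<^bsub>SM lam r V\<^esub> t) = ps c V s \<oplus>\<^bsub>S V\<^esub> ps c V t"
proof -
  have "ps c V (s \<oplus>\<^bsub>SM lam r V\<^esub> t) = psf c V (\<lambda>i z. sel c (s i) z + sel c (t i) z)"
    unfolding ps_def by (rule psf_cong) (use s t in \<open>auto simp: Model_simps(3) intro!: rat_add ps_rat\<close>)
  then show ?thesis unfolding ps_def using psf_add[OF ps_rat[OF s] ps_rat[OF t]] by simp
qed

lemma ps_res:
  assumes s: "s \<in> CN lam r V" and W: "W \<in> opens V"
  shows "res M V W (ps c V s) = ps c W (RM lam r V W s)"
proof -
  have "psf c W (\<lambda>i. sel c (RM lam r V W s i)) = psf c W (\<lambda>i. sel c (s i))"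
  proof (rule framed.psf_cong[OF framed_axioms opens_trans[OF V W]])
    show "rat (part c W) (sel c (s i))" if "i < r" for i
    using ps_rat[OF s that] part_mono[OF opens_D(2)[OF W]] by (rule rat_subset)
  qed (simp add: Model_simps(5))
  moreover have "res M V W (psf c V (\<lambda>i. sel c (s i))) = psf c W (\<lambda>i. sel c (s i))"
    by (rule psf_res[OF ps_rat[OF s] W])
  ultimately show ?thesis by (simp add: ps_def)
qed

lemma ps_smul:
  assumes s: "s \<in> CN lam r V" and P: "P \<in> tdo_carrier lam V"
  shows "P \<odot>\<^bsub>S V\<^esub> ps c V s = ps c V (P \<odot>\<^bsub>SM lam r V\<^esub> s)"
proof -
  interpret A: abelian_group "S V" by (rule abelian_secs[OF V'(1)])
  have Ps: "P \<odot>\<^bsub>SM lam r V\<^esub> s \<in> CN lam r V" by (rule Model_smul_closed[OF V'(1) P s])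
  have F: "(\<lambda>i. mm V (\<lambda>p. sel c (s i) (coord c p)) (kr c V i)) \<in> {..<r} \<rightarrow> CM V"
    by (rule psf_fun[OF ps_rat[OF s]])
  have F': "(\<lambda>i. mm V (\<lambda>p. sel c ((P \<odot>\<^bsub>SM lam r V\<^esub> s) i) (coord c p)) (kr c V i)) \<in> {..<r} \<rightarrow> CM V"
    by (rule psf_fun[OF ps_rat[OF Ps]])
  show ?thesis
    unfolding ps_def psf_def smul_finsum[OF V'(1) P F]
    by (rule A.finsum_cong'[OF HOL.refl F'])
      (simp add: smul_horizontal[OF V' kr_closed kr_horizontal P CN_mem[OF s]] Model_simps(4))
qed

lemma ps_inj:
  assumes s: "s \<in> CN lam r V" and t: "t \<in> CN lam r V" and e: "ps c V s = ps c V t"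
  shows "s = t"
proof -
  interpret A: abelian_group "S V" by (rule abelian_secs[OF V'(1)])
  let ?u = "\<lambda>i z. sel c (s i) z - sel c (t i) z"
  have u: "rat (part c V) (?u i)" if "i < r" for i by (intro rat_diff ps_rat s t that)
  have "psf c V ?u \<oplus>\<^bsub>S V\<^esub> ps c V t = psf c V (\<lambda>i z. ?u i z + sel c (t i) z)"
    unfolding ps_def by (rule psf_add[OF u ps_rat[OF t], symmetric])
  also have "\<dots> = ps c V s" unfolding ps_def by (rule psf_cong[OF ps_rat[OF s]]) simp_all
  also have "\<dots> = Z V \<oplus>\<^bsub>S V\<^esub> ps c V t" using e ps_closed[OF t] by simp
  finally have u0: "psf c V ?u = Z V"
    using A.add.right_cancel[OF ps_closed[OF t] psf_closed[OF u] A.zero_closed] by simp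
  have z: "?u i x = 0" if "i < r" "x \<in> part c V" for i x by (rule psf_zero[OF u u0 that])
  show ?thesis
  proof (rule CN_eqI[OF s t])
    fix i assume i: "i < r"
    show "s i = t i"
      by (rule line_bundle_eqI_chart[OF V' CN_mem[OF s i] CN_mem[OF t i]]) (use z[OF i] in auto)
  qed
qed

lemma ps_surj:
  assumes m: "m \<in> CM V" shows "\<exists>s\<in>CN lam r V. ps c V s = m"
proof -
  obtain f where f: "\<And>i. i < r \<Longrightarrow> rat (part c V) (f i)" "m = psf c V f" using psf_surj[OF m] by blast
  let ?s = "\<lambda>i\<in>{..<r}. chart_sec c (lam - 1) V (f i)"
  have "?s \<in> CN lam r V" by (rule CN_I) (rule chart_sec_closed[OF V' f(1)])
  moreover have "ps c V ?s = m" unfolding ps_def f(2) by (rule psf_cong[OF f(1)]) simp_all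
  ultimately show ?thesis by blast
qed

end

text \<open>The frames differ by \<open>coord c ^ nn\<close> and the chart functions of a section by
  the inverse factor, so the products agree. Here the twist \<open>lam - 1\<close> of the line
  bundle meets the one found in the module.\<close>

lemma ps_overlap:
  assumes V: "V \<in> opens Uov" and s: "s \<in> CN lam r V"
  shows "ps (\<not> c) V s = ps c V s"
proof -
  let ?d = "\<not> c"
  have V': "zariski_open V" "V \<subseteq> Uov" "V \<subseteq> Uc c" "V \<subseteq> Uc ?d" using V Uov_subset by (auto simp: opens_def)
  have Vc: "V \<in> opens (Uc c)" using V' by (auto simp: opens_def)
  interpret A: abelian_group "S V" by (rule abelian_secs[OF V'(1)])
  have krd: "kr ?d V i = mm V (cpow c nn) (kr c V i)" if i: "i < r" for i
  proof -
    have "kr ?d V i = res M Uov V (r\<^sub>c ?d (k ?d i))"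
      unfolding kr_def by (rule res_res[OF zariski_open_Uc Uov_opens V k_closed[OF i], symmetric])
    also have "\<dots> = mm V (cpow c nn) (res M Uov V (r\<^sub>c c (k c i)))"
      unfolding k_overlap[OF i] by (rule res_mm[OF zariski_open_Uov V hreg_Uov_power r_closed[OF k_closed[OF i]]])
    also have "res M Uov V (r\<^sub>c c (k c i)) = kr c V i"
      unfolding kr_def by (rule res_res[OF zariski_open_Uc Uov_opens V k_closed[OF i]])
    finally show ?thesis .
  qed
  have hz: "hreg V (cpow c nn)" by (rule hreg_subset[OF hreg_Uov_power V'(2)])
  show ?thesis
    unfolding ps_def psf_def
  proof (rule A.finsum_cong'[OF HOL.refl psf_fun[OF Vc ps_rat[OF Vc s]]])
    fix i assume "i \<in> {..<r}"
    then have i: "i < r" by simp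
    have hs: "hreg V (\<lambda>p. sel d (s i) (coord d p))" for d
      using hreg_coord[OF _ line_bundle_rat[OF V'(1) CN_mem[OF s i]], of d] V'(3,4) by (cases "d = c") auto
    show "mm V (\<lambda>p. sel ?d (s i) (coord ?d p)) (kr ?d V i) = mm V (\<lambda>p. sel c (s i) (coord c p)) (kr c V i)"
      unfolding krd[OF i]
    proof (rule mm_mm[OF V'(1) hs hz kr_closed[OF Vc i]])
      fix p assume p: "p \<in> V"
      then have z: "coord c p \<noteq> 0" "coord ?d p = inverse (coord c p)" using Uov_coord V'(2) by auto
      have "coord c p \<in> part c V" using p V'(3) chart_coord[of p c] by (auto simp: mem_part)
      from line_bundle_trans[OF V'(1) CN_mem[OF s i] this z(1)]
      have "sel c (s i) (coord c p) = coord c p powi (lam - 1) * sel ?d (s i) (inverse (coord c p))" .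
      moreover have "coord c p powi (lam - 1) = coord c p ^ nn"
        using lam_pos by (simp add: nn_def power_int_def)
      ultimately show "sel ?d (s i) (coord ?d p) * coord c p ^ nn = sel c (s i) (coord c p)" using z(2) by simp
    qed
  qed
qed

subsection \<open>Gluing the two charts\<close>

lemma opens_Int_Uc: "zariski_open U \<Longrightarrow> U \<inter> Uc c \<in> opens U" "zariski_open U \<Longrightarrow> U \<inter> Uc c \<in> opens (Uc c)"
  by (auto simp: opens_def intro: zariski_open_Int)

lemma opens_Int_Uov: "zariski_open U \<Longrightarrow> U \<inter> Uov \<in> opens (U \<inter> Uc c)" "zariski_open U \<Longrightarrow> U \<inter> Uov \<in> opens Uov"
  using Uov_subset[of c] by (auto simp: opens_def intro: zariski_open_Int)

lemma glue_charts:
  assumes U: "zariski_open U" and a: "\<And>c. a c \<in> CM (U \<inter> Uc c)"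
    and ov: "\<And>c. res M (U \<inter> Uc (\<not> c)) (U \<inter> Uov) (a (\<not> c)) = res M (U \<inter> Uc c) (U \<inter> Uov) (a c)"
  shows "\<exists>!m. m \<in> CM U \<and> (\<forall>c. res M U (U \<inter> Uc c) m = a c)"
proof -
  define \<V> where "\<V> = range (\<lambda>c. U \<inter> Uc c)"
  define b where "b = (\<lambda>V. if V = U \<inter> Uc False then a False else a True)"
  have O: "zariski_open (U \<inter> Uc c)" for c by (rule zariski_open_Int[OF U zariski_open_Uc])
  \<comment> \<open>The cover is a set, so a family indexed by it takes only one value when the two
    members coincide; they then equal the overlap, and the two given sections agree.\<close>
  have b: "b (U \<inter> Uc c) = a c" for c
  proof (cases "U \<inter> Uc c = U \<inter> Uc False")
    case True
    show ?thesis
    proof (cases c)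
      case c: True
      then have e: "U \<inter> Uc True = U \<inter> Uc False" using True by simp
      then have e': "U \<inter> Uov = U \<inter> Uc False" by (auto simp: Uov_def)
      have "a True = a False"
        using ov[of False] res_id[OF O[of False], of "a True"] res_id[OF O[of False] a[of False]] e e' a[of True] by simp
      then show ?thesis using c by (simp add: b_def)
    qed (simp add: b_def)
  next
    case False
    then have c by (cases c) auto
    then show ?thesis using False by (simp add: b_def)
  qed
  have Un: "\<Union>\<V> = U" unfolding \<V>_def using Uc_Un[of False] by auto
  have "\<V> \<subseteq> opens UNIV" unfolding \<V>_def using O by (auto simp: opens_UNIV)
  moreover have "\<forall>V\<in>\<V>. b V \<in> CM V" unfolding \<V>_def using a by (auto simp: b)
  moreover have "\<forall>V\<in>\<V>. \<forall>W\<in>\<V>. res M V (V \<inter> W) (b V) = res M W (V \<inter> W) (b W)"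
  proof (intro ballI)
    fix V W assume "V \<in> \<V>" "W \<in> \<V>"
    then obtain c d where VW: "V = U \<inter> Uc c" "W = U \<inter> Uc d" unfolding \<V>_def by auto
    show "res M V (V \<inter> W) (b V) = res M W (V \<inter> W) (b W)"
    proof (cases "d = c")
      case False
      then have d: "d = (\<not> c)" by auto
      have "V \<inter> W = U \<inter> Uov" unfolding VW d Uov_eq[of c] by auto
      then show ?thesis using ov[of c] unfolding VW d b by simp
    qed (simp add: VW)
  qed
  ultimately have "\<exists>!m. m \<in> CM (\<Union>\<V>) \<and> (\<forall>V\<in>\<V>. res M (\<Union>\<V>) V m = b V)"
    using sheaf unfolding sheaf_condition_def by simp
  then show ?thesis unfolding Un unfolding \<V>_def by (simp add: b)
qed

abbreviation MR :: "p1 set \<Rightarrow> p1 set \<Rightarrow> (nat \<Rightarrow> lsec) \<Rightarrow> nat \<Rightarrow> lsec" where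
  "MR \<equiv> RM lam r"

definition phi :: "p1 set \<Rightarrow> (nat \<Rightarrow> lsec) \<Rightarrow> 'v" where
  "phi = (\<lambda>U\<in>opens UNIV. \<lambda>s\<in>CN lam r U.
     THE m. m \<in> CM U \<and> (\<forall>c. res M U (U \<inter> Uc c) m = ps c (U \<inter> Uc c) (MR U (U \<inter> Uc c) s)))"

lemma MR_MR: "W \<subseteq> V \<Longrightarrow> MR V W (MR U V s) = MR U W s"
  by (auto simp: Model_simps(5) sres_sres intro!: restrict_ext)

context
  fixes U assumes U: "zariski_open U"
begin

lemma phi_unique: "s \<in> CN lam r U \<Longrightarrow>
    \<exists>!m. m \<in> CM U \<and> (\<forall>c. res M U (U \<inter> Uc c) m = ps c (U \<inter> Uc c) (MR U (U \<inter> Uc c) s))"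
proof (rule glue_charts[OF U])
  fix c
  assume s: "s \<in> CN lam r U"
  have cl: "MR U (U \<inter> Uc c) s \<in> CN lam r (U \<inter> Uc c)" for c
    by (rule Model_res_closed[OF U opens_Int_Uc(1)[OF U] s])
  show "ps c (U \<inter> Uc c) (MR U (U \<inter> Uc c) s) \<in> CM (U \<inter> Uc c)"
    by (rule ps_closed[OF opens_Int_Uc(2)[OF U] cl])
  have e: "res M (U \<inter> Uc c) (U \<inter> Uov) (ps c (U \<inter> Uc c) (MR U (U \<inter> Uc c) s)) = ps c (U \<inter> Uov) (MR U (U \<inter> Uov) s)" for c
    unfolding ps_res[OF opens_Int_Uc(2)[OF U] cl opens_Int_Uov(1)[OF U]]
    using MR_MR[of "U \<inter> Uov" "U \<inter> Uc c"] Uov_subset[of c] by (simp add: le_infI2)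
  have "U \<inter> Uov \<in> opens U" using zariski_open_Int[OF U zariski_open_Uov] by (simp add: opens_def)
  from Model_res_closed[OF U this s]
  show "res M (U \<inter> Uc (\<not> c)) (U \<inter> Uov) (ps (\<not> c) (U \<inter> Uc (\<not> c)) (MR U (U \<inter> Uc (\<not> c)) s)) =
      res M (U \<inter> Uc c) (U \<inter> Uov) (ps c (U \<inter> Uc c) (MR U (U \<inter> Uc c) s))"
    unfolding e by (rule ps_overlap[OF opens_Int_Uov(2)[OF U]])
qed

lemma phi_props:
  assumes s: "s \<in> CN lam r U"
  shows "phi U s \<in> CM U" "res M U (U \<inter> Uc c) (phi U s) = ps c (U \<inter> Uc c) (MR U (U \<inter> Uc c) s)"
proof -
  have e: "phi U s = (THE m. m \<in> CM U \<and> (\<forall>c. res M U (U \<inter> Uc c) m = ps c (U \<inter> Uc c) (MR U (U \<inter> Uc c) s)))"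
    using U s by (simp add: phi_def opens_UNIV)
  from theI'[OF phi_unique[OF s], folded e]
  show "phi U s \<in> CM U" "res M U (U \<inter> Uc c) (phi U s) = ps c (U \<inter> Uc c) (MR U (U \<inter> Uc c) s)" by auto
qed

lemma phi_eqI:
  assumes s: "s \<in> CN lam r U" and m: "m \<in> CM U"
    and e: "\<And>c. res M U (U \<inter> Uc c) m = ps c (U \<inter> Uc c) (MR U (U \<inter> Uc c) s)"
  shows "phi U s = m"
proof -
  have "phi U s = (THE m. m \<in> CM U \<and> (\<forall>c. res M U (U \<inter> Uc c) m = ps c (U \<inter> Uc c) (MR U (U \<inter> Uc c) s)))"
    using U s by (simp add: phi_def opens_UNIV)
  also have "\<dots> = m" by (rule the1_equality[OF phi_unique[OF s]]) (simp add: m e)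
  finally show ?thesis .
qed

private lemma MR_cl: "s \<in> CN lam r U \<Longrightarrow> MR U (U \<inter> Uc c) s \<in> CN lam r (U \<inter> Uc c)"
  by (rule Model_res_closed[OF U opens_Int_Uc(1)[OF U]])

lemma phi_add:
  assumes s: "s \<in> CN lam r U" and t: "t \<in> CN lam r U"
  shows "phi U (s \<oplus>\<^bsub>SM lam r U\<^esub> t) = phi U s \<oplus>\<^bsub>S U\<^esub> phi U t"
proof (rule phi_eqI[OF Model_add_closed[OF U s t]])
  interpret A: abelian_group "S U" by (rule abelian_secs[OF U])
  show "phi U s \<oplus>\<^bsub>S U\<^esub> phi U t \<in> CM U" by (intro A.a_closed phi_props s t)
  fix c
  have "MR U (U \<inter> Uc c) (s \<oplus>\<^bsub>SM lam r U\<^esub> t) =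
      MR U (U \<inter> Uc c) s \<oplus>\<^bsub>SM lam r (U \<inter> Uc c)\<^esub> MR U (U \<inter> Uc c) t"
    by (auto simp: Model_simps(3,5) sres_sadd intro!: restrict_ext)
  then show "res M U (U \<inter> Uc c) (phi U s \<oplus>\<^bsub>S U\<^esub> phi U t) =
      ps c (U \<inter> Uc c) (MR U (U \<inter> Uc c) (s \<oplus>\<^bsub>SM lam r U\<^esub> t))"
    unfolding res_add[OF U opens_Int_Uc(1)[OF U] phi_props(1)[OF s] phi_props(1)[OF t]] phi_props(2)[OF s] phi_props(2)[OF t]
    by (simp add: ps_add[OF opens_Int_Uc(2)[OF U] MR_cl[OF s] MR_cl[OF t]])
qed

lemma phi_smul:
  assumes s: "s \<in> CN lam r U" and P: "P \<in> tdo_carrier lam U"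
  shows "phi U (P \<odot>\<^bsub>SM lam r U\<^esub> s) = P \<odot>\<^bsub>S U\<^esub> phi U s"
proof (rule phi_eqI[OF Model_smul_closed[OF U P s]])
  show "P \<odot>\<^bsub>S U\<^esub> phi U s \<in> CM U" by (intro smul_closed U P phi_props s)
  fix c
  have "P (U \<inter> Uc c) (sres (U \<inter> Uc c) (s i)) = sres (U \<inter> Uc c) (P U (s i))" if "i < r" for i
    by (rule tdo_apply_sres[OF U P opens_self[OF U] opens_Int_Uc(1)[OF U] CN_mem[OF s that]])
  then have "MR U (U \<inter> Uc c) (P \<odot>\<^bsub>SM lam r U\<^esub> s) =
      tdo_res (U \<inter> Uc c) P \<odot>\<^bsub>SM lam r (U \<inter> Uc c)\<^esub> MR U (U \<inter> Uc c) s"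
    using opens_self[OF zariski_open_Int[OF U zariski_open_Uc[of c]]]
    by (auto simp: Model_simps(4,5) intro!: restrict_ext)
  then show "res M U (U \<inter> Uc c) (P \<odot>\<^bsub>S U\<^esub> phi U s) =
      ps c (U \<inter> Uc c) (MR U (U \<inter> Uc c) (P \<odot>\<^bsub>SM lam r U\<^esub> s))"
    unfolding res_smul[OF U opens_Int_Uc(1)[OF U] P phi_props(1)[OF s]] phi_props(2)[OF s]
    by (simp add: ps_smul[OF opens_Int_Uc(2)[OF U] MR_cl[OF s] tdo_res_closed[OF U opens_Int_Uc(1)[OF U] P]])
qed

lemma phi_res:
  assumes s: "s \<in> CN lam r U" and V: "V \<in> opens U"
  shows "phi V (MR U V s) = res M U V (phi U s)"
proof -
  have V': "zariski_open V" "V \<subseteq> U" using V by (auto simp: opens_def)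
  have VU: "V \<inter> Uc c \<in> opens (U \<inter> Uc c)" for c using V' by (auto simp: opens_def intro: zariski_open_Int)
  show ?thesis
  proof (rule framed.phi_eqI[OF framed_axioms V'(1) Model_res_closed[OF U V s] res_closed[OF U V phi_props(1)[OF s]]])
    fix c
    have "res M V (V \<inter> Uc c) (res M U V (phi U s)) = res M (U \<inter> Uc c) (V \<inter> Uc c) (res M U (U \<inter> Uc c) (phi U s))"
      using res_res[OF U V opens_Int_Uc(1)[OF V'(1)] phi_props(1)[OF s]]
        res_res[OF U opens_Int_Uc(1)[OF U] VU phi_props(1)[OF s]] by simp
    also have "\<dots> = ps c (V \<inter> Uc c) (MR (U \<inter> Uc c) (V \<inter> Uc c) (MR U (U \<inter> Uc c) s))"
      unfolding phi_props(2)[OF s] by (rule ps_res[OF opens_Int_Uc(2)[OF U] MR_cl[OF s] VU])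
    also have "\<dots> = ps c (V \<inter> Uc c) (MR V (V \<inter> Uc c) (MR U V s))"
      using MR_MR[of "V \<inter> Uc c" "U \<inter> Uc c"] MR_MR[of "V \<inter> Uc c" V] V'(2) by (simp add: le_infI1)
    finally show "res M V (V \<inter> Uc c) (res M U V (phi U s)) = ps c (V \<inter> Uc c) (MR V (V \<inter> Uc c) (MR U V s))" .
  qed
qed

lemma phi_inj:
  assumes s: "s \<in> CN lam r U" and t: "t \<in> CN lam r U" and e: "phi U s = phi U t"
  shows "s = t"
proof (rule CN_eqI[OF s t])
  fix i assume i: "i < r"
  have MRe: "MR U (U \<inter> Uc c) s = MR U (U \<inter> Uc c) t" for c
    using ps_inj[OF opens_Int_Uc(2)[OF U] MR_cl[OF s] MR_cl[OF t]] phi_props(2)[OF s, of c] phi_props(2)[OF t, of c] e by simp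
  have rs: "sres (U \<inter> Uc c) (s i) = sres (U \<inter> Uc c) (t i)" for c
    using fun_cong[OF MRe[of c], of i] i by (simp add: Model_simps(5))
  show "s i = t i"
  proof (rule line_bundle_eqI[OF U CN_mem[OF s i] CN_mem[OF t i]])
    fix c z assume "z \<in> part c U"
    then have "z \<in> part c (U \<inter> Uc c)" by simp
    then show "sel c (s i) z = sel c (t i) z" using arg_cong[OF rs[of c], of "\<lambda>x. sel c x z"] by simp
  qed
qed

text \<open>The coordinate tuples of \<open>m\<close> on the two charts agree over the overlap by
  injectivity of \<open>ps\<close> there, so they glue to a tuple of sections over
  \<open>U\<close>.\<close>

lemma phi_surj:
  assumes m: "m \<in> CM U" shows "\<exists>s\<in>CN lam r U. phi U s = m"
proof -
  have "\<exists>t. t \<in> CN lam r (U \<inter> Uc c) \<and> ps c (U \<inter> Uc c) t = res M U (U \<inter> Uc c) m" for c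
    using ps_surj[OF opens_Int_Uc(2)[OF U] res_closed[OF U opens_Int_Uc(1)[OF U] m], of c] by blast
  then obtain t where t: "\<And>c. t c \<in> CN lam r (U \<inter> Uc c)" "\<And>c. ps c (U \<inter> Uc c) (t c) = res M U (U \<inter> Uc c) m"
    by metis
  have O: "zariski_open (U \<inter> Uc c)" for c by (rule zariski_open_Int[OF U zariski_open_Uc])
  have tov: "MR (U \<inter> Uc c) (U \<inter> Uov) (t c) \<in> CN lam r (U \<inter> Uov)" for c
    by (rule Model_res_closed[OF O opens_Int_Uov(1)[OF U] t(1)])
  have pov: "ps c (U \<inter> Uov) (MR (U \<inter> Uc c) (U \<inter> Uov) (t c)) = res M U (U \<inter> Uov) m" for c
    using ps_res[OF opens_Int_Uc(2)[OF U] t(1) opens_Int_Uov(1)[OF U], of c] t(2)[of c]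
      res_res[OF U opens_Int_Uc(1)[OF U] opens_Int_Uov(1)[OF U] m, of c] by simp
  have te: "MR (U \<inter> Uc (\<not> c)) (U \<inter> Uov) (t (\<not> c)) = MR (U \<inter> Uc c) (U \<inter> Uov) (t c)" for c
  proof (rule ps_inj[of _ c])
    show "U \<inter> Uov \<in> opens (Uc c)" using opens_Int_Uov(2)[OF U] Uov_subset opens_mono by blast
    show "ps c (U \<inter> Uov) (MR (U \<inter> Uc (\<not> c)) (U \<inter> Uov) (t (\<not> c))) = ps c (U \<inter> Uov) (MR (U \<inter> Uc c) (U \<inter> Uov) (t c))"
      using ps_overlap[OF opens_Int_Uov(2)[OF U] tov, of "c" "\<not> c"] pov[of c] pov[of "\<not> c"] by simp
  qed (rule tov)+
  have agree: "sel c (t (\<not> c) i) z = sel c (t c i) z" if i: "i < r" and z: "z \<in> part c (U \<inter> Uov)" for c i z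
  proof -
    have "sres (U \<inter> Uov) (t (\<not> c) i) = sres (U \<inter> Uov) (t c i)"
      using fun_cong[OF te[of c], of i] i by (simp add: Model_simps(5))
    from arg_cong[OF this, of "\<lambda>x. sel c x z"] show ?thesis using z by simp
  qed
  define s where "s = (\<lambda>i\<in>{..<r}. mk_sec (\<lambda>c. sel c (t c i)))"
  have s: "s \<in> CN lam r U"
    unfolding s_def
  proof (rule CN_I, rule line_bundleI[OF U])
    fix i c z assume i: "i < r"
    have ti: "t d i \<in> lb lam (U \<inter> Uc d)" for d by (rule CN_mem[OF t(1) i])
    have pe: "part c (U \<inter> Uc c) = part c U" by simp
    show "rat (part c U) (sel c (mk_sec (\<lambda>c. sel c (t c i))))"
      using line_bundle_rat[OF O ti, of c c] by (simp only: pe sel_mk)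
    show "z \<notin> part c U \<Longrightarrow> sel c (mk_sec (\<lambda>c. sel c (t c i))) z = 0"
      using line_bundle_zero[OF O ti, of z c c] by (simp only: pe sel_mk not_False_eq_True)
    assume z: "z \<in> part c U" "z \<noteq> 0"
    have zov: "z \<in> part c (U \<inter> Uov)" using z part_Uov[of c] by simp
    have zd: "z \<in> part c (U \<inter> Uc (\<not> c))" using zov Uov_subset[of "\<not> c"] by (auto simp: mem_part)
    show "sel c (mk_sec (\<lambda>c. sel c (t c i))) z = z powi (lam - 1) * sel (\<not> c) (mk_sec (\<lambda>c. sel c (t c i))) (inverse z)"
      using line_bundle_trans[OF O ti zd z(2)] agree[OF i zov] by simp
  qed
  have "phi U s = m"
  proof (rule phi_eqI[OF s m])
    fix c
    have "MR U (U \<inter> Uc c) s = t c"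
    proof (rule CN_eqI[OF MR_cl[OF s] t(1)])
      fix i assume i: "i < r"
      show "MR U (U \<inter> Uc c) s i = t c i"
      proof (rule line_bundle_eqI_chart[OF O])
        show "U \<inter> Uc c \<subseteq> Uc c" by simp
        show "MR U (U \<inter> Uc c) s i \<in> lb lam (U \<inter> Uc c)" by (rule CN_mem[OF MR_cl[OF s] i])
        show "t c i \<in> lb lam (U \<inter> Uc c)" by (rule CN_mem[OF t(1) i])
        show "sel c (MR U (U \<inter> Uc c) s i) z = sel c (t c i) z" if "z \<in> part c (U \<inter> Uc c)" for z
          using that i by (simp add: Model_simps(5) s_def)
      qed
    qed
    then show "res M U (U \<inter> Uc c) m = ps c (U \<inter> Uc c) (MR U (U \<inter> Uc c) s)" using t(2)[of c] by simp
  qed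
  then show ?thesis using s by blast
qed

end

lemma phi_hom: "phi \<in> dmod_hom lam (Model lam r) M"
  unfolding dmod_hom_def mem_Collect_eq
proof (intro conjI ballI)
  show "phi \<in> (\<Pi>\<^sub>E U\<in>opens UNIV. CN lam r U \<rightarrow>\<^sub>E CM U)"
  proof (rule PiE_I)
    fix U assume U: "U \<in> opens UNIV"
    show "phi U \<in> CN lam r U \<rightarrow>\<^sub>E CM U"
      by (rule PiE_I) (use U phi_props(1) in \<open>auto simp: phi_def opens_UNIV\<close>)
  qed (simp add: phi_def)
qed (auto simp: opens_UNIV tdo_simps(1) phi_add phi_smul phi_res)

lemma phi_bij: "zariski_open U \<Longrightarrow> bij_betw (phi U) (CN lam r U) (CM U)"
proof (rule bij_betw_imageI)
  assume U: "zariski_open U"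
  show "inj_on (phi U) (CN lam r U)" by (rule inj_onI) (rule phi_inj[OF U])
  show "phi U ` CN lam r U = CM U"
  proof (intro equalityI subsetI)
    fix m assume "m \<in> CM U"
    from phi_surj[OF U this] show "m \<in> phi U ` CN lam r U" by blast
  next
    fix m assume "m \<in> phi U ` CN lam r U"
    then show "m \<in> CM U" using phi_props(1)[OF U] by blast
  qed
qed

end

theorem (in Omod) trivialisation:
  "\<exists>r \<phi>. \<phi> \<in> dmod_hom lam (Model lam r) M \<and>
    (\<forall>U. zariski_open U \<longrightarrow> bij_betw (\<phi> U) (carrier (SM lam r U)) (carrier (S U)))"
proof -
  obtain r and k :: "bool \<Rightarrow> nat \<Rightarrow> 'v" where *:
    "\<And>c i. i < r \<Longrightarrow> k c i \<in> CM (Uc c)"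
    "\<And>c i. i < r \<Longrightarrow> dd (Uc c) c (k c i) = Z (Uc c)"
    "\<And>c. GEN c (k c) {..<r}" "\<And>c. INDEP c (k c) {..<r}"
    "\<And>c i. i < r \<Longrightarrow> r\<^sub>c (\<not> c) (k (\<not> c) i) = mm Uov (cpow c nn) (r\<^sub>c c (k c i))"
    by (rule horizontal_frame) (rule that)
  interpret F: framed lam M r k
    by (intro framed.intro framed_axioms.intro Omod_axioms *)
  show ?thesis using F.phi_hom F.phi_bij by blast
qed

subsection \<open>The model is a coherent module\<close>

lemma Model_abelian: "zariski_open U \<Longrightarrow> abelian_group (SM lam r U)"
proof (rule abelian_groupI)
  assume U: "zariski_open U"
  show "\<zero>\<^bsub>SM lam r U\<^esub> \<in> CN lam r U" unfolding Model_simps(2) by (rule CN_I) (rule szero_closed[OF U])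
  show "\<exists>y\<in>CN lam r U. y \<oplus>\<^bsub>SM lam r U\<^esub> s = \<zero>\<^bsub>SM lam r U\<^esub>" if s: "s \<in> CN lam r U" for s
  proof (rule bexI)
    show "(\<lambda>i\<in>{..<r}. hmul (\<lambda>_. -1) (s i)) \<in> CN lam r U"
      by (rule CN_I) (rule hmul_closed[OF U hreg_const CN_mem[OF s]])
    show "(\<lambda>i\<in>{..<r}. hmul (\<lambda>_. -1) (s i)) \<oplus>\<^bsub>SM lam r U\<^esub> s = \<zero>\<^bsub>SM lam r U\<^esub>"
      unfolding Model_simps by (rule restrict_ext) (auto intro: sel_eqI)
  qed
  show "\<zero>\<^bsub>SM lam r U\<^esub> \<oplus>\<^bsub>SM lam r U\<^esub> s = s" if s: "s \<in> CN lam r U" for s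
    using s unfolding Model_simps by (auto simp: fun_eq_iff restrict_def extensional_def PiE_iff intro!: sel_eqI)
  show "s \<oplus>\<^bsub>SM lam r U\<^esub> t \<in> CN lam r U" if "s \<in> CN lam r U" "t \<in> CN lam r U" for s t
    by (rule Model_add_closed[OF U that])
  show "s \<oplus>\<^bsub>SM lam r U\<^esub> t = t \<oplus>\<^bsub>SM lam r U\<^esub> s" for s t
    unfolding Model_simps by (rule restrict_ext) (auto intro: sel_eqI)
  show "s \<oplus>\<^bsub>SM lam r U\<^esub> t \<oplus>\<^bsub>SM lam r U\<^esub> u = s \<oplus>\<^bsub>SM lam r U\<^esub> (t \<oplus>\<^bsub>SM lam r U\<^esub> u)" for s t u
    unfolding Model_simps by (rule restrict_ext) (auto intro: sel_eqI)
qed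

lemma Model_left_module:
  assumes U: "zariski_open U" shows "left_module (tdo lam U) (SM lam r U)"
  unfolding left_module_def tdo_simps(1)
proof (intro conjI ballI Model_abelian[OF U])
  fix P m assume P: "P \<in> tdo_carrier lam U" and m: "m \<in> CN lam r U"
  show "P \<odot>\<^bsub>SM lam r U\<^esub> m \<in> CN lam r U" by (rule Model_smul_closed[OF U P m])
  fix Q
  show "(P \<oplus>\<^bsub>tdo lam U\<^esub> Q) \<odot>\<^bsub>SM lam r U\<^esub> m =
    P \<odot>\<^bsub>SM lam r U\<^esub> m \<oplus>\<^bsub>SM lam r U\<^esub> Q \<odot>\<^bsub>SM lam r U\<^esub> m"
    unfolding Model_simps by (rule restrict_ext) (simp add: tdo_simps(3)[OF opens_self[OF U] CN_mem[OF m]])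
  show "(P \<otimes>\<^bsub>tdo lam U\<^esub> Q) \<odot>\<^bsub>SM lam r U\<^esub> m = P \<odot>\<^bsub>SM lam r U\<^esub> (Q \<odot>\<^bsub>SM lam r U\<^esub> m)"
    unfolding Model_simps by (rule restrict_ext) (simp add: tdo_simps(2)[OF opens_self[OF U] CN_mem[OF m]])
next
  fix P m n assume P: "P \<in> tdo_carrier lam U" and m: "m \<in> CN lam r U" and n: "n \<in> CN lam r U"
  show "P \<odot>\<^bsub>SM lam r U\<^esub> (m \<oplus>\<^bsub>SM lam r U\<^esub> n) =
    P \<odot>\<^bsub>SM lam r U\<^esub> m \<oplus>\<^bsub>SM lam r U\<^esub> P \<odot>\<^bsub>SM lam r U\<^esub> n"
    unfolding Model_simps
    by (rule restrict_ext) (simp add: tdo_apply_sadd[OF U P opens_self[OF U] CN_mem[OF m] CN_mem[OF n]])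
next
  fix m assume m: "m \<in> CN lam r U"
  show "\<one>\<^bsub>tdo lam U\<^esub> \<odot>\<^bsub>SM lam r U\<^esub> m = m"
  proof (rule CN_eqI[OF _ m])
    show "\<one>\<^bsub>tdo lam U\<^esub> \<odot>\<^bsub>SM lam r U\<^esub> m \<in> CN lam r U"
      unfolding Model_simps(4)
      by (rule CN_I) (simp add: tdo_simps(4)[OF opens_self[OF U] CN_mem[OF m]] CN_mem[OF m])
    show "(\<one>\<^bsub>tdo lam U\<^esub> \<odot>\<^bsub>SM lam r U\<^esub> m) i = m i" if "i < r" for i
      using that by (simp add: Model_simps(4) tdo_simps(4)[OF opens_self[OF U] CN_mem[OF m]])
  qed
qed

lemma Model_presheaf: "D_presheaf lam (Model lam r)"
  unfolding D_presheaf_def tdo_simps(1)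
proof (intro conjI ballI)
  fix U assume "U \<in> opens UNIV"
  then have U: "zariski_open U" by (simp add: opens_UNIV)
  show "left_module (tdo lam U) (SM lam r U)" by (rule Model_left_module[OF U])
  show "RM lam r U U m = m" if m: "m \<in> CN lam r U" for m
  proof (rule CN_eqI[OF Model_res_closed[OF U opens_self[OF U] m] m])
    show "RM lam r U U m i = m i" if "i < r" for i
      using that sres_id[OF U CN_mem[OF m]] by (simp add: Model_simps(5))
  qed
  fix V assume V: "V \<in> opens U"
  show "RM lam r U V \<in> CN lam r U \<rightarrow> CN lam r V" using Model_res_closed[OF U V] by blast
  show "RM lam r U V (m \<oplus>\<^bsub>SM lam r U\<^esub> n) =
     RM lam r U V m \<oplus>\<^bsub>SM lam r V\<^esub> RM lam r U V n" for m n
    unfolding Model_simps by (rule restrict_ext) (simp add: sres_sadd)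
  show "RM lam r U V (P \<odot>\<^bsub>SM lam r U\<^esub> m) =
     tdo_res V P \<odot>\<^bsub>SM lam r V\<^esub> RM lam r U V m"
    if P: "P \<in> tdo_carrier lam U" and m: "m \<in> CN lam r U" for P m
    unfolding Model_simps
    by (rule restrict_ext) (simp add: tdo_apply_sres[OF U P opens_self[OF U] V CN_mem[OF m]] opens_self[OF opens_D(1)[OF V]])
  show "RM lam r V W (RM lam r U V m) = RM lam r U W m" if "W \<in> opens V" for W m
    unfolding Model_simps by (rule restrict_ext) (simp add: sres_sres[OF opens_D(2)[OF that]])
qed

text \<open>\<open>regular_on\<close> tests a quotient wherever its denominator is nonzero;
  multiplying both polynomials by one that vanishes exactly off \<open>T\<close> restricts this test
  to \<open>T\<close>.\<close>

lemma local_rat: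
  assumes S: "cof S" and zero: "\<And>z. z \<notin> S \<Longrightarrow> f z = 0"
    and loc: "\<And>z. z \<in> S \<Longrightarrow> \<exists>T. z \<in> T \<and> cof T \<and> T \<subseteq> S \<and> rat T f"
  shows "rat S f"
proof (rule regular_on_rat[OF S])
  show "regular_on S f"
    unfolding regular_on_def
  proof (intro conjI ballI allI impI)
    fix z assume "z \<in> S"
    then obtain T where T: "z \<in> T" "cof T" "T \<subseteq> S" "rat T f" using loc by blast
    obtain p q where pq: "\<And>y. y \<in> T \<Longrightarrow> poly q y \<noteq> 0 \<and> f y = poly p y / poly q y" using T(4) unfolding rat_def by blast
    have fin: "finite (- T)" using T(1,2) by (auto simp: cof_def)
    define h where "h = (\<Prod>a\<in>- T. [:- a, 1 :: complex:])"
    have h: "poly h y \<noteq> 0 \<longleftrightarrow> y \<in> T" for y unfolding h_def using fin by (simp add: poly_prod prod_zero_iff)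
    show "\<exists>p q. poly q z \<noteq> 0 \<and> (\<forall>y\<in>S. poly q y \<noteq> 0 \<longrightarrow> f y = poly p y / poly q y)"
    proof (rule exI[of _ "p * h"], rule exI[of _ "q * h"], intro conjI ballI impI)
      show "poly (q * h) z \<noteq> 0" using pq[OF T(1)] h T(1) by simp
      fix y assume "poly (q * h) y \<noteq> 0"
      then have "poly h y \<noteq> 0" by auto
      then show "f y = poly (p * h) y / poly (q * h) y" using pq[of y] h[of y] by simp
    qed
  qed (rule zero)
qed

lemma Model_sheaf: "sheaf_condition (Model lam r)"
  unfolding sheaf_condition_def
proof (intro allI impI, elim conjE)
  fix \<V> s assume \<V>: "\<V> \<subseteq> opens UNIV" and s: "\<forall>V\<in>\<V>. s V \<in> CN lam r V"
    and ov: "\<forall>V\<in>\<V>. \<forall>W\<in>\<V>. RM lam r V (V \<inter> W) (s V) = RM lam r W (V \<inter> W) (s W)"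
  have op: "zariski_open V" if "V \<in> \<V>" for V using \<V> that by (auto simp: opens_UNIV)
  have U: "zariski_open (\<Union>\<V>)" by (rule zariski_open_Union[OF \<V>])
  have agree: "sel c (s V i) z = sel c (s W i) z"
    if VW: "V \<in> \<V>" "W \<in> \<V>" and i: "i < r" and z: "z \<in> part c V" "z \<in> part c W" for V W i c z
  proof -
    have "RM lam r V (V \<inter> W) (s V) = RM lam r W (V \<inter> W) (s W)" using ov VW by blast
    from fun_cong[OF this, of i] have "sres (V \<inter> W) (s V i) = sres (V \<inter> W) (s W i)" using i by (simp add: Model_simps(5))
    from arg_cong[OF this, of "\<lambda>x. sel c x z"] show ?thesis using z by simp
  qed
  \<comment> \<open>Glued pointwise: by \<open>agree\<close>, any member of the cover containing the
    point may be chosen.\<close>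
  define m where "m = (\<lambda>i\<in>{..<r}. mk_sec (\<lambda>c z. if \<exists>V\<in>\<V>. z \<in> part c V then
      sel c (s (SOME V. V \<in> \<V> \<and> z \<in> part c V) i) z else 0))"
  have sel_m: "sel c (m i) z = sel c (s V i) z" if V: "V \<in> \<V>" and i: "i < r" and z: "z \<in> part c V" for V i c z
  proof -
    have "(SOME V. V \<in> \<V> \<and> z \<in> part c V) \<in> \<V> \<and> z \<in> part c (SOME V. V \<in> \<V> \<and> z \<in> part c V)"
      by (rule someI[of _ V]) (simp add: V z)
    then have "sel c (s (SOME V. V \<in> \<V> \<and> z \<in> part c V) i) z = sel c (s V i) z"
      using agree[OF _ V i _ z] by blast
    moreover have "\<exists>V\<in>\<V>. z \<in> part c V" using V z by blast
    ultimately show ?thesis using i by (simp add: m_def)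
  qed
  have mem_Un: "z \<in> part c (\<Union>\<V>) \<longleftrightarrow> (\<exists>V\<in>\<V>. z \<in> part c V)" for c z by (auto simp: mem_part)
  have sV: "s V i \<in> lb lam V" if "V \<in> \<V>" "i < r" for V i using s that CN_mem by blast
  have mi: "m i \<in> lb lam (\<Union>\<V>)" if i: "i < r" for i
  proof (rule line_bundleI[OF U])
    fix c
    show z0: "z \<notin> part c (\<Union>\<V>) \<Longrightarrow> sel c (m i) z = 0" for z unfolding mem_Un using i by (simp add: m_def)
    show "rat (part c (\<Union>\<V>)) (sel c (m i))"
    proof (rule local_rat[OF cof_part[OF U] z0])
      fix z assume "z \<in> part c (\<Union>\<V>)"
      then obtain V where V: "V \<in> \<V>" "z \<in> part c V" unfolding mem_Un by blast
      have "rat (part c V) (sel c (m i))"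
        using line_bundle_rat[OF op[OF V(1)] sV[OF V(1) i], of c] sel_m[OF V(1) i]
        by (subst rat_cong[of _ _ "sel c (s V i)"]) auto
      moreover have "part c V \<subseteq> part c (\<Union>\<V>)" using V(1) by (intro part_mono) auto
      ultimately show "\<exists>T. z \<in> T \<and> cof T \<and> T \<subseteq> part c (\<Union>\<V>) \<and> rat T (sel c (m i))"
        using V cof_part[OF op[OF V(1)]] by blast
    qed
    fix z assume z: "z \<in> part c (\<Union>\<V>)" "z \<noteq> 0"
    then obtain V where V: "V \<in> \<V>" "z \<in> part c V" unfolding mem_Un by blast
    show "sel c (m i) z = z powi (lam - 1) * sel (\<not> c) (m i) (inverse z)"
      unfolding sel_m[OF V(1) i V(2)] sel_m[OF V(1) i inverse_in_part[OF V(2) z(2)]]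
      by (rule line_bundle_trans[OF op[OF V(1)] sV[OF V(1) i] V(2) z(2)])
  qed
  have "(\<lambda>i\<in>{..<r}. m i) = m" by (rule ext) (simp add: m_def)
  then have mC: "m \<in> CN lam r (\<Union>\<V>)" using CN_I[of r m lam "\<Union>\<V>", OF mi] by simp
  have sub: "V \<in> opens (\<Union>\<V>)" if "V \<in> \<V>" for V using op[OF that] that by (auto simp: opens_def)
  show "\<exists>!m. m \<in> CN lam r (\<Union>\<V>) \<and> (\<forall>V\<in>\<V>. RM lam r (\<Union>\<V>) V m = s V)"
  proof (rule ex1I[of _ m])
    show "m \<in> CN lam r (\<Union>\<V>) \<and> (\<forall>V\<in>\<V>. RM lam r (\<Union>\<V>) V m = s V)"
    proof (intro conjI ballI mC)
      fix V assume V: "V \<in> \<V>"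
      show "RM lam r (\<Union>\<V>) V m = s V"
      proof (rule CN_eqI[OF Model_res_closed[OF U sub[OF V] mC]])
        show "s V \<in> CN lam r V" using s V by blast
        fix i assume i: "i < r"
        have "sres V (m i) = s V i"
          by (rule sel_eqI) (simp add: sel_m[OF V i] line_bundle_zero[OF op[OF V] sV[OF V i]])
        then show "RM lam r (\<Union>\<V>) V m i = s V i" using i by (simp add: Model_simps(5))
      qed
    qed
    fix m' assume "m' \<in> CN lam r (\<Union>\<V>) \<and> (\<forall>V\<in>\<V>. RM lam r (\<Union>\<V>) V m' = s V)"
    then have m': "m' \<in> CN lam r (\<Union>\<V>)" "\<And>V. V \<in> \<V> \<Longrightarrow> RM lam r (\<Union>\<V>) V m' = s V" by auto
    show "m' = m"
    proof (rule CN_eqI[OF m'(1) mC])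
      fix i assume i: "i < r"
      show "m' i = m i"
      proof (rule line_bundle_eqI[OF U CN_mem[OF m'(1) i] mi[OF i]])
        fix c z assume "z \<in> part c (\<Union>\<V>)"
        then obtain V where V: "V \<in> \<V>" "z \<in> part c V" unfolding mem_Un by blast
        have "sres V (m' i) = s V i" using fun_cong[OF m'(2)[OF V(1)], of i] i by (simp add: Model_simps(5))
        from arg_cong[OF this, of "\<lambda>x. sel c x z"] show "sel c (m' i) z = sel c (m i) z"
          using V(2) sel_m[OF V(1) i V(2)] by simp
      qed
    qed
  qed
qed

text \<open>A regular function that is nonzero somewhere has finitely many zeros in each chart,
  provided that both numerators are nonzero polynomials. The chart of the given point settles one;
  it yields infinitely many points where \<open>h\<close> is nonzero, and these are visible in the
  other chart too.\<close>

lemma nonvanishing_open: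
  assumes U: "zariski_open U" and h: "hreg U h"
  shows "zariski_open {p \<in> U. h p \<noteq> 0}"
proof (cases "{p \<in> U. h p \<noteq> 0} = {}")
  case False
  then obtain p0 where p0: "p0 \<in> U" "h p0 \<noteq> 0" by blast
  have finU: "finite (- U)" using U p0(1) by (auto simp: zariski_open_def)
  have "\<exists>P Q. \<forall>z\<in>part c U. poly Q z \<noteq> 0 \<and> h (chart c z) = poly P z / poly Q z" for c
    using h unfolding hreg_def rat_def by blast
  then obtain P Q where PQ: "\<And>c z. z \<in> part c U \<Longrightarrow> poly (Q c) z \<noteq> 0 \<and> h (chart c z) = poly (P c) z / poly (Q c) z"
    by metis
  obtain c0 z0 where "p0 = chart c0 z0" by (rule chart_surj)
  then have nz0: "P c0 \<noteq> 0" using PQ[of z0 c0] p0 by (auto simp: mem_part)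
  have "P (\<not> c0) \<noteq> 0"
  proof
    assume z: "P (\<not> c0) = 0"
    have "infinite (part c0 U)" by (rule infinite_part[OF U]) (use p0 in auto)
    moreover have "finite (insert 0 {z. poly (P c0) z = 0})" using poly_roots_finite[OF nz0] by simp
    ultimately have "infinite (part c0 U - insert 0 {z. poly (P c0) z = 0})" by (metis Diff_infinite_finite)
    then obtain z where z1: "z \<in> part c0 U" "z \<noteq> 0" "poly (P c0) z \<noteq> 0" using infinite_imp_nonempty by blast
    have "h (chart c0 z) \<noteq> 0" using PQ[OF z1(1)] z1(3) by simp
    moreover have "h (chart (\<not> c0) (inverse z)) = 0" using PQ[OF inverse_in_part[OF z1(1,2)]] z by simp
    ultimately show False using chart_inverse[OF z1(2), of c0] by simp
  qed
  then have nz: "P c \<noteq> 0" for c using nz0 by (cases "c = c0") auto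
  have "- {p \<in> U. h p \<noteq> 0} \<subseteq> - U \<union> (\<Union>c. chart c ` {z. poly (P c) z = 0})"
  proof
    fix p assume p: "p \<in> - {p \<in> U. h p \<noteq> 0}"
    obtain c z where "p = chart c z" by (rule chart_surj)
    then show "p \<in> - U \<union> (\<Union>c. chart c ` {z. poly (P c) z = 0})" using p PQ[of z c] by (auto simp: mem_part)
  qed
  moreover have "finite (- U \<union> (\<Union>c. chart c ` {z. poly (P c) z = 0}))"
    using finU poly_roots_finite[OF nz] by simp
  ultimately show ?thesis unfolding zariski_open_def using finite_subset by blast
next
  case True
  then show ?thesis by (simp only: zariski_open_empty)
qed

text \<open>On \<open>S\<close> the denominator \<open>q\<close> vanishes only where
  \<open>h\<close> does, with multiplicity at most \<open>degree q\<close>, so \<open>h^k\<close>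
  absorbs the pole. The convention that \<open>f\<close> is 0 where \<open>h\<close> is 0 is
  respected because at least one factor is left over.\<close>

lemma rat_extend_zero:
  assumes S: "cof S" and h: "rat S h"
    and f: "\<And>z. z \<in> S \<Longrightarrow> h z \<noteq> 0 \<Longrightarrow> poly q z \<noteq> 0 \<and> f z = poly p z / poly q z"
    and f0: "\<And>z. z \<notin> S \<or> h z = 0 \<Longrightarrow> f z = 0" and k: "degree q < k"
  shows "rat S (\<lambda>z. h z ^ k * f z)"
proof (cases "q = 0")
  case True
  then have "f z = 0" for z using f f0 by (cases "z \<in> S \<and> h z \<noteq> 0") auto
  then show ?thesis by (simp add: rat_const)
next
  case False
  obtain a b where ab: "\<And>z. z \<in> S \<Longrightarrow> poly b z \<noteq> 0 \<and> h z = poly a z / poly b z" using h unfolding rat_def by blast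
  show ?thesis
  proof (rule regular_on_rat[OF S], unfold regular_on_def, intro conjI allI impI ballI)
    fix z assume "z \<notin> S" then show "h z ^ k * f z = 0" using f0 by simp
  next
    fix z0 assume z0: "z0 \<in> S"
    show "\<exists>p q. poly q z0 \<noteq> 0 \<and> (\<forall>y\<in>S. poly q y \<noteq> 0 \<longrightarrow> h y ^ k * f y = poly p y / poly q y)"
    proof (cases "h z0 = 0")
      case False
      show ?thesis
      proof (rule exI[of _ "a ^ k * p"], rule exI[of _ "b ^ k * q"], intro conjI ballI impI)
        show "poly (b ^ k * q) z0 \<noteq> 0" using f[OF z0 False] ab[OF z0] by simp
        fix y assume y: "y \<in> S"
        show "h y ^ k * f y = poly (a ^ k * p) y / poly (b ^ k * q) y"
        proof (cases "h y = 0")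
          case True
          then have "poly a y = 0" using ab[OF y] by simp
          then show ?thesis using True f0[of y] k by simp
        next
          case False
          then show ?thesis using f[OF y False] ab[OF y] by (simp add: power_divide)
        qed
      qed
    next
      case True
      then have "poly a z0 = 0" using ab[OF z0] by simp
      then obtain a1 where a1: "a = [:- z0, 1:] * a1" by (metis dvdE poly_eq_0_iff_dvd)
      define j where "j = order z0 q"
      obtain q1 where q1: "q = [:- z0, 1:] ^ j * q1" "\<not> [:- z0, 1:] dvd q1"
        using order_decomp[OF False, of z0] by (auto simp: j_def)
      have q1z: "poly q1 z0 \<noteq> 0" using q1(2) by (simp add: poly_eq_0_iff_dvd)
      \<comment> \<open>Strictness matters: the left side is 0 at \<open>z0\<close>, so a factor
        \<open>X - z0\<close> has to remain in the numerator.\<close>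
      have jk: "j < k" using order_degree[OF False, of z0] k by (simp add: j_def)
      show ?thesis
      proof (rule exI[of _ "[:- z0, 1:] ^ (k - j) * a1 ^ k * p"], rule exI[of _ "b ^ k * q1"], intro conjI ballI impI)
        show "poly (b ^ k * q1) z0 \<noteq> 0" using q1z ab[OF z0] by simp
        fix y assume y: "y \<in> S" and q1y: "poly (b ^ k * q1) y \<noteq> 0"
        have ay: "poly a y = (y - z0) * poly a1 y" unfolding a1 by (simp add: algebra_simps)
        show "h y ^ k * f y = poly ([:- z0, 1:] ^ (k - j) * a1 ^ k * p) y / poly (b ^ k * q1) y"
        proof (cases "h y = 0")
          case True
          then have "poly a y = 0" using ab[OF y] by simp
          then have "y = z0 \<or> poly a1 y = 0" unfolding ay by simp
          then show ?thesis using True f0[of y] jk by (auto simp: poly_power)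
        next
          case False
          then have nz: "poly a y \<noteq> 0" using ab[OF y] by auto
          then have yz: "y - z0 \<noteq> 0" using ay by auto
          have qy: "poly q y = (y - z0) ^ j * poly q1 y" unfolding q1(1) by (simp add: poly_power)
          have "h y ^ k * f y = ((y - z0) ^ k * poly a1 y ^ k * poly p y) / (poly b y ^ k * ((y - z0) ^ j * poly q1 y))"
            using f[OF y False] ab[OF y] by (simp add: power_divide ay qy power_mult_distrib)
          also have "(y - z0) ^ k = (y - z0) ^ j * (y - z0) ^ (k - j)" using jk by (simp add: power_add[symmetric])
          finally show ?thesis using yz by (simp add: poly_power field_simps)
        qed
      qed
    qed
  qed
qed

lemma Model_associated:
  assumes U: "zariski_open U" shows "associated_on lam (Model lam r) U"
  unfolding associated_on_def Let_def
proof (intro ballI conjI impI)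
  fix h assume "h \<in> str_sheaf U"
  then have h: "hreg U h" "\<And>p. p \<notin> U \<Longrightarrow> h p = 0" by (auto simp: str_sheaf_iff[OF U])
  let ?V = "{p \<in> U. h p \<noteq> 0}"
  have V: "zariski_open ?V" by (rule nonvanishing_open[OF U h(1)])
  {
    fix m assume m: "m \<in> CN lam r U" and z: "RM lam r U ?V m = \<zero>\<^bsub>SM lam r ?V\<^esub>"
    \<comment> \<open>Exponent 1 is enough: off the locus \<open>h\<close> vanishes, and on it
      \<open>m i\<close> does.\<close>
    have "hmul (\<lambda>p. h p ^ 1) (m i) = szero" if i: "i < r" for i
    proof (rule sel_eqI)
      fix c x
      have "sres ?V (m i) = szero" using fun_cong[OF z, of i] i by (simp add: Model_simps)
      from arg_cong[OF this, of "\<lambda>y. sel c y x"] have "x \<in> part c ?V \<Longrightarrow> sel c (m i) x = 0" by simp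
      then show "sel c (hmul (\<lambda>p. h p ^ 1) (m i)) x = sel c szero x"
        using h(2)[of "chart c x"] by (auto simp: mem_part)
    qed
    then have "mulop lam U (\<lambda>p. h p ^ 1) \<odot>\<^bsub>SM lam r U\<^esub> m = \<zero>\<^bsub>SM lam r U\<^esub>"
      unfolding Model_simps using mulop_apply[OF opens_self[OF U] CN_mem[OF m]] by (intro restrict_ext) simp
    then show "\<exists>k. mulop lam U (\<lambda>p. h p ^ k) \<odot>\<^bsub>SM lam r U\<^esub> m = \<zero>\<^bsub>SM lam r U\<^esub>" by blast
  }
  fix t assume t: "t \<in> CN lam r ?V"
  define R where "R = (\<lambda>c i p q. \<forall>z\<in>part c ?V. poly q z \<noteq> 0 \<and> sel c (t i) z = poly p z / poly q z)"
  have "\<exists>p q. R c i p q" if "i < r" for c i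
    using line_bundle_rat[OF V CN_mem[OF t that], of c] unfolding rat_def R_def .
  then have "\<forall>c i. \<exists>p q. i < r \<longrightarrow> R c i p q" by blast
  then obtain p q where R: "\<And>c i. i < r \<Longrightarrow> R c i (p c i) (q c i)" by metis
  have pq: "poly (q c i) z \<noteq> 0 \<and> sel c (t i) z = poly (p c i) z / poly (q c i) z"
    if i: "i < r" and z: "z \<in> part c ?V" for c i z
    using R[OF i, of c] z unfolding R_def by (rule bspec)
  \<comment> \<open>One exponent exceeding the denominator degrees of all components in both charts,
    as \<open>rat_extend_zero\<close> asks.\<close>
  define k where "k = Suc (\<Sum>i<r. degree (q True i) + degree (q False i))"
  have dk: "degree (q c i) < k" if "i < r" for c i
  proof -
    have "degree (q c i) \<le> degree (q True i) + degree (q False i)" by (cases c) auto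
    also have "\<dots> \<le> (\<Sum>i<r. degree (q True i) + degree (q False i))"
      using that by (intro member_le_sum[of i "{..<r}" "\<lambda>i. degree (q True i) + degree (q False i)"]) auto
    finally show ?thesis by (simp add: k_def)
  qed
  let ?m = "\<lambda>i. hmul (\<lambda>p. h p ^ k) (t i)"
  have mi: "?m i \<in> lb lam U" if i: "i < r" for i
  proof (rule line_bundleI[OF U])
    have t0: "sel c (t i) z = 0" if "z \<notin> part c U \<or> h (chart c z) = 0" for c z
      by (rule line_bundle_zero[OF V CN_mem[OF t i]]) (use that in \<open>auto simp: mem_part\<close>)
    fix c
    have "rat (part c U) (\<lambda>z. h (chart c z) ^ k * sel c (t i) z)"
    proof (rule rat_extend_zero[OF cof_part[OF U] _ _ t0 dk[OF i]])
      show "rat (part c U) (\<lambda>z. h (chart c z))" using h(1) by (simp add: hreg_def)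
      fix z assume "z \<in> part c U" "h (chart c z) \<noteq> 0"
      then have "z \<in> part c ?V" by (simp add: mem_part)
      then show "poly (q c i) z \<noteq> 0 \<and> sel c (t i) z = poly (p c i) z / poly (q c i) z" by (rule pq[OF i])
    qed
    then show "rat (part c U) (sel c (?m i))" by (simp add: hmul_def)
    fix z
    show "z \<notin> part c U \<Longrightarrow> sel c (?m i) z = 0" using t0 by simp
    assume z: "z \<in> part c U" "z \<noteq> 0"
    show "sel c (?m i) z = z powi (lam - 1) * sel (\<not> c) (?m i) (inverse z)"
    proof (cases "z \<in> part c ?V")
      case True
      then show ?thesis using line_bundle_trans[OF V CN_mem[OF t i] True z(2)] by (simp add: chart_inverse[OF z(2)])
    next
      case False
      then have "h (chart c z) = 0" using z by (simp add: mem_part)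
      then show ?thesis by (simp add: chart_inverse[OF z(2)] k_def)
    qed
  qed
  show "\<exists>k. \<exists>m\<in>CN lam r U. RM lam r U ?V m = mulop lam ?V (\<lambda>p. h p ^ k) \<odot>\<^bsub>SM lam r ?V\<^esub> t"
  proof (intro exI[of _ k] bexI[of _ "\<lambda>i\<in>{..<r}. ?m i"])
    show "(\<lambda>i\<in>{..<r}. ?m i) \<in> CN lam r U" by (rule CN_I[OF mi])
    have "sres ?V (?m i) = ?m i" if i: "i < r" for i
      by (rule sel_eqI) (simp add: line_bundle_zero[OF V CN_mem[OF t i]])
    then show "RM lam r U ?V (\<lambda>i\<in>{..<r}. ?m i) =
        mulop lam ?V (\<lambda>p. h p ^ k) \<odot>\<^bsub>SM lam r ?V\<^esub> t"
      unfolding Model_simps using mulop_apply[OF opens_self[OF V] CN_mem[OF t]] by (intro restrict_ext) simp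
  qed
qed

text \<open>The power \<open>lam - 1\<close> of the linear form that vanishes only at a point
  \<open>a\<close> outside \<open>U\<close>; \<open>b\<close> is this form in the two charts.
  Affineness of \<open>U\<close> provides \<open>a\<close>, positivity of \<open>lam\<close> makes
  the exponent a natural number.\<close>

lemma ex_nonvanishing_section:
  assumes "lam > 0" "affine_open U"
  shows "\<exists>g\<in>lb lam U. \<forall>c. \<forall>z\<in>part c U. sel c g z \<noteq> 0"
proof -
  have U: "zariski_open U" "U \<noteq> UNIV" using assms(2) by (auto simp: affine_open_def)
  then obtain a where a: "a \<notin> U" by blast
  obtain c0 z0 where a0: "a = chart c0 z0" by (rule chart_surj)
  define n where "n = nat (lam - 1)"
  define b where "b = (\<lambda>d z. if d = c0 then z - z0 else 1 - z0 * z)"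
  define g where "g = mk_sec (\<lambda>d z. if z \<in> part d U then b d z ^ n else 0)"
  have pw: "z powi (lam - 1) = z ^ n" for z :: complex using assms(1) by (simp add: n_def power_int_def)
  have "g \<in> lb lam U"
  proof (rule line_bundleI[OF U(1)])
    fix c z
    have "rat (part c U) (\<lambda>z. b c z ^ n)"
      unfolding b_def by (intro rat_power) (cases "c = c0"; simp; intro rat_diff rat_mult rat_id rat_const)
    then show "rat (part c U) (sel c g)" by (subst rat_cong[of _ _ "\<lambda>z. b c z ^ n"]) (auto simp: g_def)
    show "z \<notin> part c U \<Longrightarrow> sel c g z = 0" by (simp add: g_def)
    assume z: "z \<in> part c U" "z \<noteq> 0"
    have "b c z = z * b (\<not> c) (inverse z)" using z(2) by (auto simp: b_def field_simps)
    then show "sel c g z = z powi (lam - 1) * sel (\<not> c) g (inverse z)"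
      using z inverse_in_part[OF z] by (simp add: g_def pw power_mult_distrib)
  qed
  moreover have "sel c g z \<noteq> 0" if z: "z \<in> part c U" for c z
  proof -
    have "b c z \<noteq> 0"
    proof
      assume b0: "b c z = 0"
      show False
      proof (cases "c = c0")
        case True
        then show False using b0 z a a0 by (simp add: b_def mem_part)
      next
        case False
        then have e: "z0 * z = 1" using b0 by (simp add: b_def)
        then have "z \<noteq> 0" by auto
        moreover have "inverse z = z0" using e by (intro inverse_unique) (simp add: mult.commute)
        moreover have "(\<not> c) = c0" using False by auto
        ultimately show False using chart_inverse[of z c] z a a0 by (simp add: mem_part)
      qed
    qed
    then show ?thesis using z by (simp add: g_def)
  qed
  ultimately show ?thesis by blast
qed

lemma Model_finitely_generated:
  assumes "lam > 0" "affine_open U" shows "finitely_generated_on lam (Model lam r) U"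
proof -
  have U: "zariski_open U" using assms(2) by (auto simp: affine_open_def)
  interpret A: abelian_group "SM lam r U" by (rule Model_abelian[OF U])
  obtain g where g: "g \<in> lb lam U" "\<And>c z. z \<in> part c U \<Longrightarrow> sel c g z \<noteq> 0"
    using ex_nonvanishing_section[OF assms] by blast
  define e where "e = (\<lambda>i. \<lambda>j\<in>{..<r}. if j = i then g else szero)"
  have e: "e i \<in> CN lam r U" for i unfolding e_def by (rule CN_I) (auto intro: g(1) szero_closed[OF U])
  show ?thesis
  \<comment> \<open>Over the empty set all sections coincide and the family \<open>e\<close> need
    not be injective; that case is settled with no generators.\<close>
  proof (cases "U = {}")
    case True
    have "m = finsum (SM lam r U) (\<lambda>b. mulop lam U ((\<lambda>_ _. 0) b) \<odot>\<^bsub>SM lam r U\<^esub> b) {}"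
      if m: "m \<in> CN lam r U" for m
    proof (simp, rule CN_eqI[OF m A.zero_closed])
      fix i assume i: "i < r"
      have "m i = szero" by (rule line_bundle_eqI[OF U CN_mem[OF m i] szero_closed[OF U]]) (simp add: True)
      then show "m i = \<zero>\<^bsub>SM lam r U\<^esub> i" using i by (simp add: Model_simps)
    qed
    then show ?thesis unfolding finitely_generated_on_def by (intro exI[of _ "{}"]) auto
  next
    case False
    have inj: "inj_on e {..<r}"
    proof (rule inj_onI)
      fix i j assume ij: "i \<in> {..<r}" "j \<in> {..<r}" "e i = e j"
      obtain z where z: "z \<in> part False U" using infinite_part[OF U False, of False] infinite_imp_nonempty by blast
      show "i = j"
      proof (rule ccontr)
        assume "i \<noteq> j"
        then have "g = szero" using fun_cong[OF ij(3), of i] ij by (simp add: e_def)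
        then show False using g(2)[OF z] by simp
      qed
    qed
    show ?thesis
      unfolding finitely_generated_on_def
    proof (intro exI[of _ "e ` {..<r}"] conjI ballI)
      show "e ` {..<r} \<subseteq> CN lam r U" using e by auto
      fix m assume m: "m \<in> CN lam r U"
      let ?t = "\<lambda>i. \<lambda>j\<in>{..<r}. if j = i then m i else szero"
      \<comment> \<open>The coordinate of \<open>m\<close> relative to \<open>g\<close> as a
        function on the line: the quotient of the chart functions does not depend on the chart, and
        only the point at infinity has to be read in the second one.\<close>
      define H where "H = (\<lambda>i p. if p \<in> U then (if p \<in> Uc False then
          sel False (m i) (coord False p) / sel False g (coord False p) else sel True (m i) 0 / sel True g 0) else 0)"
      have Hc: "H i (chart c z) = sel c (m i) z / sel c g z" if i: "i < r" and z: "z \<in> part c U" for i c z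
      proof (cases c)
        case True
        show ?thesis
        proof (cases "z = 0")
          case z0: True
          have "chart True 0 \<notin> Uc False" by (simp add: Uc_eq)
          then show ?thesis using z True z0 by (simp add: H_def mem_part)
        next
          case nz: False
          have inU: "inverse z \<in> part False U" using inverse_in_part[OF z nz] True by simp
          have ch: "chart True z = chart False (inverse z)" using chart_inverse[OF nz, of True] by simp
          have "sel True (m i) z / sel True g z = sel False (m i) (inverse z) / sel False g (inverse z)"
            using line_bundle_trans[OF U CN_mem[OF m i] z nz] line_bundle_trans[OF U g(1) z nz] True nz by simp
          then show ?thesis using True inU by (simp add: H_def ch mem_part)
        qed
      next
        case False
        then show ?thesis using z by (simp add: H_def mem_part)
      qed
      have Hs: "H i \<in> str_sheaf U" if i: "i < r" for i
        unfolding str_sheaf_iff[OF U] hreg_def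
      proof (intro conjI allI impI)
        fix c
        have "rat (part c U) (\<lambda>z. sel c (m i) z / sel c g z)"
          by (intro rat_divide line_bundle_rat[OF U CN_mem[OF m i]] line_bundle_rat[OF U g(1)] g(2))
        then show "rat (part c U) (\<lambda>z. H i (chart c z))" using Hc[OF i] by (subst rat_cong) auto
      qed (simp add: H_def)
      have Hg: "hmul (H i) g = m i" if i: "i < r" for i
      proof (rule sel_eqI)
        fix c z
        show "sel c (hmul (H i) g) z = sel c (m i) z"
        proof (cases "z \<in> part c U")
          case True
          then show ?thesis using Hc[OF i True] g(2)[OF True] by simp
        qed (simp add: line_bundle_zero[OF U g(1)] line_bundle_zero[OF U CN_mem[OF m i]])
      qed
      define h where "h = (\<lambda>b. H (the_inv_into {..<r} e b))"
      have he: "h (e i) = H i" if "i < r" for i using that by (simp add: h_def the_inv_into_f_f[OF inj])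
      have tm: "mulop lam U (h (e i)) \<odot>\<^bsub>SM lam r U\<^esub> e i = ?t i"
        if i: "i < r" for i
      proof -
        have "hmul (H i) szero = szero" by (rule sel_eqI) simp
        then show ?thesis
          unfolding Model_simps he[OF i] using mulop_apply[OF opens_self[OF U] CN_mem[OF e]] Hg[OF i]
          by (intro restrict_ext) (simp add: e_def)
      qed
      have tc: "?t i \<in> CN lam r U" if "i < r" for i
        by (rule CN_I) (auto intro: CN_mem[OF m that] szero_closed[OF U])
      have part_sum: "finsum (SM lam r U) ?t {..<l} =
          (\<lambda>j\<in>{..<r}. if j < l then m j else szero)" if "l \<le> r" for l
        using that
      proof (induction l)
        case 0
        show ?case by (simp add: Model_simps)
      next
        case (Suc l)
        have f: "?t \<in> {..<l} \<rightarrow> CN lam r U" using tc Suc.prems by auto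
        have "finsum (SM lam r U) ?t {..<Suc l} =
           ?t l \<oplus>\<^bsub>SM lam r U\<^esub>
           finsum (SM lam r U) ?t {..<l}"
          unfolding lessThan_Suc by (rule A.finsum_insert[OF finite_lessThan _ f tc]) (use Suc.prems in auto)
        also have "\<dots> = ?t l \<oplus>\<^bsub>SM lam r U\<^esub> (\<lambda>j\<in>{..<r}. if j < l then m j else szero)"
          by (simp only: Suc.IH[OF Suc_leD[OF Suc.prems]])
        also have "\<dots> = (\<lambda>j\<in>{..<r}. if j < Suc l then m j else szero)"
          unfolding Model_simps by (rule restrict_ext) (auto simp: less_Suc_eq intro!: sel_eqI)
        finally show ?case .
      qed
      have "finsum (SM lam r U) (\<lambda>b. mulop lam U (h b) \<odot>\<^bsub>SM lam r U\<^esub> b) (e ` {..<r}) =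
          finsum (SM lam r U) (\<lambda>i. mulop lam U (h (e i)) \<odot>\<^bsub>SM lam r U\<^esub> e i) {..<r}"
        by (rule A.finsum_reindex[OF _ inj]) (use tm tc in auto)
      also have "\<dots> = finsum (SM lam r U) ?t {..<r}"
        by (rule A.finsum_cong'[OF HOL.refl]) (use tm tc in auto)
      also have "\<dots> = m"
        unfolding part_sum[OF order_refl]
        by (rule CN_eqI[OF _ m]) (auto intro!: CN_I CN_mem[OF m] szero_closed[OF U])
      finally have "m = finsum (SM lam r U) (\<lambda>b. mulop lam U (h b) \<odot>\<^bsub>SM lam r U\<^esub> b) (e ` {..<r})" by simp
      moreover have "\<forall>b\<in>e ` {..<r}. h b \<in> str_sheaf U" using he Hs by auto
      ultimately show "\<exists>h. (\<forall>b\<in>e ` {..<r}. h b \<in> str_sheaf U) \<and>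
          m = finsum (SM lam r U) (\<lambda>b. mulop lam U (h b) \<odot>\<^bsub>SM lam r U\<^esub> b) (e ` {..<r})" by blast
    qed simp
  qed
qed

subsection \<open>Transport of structure\<close>

text \<open>Only \<open>N\<close> is assumed to be a presheaf of modules; the axioms for
  \<open>M\<close> are carried over along the bijections. \<open>f_zero\<close> is a separate
  assumption since \<open>M\<close> is not known in advance to be a group.\<close>

locale dmod_iso =
  fixes lam :: int and N :: "'w dmod" and M :: "'v dmod" and f :: "p1 set \<Rightarrow> 'w \<Rightarrow> 'v"
  assumes pre: "D_presheaf lam N"
    and bij: "\<And>U. zariski_open U \<Longrightarrow> bij_betw (f U) (carrier (secs N U)) (carrier (secs M U))"
    and f_add: "\<And>U m n. \<lbrakk>zariski_open U; m \<in> carrier (secs N U); n \<in> carrier (secs N U)\<rbrakk> \<Longrightarrow>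
      f U (m \<oplus>\<^bsub>secs N U\<^esub> n) = f U m \<oplus>\<^bsub>secs M U\<^esub> f U n"
    and f_zero: "\<And>U. zariski_open U \<Longrightarrow> f U \<zero>\<^bsub>secs N U\<^esub> = \<zero>\<^bsub>secs M U\<^esub>"
    and f_smul: "\<And>U P m. \<lbrakk>zariski_open U; P \<in> tdo_carrier lam U; m \<in> carrier (secs N U)\<rbrakk> \<Longrightarrow>
      f U (P \<odot>\<^bsub>secs N U\<^esub> m) = P \<odot>\<^bsub>secs M U\<^esub> f U m"
    and f_res: "\<And>U V m. \<lbrakk>zariski_open U; V \<in> opens U; m \<in> carrier (secs N U)\<rbrakk> \<Longrightarrow>
      f V (res N U V m) = res M U V (f U m)"
begin

sublocale N: Dmod lam N
  by unfold_locales (rule pre)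

lemma carrier_eq: "zariski_open U \<Longrightarrow> carrier (secs M U) = f U ` N.CM U"
  using bij by (simp add: bij_betw_def)

lemma f_inj: "\<lbrakk>zariski_open U; m \<in> N.CM U; n \<in> N.CM U; f U m = f U n\<rbrakk> \<Longrightarrow> m = n"
  using bij by (auto simp: bij_betw_def inj_on_def)

lemma M_abelian:
  assumes U: "zariski_open U" shows "abelian_group (secs M U)"
proof -
  interpret A: abelian_group "secs N U" by (rule N.abelian_secs[OF U])
  note r = f_add[OF U, symmetric] f_zero[OF U, symmetric]
  show ?thesis
  proof (rule abelian_groupI, unfold carrier_eq[OF U])
    show "\<zero>\<^bsub>secs M U\<^esub> \<in> f U ` N.CM U" by (simp add: r)
    fix x assume "x \<in> f U ` N.CM U"
    then obtain m where m: "m \<in> N.CM U" "x = f U m" by blast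
    show "\<zero>\<^bsub>secs M U\<^esub> \<oplus>\<^bsub>secs M U\<^esub> x = x" using m by (simp add: r)
    have "f U (\<ominus>\<^bsub>secs N U\<^esub> m) \<oplus>\<^bsub>secs M U\<^esub> x = \<zero>\<^bsub>secs M U\<^esub>" using m by (simp add: r A.l_neg)
    then show "\<exists>y\<in>f U ` N.CM U. y \<oplus>\<^bsub>secs M U\<^esub> x = \<zero>\<^bsub>secs M U\<^esub>" using m by blast
    fix y assume "y \<in> f U ` N.CM U"
    then obtain n where n: "n \<in> N.CM U" "y = f U n" by blast
    show "x \<oplus>\<^bsub>secs M U\<^esub> y \<in> f U ` N.CM U" using m n by (simp add: r)
    show "x \<oplus>\<^bsub>secs M U\<^esub> y = y \<oplus>\<^bsub>secs M U\<^esub> x" using m n by (simp add: r A.a_comm)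
    fix z assume "z \<in> f U ` N.CM U"
    then obtain l where l: "l \<in> N.CM U" "z = f U l" by blast
    show "x \<oplus>\<^bsub>secs M U\<^esub> y \<oplus>\<^bsub>secs M U\<^esub> z = x \<oplus>\<^bsub>secs M U\<^esub> (y \<oplus>\<^bsub>secs M U\<^esub> z)"
      using m n l by (simp add: r A.a_assoc)
  qed
qed

lemma M_left_module:
  assumes U: "zariski_open U" shows "left_module (tdo lam U) (secs M U)"
proof -
  interpret A: abelian_group "secs N U" by (rule N.abelian_secs[OF U])
  have one: "\<one>\<^bsub>tdo lam U\<^esub> \<in> tdo_carrier lam U" unfolding mulop_one[symmetric] by (rule mulop_closed[OF U hreg_const])
  note r = f_add[OF U, symmetric] f_smul[OF U, symmetric] N.smul_closed[OF U] A.a_closed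
  show ?thesis
    unfolding left_module_def tdo_simps(1) carrier_eq[OF U]
    by (intro conjI M_abelian[OF U])
      (auto simp: r N.smul_add[OF U] N.smul_addr[OF U] N.smul_mult[OF U] N.smul_one[OF U]
        tdo_add_closed[OF U] tdo_mult_closed[OF U] one)
qed

lemma M_presheaf: "D_presheaf lam M"
  unfolding D_presheaf_def tdo_simps(1)
proof (intro conjI ballI)
  fix U assume "U \<in> opens UNIV"
  then have U: "zariski_open U" by (simp add: opens_UNIV)
  interpret A: abelian_group "secs N U" by (rule N.abelian_secs[OF U])
  show "left_module (tdo lam U) (secs M U)" by (rule M_left_module[OF U])
  show "res M U U x = x" if "x \<in> carrier (secs M U)" for x
    using that unfolding carrier_eq[OF U] by (auto simp: f_res[OF U opens_self[OF U], symmetric] N.res_id[OF U])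
  fix V assume V: "V \<in> opens U"
  have V': "zariski_open V" by (rule opens_D(1)[OF V])
  show "res M U V \<in> carrier (secs M U) \<rightarrow> carrier (secs M V)"
    unfolding carrier_eq[OF U] carrier_eq[OF V'] by (auto simp: f_res[OF U V, symmetric] N.res_closed[OF U V])
  show "res M U V (x \<oplus>\<^bsub>secs M U\<^esub> y) = res M U V x \<oplus>\<^bsub>secs M V\<^esub> res M U V y"
    if "x \<in> carrier (secs M U)" "y \<in> carrier (secs M U)" for x y
    using that unfolding carrier_eq[OF U]
    by (auto simp: f_res[OF U V, symmetric] f_add[OF U, symmetric] f_add[OF V', symmetric] N.res_closed[OF U V] N.res_add[OF U V])
  show "res M U V (P \<odot>\<^bsub>secs M U\<^esub> x) = tdo_res V P \<odot>\<^bsub>secs M V\<^esub> res M U V x"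
    if P: "P \<in> tdo_carrier lam U" and x: "x \<in> carrier (secs M U)" for P x
    using x unfolding carrier_eq[OF U]
    by (auto simp: f_res[OF U V, symmetric] f_smul[OF U P, symmetric] f_smul[OF V' tdo_res_closed[OF U V P], symmetric]
        N.res_closed[OF U V] N.res_smul[OF U V P] N.smul_closed[OF U P])
  show "res M V W (res M U V x) = res M U W x" if W: "W \<in> opens V" and x: "x \<in> carrier (secs M U)" for W x
    using x unfolding carrier_eq[OF U]
    by (auto simp: f_res[OF U V, symmetric] f_res[OF V' W, symmetric] f_res[OF U opens_trans[OF V W], symmetric]
        N.res_closed[OF U V] N.res_res[OF U V W])
qed

lemma M_sheaf:
  assumes "sheaf_condition N" shows "sheaf_condition M"
  unfolding sheaf_condition_def
proof (intro allI impI, elim conjE)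
  fix \<V> s assume \<V>: "\<V> \<subseteq> opens UNIV" and s: "\<forall>V\<in>\<V>. s V \<in> carrier (secs M V)"
    and ov: "\<forall>V\<in>\<V>. \<forall>W\<in>\<V>. res M V (V \<inter> W) (s V) = res M W (V \<inter> W) (s W)"
  have op: "zariski_open V" if "V \<in> \<V>" for V using \<V> that by (auto simp: opens_UNIV)
  have U: "zariski_open (\<Union>\<V>)" by (rule zariski_open_Union[OF \<V>])
  have sub: "V \<in> opens (\<Union>\<V>)" if "V \<in> \<V>" for V using op[OF that] that by (auto simp: opens_def)
  have "\<exists>t. t \<in> N.CM V \<and> s V = f V t" if "V \<in> \<V>" for V
    using s that carrier_eq[OF op[OF that]] by auto
  then obtain t where t: "\<And>V. V \<in> \<V> \<Longrightarrow> t V \<in> N.CM V \<and> s V = f V (t V)" by metis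
  have tt: "res N V (V \<inter> W) (t V) = res N W (V \<inter> W) (t W)" if V: "V \<in> \<V>" and W: "W \<in> \<V>" for V W
  proof -
    have O: "zariski_open (V \<inter> W)" by (rule zariski_open_Int[OF op[OF V] op[OF W]])
    then have VW: "V \<inter> W \<in> opens V" "V \<inter> W \<in> opens W" by (auto simp: opens_def)
    show ?thesis
    proof (rule f_inj[OF O])
      show "res N V (V \<inter> W) (t V) \<in> N.CM (V \<inter> W)" by (rule N.res_closed[OF op[OF V] VW(1)]) (use t[OF V] in simp)
      show "res N W (V \<inter> W) (t W) \<in> N.CM (V \<inter> W)" by (rule N.res_closed[OF op[OF W] VW(2)]) (use t[OF W] in simp)
      have "res M V (V \<inter> W) (s V) = res M W (V \<inter> W) (s W)" using ov V W by blast
      then show "f (V \<inter> W) (res N V (V \<inter> W) (t V)) = f (V \<inter> W) (res N W (V \<inter> W) (t W))"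
        using t[OF V] t[OF W] f_res[OF op[OF V] VW(1)] f_res[OF op[OF W] VW(2)] by simp
    qed
  qed
  have "(\<forall>V\<in>\<V>. t V \<in> N.CM V) \<and>
      (\<forall>V\<in>\<V>. \<forall>W\<in>\<V>. res N V (V \<inter> W) (t V) = res N W (V \<inter> W) (t W))"
    using t by (intro conjI ballI tt) auto
  from mp[OF spec[OF mp[OF spec[OF assms[unfolded sheaf_condition_def]] \<V>]] this]
  have "\<exists>!m. m \<in> N.CM (\<Union>\<V>) \<and> (\<forall>V\<in>\<V>. res N (\<Union>\<V>) V m = t V)" .
  then obtain m where m: "m \<in> N.CM (\<Union>\<V>)" "\<And>V. V \<in> \<V> \<Longrightarrow> res N (\<Union>\<V>) V m = t V"
    and uniq: "\<And>m'. m' \<in> N.CM (\<Union>\<V>) \<Longrightarrow> (\<forall>V\<in>\<V>. res N (\<Union>\<V>) V m' = t V) \<Longrightarrow> m' = m"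
    by (elim ex1E) auto
  show "\<exists>!m. m \<in> carrier (secs M (\<Union>\<V>)) \<and> (\<forall>V\<in>\<V>. res M (\<Union>\<V>) V m = s V)"
  proof (rule ex1I[of _ "f (\<Union>\<V>) m"])
    show "f (\<Union>\<V>) m \<in> carrier (secs M (\<Union>\<V>)) \<and> (\<forall>V\<in>\<V>. res M (\<Union>\<V>) V (f (\<Union>\<V>) m) = s V)"
      using m t by (auto simp: carrier_eq[OF U] f_res[OF U sub _, symmetric])
    fix x assume x: "x \<in> carrier (secs M (\<Union>\<V>)) \<and> (\<forall>V\<in>\<V>. res M (\<Union>\<V>) V x = s V)"
    then obtain m' where m': "m' \<in> N.CM (\<Union>\<V>)" "x = f (\<Union>\<V>) m'" by (auto simp: carrier_eq[OF U])
    have "res N (\<Union>\<V>) V m' = t V" if V: "V \<in> \<V>" for V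
    proof (rule f_inj[OF op[OF V] N.res_closed[OF U sub[OF V] m'(1)]])
      show "t V \<in> N.CM V" using t[OF V] by simp
      show "f V (res N (\<Union>\<V>) V m') = f V (t V)" using x V m'(2) t[OF V] f_res[OF U sub[OF V] m'(1)] by simp
    qed
    then show "x = f (\<Union>\<V>) m" using uniq[OF m'(1)] m'(2) by simp
  qed
qed

lemma M_associated:
  assumes U: "zariski_open U" and N: "associated_on lam N U" shows "associated_on lam M U"
  unfolding associated_on_def Let_def
proof (intro ballI conjI impI)
  fix h assume hs: "h \<in> str_sheaf U"
  then have h: "hreg U h" by (simp add: str_sheaf_iff[OF U])
  let ?V = "{p \<in> U. h p \<noteq> 0}"
  have V: "zariski_open ?V" by (rule nonvanishing_open[OF U h])
  have VU: "?V \<in> opens U" using V by (auto simp: opens_def)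
  have hU: "mulop lam U (\<lambda>p. h p ^ k) \<in> tdo_carrier lam U" for k by (rule mulop_closed[OF U hreg_power[OF h]])
  have hV: "mulop lam ?V (\<lambda>p. h p ^ k) \<in> tdo_carrier lam ?V" for k
    by (rule mulop_closed[OF V hreg_power[OF hreg_subset[OF h]]]) auto
  note ass = N[unfolded associated_on_def Let_def, rule_format, OF hs]
  {
    fix x assume x: "x \<in> carrier (secs M U)" and z: "res M U ?V x = \<zero>\<^bsub>secs M ?V\<^esub>"
    then obtain m where m: "m \<in> N.CM U" "x = f U m" by (auto simp: carrier_eq[OF U])
    have "res N U ?V m = \<zero>\<^bsub>secs N ?V\<^esub>"
      by (rule f_inj[OF V N.res_closed[OF U VU m(1)] N.zero_closed[OF V]])
        (simp add: f_res[OF U VU m(1)] f_zero[OF V] z m(2)[symmetric])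
    then obtain k where "mulop lam U (\<lambda>p. h p ^ k) \<odot>\<^bsub>secs N U\<^esub> m = \<zero>\<^bsub>secs N U\<^esub>" using conjunct1[OF ass] m(1) by blast
    then have "mulop lam U (\<lambda>p. h p ^ k) \<odot>\<^bsub>secs M U\<^esub> x = \<zero>\<^bsub>secs M U\<^esub>"
      using m f_smul[OF U hU m(1), of k] f_zero[OF U] by simp
    then show "\<exists>k. mulop lam U (\<lambda>p. h p ^ k) \<odot>\<^bsub>secs M U\<^esub> x = \<zero>\<^bsub>secs M U\<^esub>" by blast
  }
  fix y assume "y \<in> carrier (secs M ?V)"
  then obtain t where t: "t \<in> N.CM ?V" "y = f ?V t" by (auto simp: carrier_eq[OF V])
  obtain k m where m: "m \<in> N.CM U" "res N U ?V m = mulop lam ?V (\<lambda>p. h p ^ k) \<odot>\<^bsub>secs N ?V\<^esub> t"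
    using conjunct2[OF ass] t(1) by blast
  have "res M U ?V (f U m) = mulop lam ?V (\<lambda>p. h p ^ k) \<odot>\<^bsub>secs M ?V\<^esub> y"
    unfolding f_res[OF U VU m(1), symmetric] m(2) t(2) by (rule f_smul[OF V hV t(1)])
  then show "\<exists>k. \<exists>m\<in>carrier (secs M U). res M U ?V m = mulop lam ?V (\<lambda>p. h p ^ k) \<odot>\<^bsub>secs M ?V\<^esub> y"
    using m(1) carrier_eq[OF U] by blast
qed

lemma f_finsum:
  assumes U: "zariski_open U" and "g \<in> I \<rightarrow> N.CM U"
  shows "f U (finsum (secs N U) g I) = finsum (secs M U) (\<lambda>i. f U (g i)) I"
proof -
  interpret A: abelian_group "secs N U" by (rule N.abelian_secs[OF U])
  interpret B: abelian_group "secs M U" by (rule M_abelian[OF U])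
  show ?thesis using assms(2)
  proof (induction I rule: infinite_finite_induct)
    case (insert i I)
    then have 1: "g i \<in> N.CM U" "g \<in> I \<rightarrow> N.CM U" by auto
    have 2: "(\<lambda>i. f U (g i)) \<in> I \<rightarrow> carrier (secs M U)" "f U (g i) \<in> carrier (secs M U)" using 1 by (auto simp: carrier_eq[OF U])
    show ?case
      unfolding A.finsum_insert[OF insert.hyps 1(2,1)] B.finsum_insert[OF insert.hyps 2]
        f_add[OF U 1(1) A.finsum_closed[OF 1(2)]] insert.IH[OF 1(2)] ..
  qed (simp_all add: f_zero[OF U])
qed

lemma M_finitely_generated:
  assumes U: "zariski_open U" and N: "finitely_generated_on lam N U" shows "finitely_generated_on lam M U"
proof -
  interpret B: abelian_group "secs M U" by (rule M_abelian[OF U])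
  from N obtain B where B: "finite B" "B \<subseteq> N.CM U"
    and g: "\<forall>m\<in>N.CM U. \<exists>h. (\<forall>b\<in>B. h b \<in> str_sheaf U) \<and>
        m = finsum (secs N U) (\<lambda>b. mulop lam U (h b) \<odot>\<^bsub>secs N U\<^esub> b) B"
    unfolding finitely_generated_on_def by (elim exE conjE)
  have inj: "inj_on (f U) B" using bij[OF U] B(2) by (auto simp: bij_betw_def intro: inj_on_subset)
  show ?thesis
    unfolding finitely_generated_on_def
  proof (intro exI[of _ "f U ` B"] conjI ballI)
    show "finite (f U ` B)" using B(1) by simp
    show "f U ` B \<subseteq> carrier (secs M U)" using B(2) by (auto simp: carrier_eq[OF U])
    fix x assume "x \<in> carrier (secs M U)"
    then obtain m where m: "m \<in> N.CM U" "x = f U m" by (auto simp: carrier_eq[OF U])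
    from bspec[OF g m(1)] obtain h where h: "\<And>b. b \<in> B \<Longrightarrow> h b \<in> str_sheaf U"
      and me: "m = finsum (secs N U) (\<lambda>b. mulop lam U (h b) \<odot>\<^bsub>secs N U\<^esub> b) B" by auto
    have hc: "mulop lam U (h b) \<in> tdo_carrier lam U" if "b \<in> B" for b
      using h[OF that] by (intro mulop_closed[OF U]) (simp add: str_sheaf_iff[OF U])
    have cl: "(\<lambda>b. mulop lam U (h b) \<odot>\<^bsub>secs N U\<^esub> b) \<in> B \<rightarrow> N.CM U"
      using N.smul_closed[OF U hc] B(2) by auto
    define h' where "h' = (\<lambda>y. h (the_inv_into B (f U) y))"
    have h': "h' (f U b) = h b" if "b \<in> B" for b using that by (simp add: h'_def the_inv_into_f_f[OF inj])
    have e: "f U (mulop lam U (h b) \<odot>\<^bsub>secs N U\<^esub> b) = mulop lam U (h' (f U b)) \<odot>\<^bsub>secs M U\<^esub> f U b" if b: "b \<in> B" for b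
      unfolding h'[OF b] by (rule f_smul[OF U hc[OF b]]) (use B(2) b in auto)
    have cl': "(\<lambda>b. mulop lam U (h' (f U b)) \<odot>\<^bsub>secs M U\<^esub> f U b) \<in> B \<rightarrow> carrier (secs M U)"
      using cl e carrier_eq[OF U] by (auto simp: Pi_iff) (metis imageI)
    have "x = finsum (secs M U) (\<lambda>b. f U (mulop lam U (h b) \<odot>\<^bsub>secs N U\<^esub> b)) B"
      unfolding m(2) me by (rule f_finsum[OF U cl])
    also have "\<dots> = finsum (secs M U) (\<lambda>b. mulop lam U (h' (f U b)) \<odot>\<^bsub>secs M U\<^esub> f U b) B"
      by (rule B.finsum_cong'[OF HOL.refl cl' e])
    also have "\<dots> = finsum (secs M U) (\<lambda>y. mulop lam U (h' y) \<odot>\<^bsub>secs M U\<^esub> y) (f U ` B)"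
      by (rule B.finsum_reindex[OF _ inj, symmetric]) (use cl' in auto)
    finally show "\<exists>h. (\<forall>b\<in>f U ` B. h b \<in> str_sheaf U) \<and> x = finsum (secs M U) (\<lambda>b. mulop lam U (h b) \<odot>\<^bsub>secs M U\<^esub> b) (f U ` B)"
      using h h' by (intro exI[of _ h']) auto
  qed
qed

end

text \<open>The structure of \<open>N\<close> moved along the maps \<open>f U\<close>. These have to
  be injective on each carrier separately, as sections over different open sets are never
  compared.\<close>

definition transport :: "'w dmod \<Rightarrow> (p1 set \<Rightarrow> 'w \<Rightarrow> 'v) \<Rightarrow> 'v dmod" where
  "transport N f = \<lparr>secs = (\<lambda>U. let g = inv_into (carrier (secs N U)) (f U) in
      \<lparr>carrier = f U ` carrier (secs N U), mult = undefined, one = undefined,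
       zero = f U \<zero>\<^bsub>secs N U\<^esub>, add = (\<lambda>x y. f U (g x \<oplus>\<^bsub>secs N U\<^esub> g y)),
       smult = (\<lambda>P x. f U (P \<odot>\<^bsub>secs N U\<^esub> g x))\<rparr>),
     res = (\<lambda>U V x. f V (res N U V (inv_into (carrier (secs N U)) (f U) x)))\<rparr>"

lemma transport_iso:
  assumes "D_presheaf lam N" "\<And>U. zariski_open U \<Longrightarrow> inj_on (f U) (carrier (secs N U))"
  shows "dmod_iso lam N (transport N f) f"
  using assms by unfold_locales (auto simp: transport_def Let_def bij_betw_def)

text \<open>Both types have the size of the continuum: reals are coded by sets of natural numbers,
  and the sets for the real and imaginary parts of all members of a sequence are merged into one by
  \<open>prod_decode\<close>.\<close>

lemma ex_inj_sequences: "\<exists>g :: (nat \<Rightarrow> complex) \<Rightarrow> complex. inj g"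
proof -
  obtain b :: "nat set \<Rightarrow> real" where b: "bij b"
    using nat_sets_eqpoll_reals unfolding eqpoll_def by auto
  define a where "a = inv_into UNIV b"
  have a: "inj a" unfolding a_def using b by (simp add: bij_imp_bij_inv bij_is_inj)
  define S where "S = (\<lambda>x :: nat \<Rightarrow> complex. {y. case prod_decode y of (j, m) \<Rightarrow>
      m \<in> a (if even j then Re (x (j div 2)) else Im (x (j div 2)))})"
  have "inj S"
  proof (rule injI, rule ext)
    fix x y k assume e: "S x = S y"
    have "a (Re (x k)) = a (Re (y k))"
    proof (rule Set.set_eqI)
      fix m
      have "prod_encode (2 * k, m) \<in> S x \<longleftrightarrow> prod_encode (2 * k, m) \<in> S y" using e by simp
      then show "m \<in> a (Re (x k)) \<longleftrightarrow> m \<in> a (Re (y k))" by (simp add: S_def)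
    qed
    moreover have "a (Im (x k)) = a (Im (y k))"
    proof (rule Set.set_eqI)
      fix m
      have "prod_encode (Suc (2 * k), m) \<in> S x \<longleftrightarrow> prod_encode (Suc (2 * k), m) \<in> S y" using e by simp
      then show "m \<in> a (Im (x k)) \<longleftrightarrow> m \<in> a (Im (y k))" by (simp add: S_def)
    qed
    ultimately show "x k = y k" using a by (simp add: complex_eq_iff inj_eq)
  qed
  moreover have "inj (\<lambda>s. complex_of_real (b s))"
    using b by (auto simp: inj_on_def bij_def)
  ultimately have "inj ((\<lambda>s. complex_of_real (b s)) \<circ> S)" by (rule inj_compose[rotated])
  then show ?thesis by blast
qed

text \<open>Both categories live on one type \<open>'v\<close>, so the model has to be copied into the type of a given
  representation. A section is determined by its values at the natural numbers, hence there are no more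
  sections than complex numbers, and a nonzero representation contains a complex line.\<close>

lemma ex_inj_Model: "\<exists>g :: (nat \<Rightarrow> lsec) \<Rightarrow> complex. \<forall>U. zariski_open U \<longrightarrow> inj_on g (CN lam r U)"
proof -
  obtain g0 :: "(nat \<Rightarrow> complex) \<Rightarrow> complex" where g0: "inj g0" using ex_inj_sequences by blast
  \<comment> \<open>Interleaves the values of all components at the natural numbers, with even
    positions for the chart at 0 and odd ones for the chart at infinity.\<close>
  define e where "e = (\<lambda>(s :: nat \<Rightarrow> lsec) y. case prod_decode y of (i, l) \<Rightarrow> sel (odd l) (s i) (of_nat (l div 2)))"
  have "inj_on e (CN lam r U)" if U: "zariski_open U" for U
  proof (rule inj_onI)
    fix s t assume s: "s \<in> CN lam r U" and t: "t \<in> CN lam r U" and st: "e s = e t"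
    show "s = t"
    proof (rule CN_eqI[OF s t])
      fix i assume i: "i < r"
      have eq: "sel c (s i) (of_nat j) = sel c (t i) (of_nat j)" for c j
        using fun_cong[OF st, of "prod_encode (i, if c then Suc (2 * j) else 2 * j)"] by (cases c) (auto simp: e_def)
      show "s i = t i"
      proof (rule line_bundle_eqI[OF U CN_mem[OF s i] CN_mem[OF t i]])
        fix c z assume z: "z \<in> part c U"
        have fin: "finite (- part c U)" using cof_part[OF U, of c] z by (auto simp: cof_def)
        have "infinite (range (of_nat :: nat \<Rightarrow> complex))"
          using finite_imageD[OF _ inj_of_nat] infinite_UNIV_nat by blast
        then have "infinite (range (of_nat :: nat \<Rightarrow> complex) - (- part c U))" using fin by (metis Diff_infinite_finite)
        then show "sel c (s i) z = sel c (t i) z"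
          by (rule rat_eqI[OF line_bundle_rat[OF U CN_mem[OF s i]] line_bundle_rat[OF U CN_mem[OF t i]] _ _ _ z])
            (auto simp: eq)
      qed
    qed
  qed
  then have "\<forall>U. zariski_open U \<longrightarrow> inj_on (g0 \<circ> e) (CN lam r U)"
    using g0 by (auto intro!: comp_inj_on inj_on_subset[of g0 UNIV])
  then show ?thesis by blast
qed

theorem ex_coherent_copy:
  fixes w :: "complex \<Rightarrow> 'v"
  assumes lam: "lam > 0" and w: "r = 0 \<or> inj w"
  shows "\<exists>(M :: 'v dmod) f. dmod_iso lam (Model lam r) M f \<and> D_module lam M \<and> O_coherent_on lam M UNIV"
proof -
  obtain g :: "(nat \<Rightarrow> lsec) \<Rightarrow> complex" where g: "\<And>U. zariski_open U \<Longrightarrow> inj_on g (CN lam r U)"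
    using ex_inj_Model by blast
  \<comment> \<open>For \<open>r = 0\<close> every carrier has a single element and a constant map
    will do; the target type may then be too small to contain the complex numbers.\<close>
  define f where "f = (\<lambda>U :: p1 set. if r = 0 then (\<lambda>_. undefined) else w \<circ> g)"
  interpret dmod_iso lam "Model lam r" "transport (Model lam r) f" f
  proof (rule transport_iso[OF Model_presheaf])
    fix U assume "zariski_open U"
    show "inj_on (f U) (CN lam r U)"
    proof (cases "r = 0")
      case True
      then show ?thesis by (auto simp: f_def Model_simps inj_on_def)
    next
      case False
      then show ?thesis
        unfolding f_def using g[OF \<open>zariski_open U\<close>] w by (auto intro!: comp_inj_on intro: inj_on_subset)
    qed
  qed
  have "D_module lam (transport (Model lam r) f)"
    unfolding D_module_def using M_presheaf M_sheaf[OF Model_sheaf] by simp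
  moreover have "O_coherent_on lam (transport (Model lam r) f) UNIV"
    unfolding O_coherent_on_def
    using M_associated[OF _ Model_associated] M_finitely_generated[OF _ Model_finitely_generated[OF lam]]
    by (auto simp: affine_open_def)
  ultimately show ?thesis using dmod_iso_axioms by blast
qed

section \<open>Representations\<close>

lemma complex_ring_simps [simp]:
  "carrier complex_ring = UNIV" "\<zero>\<^bsub>complex_ring\<^esub> = 0" "\<one>\<^bsub>complex_ring\<^esub> = 1"
  "a \<oplus>\<^bsub>complex_ring\<^esub> b = a + b" "a \<otimes>\<^bsub>complex_ring\<^esub> b = a * b"
  by (simp_all add: complex_ring_def)

lemma cring_complex_ring: "cring complex_ring"
proof (rule cringI)
  show "abelian_group complex_ring"
    by (rule abelian_groupI) (auto simp: algebra_simps intro: exI[of _ "- _"])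
  show "comm_monoid complex_ring" by (rule comm_monoidI) auto
qed (auto simp: algebra_simps)

lemma (in abelian_group) minus_eq_iff:
  assumes "x \<in> carrier G" "y \<in> carrier G" "z \<in> carrier G"
  shows "x \<ominus> y = z \<longleftrightarrow> x = z \<oplus> y"
proof
  assume "x \<ominus> y = z"
  then have "z \<oplus> y = (x \<oplus> \<ominus> y) \<oplus> y" by (simp add: a_minus_def)
  then show "x = z \<oplus> y" using assms by (simp add: a_assoc l_neg)
next
  assume "x = z \<oplus> y"
  then show "x \<ominus> y = z" using assms by (simp add: a_minus_def a_assoc r_neg)
qed

lemma sl2_repI:
  assumes A: "abelian_group V"
    and sm: "\<And>c v. v \<in> carrier V \<Longrightarrow> c \<odot>\<^bsub>V\<^esub> v \<in> carrier V"
    "\<And>c d v. v \<in> carrier V \<Longrightarrow> (c + d) \<odot>\<^bsub>V\<^esub> v = c \<odot>\<^bsub>V\<^esub> v \<oplus>\<^bsub>V\<^esub> d \<odot>\<^bsub>V\<^esub> v"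
    "\<And>c v w. v \<in> carrier V \<Longrightarrow> w \<in> carrier V \<Longrightarrow> c \<odot>\<^bsub>V\<^esub> (v \<oplus>\<^bsub>V\<^esub> w) = c \<odot>\<^bsub>V\<^esub> v \<oplus>\<^bsub>V\<^esub> c \<odot>\<^bsub>V\<^esub> w"
    "\<And>c d v. v \<in> carrier V \<Longrightarrow> (c * d) \<odot>\<^bsub>V\<^esub> v = c \<odot>\<^bsub>V\<^esub> (d \<odot>\<^bsub>V\<^esub> v)"
    "\<And>v. v \<in> carrier V \<Longrightarrow> 1 \<odot>\<^bsub>V\<^esub> v = v"
    and ac: "\<And>x v. v \<in> carrier V \<Longrightarrow> act V x v \<in> carrier V"
    "\<And>x v w. v \<in> carrier V \<Longrightarrow> w \<in> carrier V \<Longrightarrow> act V x (v \<oplus>\<^bsub>V\<^esub> w) = act V x v \<oplus>\<^bsub>V\<^esub> act V x w"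
    "\<And>x c v. v \<in> carrier V \<Longrightarrow> act V x (c \<odot>\<^bsub>V\<^esub> v) = c \<odot>\<^bsub>V\<^esub> act V x v"
    and EF: "\<And>v. v \<in> carrier V \<Longrightarrow> act V gE (act V gF v) = act V gH v \<oplus>\<^bsub>V\<^esub> act V gF (act V gE v)"
    and HE: "\<And>v. v \<in> carrier V \<Longrightarrow> act V gH (act V gE v) = 2 \<odot>\<^bsub>V\<^esub> act V gE v \<oplus>\<^bsub>V\<^esub> act V gE (act V gH v)"
    and HF: "\<And>v. v \<in> carrier V \<Longrightarrow> act V gH (act V gF v) = (-2) \<odot>\<^bsub>V\<^esub> act V gF v \<oplus>\<^bsub>V\<^esub> act V gF (act V gH v)"
  shows "sl2_rep V"
proof -
  interpret abelian_group V by (rule A)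
  have "Module.module complex_ring V"
    by (rule moduleI[OF cring_complex_ring A]) (simp_all add: sm)
  then show ?thesis
    unfolding sl2_rep_def using ac by (auto simp: minus_eq_iff sm(1) EF HE HF)
qed

locale sl2 =
  fixes V :: "'v sl2rep" (structure)
  assumes rep: "sl2_rep V"

sublocale sl2 \<subseteq> abelian_group V
  using rep unfolding sl2_rep_def Module.module_def by blast

context sl2
begin

lemma mod: "Module.module complex_ring V"
  using rep by (simp add: sl2_rep_def)

lemma sm_closed [simp, intro]: "v \<in> carrier V \<Longrightarrow> c \<odot> v \<in> carrier V"
  using module.smult_closed[OF mod] by simp

lemma sm_add: "v \<in> carrier V \<Longrightarrow> (c + d) \<odot> v = c \<odot> v \<oplus> d \<odot> v"
  using module.smult_l_distr[OF mod] by simp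

lemma sm_addr: "v \<in> carrier V \<Longrightarrow> w \<in> carrier V \<Longrightarrow> c \<odot> (v \<oplus> w) = c \<odot> v \<oplus> c \<odot> w"
  using module.smult_r_distr[OF mod] by simp

lemma sm_mult: "v \<in> carrier V \<Longrightarrow> (c * d) \<odot> v = c \<odot> (d \<odot> v)"
  using module.smult_assoc1[OF mod] by simp

lemma sm_one [simp]: "v \<in> carrier V \<Longrightarrow> 1 \<odot> v = v"
  using module.smult_one[OF mod] by simp

lemma sm_zero_left [simp]: "v \<in> carrier V \<Longrightarrow> 0 \<odot> v = \<zero>"
  using module.smult_l_null[OF mod] by simp

lemma sm_zero [simp]: "c \<odot> \<zero> = \<zero>"
  using module.smult_r_null[OF mod] by simp

lemma sm_minus_one: "v \<in> carrier V \<Longrightarrow> (-1) \<odot> v = \<ominus> v"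
  using sm_add[of v 1 "-1"] minus_equality[of v "(-1) \<odot> v"] minus_equality[of "(-1) \<odot> v" v] by (simp add: a_comm)

lemma act_closed [simp, intro]: "v \<in> carrier V \<Longrightarrow> act V x v \<in> carrier V"
  using rep by (auto simp: sl2_rep_def)

lemma act_add: "v \<in> carrier V \<Longrightarrow> w \<in> carrier V \<Longrightarrow> act V x (v \<oplus> w) = act V x v \<oplus> act V x w"
  using rep by (simp add: sl2_rep_def)

lemma act_sm: "v \<in> carrier V \<Longrightarrow> act V x (c \<odot> v) = c \<odot> act V x v"
  using rep by (simp add: sl2_rep_def)

lemma act_zero [simp]: "act V x \<zero> = \<zero>"
  using act_sm[of \<zero> x 0] by simp

lemma rel_EF: "v \<in> carrier V \<Longrightarrow> act V gE (act V gF v) = act V gH v \<oplus> act V gF (act V gE v)"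
  using rep minus_eq_iff[of "act V gE (act V gF v)" "act V gF (act V gE v)" "act V gH v"]
  by (simp add: sl2_rep_def)

lemma rel_HE: "v \<in> carrier V \<Longrightarrow> act V gH (act V gE v) = 2 \<odot> act V gE v \<oplus> act V gE (act V gH v)"
  using rep minus_eq_iff[of "act V gH (act V gE v)" "act V gE (act V gH v)" "2 \<odot> act V gE v"]
  by (simp add: sl2_rep_def)

lemma rel_HF: "v \<in> carrier V \<Longrightarrow> act V gH (act V gF v) = (-2) \<odot> act V gF v \<oplus> act V gF (act V gH v)"
  using rep minus_eq_iff[of "act V gH (act V gF v)" "act V gF (act V gH v)" "(-2) \<odot> act V gF v"]
  by (simp add: sl2_rep_def)

lemma subrepI:
  assumes "W \<subseteq> carrier V" "\<zero> \<in> W" "\<And>v w. v \<in> W \<Longrightarrow> w \<in> W \<Longrightarrow> v \<oplus> w \<in> W" "\<And>c v. v \<in> W \<Longrightarrow> c \<odot> v \<in> W"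
  shows "submodule W complex_ring V"
proof (rule module.submoduleI[OF mod assms(1,2)])
  fix a assume "a \<in> W"
  then show "\<ominus> a \<in> W" using assms(4)[of a "-1"] sm_minus_one[of a] assms(1) by auto
qed (use assms in auto)

lemma subrepD:
  assumes "submodule W complex_ring V"
  shows "W \<subseteq> carrier V" "\<zero> \<in> W" "v \<in> W \<Longrightarrow> w \<in> W \<Longrightarrow> v \<oplus> w \<in> W" "v \<in> W \<Longrightarrow> c \<odot> v \<in> W"
proof -
  show "W \<subseteq> carrier V" using module.submoduleE(1)[OF mod assms] .
  show "v \<in> W \<Longrightarrow> w \<in> W \<Longrightarrow> v \<oplus> w \<in> W" using module.submoduleE(5)[OF mod assms] by simp
  show sm: "v \<in> W \<Longrightarrow> c \<odot> v \<in> W" for c v using module.submoduleE(4)[OF mod assms] by simp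
  obtain a where "a \<in> W" using module.submoduleE(2)[OF mod assms] by blast
  then show "\<zero> \<in> W" using sm[of a 0] \<open>W \<subseteq> carrier V\<close> by (metis sm_zero_left subsetD)
qed

subsection \<open>The enveloping algebra\<close>

lemma uact_closed [simp, intro]: "v \<in> carrier V \<Longrightarrow> uact V a v \<in> carrier V"
  by (induction a arbitrary: v) auto

lemma uact_add: "v \<in> carrier V \<Longrightarrow> w \<in> carrier V \<Longrightarrow> uact V a (v \<oplus> w) = uact V a v \<oplus> uact V a w"
proof (induction a arbitrary: v w)
  case (UAdd a b)
  then show ?case by (simp add: a_ac)
qed (auto simp: sm_addr act_add)

lemma uact_sm: "v \<in> carrier V \<Longrightarrow> uact V a (c \<odot> v) = c \<odot> uact V a v"
proof (induction a arbitrary: v)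
  case (UConst d)
  then show ?case using sm_mult[of v d c] sm_mult[of v c d] by (simp add: mult.commute)
next
  case (UAdd a b)
  then show ?case by (simp add: sm_addr)
qed (auto simp: act_sm)

lemma ueq_uact: "ueq a b \<Longrightarrow> v \<in> carrier V \<Longrightarrow> uact V a v = uact V b v"
proof (induction arbitrary: v rule: ueq.induct)
  case (add_neg a)
  then show ?case by (simp add: sm_minus_one r_neg)
next
  case (const_central c a)
  then show ?case by (simp add: uact_sm)
next
  case bracket_EF
  then show ?case by (simp add: rel_EF a_comm)
next
  case bracket_HE
  then show ?case by (simp add: rel_HE a_comm)
next
  case bracket_HF
  then show ?case by (simp add: rel_HF a_comm)
qed (auto simp: a_ac uact_add sm_add sm_mult)

lemma ucentral_commutes:
  assumes "ucentral z" "v \<in> carrier V"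
  shows "uact V z (act V x v) = act V x (uact V z v)"
  using ueq_uact[of "UMul z (UGen x)" "UMul (UGen x) z" v] assms unfolding ucentral_def by simp

end

section \<open>Homomorphisms, isomorphic copies and powers of representations\<close>

lemma rep_homD:
  assumes "f \<in> rep_hom V W"
  shows "v \<in> carrier V \<Longrightarrow> f v \<in> carrier W"
    "v \<in> carrier V \<Longrightarrow> w \<in> carrier V \<Longrightarrow> f (v \<oplus>\<^bsub>V\<^esub> w) = f v \<oplus>\<^bsub>W\<^esub> f w"
    "v \<in> carrier V \<Longrightarrow> f (c \<odot>\<^bsub>V\<^esub> v) = c \<odot>\<^bsub>W\<^esub> f v"
    "v \<in> carrier V \<Longrightarrow> f (act V x v) = act W x (f v)"
  using assms unfolding rep_hom_def by auto

lemma rep_homI: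
  assumes "f \<in> carrier V \<rightarrow>\<^sub>E carrier W"
    "\<And>v w. v \<in> carrier V \<Longrightarrow> w \<in> carrier V \<Longrightarrow> f (v \<oplus>\<^bsub>V\<^esub> w) = f v \<oplus>\<^bsub>W\<^esub> f w"
    "\<And>c v. v \<in> carrier V \<Longrightarrow> f (c \<odot>\<^bsub>V\<^esub> v) = c \<odot>\<^bsub>W\<^esub> f v"
    "\<And>x v. v \<in> carrier V \<Longrightarrow> f (act V x v) = act W x (f v)"
  shows "f \<in> rep_hom V W"
  using assms unfolding rep_hom_def by simp

lemma sl2_closed:
  assumes "sl2_rep V"
  shows "v \<in> carrier V \<Longrightarrow> w \<in> carrier V \<Longrightarrow> v \<oplus>\<^bsub>V\<^esub> w \<in> carrier V" "v \<in> carrier V \<Longrightarrow> c \<odot>\<^bsub>V\<^esub> v \<in> carrier V"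
    "v \<in> carrier V \<Longrightarrow> act V x v \<in> carrier V" "\<zero>\<^bsub>V\<^esub> \<in> carrier V"
proof -
  interpret sl2 V by (rule sl2.intro[OF assms])
  show "v \<in> carrier V \<Longrightarrow> w \<in> carrier V \<Longrightarrow> v \<oplus>\<^bsub>V\<^esub> w \<in> carrier V" "v \<in> carrier V \<Longrightarrow> c \<odot>\<^bsub>V\<^esub> v \<in> carrier V"
    "v \<in> carrier V \<Longrightarrow> act V x v \<in> carrier V" "\<zero>\<^bsub>V\<^esub> \<in> carrier V" by auto
qed

lemma uact_hom:
  assumes "sl2_rep V" "f \<in> rep_hom V W" "v \<in> carrier V"
  shows "f (uact V a v) = uact W a (f v)"
proof -
  interpret sl2 V by (rule sl2.intro[OF assms(1)])
  show ?thesis using assms(3) by (induction a arbitrary: v) (auto simp: rep_homD[OF assms(2)])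
qed

lemma sl2_rep_image:
  assumes W: "sl2_rep W" and A: "abelian_group V" and f: "bij_betw f (carrier W) (carrier V)"
    and hom: "\<And>a b. a \<in> carrier W \<Longrightarrow> b \<in> carrier W \<Longrightarrow> f (a \<oplus>\<^bsub>W\<^esub> b) = f a \<oplus>\<^bsub>V\<^esub> f b"
      "\<And>c a. a \<in> carrier W \<Longrightarrow> f (c \<odot>\<^bsub>W\<^esub> a) = c \<odot>\<^bsub>V\<^esub> f a"
      "\<And>x a. a \<in> carrier W \<Longrightarrow> f (act W x a) = act V x (f a)"
  shows "sl2_rep V"
proof -
  interpret W: sl2 W by (rule sl2.intro[OF W])
  have im: "carrier V = f ` carrier W" using f by (simp add: bij_betw_def)
  show ?thesis
  proof (rule sl2_repI[OF A], unfold im)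
  qed (auto simp: hom[symmetric] W.sm_add W.sm_addr W.sm_mult W.act_add W.act_sm W.rel_EF W.rel_HE W.rel_HF
      intro!: arg_cong[where f=f])
qed

lemma rep_power_simps:
  "carrier (rep_power r V) = {..<r} \<rightarrow>\<^sub>E carrier V"
  "\<zero>\<^bsub>rep_power r V\<^esub> = (\<lambda>i\<in>{..<r}. \<zero>\<^bsub>V\<^esub>)"
  "f \<oplus>\<^bsub>rep_power r V\<^esub> g = (\<lambda>i\<in>{..<r}. f i \<oplus>\<^bsub>V\<^esub> g i)"
  "c \<odot>\<^bsub>rep_power r V\<^esub> f = (\<lambda>i\<in>{..<r}. c \<odot>\<^bsub>V\<^esub> f i)"
  "act (rep_power r V) x f = (\<lambda>i\<in>{..<r}. act V x (f i))"
  by (simp_all add: rep_power_def)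

lemma rep_power_mem: "f \<in> carrier (rep_power r V) \<Longrightarrow> i < r \<Longrightarrow> f i \<in> carrier V"
  unfolding rep_power_simps by (erule PiE_mem) simp

lemma rep_power_I: "(\<And>i. i < r \<Longrightarrow> h i \<in> carrier V) \<Longrightarrow> (\<lambda>i\<in>{..<r}. h i) \<in> carrier (rep_power r V)"
  unfolding rep_power_simps by auto

lemma rep_power_ext: "\<lbrakk>f \<in> carrier (rep_power r V); g \<in> carrier (rep_power r V); (\<And>i. i < r \<Longrightarrow> f i = g i)\<rbrakk> \<Longrightarrow> f = g"
  unfolding rep_power_simps by (rule PiE_ext) auto

lemma restrict_lt_ext: "(\<And>i. i < r \<Longrightarrow> f i = g i) \<Longrightarrow> (\<lambda>i\<in>{..<r}. f i) = (\<lambda>i\<in>{..<(r::nat)}. g i)"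
  by (rule restrict_ext) simp

lemma sl2_rep_power:
  assumes "sl2_rep V" shows "sl2_rep (rep_power r V)"
proof -
  interpret V: sl2 V by (rule sl2.intro[OF assms])
  let ?P = "rep_power r V"
  note mem = rep_power_mem[of _ r V]
  show ?thesis
  proof (rule sl2_repI)
    show "abelian_group ?P"
    proof (rule abelian_groupI)
      show "\<zero>\<^bsub>?P\<^esub> \<in> carrier ?P" unfolding rep_power_simps(2) by (rule rep_power_I) simp
      fix f assume f: "f \<in> carrier ?P"
      have "(\<lambda>i\<in>{..<r}. \<ominus>\<^bsub>V\<^esub> f i) \<oplus>\<^bsub>?P\<^esub> f = \<zero>\<^bsub>?P\<^esub>"
        unfolding rep_power_simps by (rule restrict_lt_ext) (simp add: V.l_neg mem[OF f])
      moreover have "(\<lambda>i\<in>{..<r}. \<ominus>\<^bsub>V\<^esub> f i) \<in> carrier ?P" by (rule rep_power_I) (simp add: mem[OF f])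
      ultimately show "\<exists>g\<in>carrier ?P. g \<oplus>\<^bsub>?P\<^esub> f = \<zero>\<^bsub>?P\<^esub>" by blast
      show "\<zero>\<^bsub>?P\<^esub> \<oplus>\<^bsub>?P\<^esub> f = f"
        unfolding rep_power_simps(2,3) by (rule rep_power_ext[OF rep_power_I f]) (simp_all add: mem[OF f])
      fix g assume g: "g \<in> carrier ?P"
      show "f \<oplus>\<^bsub>?P\<^esub> g \<in> carrier ?P" unfolding rep_power_simps(3) by (rule rep_power_I) (simp add: mem[OF f] mem[OF g])
      show "f \<oplus>\<^bsub>?P\<^esub> g = g \<oplus>\<^bsub>?P\<^esub> f" unfolding rep_power_simps(3) by (rule restrict_lt_ext) (simp add: V.a_comm mem[OF f] mem[OF g])
      fix h assume h: "h \<in> carrier ?P"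
      show "f \<oplus>\<^bsub>?P\<^esub> g \<oplus>\<^bsub>?P\<^esub> h = f \<oplus>\<^bsub>?P\<^esub> (g \<oplus>\<^bsub>?P\<^esub> h)"
        unfolding rep_power_simps(3) by (rule restrict_lt_ext) (simp add: V.a_assoc mem[OF f] mem[OF g] mem[OF h])
    qed
    show "1 \<odot>\<^bsub>?P\<^esub> f = f" if f: "f \<in> carrier ?P" for f
      unfolding rep_power_simps(4) by (rule rep_power_ext[OF rep_power_I f]) (simp_all add: mem[OF f])
    show "c \<odot>\<^bsub>?P\<^esub> f \<in> carrier ?P" if f: "f \<in> carrier ?P" for c f
      unfolding rep_power_simps(4) by (rule rep_power_I) (simp add: mem[OF f])
    show "act ?P x f \<in> carrier ?P" if f: "f \<in> carrier ?P" for x f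
      unfolding rep_power_simps(5) by (rule rep_power_I) (simp add: mem[OF f])
    show "(c + d) \<odot>\<^bsub>?P\<^esub> f = c \<odot>\<^bsub>?P\<^esub> f \<oplus>\<^bsub>?P\<^esub> d \<odot>\<^bsub>?P\<^esub> f" if f: "f \<in> carrier ?P" for c d f
      unfolding rep_power_simps(3,4) by (rule restrict_lt_ext) (simp add: V.sm_add mem[OF f])
    show "(c * d) \<odot>\<^bsub>?P\<^esub> f = c \<odot>\<^bsub>?P\<^esub> (d \<odot>\<^bsub>?P\<^esub> f)" if f: "f \<in> carrier ?P" for c d f
      unfolding rep_power_simps(3,4) by (rule restrict_lt_ext) (simp add: V.sm_mult mem[OF f])
    show "c \<odot>\<^bsub>?P\<^esub> (f \<oplus>\<^bsub>?P\<^esub> g) = c \<odot>\<^bsub>?P\<^esub> f \<oplus>\<^bsub>?P\<^esub> c \<odot>\<^bsub>?P\<^esub> g" if f: "f \<in> carrier ?P" and g: "g \<in> carrier ?P" for c f g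
      unfolding rep_power_simps(3,4) by (rule restrict_lt_ext) (simp add: V.sm_addr mem[OF f] mem[OF g])
    show "act ?P x (f \<oplus>\<^bsub>?P\<^esub> g) = act ?P x f \<oplus>\<^bsub>?P\<^esub> act ?P x g" if f: "f \<in> carrier ?P" and g: "g \<in> carrier ?P" for x f g
      unfolding rep_power_simps(3,5) by (rule restrict_lt_ext) (simp add: V.act_add mem[OF f] mem[OF g])
    show "act ?P x (c \<odot>\<^bsub>?P\<^esub> f) = c \<odot>\<^bsub>?P\<^esub> act ?P x f" if f: "f \<in> carrier ?P" for x c f
      unfolding rep_power_simps(4,5) by (rule restrict_lt_ext) (simp add: V.act_sm mem[OF f])
    fix f assume f: "f \<in> carrier ?P"
    show "act ?P gE (act ?P gF f) = act ?P gH f \<oplus>\<^bsub>?P\<^esub> act ?P gF (act ?P gE f)"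
      unfolding rep_power_simps(3,5) by (rule restrict_lt_ext) (simp add: V.rel_EF mem[OF f])
    show "act ?P gH (act ?P gE f) = 2 \<odot>\<^bsub>?P\<^esub> act ?P gE f \<oplus>\<^bsub>?P\<^esub> act ?P gE (act ?P gH f)"
      unfolding rep_power_simps(3-5) by (rule restrict_lt_ext) (simp add: V.rel_HE mem[OF f])
    show "act ?P gH (act ?P gF f) = (-2) \<odot>\<^bsub>?P\<^esub> act ?P gF f \<oplus>\<^bsub>?P\<^esub> act ?P gF (act ?P gH f)"
      unfolding rep_power_simps(3-5) by (rule restrict_lt_ext) (simp add: V.rel_HF mem[OF f])
  qed
qed

lemma uact_power: "v \<in> carrier (rep_power r V) \<Longrightarrow> sl2_rep V \<Longrightarrow> uact (rep_power r V) a v = (\<lambda>i\<in>{..<r}. uact V a (v i))"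
proof -
  assume v: "v \<in> carrier (rep_power r V)" and V: "sl2_rep V"
  interpret V: sl2 V by (rule sl2.intro[OF V])
  show ?thesis using v
  proof (induction a arbitrary: v)
    case (UMul a b)
    have cl: "(\<lambda>i\<in>{..<r}. uact V b (v i)) \<in> carrier (rep_power r V)"
      using UMul.prems by (auto simp: rep_power_def)
    show ?case unfolding uact.simps UMul.IH(2)[OF UMul.prems] UMul.IH(1)[OF cl] by (rule restrict_ext) simp
  qed (auto simp: rep_power_def intro!: restrict_ext)
qed

subsection \<open>The irreducible representation of highest weight \<open>n\<close>\<close>

text \<open>Coefficient sequences of polynomials of degree at most \<open>n\<close>, with the action given by the
  operators on \<open>U\<^sub>0\<close>.\<close>

definition Lstd :: "nat \<Rightarrow> (nat \<Rightarrow> complex) sl2rep" where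
  "Lstd n = \<lparr>carrier = {a. \<forall>k>n. a k = 0}, mult = undefined, one = undefined, zero = (\<lambda>_. 0),
     add = (\<lambda>a b k. a k + b k), smult = (\<lambda>c a k. c * a k),
     act = (\<lambda>x a k. case x of
        gE \<Rightarrow> (if k = 0 then 0 else (of_nat (k - 1) - of_nat n) * a (k - 1))
      | gF \<Rightarrow> - (of_nat (Suc k) * a (Suc k))
      | gH \<Rightarrow> (2 * of_nat k - of_nat n) * a k)\<rparr>"

lemma Lstd_simps [simp]:
  "a \<in> carrier (Lstd n) \<longleftrightarrow> (\<forall>k>n. a k = 0)" "\<zero>\<^bsub>Lstd n\<^esub> = (\<lambda>_. 0)"
  "a \<oplus>\<^bsub>Lstd n\<^esub> b = (\<lambda>k. a k + b k)" "c \<odot>\<^bsub>Lstd n\<^esub> a = (\<lambda>k. c * a k)"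
  "act (Lstd n) gE a = (\<lambda>k. if k = 0 then 0 else (of_nat (k - 1) - of_nat n) * a (k - 1))"
  "act (Lstd n) gF a = (\<lambda>k. - (of_nat (Suc k) * a (Suc k)))"
  "act (Lstd n) gH a = (\<lambda>k. (2 * of_nat k - of_nat n) * a k)"
  by (simp_all add: Lstd_def)

lemma Lstd_rep: "sl2_rep (Lstd n)"
proof (rule sl2_repI)
  show "abelian_group (Lstd n)"
  proof (rule abelian_groupI)
    fix a assume "a \<in> carrier (Lstd n)"
    then show "\<exists>b\<in>carrier (Lstd n). b \<oplus>\<^bsub>Lstd n\<^esub> a = \<zero>\<^bsub>Lstd n\<^esub>"
      by (intro bexI[of _ "\<lambda>k. - a k"]) auto
  qed (auto simp: algebra_simps)
next
  fix x a assume a: "a \<in> carrier (Lstd n)"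
  show "act (Lstd n) x a \<in> carrier (Lstd n)"
  proof (cases x)
    case gE
    \<comment> \<open>At \<open>k = n + 1\<close> the entry \<open>a n\<close> may be nonzero, and
      the factor vanishes instead.\<close>
    have "(of_nat (k - 1) - of_nat n) * a (k - 1) = 0" if "k > n" for k
      using that a by (cases "k - 1 = n") auto
    then show ?thesis using gE by simp
  qed (use a in auto)
  fix b assume b: "b \<in> carrier (Lstd n)"
  show "act (Lstd n) x (a \<oplus>\<^bsub>Lstd n\<^esub> b) = act (Lstd n) x a \<oplus>\<^bsub>Lstd n\<^esub> act (Lstd n) x b"
    by (cases x) (auto simp: algebra_simps fun_eq_iff)
next
  fix x c a
  show "act (Lstd n) x (c \<odot>\<^bsub>Lstd n\<^esub> a) = c \<odot>\<^bsub>Lstd n\<^esub> act (Lstd n) x a"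
    by (cases x) (auto simp: algebra_simps fun_eq_iff)
next
  fix a
  show "act (Lstd n) gE (act (Lstd n) gF a) = act (Lstd n) gH a \<oplus>\<^bsub>Lstd n\<^esub> act (Lstd n) gF (act (Lstd n) gE a)"
  proof
    fix k
    show "act (Lstd n) gE (act (Lstd n) gF a) k = (act (Lstd n) gH a \<oplus>\<^bsub>Lstd n\<^esub> act (Lstd n) gF (act (Lstd n) gE a)) k"
      by (cases k) (auto simp: algebra_simps)
  qed
  show "act (Lstd n) gH (act (Lstd n) gE a) = 2 \<odot>\<^bsub>Lstd n\<^esub> act (Lstd n) gE a \<oplus>\<^bsub>Lstd n\<^esub> act (Lstd n) gE (act (Lstd n) gH a)"
  proof
    fix k
    show "act (Lstd n) gH (act (Lstd n) gE a) k = (2 \<odot>\<^bsub>Lstd n\<^esub> act (Lstd n) gE a \<oplus>\<^bsub>Lstd n\<^esub> act (Lstd n) gE (act (Lstd n) gH a)) k"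
      by (cases k) (auto simp: algebra_simps)
  qed
  show "act (Lstd n) gH (act (Lstd n) gF a) = (-2) \<odot>\<^bsub>Lstd n\<^esub> act (Lstd n) gF a \<oplus>\<^bsub>Lstd n\<^esub> act (Lstd n) gF (act (Lstd n) gH a)"
    by (auto simp: algebra_simps fun_eq_iff)
qed (auto simp: algebra_simps)

definition ebas :: "nat \<Rightarrow> nat \<Rightarrow> complex" where
  "ebas j = (\<lambda>k. if k = j then 1 else 0)"

lemma Lstd_spanned:
  assumes S: "(\<lambda>_. 0) \<in> S" "\<And>a b. a \<in> S \<Longrightarrow> b \<in> S \<Longrightarrow> (\<lambda>k. a k + b k) \<in> S"
    "\<And>c a. a \<in> S \<Longrightarrow> (\<lambda>k. c * a k) \<in> S" "\<And>j. j \<le> n \<Longrightarrow> ebas j \<in> S" and a: "a \<in> carrier (Lstd n)"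
  shows "a \<in> S"
proof -
  have "(\<lambda>k. if k < l then a k else 0) \<in> S" if "l \<le> Suc n" for l
    using that
  proof (induction l)
    case (Suc l)
    have "(\<lambda>k. (if k < l then a k else 0) + a l * ebas l k) \<in> S"
      using Suc by (intro S(2) S(3) S(4)) auto
    also have "(\<lambda>k. (if k < l then a k else 0) + a l * ebas l k) = (\<lambda>k. if k < Suc l then a k else 0)"
      by (auto simp: ebas_def less_Suc_eq)
    finally show ?case .
  qed (use S(1) in simp)
  from this[of "Suc n"] have "(\<lambda>k. if k < Suc n then a k else 0) \<in> S" by simp
  moreover have "(\<lambda>k. if k < Suc n then a k else 0) = a" using a by (auto simp: fun_eq_iff)
  ultimately show ?thesis by simp
qed

lemma Lstd_act_linear:
  "act (Lstd n) x (\<lambda>k. a k + b k) = (\<lambda>k. act (Lstd n) x a k + act (Lstd n) x b k)"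
  "act (Lstd n) x (\<lambda>k. c * a k) = (\<lambda>k. c * act (Lstd n) x a k)"
  by (cases x; auto simp: algebra_simps fun_eq_iff)+

lemma act_ebas:
  "act (Lstd n) gE (ebas j) = (\<lambda>k. (of_nat j - of_nat n) * ebas (Suc j) k)"
  "act (Lstd n) gF (ebas j) = (\<lambda>k. - of_nat j * ebas (j - 1) k)"
  "act (Lstd n) gH (ebas j) = (\<lambda>k. (2 * of_nat j - of_nat n) * ebas j k)"
  by (auto simp: ebas_def fun_eq_iff)

text \<open>\<open>ebas 0\<close> is a lowest weight vector, and \<open>E\<close> maps
  \<open>ebas j\<close> to \<open>j - n\<close> times \<open>ebas (Suc j)\<close>, a nonzero
  multiple below the top.\<close>

lemma Lstd_generated:
  assumes S: "(\<lambda>_. 0) \<in> S" "\<And>a b. a \<in> S \<Longrightarrow> b \<in> S \<Longrightarrow> (\<lambda>k. a k + b k) \<in> S"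
    "\<And>c a. a \<in> S \<Longrightarrow> (\<lambda>k. c * a k) \<in> S" "\<And>a. a \<in> S \<Longrightarrow> act (Lstd n) gE a \<in> S" "ebas 0 \<in> S"
    and a: "a \<in> carrier (Lstd n)"
  shows "a \<in> S"
proof (rule Lstd_spanned[OF S(1-3) _ a])
  show "ebas j \<in> S" if "j \<le> n" for j using that
  proof (induction j)
    case (Suc j)
    then have nz: "(of_nat j :: complex) - of_nat n \<noteq> 0" by auto
    have "(\<lambda>k. inverse (of_nat j - of_nat n) * act (Lstd n) gE (ebas j) k) \<in> S"
      using Suc by (intro S(3) S(4)) auto
    then show ?case using nz by (simp add: act_ebas(1) mult.assoc[symmetric] del: Lstd_simps)
  qed (rule S(5))
qed

text \<open>\<open>F\<close> is minus differentiation, so it brings any nonzero vector down to a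
  multiple of \<open>ebas 0\<close>, from which \<open>E\<close> regenerates everything.\<close>

lemma Lstd_irreducible: "irreducible_rep (Lstd n)"
  unfolding irreducible_rep_def
proof (intro conjI allI impI Lstd_rep)
  interpret L: sl2 "Lstd n" by (rule sl2.intro[OF Lstd_rep])
  have "ebas 0 \<in> carrier (Lstd n)" "ebas 0 \<noteq> (\<lambda>_. 0)" by (auto simp: ebas_def fun_eq_iff)
  then show "carrier (Lstd n) \<noteq> {\<zero>\<^bsub>Lstd n\<^esub>}" unfolding Lstd_simps(2) by blast
  fix W assume W: "submodule W complex_ring (Lstd n) \<and> (\<forall>x. act (Lstd n) x ` W \<subseteq> W)"
  have sub: "W \<subseteq> carrier (Lstd n)" "(\<lambda>_. 0) \<in> W" "\<And>a b. a \<in> W \<Longrightarrow> b \<in> W \<Longrightarrow> (\<lambda>k. a k + b k) \<in> W"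
    "\<And>c a. a \<in> W \<Longrightarrow> (\<lambda>k. c * a k) \<in> W" "\<And>x a. a \<in> W \<Longrightarrow> act (Lstd n) x a \<in> W"
    using L.subrepD[of W] W by (auto simp: image_subset_iff simp del: Lstd_simps(1,5-7))
  show "W = {\<zero>\<^bsub>Lstd n\<^esub>} \<or> W = carrier (Lstd n)"
  proof (cases "W \<subseteq> {\<lambda>_. 0}")
    case True
    then have "W = {\<lambda>_. 0}" using sub(2) by blast
    then show ?thesis by simp
  next
    case False
    then obtain v where v: "v \<in> W" "v \<noteq> (\<lambda>_. 0)" by blast
    have "ebas 0 \<in> W" if "v \<in> W" "v \<noteq> (\<lambda>_. 0)" "\<forall>k>l. v k = 0" for v l
      using that
    proof (induction l arbitrary: v)
      case 0
      then have ve: "v = (\<lambda>k. v 0 * ebas 0 k)" by (auto simp: ebas_def fun_eq_iff)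
      then have nz: "v 0 \<noteq> 0" using 0(2) by auto
      have "(\<lambda>k. inverse (v 0) * v k) \<in> W" by (rule sub(4)[OF 0(1)])
      moreover have "(\<lambda>k. inverse (v 0) * v k) = ebas 0"
        using nz 0(3) by (auto simp: ebas_def fun_eq_iff)
      ultimately show ?case by simp
    next
      case (Suc l)
      show ?case
      proof (cases "v (Suc l) = 0")
        case True
        then have "\<forall>k>l. v k = 0" using Suc.prems(3) by (metis Suc_lessI)
        then show ?thesis using Suc.IH Suc.prems by blast
      next
        case False
        have "act (Lstd n) gF v l \<noteq> 0" using False of_nat_neq_0[of l] by (simp del: of_nat_Suc)
        then have "act (Lstd n) gF v \<noteq> (\<lambda>_. 0)" by (metis)
        moreover have "\<forall>k>l. act (Lstd n) gF v k = 0" using Suc.prems(3) by simp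
        ultimately show ?thesis using Suc.IH sub(5)[OF Suc.prems(1)] by blast
      qed
    qed
    from this[OF v, of n] have "ebas 0 \<in> W" using v(1) sub(1) by auto
    then have "carrier (Lstd n) \<subseteq> W" using Lstd_generated[OF sub(2-4) sub(5)] by blast
    then show ?thesis using sub(1) by blast
  qed
qed

lemma Lstd_highest: "has_highest_weight (Lstd n) (of_nat n)"
  unfolding has_highest_weight_def
proof (intro bexI[of _ "ebas n"] conjI)
  show "ebas n \<noteq> \<zero>\<^bsub>Lstd n\<^esub>" by (auto simp: ebas_def fun_eq_iff)
qed (auto simp: act_ebas simp del: Lstd_simps(5-7), auto simp: ebas_def)

lemma Lstd_finite_dim: "finite_dim (Lstd n)"
  unfolding finite_dim_def
proof (intro exI[of _ "ebas ` {..n}"] conjI ballI)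
  interpret L: sl2 "Lstd n" by (rule sl2.intro[OF Lstd_rep])
  show "ebas ` {..n} \<subseteq> carrier (Lstd n)" by (auto simp: ebas_def)
  fix v assume v: "v \<in> carrier (Lstd n)"
  have inj: "inj_on ebas {..n}"
    by (rule inj_onI) (metis ebas_def zero_neq_one)
  define c where "c = (\<lambda>b. v (the_inv_into {..n} ebas b))"
  have ce: "c (ebas j) = v j" if "j \<le> n" for j using that by (simp add: c_def the_inv_into_f_f[OF inj])
  have cl: "(\<lambda>j. v j \<odot>\<^bsub>Lstd n\<^esub> ebas j) \<in> {..m} \<rightarrow> carrier (Lstd n)" if "m \<le> n" for m
    using that by (auto simp: ebas_def)
  have part: "finsum (Lstd n) (\<lambda>j. v j \<odot>\<^bsub>Lstd n\<^esub> ebas j) {..m} = (\<lambda>k. if k \<le> m then v k else 0)" if "m \<le> n" for m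
    using that
  proof (induction m)
    case 0
    show ?case using L.finsum_insert[of "{}" 0 "\<lambda>j. v j \<odot>\<^bsub>Lstd n\<^esub> ebas j"] by (auto simp: ebas_def)
  next
    case (Suc m)
    have "finsum (Lstd n) (\<lambda>j. v j \<odot>\<^bsub>Lstd n\<^esub> ebas j) {..Suc m} =
        (v (Suc m) \<odot>\<^bsub>Lstd n\<^esub> ebas (Suc m)) \<oplus>\<^bsub>Lstd n\<^esub> finsum (Lstd n) (\<lambda>j. v j \<odot>\<^bsub>Lstd n\<^esub> ebas j) {..m}"
      by (rule L.finsum_Suc[OF cl[OF Suc.prems]])
    also have "\<dots> = (\<lambda>k. if k \<le> Suc m then v k else 0)"
      using Suc by (auto simp: ebas_def fun_eq_iff le_Suc_eq)
    finally show ?case .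
  qed
  have "finsum (Lstd n) (\<lambda>b. c b \<odot>\<^bsub>Lstd n\<^esub> b) (ebas ` {..n}) = finsum (Lstd n) (\<lambda>j. c (ebas j) \<odot>\<^bsub>Lstd n\<^esub> ebas j) {..n}"
    by (rule L.finsum_reindex[OF _ inj]) (auto simp: ebas_def)
  also have "\<dots> = finsum (Lstd n) (\<lambda>j. v j \<odot>\<^bsub>Lstd n\<^esub> ebas j) {..n}"
    by (rule L.finsum_cong'[OF HOL.refl cl]) (auto simp: ce)
  also have "\<dots> = v" using v unfolding part[OF order_refl] by (auto simp: fun_eq_iff)
  finally show "\<exists>c. v = finsum (Lstd n) (\<lambda>b. c b \<odot>\<^bsub>Lstd n\<^esub> b) (ebas ` {..n})" by metis
qed simp

text \<open>The weight \<open>-n\<close> occurs only in multiples of \<open>ebas 0\<close>, so a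
  central element, commuting with \<open>H\<close>, scales this vector; commuting with
  \<open>E\<close>, it scales all that \<open>E\<close> generates from it by the same
  number.\<close>

lemma Lstd_central_scalar:
  assumes z: "ucentral z"
  shows "\<exists>c. \<forall>v\<in>carrier (Lstd n). uact (Lstd n) z v = c \<odot>\<^bsub>Lstd n\<^esub> v"
proof -
  interpret L: sl2 "Lstd n" by (rule sl2.intro[OF Lstd_rep])
  have e0: "ebas 0 \<in> carrier (Lstd n)" by (auto simp: ebas_def)
  define w where "w = uact (Lstd n) z (ebas 0)"
  have w: "w \<in> carrier (Lstd n)" unfolding w_def by (rule L.uact_closed[OF e0])
  have "act (Lstd n) gH (ebas 0) = (- of_nat n) \<odot>\<^bsub>Lstd n\<^esub> ebas 0" unfolding act_ebas(3) by simp
  then have "act (Lstd n) gH w = (- of_nat n) \<odot>\<^bsub>Lstd n\<^esub> w"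
    unfolding w_def using L.ucentral_commutes[OF z e0, of gH] L.uact_sm[OF e0, of z "- of_nat n"] by metis
  then have "(2 * of_nat k - of_nat n) * w k = - of_nat n * w k" for k by (simp add: fun_eq_iff)
  then have "2 * of_nat k * w k = 0" for k by (simp add: algebra_simps)
  then have wk: "w k = 0" if "k > 0" for k using that by (metis mult_eq_0_iff of_nat_eq_0_iff zero_neq_numeral not_gr0)
  have we: "w = (\<lambda>k. w 0 * ebas 0 k)" using wk by (auto simp: ebas_def fun_eq_iff)
  define S where "S = {v \<in> carrier (Lstd n). uact (Lstd n) z v = w 0 \<odot>\<^bsub>Lstd n\<^esub> v}"
  have "v \<in> S" if v: "v \<in> carrier (Lstd n)" for v
  proof (rule Lstd_generated[OF _ _ _ _ _ v])
    show "(\<lambda>_. 0) \<in> S" using L.uact_sm[OF e0, of z 0] by (simp add: S_def)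
    show "ebas 0 \<in> S" using e0 we by (simp add: S_def w_def[symmetric])
    show "act (Lstd n) gE a \<in> S" if "a \<in> S" for a
      using that L.ucentral_commutes[OF z, of a gE] L.act_sm[of a gE "w 0"] L.act_closed[of a gE] by (simp add: S_def del: Lstd_simps)
    show "(\<lambda>k. c * a k) \<in> S" if "a \<in> S" for c a
      using that L.uact_sm[of a z c] by (auto simp: S_def algebra_simps)
    show "(\<lambda>k. a k + b k) \<in> S" if "a \<in> S" "b \<in> S" for a b
      using that L.uact_add[of a b z] by (auto simp: S_def algebra_simps)
  qed
  then show ?thesis unfolding S_def by blast
qed

subsection \<open>Uniqueness of the irreducible representation\<close>

lemma fact_ratio: "of_nat (Suc j) * (fact j / fact n) = (fact (Suc j) / fact n :: complex)"
  by simp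

locale highest_weight = sl2 V for V :: "'v sl2rep" (structure) +
  fixes n :: nat and v :: 'v
  assumes v: "v \<in> carrier V" and Ev: "act V gE v = \<zero>" and Hv: "act V gH v = of_nat n \<odot> v"
begin

definition u :: "nat \<Rightarrow> 'v" where "u i = (act V gF ^^ i) v"

lemma u_closed [simp, intro]: "u i \<in> carrier V"
  unfolding u_def by (induction i) (auto simp: v)

lemma F_u: "act V gF (u i) = u (Suc i)"
  by (simp add: u_def)

lemma sm_sm: "w \<in> carrier V \<Longrightarrow> c \<odot> (d \<odot> w) = (c * d) \<odot> w"
  by (simp add: sm_mult)

lemma H_u: "act V gH (u i) = (of_nat n - 2 * of_nat i) \<odot> u i"
proof (induction i)
  case 0
  show ?case by (simp add: u_def Hv)
next
  case (Suc i)
  have "act V gH (u (Suc i)) = (-2) \<odot> u (Suc i) \<oplus> act V gF (act V gH (u i))"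
    using rel_HF[of "u i"] by (simp add: F_u)
  also have "act V gF (act V gH (u i)) = (of_nat n - 2 * of_nat i) \<odot> u (Suc i)"
    by (simp add: Suc act_sm F_u)
  also have "(-2) \<odot> u (Suc i) \<oplus> (of_nat n - 2 * of_nat i) \<odot> u (Suc i) = (-2 + (of_nat n - 2 * of_nat i)) \<odot> u (Suc i)"
    by (rule sm_add[symmetric]) simp
  also have "-2 + (of_nat n - 2 * of_nat i) = (of_nat n - 2 * of_nat (Suc i) :: complex)" by simp
  finally show ?case .
qed

text \<open>By \<open>E F = H + F E\<close> each step adds a weight \<open>n - 2 i\<close>. The
  resulting coefficient \<open>(i + 1) (n - i)\<close> vanishes exactly at \<open>i = n\<close>,
  where the finite-dimensional string ends.\<close>

lemma E_u: "act V gE (u (Suc i)) = (of_nat (Suc i) * (of_nat n - of_nat i)) \<odot> u i"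
proof (induction i)
  case 0
  have "act V gE (u (Suc 0)) = act V gH (u 0) \<oplus> act V gF (act V gE (u 0))"
    using rel_EF[of "u 0"] by (simp add: F_u)
  also have "act V gE (u 0) = \<zero>" by (simp add: u_def Ev)
  finally show ?case by (simp add: H_u)
next
  case (Suc i)
  have "act V gE (u (Suc (Suc i))) = act V gH (u (Suc i)) \<oplus> act V gF (act V gE (u (Suc i)))"
    using rel_EF[of "u (Suc i)"] by (simp add: F_u)
  also have "act V gF (act V gE (u (Suc i))) = (of_nat (Suc i) * (of_nat n - of_nat i)) \<odot> u (Suc i)"
    unfolding Suc by (simp only: act_sm[OF u_closed] F_u)
  also have "act V gH (u (Suc i)) = (of_nat n - 2 * of_nat (Suc i)) \<odot> u (Suc i)" by (rule H_u)
  also have "(of_nat n - 2 * of_nat (Suc i)) \<odot> u (Suc i) \<oplus> (of_nat (Suc i) * (of_nat n - of_nat i)) \<odot> u (Suc i) =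
      ((of_nat n - 2 * of_nat (Suc i)) + of_nat (Suc i) * (of_nat n - of_nat i)) \<odot> u (Suc i)"
    by (rule sm_add[symmetric]) simp
  also have "(of_nat n - 2 * of_nat (Suc i)) + of_nat (Suc i) * (of_nat n - of_nat i) =
      (of_nat (Suc (Suc i)) * (of_nat n - of_nat (Suc i)) :: complex)" by (simp add: algebra_simps)
  finally show ?case .
qed

text \<open>The vectors \<open>u\<^sub>i\<close> with \<open>i > n\<close> span a subrepresentation with weights below \<open>-n\<close>, so it does
  not contain \<open>v\<close>; in an irreducible representation it must vanish.\<close>

primrec WN :: "nat \<Rightarrow> 'v set" where
  "WN 0 = {\<zero>}"
| "WN (Suc N) = {w \<oplus> c \<odot> u (Suc n + N) | w c. w \<in> WN N}"

lemma WN_SucI: "w \<in> WN N \<Longrightarrow> w \<oplus> c \<odot> u (Suc n + N) \<in> WN (Suc N)"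
  by auto

lemma WN_sub: "WN N \<subseteq> carrier V"
  by (induction N) auto

lemma WN_Suc: "WN N \<subseteq> WN (Suc N)"
proof
  fix w assume w: "w \<in> WN N"
  have "w \<in> carrier V" using w by (rule subsetD[OF WN_sub])
  then have "w = w \<oplus> 0 \<odot> u (Suc n + N)" by simp
  then show "w \<in> WN (Suc N)" using WN_SucI[OF w, of 0] by simp
qed

lemma WN_mono: "N \<le> N' \<Longrightarrow> WN N \<subseteq> WN N'"
  by (rule lift_Suc_mono_le[of WN]) (rule WN_Suc)

lemma WN_add: "w \<in> WN N \<Longrightarrow> w' \<in> WN N \<Longrightarrow> w \<oplus> w' \<in> WN N"
proof (induction N arbitrary: w w')
  case (Suc N)
  then obtain x c y d where x: "x \<in> WN N" "w = x \<oplus> c \<odot> u (Suc n + N)" and y: "y \<in> WN N" "w' = y \<oplus> d \<odot> u (Suc n + N)"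
    by auto
  have xy: "x \<in> carrier V" "y \<in> carrier V" using x y WN_sub by auto
  have "w \<oplus> w' = (x \<oplus> y) \<oplus> (c + d) \<odot> u (Suc n + N)"
    unfolding x y sm_add[OF u_closed] using xy by (simp add: a_ac)
  then show ?case using WN_SucI[OF Suc.IH[OF x(1) y(1)]] by simp
qed simp

lemma WN_sm: "w \<in> WN N \<Longrightarrow> c \<odot> w \<in> WN N"
proof (induction N arbitrary: w)
  case (Suc N)
  then obtain x d where x: "x \<in> WN N" "w = x \<oplus> d \<odot> u (Suc n + N)" by auto
  have "c \<odot> w = c \<odot> x \<oplus> (c * d) \<odot> u (Suc n + N)"
    unfolding x using x(1) WN_sub by (subst sm_addr) (auto simp: sm_mult)
  then show ?case using WN_SucI[OF Suc.IH[OF x(1)]] by simp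
qed simp

lemma WN_u: "u (Suc n + N) \<in> WN (Suc N)"
proof -
  have "\<zero> \<in> WN N" using WN_mono[of 0 N] by auto
  from WN_SucI[OF this, of 1] show ?thesis by simp
qed

lemma WN_H: "w \<in> WN N \<Longrightarrow> act V gH w \<in> WN N"
proof (induction N arbitrary: w)
  case (Suc N)
  then obtain x d where x: "x \<in> WN N" "w = x \<oplus> d \<odot> u (Suc n + N)" by auto
  have "act V gH w = act V gH x \<oplus> (d * (of_nat n - 2 * of_nat (Suc n + N))) \<odot> u (Suc n + N)"
    unfolding x using x(1) WN_sub by (subst act_add) (auto simp: sm_mult act_sm H_u simp del: of_nat_Suc of_nat_add)
  then show ?case using WN_SucI[OF Suc.IH[OF x(1)]] by simp
qed simp

lemma WN_F: "w \<in> WN N \<Longrightarrow> act V gF w \<in> WN (Suc N)"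
proof (induction N arbitrary: w)
  case 0
  then show ?case using WN_mono[of 0 1] by auto
next
  case (Suc N)
  then obtain x d where x: "x \<in> WN N" "w = x \<oplus> d \<odot> u (Suc n + N)" by auto
  have "act V gF w = act V gF x \<oplus> d \<odot> u (Suc n + Suc N)"
    unfolding x using x(1) WN_sub by (subst act_add) (auto simp: act_sm F_u)
  then show ?case using WN_SucI[OF Suc.IH[OF x(1)]] by simp
qed

lemma WN_E: "w \<in> WN N \<Longrightarrow> act V gE w \<in> WN N"
proof (induction N arbitrary: w)
  case (Suc N)
  then obtain x d where x: "x \<in> WN N" "w = x \<oplus> d \<odot> u (Suc n + N)" by auto
  have "act V gE w = act V gE x \<oplus> d \<odot> act V gE (u (Suc n + N))"
    unfolding x using x(1) WN_sub by (subst act_add) (auto simp: act_sm)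
  moreover have "act V gE (u (Suc n + N)) \<in> WN (Suc N)"
  proof (cases N)
    case 0
    \<comment> \<open>The factor \<open>of_nat n - of_nat n\<close> in \<open>E_u\<close> vanishes,
      so \<open>E\<close> does not lead out of the span at its upper end.\<close>
    have "act V gE (u (Suc n)) = \<zero>" unfolding E_u by simp
    then show ?thesis using WN_mono[of 0 "Suc N"] 0 by auto
  next
    case (Suc j)
    have "act V gE (u (Suc (Suc n + j))) \<in> WN (Suc j)" unfolding E_u by (rule WN_sm[OF WN_u])
    then have "act V gE (u (Suc (Suc n + j))) \<in> WN (Suc (Suc j))" by (rule subsetD[OF WN_Suc])
    then show ?thesis using Suc by (simp del: WN.simps)
  qed
  moreover have "act V gE x \<in> WN (Suc N)" by (rule subsetD[OF WN_Suc Suc.IH[OF x(1)]])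
  ultimately show ?case using WN_add[OF _ WN_sm] by (simp del: WN.simps)
qed simp

text \<open>With \<open>?\<mu>\<close> the weight of the last basis vector,
  \<open>H - ?\<mu>\<close> removes that vector, while on \<open>v\<close> it is multiplication by
  \<open>2 (n + 1 + N)\<close>, which is nonzero; so \<open>v\<close> already lies in
  \<open>WN N\<close>.\<close>

lemma WN_v: "v \<in> WN N \<Longrightarrow> v = \<zero>"
proof (induction N)
  case (Suc N)
  then obtain x d where x: "x \<in> WN N" "v = x \<oplus> d \<odot> u (Suc n + N)" by auto
  have xc: "x \<in> carrier V" using x(1) WN_sub by auto
  let ?\<mu> = "of_nat n - 2 * of_nat (Suc n + N) :: complex"
  have "act V gH v = act V gH x \<oplus> d \<odot> (?\<mu> \<odot> u (Suc n + N))"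
    by (subst x(2), subst act_add) (use xc in \<open>auto simp: act_sm H_u simp del: of_nat_Suc of_nat_add\<close>)
  moreover have "(- ?\<mu>) \<odot> v = (- ?\<mu>) \<odot> x \<oplus> (- ?\<mu>) \<odot> (d \<odot> u (Suc n + N))"
    by (subst x(2), rule sm_addr) (use xc in auto)
  ultimately have "act V gH v \<oplus> (- ?\<mu>) \<odot> v = (act V gH x \<oplus> (- ?\<mu>) \<odot> x) \<oplus>
      (d \<odot> (?\<mu> \<odot> u (Suc n + N)) \<oplus> (- ?\<mu>) \<odot> (d \<odot> u (Suc n + N)))"
    using xc by (simp add: a_ac del: of_nat_Suc of_nat_add)
  also have "d \<odot> (?\<mu> \<odot> u (Suc n + N)) \<oplus> (- ?\<mu>) \<odot> (d \<odot> u (Suc n + N)) = (d * ?\<mu> + - ?\<mu> * d) \<odot> u (Suc n + N)"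
    by (simp only: sm_add[OF u_closed] sm_mult[OF u_closed])
  also have "d * ?\<mu> + - ?\<mu> * d = 0" by (simp add: algebra_simps)
  also have "act V gH x \<oplus> (- ?\<mu>) \<odot> x \<oplus> 0 \<odot> u (Suc n + N) = act V gH x \<oplus> (- ?\<mu>) \<odot> x" using xc by simp
  finally have e: "act V gH v \<oplus> (- ?\<mu>) \<odot> v \<in> WN N" using WN_add[OF WN_H[OF x(1)] WN_sm[OF x(1)]] by simp
  have "act V gH v \<oplus> (- ?\<mu>) \<odot> v = (of_nat n + - ?\<mu>) \<odot> v" unfolding Hv by (rule sm_add[OF v, symmetric])
  also have "of_nat n + - ?\<mu> = 2 * of_nat (Suc n + N)" by simp
  finally have e': "(2 * of_nat (Suc n + N)) \<odot> v \<in> WN N" using e by (simp only:)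
  have nz: "(2 * of_nat (Suc n + N) :: complex) \<noteq> 0" using of_nat_neq_0[of "n + N"] by (simp del: of_nat_Suc of_nat_add)
  have "inverse (2 * of_nat (Suc n + N)) \<odot> ((2 * of_nat (Suc n + N)) \<odot> v) = v"
    unfolding sm_sm[OF v] using nz v by (simp del: of_nat_Suc of_nat_add)
  then have "v \<in> WN N" using WN_sm[OF e', of "inverse (2 * of_nat (Suc n + N))"] by (simp only:)
  then show ?case by (rule Suc.IH)
qed simp

lemma u_top:
  assumes irr: "irreducible_rep V" and nz: "v \<noteq> \<zero>"
  shows "u (Suc n) = \<zero>"
proof -
  define W where "W = (\<Union>N. WN N)"
  have sub: "submodule W complex_ring V"
  proof (rule subrepI)
    show "W \<subseteq> carrier V" using WN_sub by (auto simp: W_def)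
    have "\<zero> \<in> WN 0" by simp
    then show "\<zero> \<in> W" unfolding W_def by blast
    fix x y assume "x \<in> W" "y \<in> W"
    then obtain N N' where "x \<in> WN N" "y \<in> WN N'" by (auto simp: W_def)
    then have "x \<in> WN (max N N')" "y \<in> WN (max N N')" using WN_mono by (meson max.cobounded1 max.cobounded2 subsetD)+
    then show "x \<oplus> y \<in> W" unfolding W_def using WN_add by blast
  next
    fix c x assume "x \<in> W"
    then show "c \<odot> x \<in> W" unfolding W_def using WN_sm by blast
  qed
  have "act V x ` W \<subseteq> W" for x
  proof (rule image_subsetI)
    fix w assume "w \<in> W"
    then obtain N where w: "w \<in> WN N" unfolding W_def by (rule UN_E)
    have WI: "y \<in> W" if "y \<in> WN N" for y N unfolding W_def using that by (rule UN_I[OF UNIV_I])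
    show "act V x w \<in> W" using WI[OF WN_E[OF w]] WI[OF WN_F[OF w]] WI[OF WN_H[OF w]] by (cases x) simp_all
  qed
  then have "W = {\<zero>} \<or> W = carrier V" using irr sub unfolding irreducible_rep_def by blast
  moreover have "v \<notin> W" using WN_v nz by (auto simp: W_def)
  ultimately have "W = {\<zero>}" using v by blast
  moreover have "u (Suc n) \<in> W" using WN_u[of 0] by (auto simp: W_def simp del: WN.simps)
  ultimately show ?thesis by blast
qed

text \<open>The solution of \<open>\<kappa> n = 1\<close> and
  \<open>- (j + 1) \<kappa> j = \<kappa> (j + 1)\<close>: the scaling for which \<open>b j\<close>
  transforms like \<open>ebas j\<close>, with \<open>b n = v\<close>.\<close>

definition \<kappa> :: "nat \<Rightarrow> complex" where
  "\<kappa> j = (-1) ^ (n - j) * (fact j / fact n)"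

definition b :: "nat \<Rightarrow> 'v" where
  "b j = \<kappa> j \<odot> u (n - j)"

lemma b_closed [simp, intro]: "b j \<in> carrier V"
  by (simp add: b_def)

lemma \<kappa>_Suc: "j < n \<Longrightarrow> - of_nat (Suc j) * \<kappa> j = \<kappa> (Suc j)"
proof -
  assume "j < n"
  then have "n - j = Suc (n - Suc j)" by simp
  then have e: "(-1 :: complex) ^ (n - j) = - ((-1) ^ (n - Suc j))" by simp
  have "- of_nat (Suc j) * \<kappa> j = (-1) ^ (n - Suc j) * (of_nat (Suc j) * (fact j / fact n))"
    unfolding \<kappa>_def e by (simp only: mult_minus_left mult_minus_right Groups.minus_minus mult.left_commute mult.assoc)
  then show ?thesis unfolding \<kappa>_def fact_ratio .
qed

lemma F_b_Suc: "j < n \<Longrightarrow> act V gF (b (Suc j)) = (- of_nat (Suc j)) \<odot> b j"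
proof -
  assume j: "j < n"
  have "act V gF (b (Suc j)) = \<kappa> (Suc j) \<odot> u (n - j)"
    unfolding b_def using j by (simp add: act_sm F_u Suc_diff_Suc)
  then show ?thesis unfolding b_def sm_sm[OF u_closed] \<kappa>_Suc[OF j] .
qed

lemma E_b: "j < n \<Longrightarrow> act V gE (b j) = (of_nat j - of_nat n) \<odot> b (Suc j)"
proof -
  assume j: "j < n"
  have "act V gE (b j) = \<kappa> j \<odot> act V gE (u (Suc (n - Suc j)))"
    unfolding b_def using j by (simp add: act_sm Suc_diff_Suc)
  also have "\<dots> = (\<kappa> j * (of_nat (Suc (n - Suc j)) * (of_nat n - of_nat (n - Suc j)))) \<odot> u (n - Suc j)"
    unfolding E_u by (simp add: sm_mult)
  also have "\<kappa> j * (of_nat (Suc (n - Suc j)) * (of_nat n - of_nat (n - Suc j))) = (of_nat j - of_nat n) * (- of_nat (Suc j) * \<kappa> j)"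
    using j by (simp add: Suc_diff_Suc of_nat_diff algebra_simps)
  finally show ?thesis unfolding b_def sm_sm[OF u_closed] \<kappa>_Suc[OF j] .
qed

lemma H_b: "j \<le> n \<Longrightarrow> act V gH (b j) = (2 * of_nat j - of_nat n) \<odot> b j"
proof -
  assume j: "j \<le> n"
  have "act V gH (b j) = (\<kappa> j * (of_nat n - 2 * of_nat (n - j))) \<odot> u (n - j)"
    unfolding b_def by (simp add: act_sm H_u sm_mult)
  also have "\<kappa> j * (of_nat n - 2 * of_nat (n - j)) = (2 * of_nat j - of_nat n) * \<kappa> j"
    using j by (simp add: of_nat_diff algebra_simps)
  finally show ?thesis unfolding b_def sm_sm[OF u_closed] .
qed

lemma b_top: "b n = v"
  by (simp add: b_def \<kappa>_def u_def v)

lemma E_b_top: "act V gE (b n) = \<zero>"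
  by (simp add: b_top Ev)

definition T :: "(nat \<Rightarrow> complex) \<Rightarrow> 'v" where
  "T a = finsum V (\<lambda>j. a j \<odot> b j) {..n}"

lemma T_closed [simp, intro]: "T a \<in> carrier V"
  unfolding T_def by (rule finsum_closed) auto

lemma T_add: "T (\<lambda>k. a k + a' k) = T a \<oplus> T a'"
  unfolding T_def by (subst finsum_addf[symmetric]) (auto simp: sm_add)

lemma T_sm: "T (\<lambda>k. c * a k) = c \<odot> T a"
proof -
  have "c \<odot> finsum V f A = finsum V (\<lambda>i. c \<odot> f i) A" if "f \<in> A \<rightarrow> carrier V" for f and A :: "nat set"
    using that
  proof (induction A rule: infinite_finite_induct)
    case (insert i A)
    then have 1: "f i \<in> carrier V" "f \<in> A \<rightarrow> carrier V" "(\<lambda>i. c \<odot> f i) \<in> A \<rightarrow> carrier V" by auto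
    then show ?case using insert finsum_closed[OF 1(2)] by (simp add: finsum_insert sm_addr)
  qed auto
  from this[of "\<lambda>j. a j \<odot> b j" "{..n}"] show ?thesis unfolding T_def by (simp add: sm_mult Pi_iff)
qed

lemma T_zero: "T (\<lambda>_. 0) = \<zero>"
  using T_sm[of 0 "\<lambda>_. 0"] by simp

lemma T_ebas: "j \<le> n \<Longrightarrow> T (ebas j) = b j"
proof -
  assume j: "j \<le> n"
  have "T (ebas j) = finsum V (\<lambda>i. if j = i then b i else \<zero>) {..n}"
    unfolding T_def by (rule finsum_cong') (auto simp: ebas_def)
  also have "\<dots> = b j" by (rule finsum_singleton) (use j in auto)
  finally show ?thesis .
qed

lemma T_hom:
  assumes irr: "irreducible_rep V" and nz: "v \<noteq> \<zero>"
  shows "restrict T (carrier (Lstd n)) \<in> rep_hom (Lstd n) V"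
proof -
  interpret L: sl2 "Lstd n" by (rule sl2.intro[OF Lstd_rep])
  have act: "T (act (Lstd n) x a) = act V x (T a)" if a: "a \<in> carrier (Lstd n)" for x a
  proof -
    define S where "S = {a. T (act (Lstd n) x a) = act V x (T a)}"
    have "a \<in> S"
    proof (rule Lstd_spanned[OF _ _ _ _ a])
      have z: "act (Lstd n) x (\<lambda>_. 0) = (\<lambda>_. 0)" using L.act_zero by simp
      show "(\<lambda>_. 0) \<in> S" unfolding S_def by (simp add: z T_zero)
      show "(\<lambda>k. a k + a' k) \<in> S" if "a \<in> S" "a' \<in> S" for a a'
        using that by (simp add: S_def Lstd_act_linear T_add act_add del: Lstd_simps)
      show "(\<lambda>k. c * a k) \<in> S" if "a \<in> S" for c a
        using that by (simp add: S_def Lstd_act_linear T_sm act_sm del: Lstd_simps)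
      show "ebas j \<in> S" if j: "j \<le> n" for j
      proof (cases x)
        case gE
        show ?thesis
        proof (cases "j = n")
          case True
          have "act (Lstd n) gE (ebas j) = (\<lambda>k. 0)" unfolding act_ebas True by simp
          then show ?thesis using gE True T_zero E_b_top T_ebas[of n] by (simp add: S_def del: Lstd_simps)
        next
          case False
          then have "j < n" using j by simp
          then show ?thesis using gE E_b[of j] T_ebas[of j] T_ebas[of "Suc j"] by (simp add: S_def act_ebas T_sm del: Lstd_simps)
        qed
      next
        case gF
        show ?thesis
        proof (cases j)
          case 0
          have "act (Lstd n) gF (ebas 0) = (\<lambda>k. 0)" unfolding act_ebas by simp
          \<comment> \<open>Up to a scalar this is \<open>u (Suc n)\<close>; irreducibility enters
            here through \<open>u_top\<close>.\<close>
          moreover have "act V gF (b 0) = \<zero>"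
            unfolding b_def using u_top[OF irr nz] by (simp add: act_sm F_u)
          ultimately show ?thesis using gF 0 T_zero T_ebas[of 0] by (simp add: S_def del: Lstd_simps)
        next
          case (Suc i)
          then show ?thesis using gF j F_b_Suc[of i] T_ebas[of "Suc i"] T_ebas[of i]
              T_sm[of "- of_nat (Suc i)" "ebas i"] by (simp add: S_def act_ebas del: Lstd_simps of_nat_Suc)
        qed
      next
        case gH
        then show ?thesis using H_b[OF j] T_ebas[OF j] by (simp add: S_def act_ebas T_sm del: Lstd_simps)
      qed
    qed
    then show ?thesis by (simp add: S_def)
  qed
  show ?thesis
    by (rule rep_homI) (use sl2_closed[OF Lstd_rep[of n]] in \<open>auto simp: act T_add[symmetric] T_sm[symmetric] simp del: Lstd_simps(1,5-7)\<close>)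
qed

end

text \<open>Schur: kernel and image are subrepresentations, and \<open>v\<close> excludes that the
  kernel is everything or the image zero.\<close>

lemma Schur_bij:
  assumes V: "irreducible_rep V" and W: "irreducible_rep W" and f: "f \<in> rep_hom V W"
    and nz: "v \<in> carrier V" "f v \<noteq> \<zero>\<^bsub>W\<^esub>"
  shows "bij_betw f (carrier V) (carrier W)"
proof -
  interpret V: sl2 V by (rule sl2.intro) (use V in \<open>simp add: irreducible_rep_def\<close>)
  interpret W: sl2 W by (rule sl2.intro) (use W in \<open>simp add: irreducible_rep_def\<close>)
  note h = rep_homD[OF f]
  have f0: "f \<zero>\<^bsub>V\<^esub> = \<zero>\<^bsub>W\<^esub>" using h(3)[OF V.zero_closed, of 0] h(1)[OF V.zero_closed] by simp
  define K where "K = {x \<in> carrier V. f x = \<zero>\<^bsub>W\<^esub>}"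
  have "submodule K complex_ring V" unfolding K_def by (rule V.subrepI) (auto simp: h f0)
  moreover have "act V x ` K \<subseteq> K" for x unfolding K_def by (auto simp: h)
  ultimately have "K = {\<zero>\<^bsub>V\<^esub>} \<or> K = carrier V" using V unfolding irreducible_rep_def by blast
  moreover have "v \<notin> K" using nz by (simp add: K_def)
  ultimately have K: "K = {\<zero>\<^bsub>V\<^esub>}" using nz by blast
  have inj: "inj_on f (carrier V)"
  proof (rule inj_onI)
    fix x y assume xy: "x \<in> carrier V" "y \<in> carrier V" "f x = f y"
    have "f (x \<oplus>\<^bsub>V\<^esub> (-1) \<odot>\<^bsub>V\<^esub> y) = f y \<oplus>\<^bsub>W\<^esub> (-1) \<odot>\<^bsub>W\<^esub> f y" using xy by (simp add: h)
    also have "\<dots> = \<zero>\<^bsub>W\<^esub>" using h(1)[OF xy(2)] by (simp add: W.sm_minus_one W.r_neg)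
    finally have "x \<oplus>\<^bsub>V\<^esub> (-1) \<odot>\<^bsub>V\<^esub> y \<in> K" using xy by (simp add: K_def)
    then have "x \<ominus>\<^bsub>V\<^esub> y = \<zero>\<^bsub>V\<^esub>" using K xy by (simp add: V.sm_minus_one a_minus_def)
    then show "x = y" using V.minus_eq_iff[of x y "\<zero>\<^bsub>V\<^esub>"] xy by simp
  qed
  define R where "R = f ` carrier V"
  have "submodule R complex_ring W"
  proof (rule W.subrepI)
    show "R \<subseteq> carrier W" using h(1) by (auto simp: R_def)
    show "\<zero>\<^bsub>W\<^esub> \<in> R" unfolding R_def using f0 V.zero_closed by (metis imageI)
    show "x \<oplus>\<^bsub>W\<^esub> y \<in> R" if "x \<in> R" "y \<in> R" for x y using that unfolding R_def by (auto simp: h(2)[symmetric])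
    show "c \<odot>\<^bsub>W\<^esub> x \<in> R" if "x \<in> R" for c x using that unfolding R_def by (auto simp: h(3)[symmetric])
  qed
  moreover have "act W x ` R \<subseteq> R" for x unfolding R_def by (auto simp: h(4)[symmetric])
  ultimately have "R = {\<zero>\<^bsub>W\<^esub>} \<or> R = carrier W" using W unfolding irreducible_rep_def by blast
  moreover have "f v \<in> R" using nz by (simp add: R_def)
  ultimately have "R = carrier W" using nz by blast
  then show ?thesis using inj by (simp add: bij_betw_def R_def)
qed

text \<open>\<open>T\<close> carries the top vector \<open>ebas n\<close> of the standard
  representation to the highest weight vector, so it is nonzero and Schur applies.\<close>

theorem irreducible_unique:
  assumes V: "irreducible_rep V" and hw: "has_highest_weight V (of_nat n)"
  shows "\<exists>f\<in>rep_hom (Lstd n) V. bij_betw f (carrier (Lstd n)) (carrier V)"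
proof -
  obtain w where w: "w \<in> carrier V" "w \<noteq> \<zero>\<^bsub>V\<^esub>" "act V gE w = \<zero>\<^bsub>V\<^esub>" "act V gH w = of_nat n \<odot>\<^bsub>V\<^esub> w"
    using hw unfolding has_highest_weight_def by blast
  interpret highest_weight V n w
    by unfold_locales (use V w in \<open>auto simp: irreducible_rep_def\<close>)
  have e: "ebas n \<in> carrier (Lstd n)" by (auto simp: ebas_def)
  have "restrict T (carrier (Lstd n)) (ebas n) \<noteq> \<zero>\<^bsub>V\<^esub>" using e T_ebas[of n] b_top w(2) by simp
  with e have "bij_betw (restrict T (carrier (Lstd n))) (carrier (Lstd n)) (carrier V)"
    by (rule Schur_bij[OF Lstd_irreducible V T_hom[OF V w(2)]])
  then show ?thesis using T_hom[OF V w(2)] by blast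
qed

text \<open>\<open>irreducible_unique\<close> carries the scalar of the standard representation to
  every \<open>L\<close> in the definition of \<open>chi\<close>, and evaluation at
  \<open>ebas 0\<close> shows that no other scalar works; the description is thus well
  defined.\<close>

lemma chi_Lstd:
  assumes lam: "lam > 0" and z: "ucentral z" and v: "v \<in> carrier (Lstd (nat (lam - 1)))"
  shows "uact (Lstd (nat (lam - 1))) z v = chi lam z \<odot>\<^bsub>Lstd (nat (lam - 1))\<^esub> v"
proof -
  define n where "n = nat (lam - 1)"
  have nl: "of_int (lam - 1) = (of_nat n :: complex)" using lam by (simp add: n_def)
  obtain c where c: "\<And>v. v \<in> carrier (Lstd n) \<Longrightarrow> uact (Lstd n) z v = c \<odot>\<^bsub>Lstd n\<^esub> v"
    using Lstd_central_scalar[OF z, of n] by blast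
  have "chi lam z = c"
    unfolding chi_def nl
  proof (rule the_equality)
    show "\<forall>L :: (nat \<Rightarrow> complex) sl2rep. irreducible_rep L \<and> has_highest_weight L (of_nat n) \<longrightarrow>
       (\<forall>v\<in>carrier L. uact L z v = c \<odot>\<^bsub>L\<^esub> v)"
    proof (intro allI impI ballI, elim conjE)
      fix L :: "(nat \<Rightarrow> complex) sl2rep" and v
      assume L: "irreducible_rep L" "has_highest_weight L (of_nat n)" and v: "v \<in> carrier L"
      obtain f where f: "f \<in> rep_hom (Lstd n) L" "bij_betw f (carrier (Lstd n)) (carrier L)"
        using irreducible_unique[OF L] by blast
      have "v \<in> f ` carrier (Lstd n)" using v f(2) by (simp add: bij_betw_def del: Lstd_simps)
      then obtain a where a: "a \<in> carrier (Lstd n)" "v = f a" by (rule imageE) (rule that)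
      show "uact L z v = c \<odot>\<^bsub>L\<^esub> v"
        using uact_hom[OF Lstd_rep f(1) a(1), of z] c[OF a(1)] rep_homD(3)[OF f(1) a(1), of c] a(2) by (simp only:)
    qed
    fix d assume d: "\<forall>L :: (nat \<Rightarrow> complex) sl2rep. irreducible_rep L \<and> has_highest_weight L (of_nat n) \<longrightarrow>
       (\<forall>v\<in>carrier L. uact L z v = d \<odot>\<^bsub>L\<^esub> v)"
    have e: "ebas 0 \<in> carrier (Lstd n)" by (auto simp: ebas_def)
    have "d \<odot>\<^bsub>Lstd n\<^esub> ebas 0 = c \<odot>\<^bsub>Lstd n\<^esub> ebas 0"
      using d Lstd_irreducible Lstd_highest e c[OF e] by metis
    from fun_cong[OF this, of 0] show "d = c" by (simp add: ebas_def)
  qed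
  then show ?thesis using c v unfolding n_def by blast
qed

subsection \<open>Global sections of the line bundle\<close>

text \<open>The homogeneous polynomial with terms \<open>a k * x^(n-k) * y^k\<close>, read at
  \<open>[1 : z]\<close> and at \<open>[w : 1]\<close>.\<close>

definition secL :: "nat \<Rightarrow> (nat \<Rightarrow> complex) \<Rightarrow> lsec" where
  "secL n a = mk_sec (\<lambda>c z. \<Sum>k\<le>n. a k * z ^ (if c then n - k else k))"

lemma sel_secL: "sel c (secL n a) z = (\<Sum>k\<le>n. a k * z ^ (if c then n - k else k))"
  by (simp add: secL_def)

lemma secL_add: "secL n (\<lambda>k. a k + b k) = sadd (secL n a) (secL n b)"
  by (rule sel_eqI) (simp add: sel_secL ring_distribs sum.distrib)

lemma secL_sm: "secL n (\<lambda>k. x * a k) = hmul (\<lambda>_. x) (secL n a)"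
  by (rule sel_eqI) (simp add: sel_secL sum_distrib_left mult.assoc)

lemma secL_zero: "secL n (\<lambda>_. 0) = szero"
  by (rule sel_eqI) (simp add: sel_secL)

text \<open>Unlike in \<open>line_bundle_eqI_chart\<close>, \<open>U\<close> may contain the point
  missing from chart \<open>c\<close>; there the identity theorem supplies the value.\<close>

lemma line_bundle_eqI_dense:
  assumes U: "zariski_open U" "U \<noteq> {}" and s: "s \<in> line_bundle n U" and t: "t \<in> line_bundle n U"
    and e: "\<And>z. z \<in> part c U \<Longrightarrow> sel c s z = sel c t z"
  shows "s = t"
proof (rule line_bundle_eqI[OF U(1) s t])
  fix d z assume z: "z \<in> part d U"
  show "sel d s z = sel d t z"
  proof (cases "d = c")
    case False
    then have d: "d = (\<not> c)" by auto
    have "infinite (part d U - {0})" using infinite_part[OF U, of d] by simp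
    then show ?thesis
    proof (rule rat_eqI[OF line_bundle_rat[OF U(1) s] line_bundle_rat[OF U(1) t] _ _ _ z])
      fix y assume y: "y \<in> part d U - {0}"
      then have "inverse y \<in> part c U" using inverse_in_part[of y d U] d by simp
      then show "sel d s y = sel d t y"
        using line_bundle_trans[OF U(1) s, of y d] line_bundle_trans[OF U(1) t, of y d] y e d by simp
    qed auto
  qed (use z e in simp)
qed

context
  fixes lam :: int assumes lam: "lam > 0"
begin

private abbreviation "n \<equiv> nat (lam - 1)"

private lemma nl: "of_int (lam - 1) = (of_nat n :: complex)"
  using lam by simp

private lemma pw: "z powi (lam - 1) = z ^ n" for z :: complex
  using lam by (simp add: power_int_def)

lemma secL_closed: "secL n a \<in> lb lam UNIV"
proof (rule line_bundleI)
  fix c and z :: complex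
  show "rat (part c UNIV) (sel c (secL n a))"
    unfolding secL_def sel_mk by (intro rat_sum rat_mult rat_const rat_power rat_id)
  assume "z \<noteq> 0"
  have "a k * z ^ (if c then n - k else k) = z ^ n * (a k * inverse z ^ (if \<not> c then n - k else k))" if "k \<le> n" for k
  proof -
    have "z ^ n = z ^ (n - k) * z ^ k" using that by (simp add: power_add[symmetric])
    then show ?thesis using \<open>z \<noteq> 0\<close> by (auto simp: power_inverse field_simps)
  qed
  then show "sel c (secL n a) z = z powi (lam - 1) * sel (\<not> c) (secL n a) (inverse z)"
    unfolding sel_secL pw sum_distrib_left by (intro sum.cong) auto
qed auto

lemma secL_ebas: "j \<le> n \<Longrightarrow> sel False (secL n (ebas j)) = (\<lambda>z. z ^ j)"
proof
  fix z assume "j \<le> n"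
  have "(\<Sum>k\<le>n. ebas j k * z ^ k) = (\<Sum>k\<le>n. if k = j then z ^ k else 0)" by (intro sum.cong) (auto simp: ebas_def)
  then show "sel False (secL n (ebas j)) z = z ^ j" using \<open>j \<le> n\<close> by (simp add: sel_secL)
qed

lemma Phi_apply_closed: "s \<in> lb lam UNIV \<Longrightarrow> Phi lam x UNIV s \<in> lb lam UNIV"
  by (rule opfun_closed[OF tdo_carrier_opfun[OF Phi_closed] opens_self]) auto

lemma sel_Phi_False: "s \<in> lb lam UNIV \<Longrightarrow> sel False (Phi lam x UNIV s) z =
    (case x of gE \<Rightarrow> z\<^sup>2 * deriv (sel False s) z - of_nat n * z * sel False s z
      | gF \<Rightarrow> - deriv (sel False s) z
      | gH \<Rightarrow> 2 * z * deriv (sel False s) z - of_nat n * sel False s z)"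
  by (cases x) (simp_all add: Phi_eq opens_self phi_coeffs_def nl[symmetric] power2_eq_square algebra_simps)

text \<open>Both sides are linear in \<open>a\<close>, which leaves the monomials, and by
  \<open>line_bundle_eqI_dense\<close> these can be compared in the chart at 0.\<close>

lemma Phi_secL:
  assumes a: "a \<in> carrier (Lstd n)"
  shows "Phi lam x UNIV (secL n a) = secL n (act (Lstd n) x a)"
proof -
  define S where "S = {a. Phi lam x UNIV (secL n a) = secL n (act (Lstd n) x a)}"
  have O: "zariski_open UNIV" "UNIV \<in> opens UNIV" by (auto simp: opens_UNIV)
  note tadd = tdo_apply_sadd[OF O(1) Phi_closed O(2) secL_closed secL_closed]
  note tsm = tdo_apply_const[OF O(1) Phi_closed O(2) secL_closed]
  have sm: "(\<lambda>k. c * a k) \<in> S" if "a \<in> S" for c a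
        using that tsm by (simp add: S_def Lstd_act_linear secL_sm del: Lstd_simps)
  have "a \<in> S"
  proof (rule Lstd_spanned[OF _ _ sm _ a])
    show "(\<lambda>k. a k + b k) \<in> S" if "a \<in> S" "b \<in> S" for a b
        using that tadd by (simp add: S_def Lstd_act_linear secL_add del: Lstd_simps)
    show eS: "ebas j \<in> S" if j: "j \<le> n" for j
      unfolding S_def mem_Collect_eq
    proof (rule line_bundle_eqI_dense[OF O(1) _ Phi_apply_closed[OF secL_closed] secL_closed, of False])
      fix z
      have d: "deriv (\<lambda>z. z ^ j) z = of_nat j * z ^ (j - 1)" for z :: complex
        by (rule DERIV_imp_deriv) (auto intro!: derivative_eq_intros)
      have s: "sel False (secL n (\<lambda>k. y * ebas i k)) z = y * sel False (secL n (ebas i)) z" for y i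
        by (simp add: secL_sm)
      show "sel False (Phi lam x UNIV (secL n (ebas j))) z = sel False (secL n (act (Lstd n) x (ebas j))) z"
      proof (cases x)
        case gE
        show ?thesis
        proof (cases "j = n")
          case True
          \<comment> \<open>\<open>E\<close> kills the top monomial: the derivative term and the
            twist both equal \<open>n * z^(n+1)\<close>.\<close>
          have "act (Lstd n) gE (ebas j) = (\<lambda>k. 0)" unfolding act_ebas True by simp
          then show ?thesis unfolding sel_Phi_False[OF secL_closed] secL_ebas[OF j] d gE
            using True by (cases n) (simp_all add: secL_zero power2_eq_square algebra_simps del: Lstd_simps)
        next
          case False
          then have "Suc j \<le> n" using j by simp
          then show ?thesis unfolding sel_Phi_False[OF secL_closed] secL_ebas[OF j] d gE act_ebas s
            by (cases j) (simp_all add: secL_ebas power2_eq_square algebra_simps)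
        qed
      next
        case gF
        show ?thesis unfolding sel_Phi_False[OF secL_closed] secL_ebas[OF j] d gF act_ebas s
          using j by (simp add: secL_ebas)
      next
        case gH
        show ?thesis unfolding sel_Phi_False[OF secL_closed] secL_ebas[OF j] d gH act_ebas s
          using j by (cases j) (simp_all add: secL_ebas algebra_simps)
      qed
    qed simp
    have "(\<lambda>k. 0 * ebas 0 k) \<in> S" by (rule sm[OF eS]) simp
    then show "(\<lambda>_. 0) \<in> S" by simp
  qed
  then show ?thesis by (simp add: S_def)
qed

text \<open>Both chart functions are polynomials \<open>p\<close> and \<open>q\<close> with
  \<open>p z = z^n * q (1/z)\<close>; clearing denominators gives
  \<open>X^(degree q) * p = X^n * reflect_poly q\<close>, which bounds \<open>degree p\<close> by
  \<open>n\<close>.\<close>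

lemma secL_surj:
  assumes s: "s \<in> lb lam UNIV" shows "\<exists>a\<in>carrier (Lstd n). s = secL n a"
proof -
  have O: "zariski_open UNIV" by simp
  obtain p where p: "sel False s = poly p" using rat_UNIV line_bundle_rat[OF O s, of False] by auto
  obtain q where q: "sel True s = poly q" using rat_UNIV line_bundle_rat[OF O s, of True] by auto
  have "monom 1 (degree q) * p = monom 1 n * reflect_poly q"
  proof (rule poly_eq_if_eq_infinite[of "- {0}"])
    show "infinite (- {0} :: complex set)" by (rule infinite_cofinite) simp
    fix z :: complex assume "z \<in> - {0}"
    then have z: "z \<noteq> 0" by simp
    have "poly p z = z ^ n * poly q (inverse z)"
      using line_bundle_trans[OF O s, of z False] z by (simp add: p q pw)
    then show "poly (monom 1 (degree q) * p) z = poly (monom 1 n * reflect_poly q) z"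
      by (simp add: poly_monom poly_reflect_poly_nz[OF z])
  qed
  then have "degree (monom 1 (degree q) * p) \<le> n + degree q"
    using degree_mult_le[of "monom 1 n" "reflect_poly q"] degree_monom_le[of "1::complex" n] degree_reflect_poly_le[of q] by simp
  then have dp: "degree p \<le> n"
    by (cases "p = 0") (simp_all add: degree_mult_eq degree_monom_eq monom_eq_0_iff)
  have "s = secL n (coeff p)"
  proof (rule line_bundle_eqI_dense[OF O _ s secL_closed, of False])
    fix z
    have "poly p z = (\<Sum>k\<le>n. coeff p k * z ^ k)"
      unfolding poly_altdef using dp by (intro sum.mono_neutral_left) (auto simp: coeff_eq_0)
    then show "sel False s z = sel False (secL n (coeff p)) z" by (simp add: p sel_secL)
  qed simp
  moreover have "coeff p \<in> carrier (Lstd n)" using dp by (auto simp: coeff_eq_0)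
  ultimately show ?thesis by blast
qed

lemma secL_inj:
  assumes a: "a \<in> carrier (Lstd n)" and b: "b \<in> carrier (Lstd n)" and e: "secL n a = secL n b"
  shows "a = b"
proof -
  have p: "poly (\<Sum>k\<le>n. monom (a k) k) z = sel False (secL n a) z" for a z
    by (simp add: poly_sum poly_monom sel_secL)
  have "(\<Sum>k\<le>n. monom (a k) k) = (\<Sum>k\<le>n. monom (b k) k)"
    by (rule poly_eq_if_eq_infinite[OF infinite_UNIV_char_0]) (simp only: p e)
  then have c: "coeff (\<Sum>k\<le>n. monom (a k) k) j = coeff (\<Sum>k\<le>n. monom (b k) k) j" for j by simp
  have co: "coeff (\<Sum>k\<le>n. monom (a k) k) j = (if j \<le> n then a j else 0)" for a j
    by (simp add: coeff_sum)
  show ?thesis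
  proof
    fix j show "a j = b j" using c[of j] a b unfolding co by (cases "j \<le> n") auto
  qed
qed

end

section \<open>Fully faithful and essentially surjective functors\<close>

lemma is_categoryD:
  assumes "is_category C"
  shows "X \<in> cob C \<Longrightarrow> cid C X \<in> chom C X X"
    and "\<lbrakk>X \<in> cob C; Y \<in> cob C; Z \<in> cob C; f \<in> chom C X Y; g \<in> chom C Y Z\<rbrakk> \<Longrightarrow> ccomp C X Y Z g f \<in> chom C X Z"
    and "\<lbrakk>X \<in> cob C; Y \<in> cob C; f \<in> chom C X Y\<rbrakk> \<Longrightarrow> ccomp C X X Y f (cid C X) = f"
    and "\<lbrakk>X \<in> cob C; Y \<in> cob C; f \<in> chom C X Y\<rbrakk> \<Longrightarrow> ccomp C X Y Y (cid C Y) f = f"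
    and "\<lbrakk>W \<in> cob C; X \<in> cob C; Y \<in> cob C; Z \<in> cob C; f \<in> chom C W X; g \<in> chom C X Y; h \<in> chom C Y Z\<rbrakk> \<Longrightarrow>
      ccomp C W X Z (ccomp C X Y Z h g) f = ccomp C W Y Z h (ccomp C W X Y g f)"
  using assms unfolding is_category_def by blast+

lemma is_categoryI:
  assumes "\<And>X. X \<in> cob C \<Longrightarrow> cid C X \<in> chom C X X"
    and "\<And>X Y Z f g. \<lbrakk>X \<in> cob C; Y \<in> cob C; Z \<in> cob C; f \<in> chom C X Y; g \<in> chom C Y Z\<rbrakk> \<Longrightarrow> ccomp C X Y Z g f \<in> chom C X Z"
    and "\<And>X Y f. \<lbrakk>X \<in> cob C; Y \<in> cob C; f \<in> chom C X Y\<rbrakk> \<Longrightarrow> ccomp C X X Y f (cid C X) = f"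
    and "\<And>X Y f. \<lbrakk>X \<in> cob C; Y \<in> cob C; f \<in> chom C X Y\<rbrakk> \<Longrightarrow> ccomp C X Y Y (cid C Y) f = f"
    and "\<And>W X Y Z f g h. \<lbrakk>W \<in> cob C; X \<in> cob C; Y \<in> cob C; Z \<in> cob C; f \<in> chom C W X; g \<in> chom C X Y; h \<in> chom C Y Z\<rbrakk> \<Longrightarrow>
      ccomp C W X Z (ccomp C X Y Z h g) f = ccomp C W Y Z h (ccomp C W X Y g f)"
  shows "is_category C"
  unfolding is_category_def by (intro conjI ballI; rule assms; assumption)

text \<open>The inverse sends \<open>Y\<close> to a chosen object with an isomorphism from its image
  to \<open>Y\<close>. Equations between arrows of \<open>C\<close> are verified after applying
  \<open>F\<close>, which is injective on hom-sets.\<close>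

lemma is_equivalenceI:
  assumes C: "is_category C" and D: "is_category D" and F: "is_functor C D F"
    and ff: "\<And>X Y. X \<in> cob C \<Longrightarrow> Y \<in> cob C \<Longrightarrow> bij_betw (far F X Y) (chom C X Y) (chom D (fob F X) (fob F Y))"
    and es: "\<And>Y. Y \<in> cob D \<Longrightarrow> \<exists>X\<in>cob C. \<exists>i. is_iso D (fob F X) Y i"
  shows "is_equivalence C D F"
proof -
  note Cid = is_categoryD(1)[OF C] and Cc = is_categoryD(2)[OF C]
  note Did = is_categoryD(1)[OF D] and Dc = is_categoryD(2)[OF D] and Dr = is_categoryD(3)[OF D]
    and Dl = is_categoryD(4)[OF D] and Da = is_categoryD(5)[OF D]
  have Fo: "fob F X \<in> cob D" if "X \<in> cob C" for X using F that unfolding is_functor_def by blast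
  have Fa: "far F X Y f \<in> chom D (fob F X) (fob F Y)" if "X \<in> cob C" "Y \<in> cob C" "f \<in> chom C X Y" for X Y f
    using F that unfolding is_functor_def by blast
  have Fi: "far F X X (cid C X) = cid D (fob F X)" if "X \<in> cob C" for X using F that unfolding is_functor_def by blast
  have Fc: "far F X Z (ccomp C X Y Z g f) = ccomp D (fob F X) (fob F Y) (fob F Z) (far F Y Z g) (far F X Y f)"
    if "X \<in> cob C" "Y \<in> cob C" "Z \<in> cob C" "f \<in> chom C X Y" "g \<in> chom C Y Z" for X Y Z f g
    using F that unfolding is_functor_def by blast
  have inj: "f = g" if "X \<in> cob C" "Y \<in> cob C" "f \<in> chom C X Y" "g \<in> chom C X Y" "far F X Y f = far F X Y g" for X Y f g
    using ff[OF that(1,2)] that(3-5) unfolding bij_betw_def inj_on_def by blast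
  define lift where "lift = (\<lambda>X Y h. SOME f. f \<in> chom C X Y \<and> far F X Y f = h)"
  have lift: "lift X Y h \<in> chom C X Y" "far F X Y (lift X Y h) = h"
    if "X \<in> cob C" "Y \<in> cob C" "h \<in> chom D (fob F X) (fob F Y)" for X Y h
  proof -
    have "h \<in> far F X Y ` chom C X Y" using ff[OF that(1,2)] that(3) unfolding bij_betw_def by simp
    then have "\<exists>f. f \<in> chom C X Y \<and> far F X Y f = h" by auto
    from someI_ex[OF this] show "lift X Y h \<in> chom C X Y" "far F X Y (lift X Y h) = h" unfolding lift_def by auto
  qed
  have "\<exists>X i j. X \<in> cob C \<and> i \<in> chom D (fob F X) Y \<and> j \<in> chom D Y (fob F X) \<and>
      ccomp D (fob F X) Y (fob F X) j i = cid D (fob F X) \<and> ccomp D Y (fob F X) Y i j = cid D Y" if "Y \<in> cob D" for Y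
    using es[OF that] unfolding is_iso_def by blast
  then obtain g e e' where ge: "\<And>Y. Y \<in> cob D \<Longrightarrow> g Y \<in> cob C \<and> e Y \<in> chom D (fob F (g Y)) Y \<and> e' Y \<in> chom D Y (fob F (g Y)) \<and>
      ccomp D (fob F (g Y)) Y (fob F (g Y)) (e' Y) (e Y) = cid D (fob F (g Y)) \<and> ccomp D Y (fob F (g Y)) Y (e Y) (e' Y) = cid D Y"
    by metis
  have g: "g Y \<in> cob C" and e: "e Y \<in> chom D (fob F (g Y)) Y" and e': "e' Y \<in> chom D Y (fob F (g Y))"
    and e'e: "ccomp D (fob F (g Y)) Y (fob F (g Y)) (e' Y) (e Y) = cid D (fob F (g Y))"
    and ee': "ccomp D Y (fob F (g Y)) Y (e Y) (e' Y) = cid D Y" if "Y \<in> cob D" for Y using ge[OF that] by auto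
  let ?G = "\<lambda>Y. fob F (g Y)"
  have Fg: "?G Y \<in> cob D" if "Y \<in> cob D" for Y by (rule Fo[OF g[OF that]])
  \<comment> \<open>Conjugation of \<open>h\<close> by the chosen isomorphisms; its preimage under
    \<open>F\<close> becomes the arrow part of \<open>G\<close>.\<close>
  define cj where "cj = (\<lambda>Y Z h. ccomp D (?G Y) Z (?G Z) (e' Z) (ccomp D (?G Y) Y Z h (e Y)))"
  have cj: "cj Y Z h \<in> chom D (?G Y) (?G Z)" if "Y \<in> cob D" "Z \<in> cob D" "h \<in> chom D Y Z" for Y Z h
    unfolding cj_def by (intro Dc[OF Fg _ Fg] Dc[OF Fg] e e' that)
  define G where "G = \<lparr>fob = g, far = (\<lambda>Y Z h. lift (g Y) (g Z) (cj Y Z h))\<rparr>"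
  have Ga: "far G Y Z h \<in> chom C (g Y) (g Z)" and FG: "far F (g Y) (g Z) (far G Y Z h) = cj Y Z h"
    if "Y \<in> cob D" "Z \<in> cob D" "h \<in> chom D Y Z" for Y Z h
    unfolding G_def using lift[OF g[OF that(1)] g[OF that(2)] cj[OF that]] by simp_all
  have e_nat: "ccomp D (?G Y) (?G Z) Z (e Z) (cj Y Z h) = ccomp D (?G Y) Y Z h (e Y)"
    if Y: "Y \<in> cob D" and Z: "Z \<in> cob D" and h: "h \<in> chom D Y Z" for Y Z h
  proof -
    have he: "ccomp D (?G Y) Y Z h (e Y) \<in> chom D (?G Y) Z" by (rule Dc[OF Fg[OF Y] Y Z e[OF Y] h])
    have "ccomp D (?G Y) (?G Z) Z (e Z) (cj Y Z h) =
        ccomp D (?G Y) Z Z (ccomp D Z (?G Z) Z (e Z) (e' Z)) (ccomp D (?G Y) Y Z h (e Y))"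
      unfolding cj_def by (rule Da[OF Fg[OF Y] Z Fg[OF Z] Z he e'[OF Z] e[OF Z], symmetric])
    then show ?thesis unfolding ee'[OF Z] Dl[OF Fg[OF Y] Z he] .
  qed
  have fG: "fob G = g" by (simp add: G_def)
  have Gf: "is_functor D C G"
    unfolding is_functor_def fG
  proof (intro conjI ballI)
    fix Y assume Y: "Y \<in> cob D"
    show "g Y \<in> cob C" by (rule g[OF Y])
    show "far G Y Y (cid D Y) = cid C (g Y)"
      by (rule inj[OF g[OF Y] g[OF Y] Ga[OF Y Y Did[OF Y]] Cid[OF g[OF Y]]])
        (simp add: FG[OF Y Y Did[OF Y]] Fi[OF g[OF Y]] cj_def Dl[OF Fg[OF Y] Y e[OF Y]] e'e[OF Y])
    fix Z h assume Z: "Z \<in> cob D" and h: "h \<in> chom D Y Z"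
    show "far G Y Z h \<in> chom C (g Y) (g Z)" by (rule Ga[OF Y Z h])
    fix W k assume W: "W \<in> cob D" and k: "k \<in> chom D Z W"
    have kh: "ccomp D Y Z W k h \<in> chom D Y W" by (rule Dc[OF Y Z W h k])
    note Y' = Fg[OF Y] and Z' = Fg[OF Z] and W' = Fg[OF W]
    have ke: "ccomp D (?G Z) Z W k (e Z) \<in> chom D (?G Z) W" by (rule Dc[OF Z' Z W e[OF Z] k])
    show "far G Y W (ccomp D Y Z W k h) = ccomp C (g Y) (g Z) (g W) (far G Z W k) (far G Y Z h)"
    proof (rule inj[OF g[OF Y] g[OF W] Ga[OF Y W kh] Cc[OF g[OF Y] g[OF Z] g[OF W] Ga[OF Y Z h] Ga[OF Z W k]]])
      have "cj Y W (ccomp D Y Z W k h) = ccomp D (?G Y) W (?G W) (e' W) (ccomp D (?G Y) Z W k (ccomp D (?G Y) Y Z h (e Y)))"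
        unfolding cj_def by (simp only: Da[OF Y' Y Z W e[OF Y] h k])
      also have "\<dots> = ccomp D (?G Y) W (?G W) (e' W) (ccomp D (?G Y) (?G Z) W (ccomp D (?G Z) Z W k (e Z)) (cj Y Z h))"
        by (simp only: e_nat[OF Y Z h, symmetric] Da[OF Y' Z' Z W cj[OF Y Z h] e[OF Z] k])
      also have "\<dots> = ccomp D (?G Y) (?G Z) (?G W) (cj Z W k) (cj Y Z h)"
        using Da[OF Y' Z' W W' cj[OF Y Z h] ke e'[OF W]] by (simp only: cj_def[THEN fun_cong, THEN fun_cong, THEN fun_cong, of Z W k])
      finally show "far F (g Y) (g W) (far G Y W (ccomp D Y Z W k h)) =
          far F (g Y) (g W) (ccomp C (g Y) (g Z) (g W) (far G Z W k) (far G Y Z h))"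
        unfolding FG[OF Y W kh] Fc[OF g[OF Y] g[OF Z] g[OF W] Ga[OF Y Z h] Ga[OF Z W k]] FG[OF Y Z h] FG[OF Z W k] .
    qed
  qed
  have FGn: "naturally_isomorphic D D (comp_fctr F G) id_fctr"
    unfolding naturally_isomorphic_def comp_fctr_def id_fctr_def
  proof (intro exI[of _ e] conjI ballI, simp_all add: fG)
    fix Y assume Y: "Y \<in> cob D"
    show "is_iso D (?G Y) Y (e Y)" unfolding is_iso_def using ge[OF Y] by blast
    fix Z h assume "Z \<in> cob D" "h \<in> chom D Y Z"
    then show "ccomp D (?G Y) (?G Z) Z (e Z) (far F (g Y) (g Z) (far G Y Z h)) = ccomp D (?G Y) Y Z h (e Y)"
      using e_nat[OF Y] FG[OF Y] by simp
  qed
  \<comment> \<open>\<open>F\<close> sends the unit to the inverse of the chosen isomorphism, so its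
    invertibility and naturality can be tested after applying \<open>F\<close>.\<close>
  define \<eta> where "\<eta> = (\<lambda>X. lift X (g (fob F X)) (e' (fob F X)))"
  have gF: "g (fob F X) \<in> cob C" if "X \<in> cob C" for X by (rule g[OF Fo[OF that]])
  have \<eta>: "\<eta> X \<in> chom C X (g (fob F X))" "far F X (g (fob F X)) (\<eta> X) = e' (fob F X)" if "X \<in> cob C" for X
    unfolding \<eta>_def using lift[OF that gF[OF that] e'[OF Fo[OF that]]] by auto
  have GFn: "naturally_isomorphic C C id_fctr (comp_fctr G F)"
    unfolding naturally_isomorphic_def comp_fctr_def id_fctr_def
  proof (intro exI[of _ \<eta>] conjI ballI, simp_all add: fG)
    fix X assume X: "X \<in> cob C"
    let ?X = "fob F X"
    let ?Y = "g ?X"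
    have Y: "?Y \<in> cob C" by (rule gF[OF X])
    define \<iota> where "\<iota> = lift ?Y X (e ?X)"
    have \<iota>: "\<iota> \<in> chom C ?Y X" "far F ?Y X \<iota> = e ?X"
      unfolding \<iota>_def using lift[OF Y X e[OF Fo[OF X]]] by auto
    have "ccomp C X ?Y X \<iota> (\<eta> X) = cid C X"
      by (rule inj[OF X X Cc[OF X Y X \<eta>(1)[OF X] \<iota>(1)] Cid[OF X]])
        (simp add: Fc[OF X Y X \<eta>(1)[OF X] \<iota>(1)] \<eta>(2)[OF X] \<iota>(2) Fi[OF X] ee'[OF Fo[OF X]])
    moreover have "ccomp C ?Y X ?Y (\<eta> X) \<iota> = cid C ?Y"
      by (rule inj[OF Y Y Cc[OF Y X Y \<iota>(1) \<eta>(1)[OF X]] Cid[OF Y]])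
        (simp add: Fc[OF Y X Y \<iota>(1) \<eta>(1)[OF X]] \<eta>(2)[OF X] \<iota>(2) Fi[OF Y] e'e[OF Fo[OF X]])
    ultimately show "is_iso C X ?Y (\<eta> X)" unfolding is_iso_def using \<eta>(1)[OF X] \<iota>(1) by blast
    fix Z f assume Z: "Z \<in> cob C" and f: "f \<in> chom C X Z"
    let ?Z = "fob F Z"
    have Z': "g ?Z \<in> cob C" by (rule gF[OF Z])
    note Ff = Fa[OF X Z f]
    have Gf': "far G ?X ?Z (far F X Z f) \<in> chom C ?Y (g ?Z)" by (rule Ga[OF Fo[OF X] Fo[OF Z] Ff])
    show "ccomp C X Z (g ?Z) (\<eta> Z) f = ccomp C X ?Y (g ?Z) (far G ?X ?Z (far F X Z f)) (\<eta> X)"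
    proof (rule inj[OF X Z' Cc[OF X Z Z' f \<eta>(1)[OF Z]] Cc[OF X Y Z' \<eta>(1)[OF X] Gf']])
      note X1 = Fo[OF X] and Z1 = Fo[OF Z]
      have fe: "ccomp D (fob F ?Y) ?X ?Z (far F X Z f) (e ?X) \<in> chom D (fob F ?Y) ?Z" by (rule Dc[OF Fg[OF X1] X1 Z1 e[OF X1] Ff])
      have "ccomp D ?X (fob F ?Y) (fob F (g ?Z)) (cj ?X ?Z (far F X Z f)) (e' ?X) =
          ccomp D ?X ?Z (fob F (g ?Z)) (e' ?Z) (ccomp D ?X (fob F ?Y) ?Z (ccomp D (fob F ?Y) ?X ?Z (far F X Z f) (e ?X)) (e' ?X))"
        unfolding cj_def by (rule Da[OF X1 Fg[OF X1] Z1 Fg[OF Z1] e'[OF X1] fe e'[OF Z1]])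
      also have "ccomp D ?X (fob F ?Y) ?Z (ccomp D (fob F ?Y) ?X ?Z (far F X Z f) (e ?X)) (e' ?X) =
          ccomp D ?X ?X ?Z (far F X Z f) (ccomp D ?X (fob F ?Y) ?X (e ?X) (e' ?X))"
        by (rule Da[OF X1 Fg[OF X1] X1 Z1 e'[OF X1] e[OF X1] Ff])
      also have "\<dots> = far F X Z f" unfolding ee'[OF X1] by (rule Dr[OF X1 Z1 Ff])
      finally show "far F X (g ?Z) (ccomp C X Z (g ?Z) (\<eta> Z) f) =
          far F X (g ?Z) (ccomp C X ?Y (g ?Z) (far G ?X ?Z (far F X Z f)) (\<eta> X))"
        unfolding Fc[OF X Z Z' f \<eta>(1)[OF Z]] Fc[OF X Y Z' \<eta>(1)[OF X] Gf'] \<eta>(2)[OF X] \<eta>(2)[OF Z] FG[OF X1 Z1 Ff] by simp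
    qed
  qed
  show ?thesis unfolding is_equivalence_def using C D F Gf FGn GFn by blast
qed

section \<open>Homomorphisms\<close>

text \<open>A tuple is the sum of its one-entry tuples. Addition \<open>p\<close> and zero
  \<open>z\<close> are parameters, so that the rule serves powers of representations as well as
  tuples of sections.\<close>

lemma tuple_induct [consumes 1, case_names unit_mem unit_right unit_left zero add single]:
  assumes a: "a \<in> {..<r::nat} \<rightarrow>\<^sub>E C" and z: "z \<in> C" and p: "\<And>x. x \<in> C \<Longrightarrow> p x z = x" "\<And>x. x \<in> C \<Longrightarrow> p z x = x"
    and zero: "(\<lambda>i\<in>{..<r}. z) \<in> S" and add: "\<And>a b. a \<in> S \<Longrightarrow> b \<in> S \<Longrightarrow> (\<lambda>i\<in>{..<r}. p (a i) (b i)) \<in> S"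
    and single: "\<And>i x. i < r \<Longrightarrow> x \<in> C \<Longrightarrow> (\<lambda>j\<in>{..<r}. if j = i then x else z) \<in> S"
  shows "a \<in> S"
proof -
  have aC: "a i \<in> C" if "i < r" for i using a that by auto
  have "(\<lambda>j\<in>{..<r}. if j < m then a j else z) \<in> S" if "m \<le> r" for m using that
  proof (induction m)
    case (Suc m)
    have m: "m < r" using Suc.prems by simp
    have "(\<lambda>j\<in>{..<r}. p ((\<lambda>j\<in>{..<r}. if j < m then a j else z) j) ((\<lambda>j\<in>{..<r}. if j = m then a m else z) j)) \<in> S"
      by (rule add[OF Suc.IH single[OF m aC[OF m]]]) (use m in simp)
    also have "(\<lambda>j\<in>{..<r}. p ((\<lambda>j\<in>{..<r}. if j < m then a j else z) j) ((\<lambda>j\<in>{..<r}. if j = m then a m else z) j)) =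
        (\<lambda>j\<in>{..<r}. if j < Suc m then a j else z)"
      by (rule restrict_ext) (auto simp: p aC z less_Suc_eq)
    finally show ?case .
  qed (use zero in simp)
  from this[of r] have "(\<lambda>j\<in>{..<r}. if j < r then a j else z) \<in> S" by simp
  moreover have "(\<lambda>j\<in>{..<r}. if j < r then a j else z) = a"
    using a by (auto simp: fun_eq_iff restrict_def PiE_iff extensional_def)
  ultimately show ?thesis by simp
qed

lemma rep_hom_ext: "\<lbrakk>f \<in> rep_hom V W; g \<in> rep_hom V W; (\<And>v. v \<in> carrier V \<Longrightarrow> f v = g v)\<rbrakk> \<Longrightarrow> f = g"
  unfolding rep_hom_def by (auto intro: extensionalityI[of _ "carrier V"] simp: PiE_iff)

lemma rep_hom_id: "sl2_rep V \<Longrightarrow> (\<lambda>v\<in>carrier V. v) \<in> rep_hom V V"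
  by (rule rep_homI) (auto simp: sl2_closed)

lemma rep_hom_compose:
  assumes V: "sl2_rep U" and f: "f \<in> rep_hom U V" and g: "g \<in> rep_hom V W"
  shows "compose (carrier U) g f \<in> rep_hom U W"
  by (rule rep_homI) (auto simp: compose_def sl2_closed[OF V] rep_homD[OF f] rep_homD[OF g])

lemma rep_hom_inv:
  assumes V: "sl2_rep V" and f: "f \<in> rep_hom V W" and b: "bij_betw f (carrier V) (carrier W)"
  shows "restrict (inv_into (carrier V) f) (carrier W) \<in> rep_hom W V"
    and "bij_betw (restrict (inv_into (carrier V) f) (carrier W)) (carrier W) (carrier V)"
proof -
  have im: "carrier W = f ` carrier V" and inj: "inj_on f (carrier V)" using b by (auto simp: bij_betw_def)
  show "bij_betw (restrict (inv_into (carrier V) f) (carrier W)) (carrier W) (carrier V)"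
    using bij_betw_inv_into[OF b] by (subst bij_betw_restrict_eq)
  show "restrict (inv_into (carrier V) f) (carrier W) \<in> rep_hom W V"
    unfolding im
    by (rule rep_homI, unfold im)
      (auto simp: sl2_closed[OF V] rep_homD(2-)[OF f, symmetric] inv_into_f_f[OF inj] inj_on_eq_iff[OF inj])
qed

text \<open>The lowest weight vectors of the summands generate a direct sum of irreducibles.\<close>

lemma rep_hom_power_eqI:
  assumes W: "sl2_rep W" and f: "f \<in> rep_hom (rep_power r (Lstd n)) W" and g: "g \<in> rep_hom (rep_power r (Lstd n)) W"
    and e: "\<And>i. i < r \<Longrightarrow> f (\<lambda>j\<in>{..<r}. if j = i then ebas 0 else (\<lambda>_. 0)) = g (\<lambda>j\<in>{..<r}. if j = i then ebas 0 else (\<lambda>_. 0))"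
  shows "f = g"
proof (rule rep_hom_ext[OF f g])
  let ?P = "rep_power r (Lstd n)"
  have P: "sl2_rep ?P" by (rule sl2_rep_power[OF Lstd_rep])
  define S where "S = {a \<in> carrier ?P. f a = g a}"
  have add: "a \<oplus>\<^bsub>?P\<^esub> b \<in> S" if "a \<in> S" "b \<in> S" for a b
    using that by (simp add: S_def sl2_closed[OF P] rep_homD[OF f] rep_homD[OF g])
  have sm: "c \<odot>\<^bsub>?P\<^esub> a \<in> S" if "a \<in> S" for a c
    using that by (simp add: S_def sl2_closed[OF P] rep_homD[OF f] rep_homD[OF g])
  have ac: "act ?P x a \<in> S" if "a \<in> S" for a x
    using that by (simp add: S_def sl2_closed[OF P] rep_homD[OF f] rep_homD[OF g])
  have ze: "\<zero>\<^bsub>?P\<^esub> \<in> S"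
  proof -
    interpret P: sl2 ?P by (rule sl2.intro[OF P])
    interpret W: sl2 W by (rule sl2.intro[OF W])
    have "h \<zero>\<^bsub>?P\<^esub> = \<zero>\<^bsub>W\<^esub>" if "h \<in> rep_hom ?P W" for h
      using rep_homD(3)[OF that P.zero_closed, of 0] rep_homD(1)[OF that P.zero_closed] by simp
    from this[OF f] this[OF g] show ?thesis by (simp add: S_def)
  qed
  fix a assume "a \<in> carrier ?P"
  then have "a \<in> {..<r} \<rightarrow>\<^sub>E carrier (Lstd n)" by (simp only: rep_power_simps)
  then have "a \<in> S"
  proof (induction rule: tuple_induct[where p = "add (Lstd n)" and z = "\<lambda>_. 0"])
    case (single i x)
    show "(\<lambda>j\<in>{..<r}. if j = i then x else (\<lambda>_. 0)) \<in> S" (is "?s x \<in> S")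
    proof (rule CollectD[of x "\<lambda>x. ?s x \<in> S"], rule Lstd_generated[OF _ _ _ _ _ single(2)], unfold mem_Collect_eq)
      show "?s (\<lambda>_. 0) \<in> S" using ze unfolding rep_power_simps Lstd_simps by (simp only: if_cancel)
      show "?s (\<lambda>k. a k + b k) \<in> S" if "?s a \<in> S" "?s b \<in> S" for a b
      proof -
        have "?s (\<lambda>k. a k + b k) = ?s a \<oplus>\<^bsub>?P\<^esub> ?s b" unfolding rep_power_simps by (rule restrict_ext) auto
        then show ?thesis using add[OF that] by simp
      qed
      show "?s (\<lambda>k. c * a k) \<in> S" if "?s a \<in> S" for c a
      proof -
        have "?s (\<lambda>k. c * a k) = c \<odot>\<^bsub>?P\<^esub> ?s a" unfolding rep_power_simps by (rule restrict_ext) auto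
        then show ?thesis using sm[OF that] by simp
      qed
      show "?s (act (Lstd n) gE a) \<in> S" if "?s a \<in> S" for a
      proof -
        have "?s (act (Lstd n) gE a) = act ?P gE (?s a)" unfolding rep_power_simps by (rule restrict_ext) auto
        then show ?thesis using ac[OF that] by simp
      qed
      have "?s (ebas 0) \<in> carrier ?P" by (auto simp: rep_power_simps ebas_def)
      then show "?s (ebas 0) \<in> S" unfolding S_def using e[OF single(1)] by blast
    qed
  next
    case zero
    show ?case using ze unfolding rep_power_simps Lstd_simps by simp
  next
    case (add a b)
    show ?case using add(1,2) \<open>\<And>b a. a \<in> S \<Longrightarrow> b \<in> S \<Longrightarrow> a \<oplus>\<^bsub>?P\<^esub> b \<in> S\<close>[of a b] unfolding rep_power_simps by simp
  qed simp_all
  then show "f a = g a" by (simp add: S_def)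
qed

text \<open>The tuple \<open>si i\<close> with \<open>ebas 0\<close> in place \<open>i\<close> is
  killed by \<open>F\<close>, and so is its image. The kernel of \<open>F\<close> in the standard
  representation consists of the multiples of \<open>ebas 0\<close>, whose factors form the matrix
  \<open>A\<close>.\<close>

lemma rep_hom_power_Lstd_matrix:
  assumes f: "f \<in> rep_hom (rep_power r (Lstd n)) (rep_power s (Lstd n))"
  shows "\<exists>A. \<forall>a\<in>carrier (rep_power r (Lstd n)). f a = (\<lambda>j\<in>{..<s}. \<lambda>k. \<Sum>i<r. A j i * a i k)"
proof -
  let ?P = "rep_power r (Lstd n)" and ?Q = "rep_power s (Lstd n)"
  define si where "si = (\<lambda>i. \<lambda>j\<in>{..<r}. if j = i then ebas 0 else (\<lambda>_. 0))"
  define A where "A = (\<lambda>j i. f (si i) j 0)"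
  define g where "g = (\<lambda>a\<in>carrier ?P. \<lambda>j\<in>{..<s}. \<lambda>k. \<Sum>i<r. A j i * a i k)"
  have P: "sl2_rep ?P" and Q: "sl2_rep ?Q" by (rule sl2_rep_power[OF Lstd_rep])+
  note mem = rep_power_mem[of _ r "Lstd n"]
  have gQ: "g a \<in> carrier ?Q" if a: "a \<in> carrier ?P" for a
  proof -
    have "(\<lambda>k. \<Sum>i<r. A j i * a i k) \<in> carrier (Lstd n)" for j
      using mem[OF a] by (auto intro!: sum.neutral)
    then show ?thesis unfolding g_def restrict_apply'[OF a] by (rule rep_power_I)
  qed
  have g: "g \<in> rep_hom ?P ?Q"
  proof (rule rep_homI)
    show "g \<in> carrier ?P \<rightarrow>\<^sub>E carrier ?Q" using gQ by (auto simp: g_def)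
    show "g (a \<oplus>\<^bsub>?P\<^esub> b) = g a \<oplus>\<^bsub>?Q\<^esub> g b" if "a \<in> carrier ?P" "b \<in> carrier ?P" for a b
      using that sl2_closed(1)[OF P that] unfolding g_def
      by (auto simp: rep_power_simps(3) fun_eq_iff restrict_def sum.distrib algebra_simps)
    show "g (c \<odot>\<^bsub>?P\<^esub> a) = c \<odot>\<^bsub>?Q\<^esub> g a" if "a \<in> carrier ?P" for a c
      using that sl2_closed(2)[OF P that, of c] unfolding g_def
      by (auto simp: rep_power_simps(4) fun_eq_iff restrict_def sum_distrib_left algebra_simps)
    show "g (act ?P x a) = act ?Q x (g a)" if "a \<in> carrier ?P" for a x
    proof -
      have "(\<lambda>k. \<Sum>i<r. A j i * act (Lstd n) x (a i) k) = act (Lstd n) x (\<lambda>k. \<Sum>i<r. A j i * a i k)" for j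
        by (cases x) (auto simp: fun_eq_iff sum_distrib_left sum_negf[symmetric] algebra_simps)
      then show ?thesis
        using that sl2_closed(3)[OF P that, of x] unfolding g_def
        by (simp add: rep_power_simps(5) fun_eq_iff restrict_def del: Lstd_simps)
    qed
  qed
  have "f (si i) = g (si i)" if i: "i < r" for i
  proof -
    have si: "si i \<in> carrier ?P" by (auto simp: si_def rep_power_simps ebas_def)
    have fsi: "f (si i) \<in> carrier ?Q" by (rule rep_homD(1)[OF f si])
    have "act ?P gF (si i) = 0 \<odot>\<^bsub>?P\<^esub> si i" unfolding rep_power_simps by (rule restrict_ext) (auto simp: si_def ebas_def)
    then have "act ?Q gF (f (si i)) = 0 \<odot>\<^bsub>?Q\<^esub> f (si i)" using rep_homD(3,4)[OF f si] by metis
    then have F: "act (Lstd n) gF (f (si i) j) k = 0" if "j < s" for j k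
      using that unfolding rep_power_simps by (auto simp: restrict_def fun_eq_iff simp del: Lstd_simps(5-7)) (metis mult_zero_left Lstd_simps(4))
    show "f (si i) = g (si i)"
    proof (rule rep_power_ext[OF fsi gQ[OF si]])
      fix j assume j: "j < s"
      show "f (si i) j = g (si i) j"
      proof
        fix k
        have "(\<Sum>l<r. A j l * si i l k) = (\<Sum>l<r. if l = i then A j i * ebas 0 k else 0)"
          by (rule sum.cong) (auto simp: si_def)
        then have "g (si i) j k = A j i * ebas 0 k" using j i si by (simp add: g_def)
        moreover have "f (si i) j k = A j i * ebas 0 k"
          using F[OF j, of "k - 1"] by (cases k) (auto simp: A_def ebas_def simp del: of_nat_Suc)
        ultimately show "f (si i) j k = g (si i) j k" by simp
      qed
    qed
  qed
  then have "f = g" by (intro rep_hom_power_eqI[OF Q f g]) (simp add: si_def)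
  then show ?thesis by (auto simp: g_def)
qed

section \<open>Homomorphisms of modules over the sheaf of operators\<close>

lemma dmod_homI:
  assumes "\<phi> \<in> extensional (opens UNIV)" "\<And>U. zariski_open U \<Longrightarrow> \<phi> U \<in> carrier (secs M U) \<rightarrow>\<^sub>E carrier (secs N U)"
    "\<And>U m n. \<lbrakk>zariski_open U; m \<in> carrier (secs M U); n \<in> carrier (secs M U)\<rbrakk> \<Longrightarrow>
          \<phi> U (m \<oplus>\<^bsub>secs M U\<^esub> n) = \<phi> U m \<oplus>\<^bsub>secs N U\<^esub> \<phi> U n"
    "\<And>U P m. \<lbrakk>zariski_open U; P \<in> tdo_carrier lam U; m \<in> carrier (secs M U)\<rbrakk> \<Longrightarrow>
          \<phi> U (P \<odot>\<^bsub>secs M U\<^esub> m) = P \<odot>\<^bsub>secs N U\<^esub> \<phi> U m"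
    "\<And>U V m. \<lbrakk>zariski_open U; V \<in> opens U; m \<in> carrier (secs M U)\<rbrakk> \<Longrightarrow> \<phi> V (res M U V m) = res N U V (\<phi> U m)"
  shows "\<phi> \<in> dmod_hom lam M N"
  using assms unfolding dmod_hom_def by (auto simp: opens_UNIV tdo_simps(1) PiE_iff)

lemma dmod_homD:
  assumes "\<phi> \<in> dmod_hom lam M N"
  shows "zariski_open U \<Longrightarrow> m \<in> carrier (secs M U) \<Longrightarrow> \<phi> U m \<in> carrier (secs N U)"
    "\<lbrakk>zariski_open U; m \<in> carrier (secs M U); n \<in> carrier (secs M U)\<rbrakk> \<Longrightarrow>
          \<phi> U (m \<oplus>\<^bsub>secs M U\<^esub> n) = \<phi> U m \<oplus>\<^bsub>secs N U\<^esub> \<phi> U n"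
    "\<lbrakk>zariski_open U; P \<in> tdo_carrier lam U; m \<in> carrier (secs M U)\<rbrakk> \<Longrightarrow>
          \<phi> U (P \<odot>\<^bsub>secs M U\<^esub> m) = P \<odot>\<^bsub>secs N U\<^esub> \<phi> U m"
    "\<lbrakk>zariski_open U; V \<in> opens U; m \<in> carrier (secs M U)\<rbrakk> \<Longrightarrow> \<phi> V (res M U V m) = res N U V (\<phi> U m)"
  using assms unfolding dmod_hom_def by (auto simp: opens_UNIV tdo_simps(1) PiE_iff Pi_iff)

lemma dmod_hom_ext:
  assumes "\<phi> \<in> dmod_hom lam M N" "\<psi> \<in> dmod_hom lam M N"
    and "\<And>U m. zariski_open U \<Longrightarrow> m \<in> carrier (secs M U) \<Longrightarrow> \<phi> U m = \<psi> U m"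
  shows "\<phi> = \<psi>"
proof (rule extensionalityI)
  show "\<phi> \<in> extensional (opens UNIV)" "\<psi> \<in> extensional (opens UNIV)" using assms by (auto simp: dmod_hom_def PiE_iff)
  fix U assume U: "U \<in> opens UNIV"
  show "\<phi> U = \<psi> U"
  proof (rule extensionalityI)
    show "\<phi> U \<in> extensional (carrier (secs M U))" "\<psi> U \<in> extensional (carrier (secs M U))"
      using assms(1,2) U by (auto simp: dmod_hom_def PiE_iff)
  qed (use assms(3) U in \<open>auto simp: opens_UNIV\<close>)
qed

lemma (in Dmod) dmod_hom_id: "(\<lambda>U\<in>opens UNIV. \<lambda>m\<in>CM U. m) \<in> dmod_hom lam M M"
  by (rule dmod_homI) (auto simp: opens_UNIV opens_D(1) smul_closed res_closed abelian_groupE(1)[OF abelian_secs])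

lemma (in Dmod) dmod_hom_compose:
  assumes f: "\<phi> \<in> dmod_hom lam M N" and g: "\<psi> \<in> dmod_hom lam N L"
  shows "(\<lambda>U\<in>opens UNIV. compose (CM U) (\<psi> U) (\<phi> U)) \<in> dmod_hom lam M L"
  by (rule dmod_homI) (auto simp: compose_def opens_UNIV opens_D(1) smul_closed res_closed abelian_groupE(1)[OF abelian_secs]
      dmod_homD[OF f] dmod_homD[OF g])

lemma (in Dmod) dmod_hom_inv:
  assumes f: "\<phi> \<in> dmod_hom lam M N" and b: "\<And>U. zariski_open U \<Longrightarrow> bij_betw (\<phi> U) (CM U) (carrier (secs N U))"
  shows "(\<lambda>U\<in>opens UNIV. \<lambda>m\<in>carrier (secs N U). inv_into (CM U) (\<phi> U) m) \<in> dmod_hom lam N M"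
proof -
  have im: "carrier (secs N U) = \<phi> U ` CM U" and inj: "inj_on (\<phi> U) (CM U)" if "zariski_open U" for U
    using b[OF that] by (auto simp: bij_betw_def)
  note [simp] = inv_into_f_f[OF inj] inj_on_eq_iff[OF inj]
  show ?thesis
  proof (rule dmod_homI)
    fix U assume U: "zariski_open U"
    note [simp] = dmod_homD(2-)[OF f U, symmetric]
    let ?g = "\<lambda>U\<in>opens UNIV. \<lambda>m\<in>carrier (secs N U). inv_into (CM U) (\<phi> U) m"
    have U': "U \<in> opens UNIV" using U by (simp add: opens_UNIV)
    show "?g U \<in> carrier (secs N U) \<rightarrow>\<^sub>E CM U" using U U' by (auto simp: im[OF U])
    show "?g U (m \<oplus>\<^bsub>secs N U\<^esub> n) = ?g U m \<oplus>\<^bsub>secs M U\<^esub> ?g U n" if "m \<in> carrier (secs N U)" "n \<in> carrier (secs N U)" for m n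
      using that U U' by (auto simp: im[OF U] abelian_groupE(1)[OF abelian_secs])
    show "?g U (P \<odot>\<^bsub>secs N U\<^esub> m) = P \<odot>\<^bsub>secs M U\<^esub> ?g U m" if "P \<in> tdo_carrier lam U" "m \<in> carrier (secs N U)" for P m
      using that U U' by (auto simp: im[OF U] smul_closed)
    show "?g V (res N U V m) = res M U V (?g U m)" if V: "V \<in> opens U" and "m \<in> carrier (secs N U)" for V m
      using that U U' opens_D(1)[OF V] by (auto simp: im opens_UNIV res_closed)
  qed auto
qed

section \<open>Global sections of coherent modules\<close>

abbreviation \<Gamma> :: "int \<Rightarrow> 'v dmod \<Rightarrow> 'v sl2rep" where
  "\<Gamma> \<equiv> global_sections"

lemma global_sections_simps:
  "carrier (\<Gamma> lam M) = carrier (secs M UNIV)"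
  "\<zero>\<^bsub>\<Gamma> lam M\<^esub> = \<zero>\<^bsub>secs M UNIV\<^esub>"
  "m \<oplus>\<^bsub>\<Gamma> lam M\<^esub> m' = m \<oplus>\<^bsub>secs M UNIV\<^esub> m'"
  "c \<odot>\<^bsub>\<Gamma> lam M\<^esub> m = mulop lam UNIV (\<lambda>_. c) \<odot>\<^bsub>secs M UNIV\<^esub> m"
  "act (\<Gamma> lam M) x m = Phi lam x \<odot>\<^bsub>secs M UNIV\<^esub> m"
  by (simp_all add: global_sections_def)

lemma mulop_const_closed: "mulop lam UNIV (\<lambda>_. c) \<in> tdo_carrier lam UNIV"
  by (rule mulop_closed) (auto simp: hreg_const)

lemma Gamma_hom:
  assumes "\<phi> \<in> dmod_hom lam M N"
  shows "\<phi> UNIV \<in> rep_hom (\<Gamma> lam M) (\<Gamma> lam N)"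
proof (rule rep_homI, unfold global_sections_simps)
  show "\<phi> UNIV \<in> carrier (secs M UNIV) \<rightarrow>\<^sub>E carrier (secs N UNIV)"
    using assms by (auto simp: dmod_hom_def opens_UNIV)
qed (use dmod_homD[OF assms, of UNIV] mulop_const_closed Phi_closed in auto)

lemma abelian_global_sections: "abelian_group (secs M UNIV) \<Longrightarrow> abelian_group (\<Gamma> lam M)"
  by (rule abelian_groupI; unfold global_sections_simps; rule abelian_groupE; assumption)

definition secpow :: "int \<Rightarrow> nat \<Rightarrow> (nat \<Rightarrow> nat \<Rightarrow> complex) \<Rightarrow> nat \<Rightarrow> lsec" where
  "secpow lam r = (\<lambda>a\<in>carrier (rep_power r (Lstd (nat (lam - 1)))). \<lambda>i\<in>{..<r}. secL (nat (lam - 1)) (a i))"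

lemma secpow_hom:
  assumes lam: "lam > 0"
  shows "secpow lam r \<in> rep_hom (rep_power r (Lstd (nat (lam - 1)))) (\<Gamma> lam (Model lam r))"
proof -
  let ?n = "nat (lam - 1)"
  let ?P = "rep_power r (Lstd ?n)"
  have P: "sl2_rep ?P" by (rule sl2_rep_power[OF Lstd_rep])
  note mem = rep_power_mem[of _ r "Lstd ?n"]
  have O: "UNIV \<in> opens UNIV" by (simp add: opens_UNIV)
  have sp: "secpow lam r a = (\<lambda>i\<in>{..<r}. secL ?n (a i))" if "a \<in> carrier ?P" for a
    using that by (simp add: secpow_def)
  show ?thesis
  proof (rule rep_homI, unfold global_sections_simps)
    show "secpow lam r \<in> carrier ?P \<rightarrow>\<^sub>E CN lam r UNIV"
      by (auto simp: secpow_def intro!: CN_I secL_closed[OF lam])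
    fix a assume a: "a \<in> carrier ?P"
    show "secpow lam r (a \<oplus>\<^bsub>?P\<^esub> b) = secpow lam r a \<oplus>\<^bsub>SM lam r UNIV\<^esub> secpow lam r b"
      if b: "b \<in> carrier ?P" for b
      unfolding sp[OF a] sp[OF b] sp[OF sl2_closed(1)[OF P a b]] unfolding Model_simps rep_power_simps
      by (rule restrict_ext) (simp add: secL_add)
    show "secpow lam r (c \<odot>\<^bsub>?P\<^esub> a) = mulop lam UNIV (\<lambda>_. c) \<odot>\<^bsub>SM lam r UNIV\<^esub> secpow lam r a" for c
      unfolding sp[OF a] sp[OF sl2_closed(2)[OF P a]] unfolding Model_simps rep_power_simps
      by (rule restrict_ext) (simp add: secL_sm mulop_apply[OF O] secL_closed[OF lam])
    show "secpow lam r (act ?P x a) = Phi lam x \<odot>\<^bsub>SM lam r UNIV\<^esub> secpow lam r a" for x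
      unfolding sp[OF a] sp[OF sl2_closed(3)[OF P a]] unfolding Model_simps rep_power_simps
      by (rule restrict_ext) (simp add: Phi_secL[OF lam mem[OF a]] del: Lstd_simps)
  qed
qed

lemma secpow_bij:
  assumes lam: "lam > 0"
  shows "bij_betw (secpow lam r) (carrier (rep_power r (Lstd (nat (lam - 1))))) (CN lam r UNIV)"
proof -
  let ?n = "nat (lam - 1)"
  let ?P = "rep_power r (Lstd ?n)"
  have cl: "secpow lam r a \<in> CN lam r UNIV" if "a \<in> carrier ?P" for a
    using rep_homD(1)[OF secpow_hom[OF lam] that] by (simp add: global_sections_simps)
  have sp: "secpow lam r a i = secL ?n (a i)" if "a \<in> carrier ?P" "i < r" for a i
    using that by (simp add: secpow_def)
  have "inj_on (secpow lam r) (carrier ?P)"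
  proof (rule inj_onI)
    fix a b assume a: "a \<in> carrier ?P" and b: "b \<in> carrier ?P" and e: "secpow lam r a = secpow lam r b"
    show "a = b"
    proof (rule rep_power_ext[OF a b])
      fix i assume i: "i < r"
      show "a i = b i"
        using fun_cong[OF e, of i] unfolding sp[OF a i] sp[OF b i]
        by (rule secL_inj[OF lam rep_power_mem[OF a i] rep_power_mem[OF b i]])
    qed
  qed
  moreover have "t \<in> secpow lam r ` carrier ?P" if t: "t \<in> CN lam r UNIV" for t
  proof -
    have "\<exists>a. i < r \<longrightarrow> a \<in> carrier (Lstd ?n) \<and> t i = secL ?n a" for i
      using secL_surj[OF lam CN_mem[OF t, of i]] by blast
    then obtain a where a: "\<And>i. i < r \<Longrightarrow> a i \<in> carrier (Lstd ?n)" "\<And>i. i < r \<Longrightarrow> t i = secL ?n (a i)"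
      by metis
    have A: "(\<lambda>i\<in>{..<r}. a i) \<in> carrier ?P" by (rule rep_power_I) (rule a(1))
    have "t = secpow lam r (\<lambda>i\<in>{..<r}. a i)"
      by (rule CN_eqI[OF t cl[OF A]]) (simp add: sp[OF A] a(2))
    then show ?thesis using A by (rule image_eqI)
  qed
  ultimately show ?thesis unfolding bij_betw_def using cl by blast
qed

lemma Omod_I: "\<lbrakk>lam > 0; D_module lam M; O_coherent_on lam M UNIV\<rbrakk> \<Longrightarrow> Omod lam M"
  by unfold_locales (auto simp: D_module_def O_coherent_on_def)

locale trivialised = Omod lam M for lam and M :: "'v dmod" +
  fixes r :: nat and \<phi> :: "p1 set \<Rightarrow> (nat \<Rightarrow> lsec) \<Rightarrow> 'v"
  assumes hom: "\<phi> \<in> dmod_hom lam (Model lam r) M"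
    and bij: "\<And>U. zariski_open U \<Longrightarrow> bij_betw (\<phi> U) (CN lam r U) (CM U)"
begin

abbreviation PL :: "(nat \<Rightarrow> nat \<Rightarrow> complex) sl2rep" where "PL \<equiv> rep_power r (Lstd (nat (lam - 1)))"

lemma PL_rep: "sl2_rep PL"
  by (rule sl2_rep_power[OF Lstd_rep])

text \<open>Not the Euler operator of the same name: the isomorphism from a power of the standard
  representation to the global sections.\<close>

definition \<theta> :: "(nat \<Rightarrow> nat \<Rightarrow> complex) \<Rightarrow> 'v" where
  "\<theta> = compose (carrier PL) (\<phi> UNIV) (secpow lam r)"

lemma \<theta>_hom: "\<theta> \<in> rep_hom PL (\<Gamma> lam M)"
  unfolding \<theta>_def by (rule rep_hom_compose[OF PL_rep secpow_hom[OF lam_pos] Gamma_hom[OF hom]])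

lemma \<theta>_bij: "bij_betw \<theta> (carrier PL) (carrier (\<Gamma> lam M))"
  unfolding global_sections_simps \<theta>_def
  by (rule bij_betw_compose[OF secpow_bij[OF lam_pos] bij]) simp

text \<open>The bracket relations are not computed for the operators \<open>Phi\<close>: they are
  inherited from the standard representation along \<open>\<theta>\<close>.\<close>

lemma Gamma_rep: "sl2_rep (\<Gamma> lam M)"
  by (rule sl2_rep_image[OF PL_rep abelian_global_sections[OF abelian_secs] \<theta>_bij])
    (use rep_homD[OF \<theta>_hom] in auto)

lemma Gamma_central: "has_central_character lam (\<Gamma> lam M)"
  unfolding has_central_character_def
proof (intro allI impI ballI)
  fix z v assume z: "ucentral z" and "v \<in> carrier (\<Gamma> lam M)"
  then have "v \<in> \<theta> ` carrier PL" using \<theta>_bij by (simp add: bij_betw_def)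
  then obtain a where a: "a \<in> carrier PL" and v: "v = \<theta> a" by (rule imageE) (rule that)
  have "uact PL z a = chi lam z \<odot>\<^bsub>PL\<^esub> a"
    unfolding uact_power[OF a Lstd_rep] rep_power_simps(4)
    by (rule restrict_lt_ext) (rule chi_Lstd[OF lam_pos z rep_power_mem[OF a]])
  then show "uact (\<Gamma> lam M) z v = chi lam z \<odot>\<^bsub>\<Gamma> lam M\<^esub> v"
    using uact_hom[OF PL_rep \<theta>_hom a, of z] rep_homD(3)[OF \<theta>_hom a, of "chi lam z"] by (simp only: v)
qed

lemma Gamma_sum: "sum_of_irrep lam (\<Gamma> lam M)"
proof -
  have "of_int (lam - 1) = (of_nat (nat (lam - 1)) :: complex)" using lam_pos by simp
  then show ?thesis
    unfolding sum_of_irrep_def rep_isomorphic_def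
    using Lstd_irreducible Lstd_finite_dim Lstd_highest rep_hom_inv[OF PL_rep \<theta>_hom \<theta>_bij] by metis
qed

end

lemma (in Omod) ex_trivialised: "\<exists>r \<phi>. trivialised lam M r \<phi>"
proof -
  obtain r \<phi> where "\<phi> \<in> dmod_hom lam (Model lam r) M"
    "\<And>U. zariski_open U \<Longrightarrow> bij_betw (\<phi> U) (CN lam r U) (CM U)"
    using trivialisation by metis
  then have "trivialised lam M r \<phi>" by unfold_locales auto
  then show ?thesis by blast
qed

subsection \<open>Faithfulness\<close>

lemma (in Dmod) separated:
  assumes sh: "sheaf_condition M" and U: "zariski_open U" and m: "m \<in> CM U" "m' \<in> CM U"
    and e: "\<And>c. res M U (U \<inter> Uc c) m = res M U (U \<inter> Uc c) m'"
  shows "m = m'"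
proof -
  define \<V> where "\<V> = range (\<lambda>c. U \<inter> Uc c)"
  have O: "V \<in> opens U" if "V \<in> \<V>" for V
    using that unfolding \<V>_def by (auto intro!: opens_I zariski_open_Int U)
  have Un: "\<Union>\<V> = U" unfolding \<V>_def using Uc_Un[of False] by auto
  have op: "\<V> \<subseteq> opens UNIV" by (auto simp: opens_UNIV intro: opens_D(1)[OF O])
  have eV: "res M U V m = res M U V m'" if "V \<in> \<V>" for V using that e unfolding \<V>_def by auto
  have "\<exists>!x. x \<in> CM (\<Union>\<V>) \<and> (\<forall>V\<in>\<V>. res M (\<Union>\<V>) V x = res M U V m)"
  proof (rule sh[unfolded sheaf_condition_def, rule_format, OF op], intro conjI ballI)
    fix V assume V: "V \<in> \<V>"
    show "res M U V m \<in> CM V" by (rule res_closed[OF U O[OF V] m(1)])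
    fix W assume W: "W \<in> \<V>"
    have I: "V \<inter> W \<in> opens V" "V \<inter> W \<in> opens W"
      using opens_D(1)[OF O[OF V]] opens_D(1)[OF O[OF W]] by (auto intro!: opens_I zariski_open_Int)
    show "res M V (V \<inter> W) (res M U V m) = res M W (V \<inter> W) (res M U W m)"
      by (simp only: res_res[OF U O[OF V] I(1) m(1)] res_res[OF U O[OF W] I(2) m(1)])
  qed
  then have ex: "\<exists>!x. x \<in> CM U \<and> (\<forall>V\<in>\<V>. res M U V x = res M U V m)" unfolding Un .
  have "m' \<in> CM U \<and> (\<forall>V\<in>\<V>. res M U V m' = res M U V m)" using m(2) eV by metis
  moreover have "m \<in> CM U \<and> (\<forall>V\<in>\<V>. res M U V m = res M U V m)" using m(1) by simp
  ultimately show ?thesis by (metis ex)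
qed

text \<open>Each chart carries a global section \<open>u\<close> that is constantly 1 there, so over
  an open \<open>V\<close> in the chart every section is a regular function times a restricted
  global one. Homomorphisms commute with such multiplications, and the charts cover the
  line.\<close>

lemma Model_hom_eqI:
  assumes lam: "lam > 0" and N: "D_module lam N"
    and \<delta>: "\<delta> \<in> dmod_hom lam (Model lam r) N" and \<epsilon>: "\<epsilon> \<in> dmod_hom lam (Model lam r) N" and e: "\<delta> UNIV = \<epsilon> UNIV"
  shows "\<delta> = \<epsilon>"
proof (rule dmod_hom_ext[OF \<delta> \<epsilon>])
  let ?n = "nat (lam - 1)"
  interpret N: Dmod lam N by unfold_locales (use N in \<open>simp add: D_module_def\<close>)
  have chart: "\<delta> V t = \<epsilon> V t" if V: "V \<in> opens (Uc c)" and t: "t \<in> CN lam r V" for c V t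
  proof -
    note O = opens_D(1)[OF V] and VU = opens_D(2)[OF V]
    have V': "V \<in> opens UNIV" using O by (simp add: opens_UNIV)
    define S where "S = {t \<in> CN lam r V. \<delta> V t = \<epsilon> V t}"
    have glob: "RM lam r UNIV V t \<in> S" if t: "t \<in> CN lam r UNIV" for t
      unfolding S_def using dmod_homD(4)[OF \<delta> _ V' t] dmod_homD(4)[OF \<epsilon> _ V' t] e Model_res_closed[OF _ V' t] by simp
    \<comment> \<open>\<open>ebas 0\<close> gives \<open>z^0\<close> on the chart at 0, and
      \<open>ebas ?n\<close> gives \<open>w^(n - n)\<close> on the chart at infinity.\<close>
    define u where "u = secL ?n (ebas (if c then ?n else 0))"
    have u1: "sel c u z = 1" for z
    proof -
      have "sel c u z = (\<Sum>k\<le>?n. if k = (if c then ?n else 0) then 1 else 0)"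
        unfolding u_def sel_secL by (rule sum.cong) (auto simp: ebas_def)
      then show ?thesis by simp
    qed
    have u: "u \<in> lb lam UNIV" unfolding u_def by (rule secL_closed[OF lam])
    have uV: "sres V u \<in> lb lam V" by (rule sres_closed[OF zariski_open_UNIV V' u])
    have z: "szero \<in> lb lam U" if "zariski_open U" for U by (rule szero_closed[OF that])
    have "t \<in> {..<r} \<rightarrow>\<^sub>E lb lam V" using t by (simp only: Model_simps)
    then have "t \<in> S"
    proof (induction rule: tuple_induct[where p = sadd and z = szero])
      case zero
      have "RM lam r UNIV V (\<lambda>i\<in>{..<r}. szero) \<in> S" by (rule glob[OF CN_I]) (simp add: z)
      also have "RM lam r UNIV V (\<lambda>i\<in>{..<r}. szero) = (\<lambda>i\<in>{..<r}. szero)"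
        unfolding Model_simps by (rule restrict_ext) (auto intro: sel_eqI)
      finally show ?case .
    next
      case (add a b)
      then have "a \<oplus>\<^bsub>SM lam r V\<^esub> b \<in> S"
        unfolding S_def using dmod_homD(2)[OF \<delta> O] dmod_homD(2)[OF \<epsilon> O] Model_add_closed[OF O] by simp
      then show ?case by (simp only: Model_simps)
    next
      case (single i x)
      let ?s = "\<lambda>j\<in>{..<r}. if j = i then u else szero"
      define h where "h = (\<lambda>p. sel c x (coord c p))"
      have h: "hreg V h" unfolding h_def by (rule hreg_coord[OF VU line_bundle_rat[OF O single(2)]])
      have hx: "hmul h (sres V u) = x"
      proof (rule line_bundle_eqI_chart[OF O VU hmul_closed[OF O h uV] single(2)])
        fix y assume "y \<in> part c V"
        then show "sel c (hmul h (sres V u)) y = sel c x y" by (simp add: h_def u1)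
      qed
      have h0: "sres V szero = szero" "hmul h szero = szero" by (rule sel_eqI, simp)+
      have s: "?s \<in> CN lam r UNIV" by (rule CN_I) (simp add: u z)
      note P = mulop_closed[OF O h]
      have "mulop lam V h \<odot>\<^bsub>SM lam r V\<^esub> RM lam r UNIV V ?s \<in> S"
        using glob[OF s] unfolding S_def
        using dmod_homD(3)[OF \<delta> O P] dmod_homD(3)[OF \<epsilon> O P] Model_smul_closed[OF O P] by simp
      also have "mulop lam V h \<odot>\<^bsub>SM lam r V\<^esub> RM lam r UNIV V ?s = (\<lambda>j\<in>{..<r}. if j = i then x else szero)"
        unfolding Model_simps by (rule restrict_ext) (simp add: mulop_apply[OF opens_self[OF O]] uV z[OF O] hx h0)
      finally show ?case .
    qed (auto simp: z[OF O] intro: sel_eqI)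
    then show ?thesis by (simp add: S_def)
  qed
  fix U t assume U: "zariski_open U" and t: "t \<in> CN lam r U"
  have UI: "U \<inter> Uc c \<in> opens U" "U \<inter> Uc c \<in> opens (Uc c)" for c
    by (auto intro!: opens_I zariski_open_Int U)
  show "\<delta> U t = \<epsilon> U t"
  proof (rule N.separated[OF _ U dmod_homD(1)[OF \<delta> U t] dmod_homD(1)[OF \<epsilon> U t]])
    show "sheaf_condition N" using N by (simp add: D_module_def)
    show "res N U (U \<inter> Uc c) (\<delta> U t) = res N U (U \<inter> Uc c) (\<epsilon> U t)" for c
      using chart[OF UI(2) Model_res_closed[OF U UI(1) t]] dmod_homD(4)[OF \<delta> U UI(1) t] dmod_homD(4)[OF \<epsilon> U UI(1) t] by simp
  qed
qed

subsection \<open>Fullness\<close>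

text \<open>Built from \<open>sadd\<close> and \<open>hmul\<close>, so that commutation with
  operators follows by induction from their linearity.\<close>

primrec lcs :: "nat \<Rightarrow> (nat \<Rightarrow> complex) \<Rightarrow> (nat \<Rightarrow> lsec) \<Rightarrow> lsec" where
  "lcs 0 A t = szero"
| "lcs (Suc k) A t = sadd (lcs k A t) (hmul (\<lambda>_. A k) (t k))"

lemma sel_lcs: "sel c (lcs k A t) z = (\<Sum>i<k. A i * sel c (t i) z)"
  by (induction k) auto

lemma lcs_closed: "zariski_open U \<Longrightarrow> (\<And>i. i < k \<Longrightarrow> t i \<in> lb lam U) \<Longrightarrow> lcs k A t \<in> lb lam U"
  by (induction k) (auto intro!: szero_closed sadd_closed hmul_closed hreg_const)

lemma lcs_cong: "(\<And>i. i < k \<Longrightarrow> t i = t' i) \<Longrightarrow> lcs k A t = lcs k A t'"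
  by (induction k) auto

lemma lcs_tdo:
  assumes U: "zariski_open U" and P: "P \<in> tdo_carrier lam U"
  shows "(\<And>i. i < k \<Longrightarrow> t i \<in> lb lam U) \<Longrightarrow> P U (lcs k A t) = lcs k A (\<lambda>i. P U (t i))"
proof (induction k)
  case 0
  have "hmul (\<lambda>_. 0) s = szero" for s by (rule sel_eqI) simp
  then show ?case using tdo_apply_const[OF U P opens_self[OF U] szero_closed[OF U], of 0] by simp
next
  case (Suc k)
  have k: "lcs k A t \<in> lb lam U" "t k \<in> lb lam U" by (auto intro!: lcs_closed U Suc.prems)
  have "hmul (\<lambda>_. A k) (t k) \<in> lb lam U" by (rule hmul_closed[OF U hreg_const k(2)])
  then show ?case
    using Suc k(1) by (simp add: tdo_apply_sadd[OF U P opens_self[OF U]] tdo_apply_const[OF U P opens_self[OF U] k(2)])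
qed

definition matop :: "int \<Rightarrow> nat \<Rightarrow> nat \<Rightarrow> (nat \<Rightarrow> nat \<Rightarrow> complex) \<Rightarrow> p1 set \<Rightarrow> (nat \<Rightarrow> lsec) \<Rightarrow> nat \<Rightarrow> lsec" where
  "matop lam r s A = (\<lambda>U\<in>opens UNIV. \<lambda>t\<in>CN lam r U. \<lambda>j\<in>{..<s}. lcs r (A j) t)"

text \<open>Constant matrices commute with differential operators, which are linear over the complex
  numbers.\<close>

lemma matop_hom: "matop lam r s A \<in> dmod_hom lam (Model lam r) (Model lam s)"
proof (rule dmod_homI)
  fix U assume U: "zariski_open U"
  then have U': "U \<in> opens UNIV" by (simp add: opens_UNIV)
  have ap: "matop lam r s A U t = (\<lambda>j\<in>{..<s}. lcs r (A j) t)" if "t \<in> CN lam r U" for t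
    using that U' by (simp add: matop_def)
  show "matop lam r s A U \<in> CN lam r U \<rightarrow>\<^sub>E CN lam s U"
    using U' by (auto simp: matop_def intro!: CN_I lcs_closed[OF U] CN_mem)
  fix t assume t: "t \<in> CN lam r U"
  show "matop lam r s A U (t \<oplus>\<^bsub>SM lam r U\<^esub> t') = matop lam r s A U t \<oplus>\<^bsub>SM lam s U\<^esub> matop lam r s A U t'"
    if t': "t' \<in> CN lam r U" for t'
    unfolding ap[OF t] ap[OF t'] ap[OF Model_add_closed[OF U t t']] unfolding Model_simps
    by (rule restrict_ext) (auto simp: sel_lcs sum.distrib algebra_simps intro!: sel_eqI)
  show "matop lam r s A U (P \<odot>\<^bsub>SM lam r U\<^esub> t) = P \<odot>\<^bsub>SM lam s U\<^esub> matop lam r s A U t"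
    if P: "P \<in> tdo_carrier lam U" for P
    unfolding ap[OF t] ap[OF Model_smul_closed[OF U P t]] unfolding Model_simps
    by (rule restrict_ext) (simp add: lcs_tdo[OF U P CN_mem[OF t]] cong: lcs_cong)
  fix V assume V: "V \<in> opens U"
  have V': "V \<in> opens UNIV" using opens_D(1)[OF V] by (simp add: opens_UNIV)
  have apV: "matop lam r s A V t = (\<lambda>j\<in>{..<s}. lcs r (A j) t)" if "t \<in> CN lam r V" for t
    using that V' by (simp add: matop_def)
  show "matop lam r s A V (RM lam r U V t) = RM lam s U V (matop lam r s A U t)"
    unfolding ap[OF t] apV[OF Model_res_closed[OF U V t]] unfolding Model_simps
    by (rule restrict_ext) (auto simp: sel_lcs intro!: sel_eqI)
qed (simp add: matop_def)

lemma lcs_secL: "lcs r A (\<lambda>i. secL n (a i)) = secL n (\<lambda>k. \<Sum>i<r. A i * a i k)"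
  by (induction r) (simp_all add: secL_zero secL_add secL_sm)

lemma (in trivialised) Gamma_faithful:
  assumes N: "D_module lam N" and \<alpha>: "\<alpha> \<in> dmod_hom lam M N" and \<beta>: "\<beta> \<in> dmod_hom lam M N"
    and e: "\<alpha> UNIV = \<beta> UNIV"
  shows "\<alpha> = \<beta>"
proof (rule dmod_hom_ext[OF \<alpha> \<beta>])
  interpret X: Dmod lam "Model lam r" by unfold_locales (rule Model_presheaf)
  have "(\<lambda>U\<in>opens UNIV. compose (CN lam r U) (\<alpha> U) (\<phi> U)) = (\<lambda>U\<in>opens UNIV. compose (CN lam r U) (\<beta> U) (\<phi> U))"
    by (rule Model_hom_eqI[OF lam_pos N X.dmod_hom_compose[OF hom \<alpha>] X.dmod_hom_compose[OF hom \<beta>]])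
      (simp add: opens_UNIV e)
  note eq = fun_cong[OF this]
  have c: "compose (CN lam r U) (\<alpha> U) (\<phi> U) = compose (CN lam r U) (\<beta> U) (\<phi> U)" if "zariski_open U" for U
    using that eq[of U] by (simp add: opens_UNIV)
  fix U m assume U: "zariski_open U" and m: "m \<in> CM U"
  obtain t where t: "t \<in> CN lam r U" "m = \<phi> U t" using bij[OF U] m unfolding bij_betw_def by blast
  show "\<alpha> U m = \<beta> U m" using fun_cong[OF c[OF U], of t] t by (simp add: compose_def)
qed

text \<open>In the trivialisations \<open>f\<close> becomes a homomorphism between powers of the
  standard representation, hence a constant matrix. The same matrix acts on the models over every
  open set, and conjugating back gives the required lift.\<close>

lemma Gamma_full:
  assumes M: "trivialised lam M r \<phi>" and N: "trivialised lam N s \<psi>"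
    and f: "f \<in> rep_hom (\<Gamma> lam M) (\<Gamma> lam N)"
  shows "\<exists>\<alpha>\<in>dmod_hom lam M N. \<alpha> UNIV = f"
proof -
  interpret M: trivialised lam M r \<phi> by (rule M)
  interpret N: trivialised lam N s \<psi> by (rule N)
  interpret X: Dmod lam "Model lam r" by unfold_locales (rule Model_presheaf)
  let ?n = "nat (lam - 1)" and ?U = "UNIV :: p1 set"
  have O: "?U \<in> opens UNIV" by (simp add: opens_UNIV)
  define i where "i = restrict (inv_into (carrier N.PL) N.\<theta>) (carrier (\<Gamma> lam N))"
  define f' where "f' = compose (carrier M.PL) i (compose (carrier M.PL) f M.\<theta>)"
  have f\<theta>: "compose (carrier M.PL) f M.\<theta> \<in> rep_hom M.PL (\<Gamma> lam N)"
    by (rule rep_hom_compose[OF M.PL_rep M.\<theta>_hom f])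
  have i: "i \<in> rep_hom (\<Gamma> lam N) N.PL"
    unfolding i_def by (rule rep_hom_inv(1)[OF N.PL_rep N.\<theta>_hom N.\<theta>_bij])
  have f': "f' \<in> rep_hom M.PL N.PL" unfolding f'_def by (rule rep_hom_compose[OF M.PL_rep f\<theta> i])
  have \<theta>f': "N.\<theta> (f' a) = f (M.\<theta> a)" if a: "a \<in> carrier M.PL" for a
  proof -
    have fa: "f (M.\<theta> a) \<in> carrier (\<Gamma> lam N)" by (rule rep_homD(1)[OF f rep_homD(1)[OF M.\<theta>_hom a]])
    have "f' a = inv_into (carrier N.PL) N.\<theta> (f (M.\<theta> a))" unfolding f'_def i_def using a fa by (simp add: compose_def)
    then show ?thesis using bij_betw_inv_into_right[OF N.\<theta>_bij fa] by simp
  qed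
  obtain A where A: "\<And>a. a \<in> carrier M.PL \<Longrightarrow> f' a = (\<lambda>j\<in>{..<s}. \<lambda>k. \<Sum>i<r. A j i * a i k)"
    using rep_hom_power_Lstd_matrix[OF f'] by blast
  define \<iota> where "\<iota> = (\<lambda>U\<in>opens UNIV. \<lambda>m\<in>carrier (secs M U). inv_into (CN lam r U) (\<phi> U) m)"
  have \<iota>: "\<iota> \<in> dmod_hom lam M (Model lam r)" unfolding \<iota>_def by (rule X.dmod_hom_inv[OF M.hom M.bij])
  define \<beta> where "\<beta> = (\<lambda>U\<in>opens UNIV. compose (carrier (secs M U)) (matop lam r s A U) (\<iota> U))"
  have \<beta>: "\<beta> \<in> dmod_hom lam M (Model lam s)" unfolding \<beta>_def by (rule M.dmod_hom_compose[OF \<iota> matop_hom])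
  define \<alpha> where "\<alpha> = (\<lambda>U\<in>opens UNIV. compose (carrier (secs M U)) (\<psi> U) (\<beta> U))"
  have \<alpha>: "\<alpha> \<in> dmod_hom lam M N" unfolding \<alpha>_def by (rule M.dmod_hom_compose[OF \<beta> N.hom])
  have "\<alpha> UNIV = f"
  proof (rule rep_hom_ext[OF Gamma_hom[OF \<alpha>] f])
    fix v assume v: "v \<in> carrier (\<Gamma> lam M)"
    then have "v \<in> M.\<theta> ` carrier M.PL" using M.\<theta>_bij by (simp add: bij_betw_def)
    then obtain a where a: "a \<in> carrier M.PL" and va: "v = M.\<theta> a" by (rule imageE) (rule that)
    have sa: "secpow lam r a \<in> CN lam r UNIV" using secpow_bij[OF M.lam_pos] a by (rule bij_betwE[rule_format])
    have v\<phi>: "v = \<phi> UNIV (secpow lam r a)" using a by (simp add: va M.\<theta>_def compose_def)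
    have \<iota>v: "\<iota> UNIV v = secpow lam r a"
      using O v bij_betw_inv_into_left[OF M.bij[OF zariski_open_UNIV] sa] by (simp add: \<iota>_def v\<phi> global_sections_simps)
    have f'a: "f' a \<in> carrier N.PL" by (rule rep_homD(1)[OF f' a])
    have "matop lam r s A UNIV (secpow lam r a) = (\<lambda>j\<in>{..<s}. lcs r (A j) (secpow lam r a))"
      using O sa by (simp add: matop_def)
    also have "\<dots> = secpow lam s (f' a)"
    proof -
      have "secpow lam s (f' a) = (\<lambda>j\<in>{..<s}. secL ?n (f' a j))" using f'a by (simp add: secpow_def)
      also have "\<dots> = (\<lambda>j\<in>{..<s}. lcs r (A j) (secpow lam r a))"
      proof (rule restrict_ext)
        fix j assume j: "j \<in> {..<s}"
        have "lcs r (A j) (secpow lam r a) = lcs r (A j) (\<lambda>i. secL ?n (a i))"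
          by (rule lcs_cong) (use a in \<open>simp add: secpow_def\<close>)
        then show "secL ?n (f' a j) = lcs r (A j) (secpow lam r a)" using j by (simp add: A[OF a] lcs_secL)
      qed
      finally show ?thesis by simp
    qed
    finally have "\<beta> UNIV v = secpow lam s (f' a)"
      using O v \<iota>v by (simp add: \<beta>_def compose_def global_sections_simps)
    then have "\<alpha> UNIV v = N.\<theta> (f' a)"
      using O v f'a by (simp add: \<alpha>_def N.\<theta>_def compose_def global_sections_simps)
    then show "\<alpha> UNIV v = f v" by (simp add: \<theta>f'[OF a] va)
  qed
  then show ?thesis using \<alpha> by blast
qed

subsection \<open>Essential surjectivity\<close>

lemma rep_power_map:
  assumes V: "sl2_rep V" and f: "f \<in> rep_hom V W" and b: "bij_betw f (carrier V) (carrier W)"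
  shows "\<exists>g\<in>rep_hom (rep_power m V) (rep_power m W). bij_betw g (carrier (rep_power m V)) (carrier (rep_power m W))"
proof -
  let ?P = "rep_power m V" and ?Q = "rep_power m W"
  define g where "g = (\<lambda>a\<in>carrier ?P. \<lambda>i\<in>{..<m}. f (a i))"
  have P: "sl2_rep ?P" by (rule sl2_rep_power[OF V])
  note mem = rep_power_mem[of _ m V]
  have ga: "g a = (\<lambda>i\<in>{..<m}. f (a i))" if "a \<in> carrier ?P" for a using that by (simp add: g_def)
  have gQ: "g a \<in> carrier ?Q" if a: "a \<in> carrier ?P" for a
    unfolding ga[OF a] by (rule rep_power_I) (rule rep_homD(1)[OF f mem[OF a]])
  have "g \<in> rep_hom ?P ?Q"
  proof (rule rep_homI)
    show "g \<in> carrier ?P \<rightarrow>\<^sub>E carrier ?Q" using gQ by (auto simp: g_def)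
    fix a assume a: "a \<in> carrier ?P"
    show "g (a \<oplus>\<^bsub>?P\<^esub> b) = g a \<oplus>\<^bsub>?Q\<^esub> g b" if b: "b \<in> carrier ?P" for b
      unfolding ga[OF a] ga[OF b] ga[OF sl2_closed(1)[OF P a b]] unfolding rep_power_simps
      by (rule restrict_ext) (simp add: rep_homD(2)[OF f mem[OF a] mem[OF b]])
    show "g (c \<odot>\<^bsub>?P\<^esub> a) = c \<odot>\<^bsub>?Q\<^esub> g a" for c
      unfolding ga[OF a] ga[OF sl2_closed(2)[OF P a]] unfolding rep_power_simps
      by (rule restrict_ext) (simp add: rep_homD(3)[OF f mem[OF a]])
    show "g (act ?P x a) = act ?Q x (g a)" for x
      unfolding ga[OF a] ga[OF sl2_closed(3)[OF P a]] unfolding rep_power_simps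
      by (rule restrict_ext) (simp add: rep_homD(4)[OF f mem[OF a]])
  qed
  moreover have "bij_betw g (carrier ?P) (carrier ?Q)"
    unfolding bij_betw_def
  proof
    show "inj_on g (carrier ?P)"
    proof (rule inj_onI)
      fix a b assume a: "a \<in> carrier ?P" and c: "b \<in> carrier ?P" and e: "g a = g b"
      show "a = b"
      proof (rule rep_power_ext[OF a c])
        fix i assume i: "i < m"
        have "f (a i) = f (b i)" using fun_cong[OF e, of i] i by (simp add: ga[OF a] ga[OF c])
        then show "a i = b i" using b mem[OF a i] mem[OF c i] by (auto simp: bij_betw_def inj_on_def)
      qed
    qed
    have "c \<in> g ` carrier ?P" if c: "c \<in> carrier ?Q" for c
    proof -
      define a where "a = (\<lambda>i\<in>{..<m}. inv_into (carrier V) f (c i))"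
      have inv: "f (inv_into (carrier V) f (c i)) = c i" "inv_into (carrier V) f (c i) \<in> carrier V" if "i < m" for i
        using bij_betw_inv_into_right[OF b rep_power_mem[OF c that]] bij_betw_inv_into[OF b] rep_power_mem[OF c that]
        by (auto simp: bij_betw_def)
      have a: "a \<in> carrier ?P" unfolding a_def by (rule rep_power_I) (rule inv(2))
      have "c = g a" by (rule rep_power_ext[OF c gQ[OF a]]) (simp add: ga[OF a], simp add: a_def inv)
      then show ?thesis using a by (rule image_eqI)
    qed
    then show "g ` carrier ?P = carrier ?Q" using gQ by blast
  qed
  ultimately show ?thesis by blast
qed

text \<open>The irreducible representation named by \<open>sum_of_irrep\<close> is replaced by the
  standard one through \<open>irreducible_unique\<close>; the model of the same rank is copied into
  the type of \<open>V\<close>.\<close>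

lemma Gamma_essentially_surjective:
  fixes V :: "'v sl2rep"
  assumes lam: "lam > 0" and V: "sl2_rep V" and sV: "sum_of_irrep lam V"
  shows "\<exists>(M :: 'v dmod) i. D_module lam M \<and> O_coherent_on lam M UNIV \<and>
    i \<in> rep_hom (\<Gamma> lam M) V \<and> bij_betw i (carrier (\<Gamma> lam M)) (carrier V)"
proof -
  let ?L = "Lstd (nat (lam - 1))"
  have nl: "of_int (lam - 1) = (of_nat (nat (lam - 1)) :: complex)" using lam by simp
  obtain L' :: "(nat \<Rightarrow> complex) sl2rep" and m g where L': "irreducible_rep L'" "has_highest_weight L' (of_nat (nat (lam - 1)))"
    and g: "g \<in> rep_hom V (rep_power m L')" "bij_betw g (carrier V) (carrier (rep_power m L'))"
    using sV unfolding sum_of_irrep_def rep_isomorphic_def nl by blast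
  let ?P = "rep_power m ?L"
  have P: "sl2_rep ?P" by (rule sl2_rep_power[OF Lstd_rep])
  obtain h where h: "h \<in> rep_hom ?L L'" "bij_betw h (carrier ?L) (carrier L')"
    using irreducible_unique[OF L'] by blast
  obtain k where k: "k \<in> rep_hom ?P (rep_power m L')" "bij_betw k (carrier ?P) (carrier (rep_power m L'))"
    using rep_power_map[OF Lstd_rep h, of m] by blast
  define l where "l = compose (carrier ?P) (restrict (inv_into (carrier V) g) (carrier (rep_power m L'))) k"
  have l: "l \<in> rep_hom ?P V" unfolding l_def by (rule rep_hom_compose[OF P k(1) rep_hom_inv(1)[OF V g]])
  have lb: "bij_betw l (carrier ?P) (carrier V)"
    unfolding l_def by (rule bij_betw_compose[OF k(2) rep_hom_inv(2)[OF V g]])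
  \<comment> \<open>Embeds the complex numbers into the type of \<open>V\<close> along a line, the
    multiples of \<open>ebas 0\<close> repeated in all \<open>m\<close> components; for
    \<open>m > 0\<close> this is injective.\<close>
  define w where "w = (\<lambda>c. l (\<lambda>i\<in>{..<m}. \<lambda>k. c * ebas 0 k))"
  have w: "m = 0 \<or> inj w"
  proof (cases "m = 0")
    case False
    have "inj w"
    proof (rule injI)
      fix c d assume e: "w c = w d"
      have "(\<lambda>i\<in>{..<m}. \<lambda>k. c * ebas 0 k) \<in> carrier ?P" for c by (rule rep_power_I) (simp add: ebas_def)
      then have "(\<lambda>i\<in>{..<m}. \<lambda>k. c * ebas 0 k) = (\<lambda>i\<in>{..<m}. \<lambda>k. d * ebas 0 k)"
        using e lb unfolding w_def bij_betw_def inj_on_def by blast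
      then have "(\<lambda>i\<in>{..<m}. \<lambda>k. c * ebas 0 k) 0 0 = (\<lambda>i\<in>{..<m}. \<lambda>k. d * ebas 0 k) 0 0" by (simp only:)
      then show "c = d" using False by (simp add: ebas_def)
    qed
    then show ?thesis ..
  qed simp
  obtain M :: "'v dmod" and f where iso: "dmod_iso lam (Model lam m) M f" and M: "D_module lam M" "O_coherent_on lam M UNIV"
    using ex_coherent_copy[OF lam w] by blast
  interpret I: dmod_iso lam "Model lam m" M f by (rule iso)
  interpret Omod lam M by (rule Omod_I[OF lam M])
  \<comment> \<open>\<open>f\<close> made undefined off the open sets and the carriers, as
    \<open>dmod_hom\<close> requires.\<close>
  define \<phi> where "\<phi> = (\<lambda>U\<in>opens UNIV. \<lambda>t\<in>CN lam m U. f U t)"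
  have \<phi>: "\<phi> U t = f U t" if "zariski_open U" "t \<in> CN lam m U" for U t using that by (simp add: \<phi>_def opens_UNIV)
  interpret T: trivialised lam M m \<phi>
  proof
    show "bij_betw (\<phi> U) (CN lam m U) (CM U)" if U: "zariski_open U" for U
      by (rule iffD2[OF bij_betw_cong I.bij[OF U]]) (rule \<phi>[OF U])
    show "\<phi> \<in> dmod_hom lam (Model lam m) M"
    proof (rule dmod_homI)
      fix U assume U: "zariski_open U"
      have fC: "f U t \<in> CM U" if "t \<in> CN lam m U" for t using that I.carrier_eq[OF U] by simp
      show "\<phi> U \<in> CN lam m U \<rightarrow>\<^sub>E CM U" using U fC by (auto simp: \<phi>_def opens_UNIV)
      fix t assume t: "t \<in> CN lam m U"
      show "\<phi> U (t \<oplus>\<^bsub>SM lam m U\<^esub> t') = \<phi> U t \<oplus>\<^bsub>secs M U\<^esub> \<phi> U t'" if t': "t' \<in> CN lam m U" for t'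
        by (simp only: \<phi>[OF U t] \<phi>[OF U t'] \<phi>[OF U Model_add_closed[OF U t t']] I.f_add[OF U t t'])
      show "\<phi> U (P \<odot>\<^bsub>SM lam m U\<^esub> t) = P \<odot>\<^bsub>secs M U\<^esub> \<phi> U t" if P: "P \<in> tdo_carrier lam U" for P
        by (simp only: \<phi>[OF U t] \<phi>[OF U Model_smul_closed[OF U P t]] I.f_smul[OF U P t])
      show "\<phi> V (RM lam m U V t) = res M U V (\<phi> U t)" if W: "V \<in> opens U" for V
        by (simp only: \<phi>[OF U t] \<phi>[OF opens_D(1)[OF W] Model_res_closed[OF U W t]] I.f_res[OF U W t])
    qed (simp add: \<phi>_def)
  qed
  define i where "i = compose (carrier (\<Gamma> lam M)) l
    (restrict (inv_into (carrier ?P) T.\<theta>) (carrier (\<Gamma> lam M)))"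
  have "i \<in> rep_hom (\<Gamma> lam M) V"
    unfolding i_def by (rule rep_hom_compose[OF T.Gamma_rep rep_hom_inv(1)[OF P T.\<theta>_hom T.\<theta>_bij] l])
  moreover have "bij_betw i (carrier (\<Gamma> lam M)) (carrier V)"
    unfolding i_def by (rule bij_betw_compose[OF rep_hom_inv(2)[OF P T.\<theta>_hom T.\<theta>_bij] lb])
  ultimately show ?thesis using M by blast
qed

subsection \<open>The equivalence\<close>

lemma is_category_full_subcat: "is_category C \<Longrightarrow> is_category (full_subcat C P)"
  unfolding is_category_def full_subcat_def by simp

lemma Mod_sl2_simps:
  "V \<in> cob (Mod_sl2 lam) \<longleftrightarrow> sl2_rep V \<and> has_central_character lam V" "chom (Mod_sl2 lam) = rep_hom"
  "cid (Mod_sl2 lam) V = (\<lambda>v\<in>carrier V. v)" "ccomp (Mod_sl2 lam) U V W g f = compose (carrier U) g f"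
  by (simp_all add: Mod_sl2_def)

lemma is_category_Mod_sl2: "is_category (Mod_sl2 lam)"
proof (rule is_categoryI, unfold Mod_sl2_simps, elim conjE)
  show "(\<lambda>v\<in>carrier U. v) \<in> rep_hom U U" if "sl2_rep U" for U :: "'v sl2rep" using that by (rule rep_hom_id)
next
  fix U V W :: "'v sl2rep" and f g assume U: "sl2_rep U \<and> has_central_character lam U" and f: "f \<in> rep_hom U V"
  show "compose (carrier U) g f \<in> rep_hom U W" if "g \<in> rep_hom V W"
    using rep_hom_compose[OF _ f that] U by simp
  assume V: "sl2_rep V \<and> has_central_character lam V"
  show "compose (carrier U) f (\<lambda>v\<in>carrier U. v) = f"
    by (rule rep_hom_ext[OF rep_hom_compose[OF _ rep_hom_id f] f]) (use U in \<open>auto simp: compose_def\<close>)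
  show "compose (carrier U) (\<lambda>v\<in>carrier V. v) f = f"
    by (rule rep_hom_ext[OF rep_hom_compose[OF _ f rep_hom_id] f]) (use U V rep_homD(1)[OF f] in \<open>auto simp: compose_def\<close>)
  fix h
  show "compose (carrier U) (compose (carrier V) h g) f = compose (carrier U) h (compose (carrier U) g f)"
    using rep_homD(1)[OF f] by (auto simp: compose_def fun_eq_iff)
qed

lemma Mod_qc_simps:
  "M \<in> cob (Mod_qc lam) \<longleftrightarrow> D_module lam M \<and> quasi_coherent lam M" "chom (Mod_qc lam) = dmod_hom lam"
  "cid (Mod_qc lam) M = (\<lambda>U\<in>opens UNIV. \<lambda>m\<in>carrier (secs M U). m)"
  "ccomp (Mod_qc lam) L M N \<psi> \<phi> = (\<lambda>U\<in>opens UNIV. compose (carrier (secs L U)) (\<psi> U) (\<phi> U))"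
  by (simp_all add: Mod_qc_def)

lemma is_category_Mod_qc: "is_category (Mod_qc lam)"
proof (rule is_categoryI, unfold Mod_qc_simps)
  fix L :: "'v dmod" assume L: "D_module lam L \<and> quasi_coherent lam L"
  interpret L: Dmod lam L by unfold_locales (use L in \<open>simp add: D_module_def\<close>)
  show "(\<lambda>U\<in>opens UNIV. \<lambda>m\<in>carrier (secs L U). m) \<in> dmod_hom lam L L" by (rule L.dmod_hom_id)
  fix M :: "'v dmod" and f assume M: "D_module lam M \<and> quasi_coherent lam M" and f: "f \<in> dmod_hom lam L M"
  interpret M: Dmod lam M by unfold_locales (use M in \<open>simp add: D_module_def\<close>)
  show "(\<lambda>U\<in>opens UNIV. compose (carrier (secs L U)) (f U) ((\<lambda>U\<in>opens UNIV. \<lambda>m\<in>carrier (secs L U). m) U)) = f"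
    by (rule dmod_hom_ext[OF L.dmod_hom_compose[OF L.dmod_hom_id f] f]) (auto simp: compose_def opens_UNIV)
  show "(\<lambda>U\<in>opens UNIV. compose (carrier (secs L U)) ((\<lambda>U\<in>opens UNIV. \<lambda>m\<in>carrier (secs M U). m) U) (f U)) = f"
    by (rule dmod_hom_ext[OF L.dmod_hom_compose[OF f M.dmod_hom_id] f]) (auto simp: compose_def opens_UNIV dmod_homD(1)[OF f])
  fix N :: "'v dmod" and g
  show "(\<lambda>U\<in>opens UNIV. compose (carrier (secs L U)) (g U) (f U)) \<in> dmod_hom lam L N" if "g \<in> dmod_hom lam M N"
    by (rule L.dmod_hom_compose[OF f that])
  fix h
  show "(\<lambda>U\<in>opens UNIV. compose (carrier (secs L U)) ((\<lambda>U\<in>opens UNIV. compose (carrier (secs M U)) (h U) (g U)) U) (f U)) =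
      (\<lambda>U\<in>opens UNIV. compose (carrier (secs L U)) (h U) ((\<lambda>U\<in>opens UNIV. compose (carrier (secs L U)) (g U) (f U)) U))"
    by (rule restrict_ext) (auto simp: compose_def fun_eq_iff opens_UNIV dmod_homD(1)[OF f])
qed

lemma is_iso_Mod_sl2I:
  assumes V: "sl2_rep V" and f: "f \<in> rep_hom V W" "bij_betw f (carrier V) (carrier W)"
  shows "is_iso (full_subcat (Mod_sl2 lam) P) V W f"
proof -
  have "compose (carrier V) (restrict (inv_into (carrier V) f) (carrier W)) f = (\<lambda>v\<in>carrier V. v)"
    by (rule compose_inv_into_id[OF f(2)])
  moreover have "compose (carrier W) f (restrict (inv_into (carrier V) f) (carrier W)) = (\<lambda>v\<in>carrier W. v)"
    by (rule compose_id_inv_into) (use f(2) in \<open>simp add: bij_betw_def\<close>)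
  ultimately show ?thesis
    unfolding is_iso_def full_subcat_def using f(1) rep_hom_inv(1)[OF V f] by (auto simp: Mod_sl2_simps)
qed

theorem theorem4p1:
  fixes lam :: int
  assumes "lam > 0"
  shows "is_equivalence
    (full_subcat (Mod_qc lam :: ('v dmod, p1 set \<Rightarrow> 'v \<Rightarrow> 'v) cat)
       (\<lambda>M. O_coherent_on lam M UNIV \<and> (\<forall>p. \<not> singularity lam M p)))
    (full_subcat (Mod_sl2 lam :: ('v sl2rep, 'v \<Rightarrow> 'v) cat) (sum_of_irrep lam))
    (Gamma_functor lam)" (is "is_equivalence ?C ?D ?F")
proof (rule is_equivalenceI)
  have C: "M \<in> cob ?C \<longleftrightarrow> D_module lam M \<and> O_coherent_on lam M UNIV" for M
  proof -
    have "quasi_coherent lam M \<and> (\<forall>p. \<not> singularity lam M p)" if "O_coherent_on lam M UNIV"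
      using that unfolding quasi_coherent_def singularity_def O_coherent_on_def by (auto intro!: exI[of _ UNIV])
    then show ?thesis by (auto simp: full_subcat_def Mod_qc_simps)
  qed
  have D: "V \<in> cob ?D \<longleftrightarrow> sl2_rep V \<and> has_central_character lam V \<and> sum_of_irrep lam V" for V
    by (auto simp: full_subcat_def Mod_sl2_simps)
  have cd [simp]: "chom ?C = dmod_hom lam" "chom ?D = rep_hom"
    "cid ?C M = (\<lambda>U\<in>opens UNIV. \<lambda>m\<in>carrier (secs M U). m)"
    "ccomp ?C L M N \<psi> \<phi> = (\<lambda>U\<in>opens UNIV. compose (carrier (secs L U)) (\<psi> U) (\<phi> U))"
    "cid ?D V = (\<lambda>v\<in>carrier V. v)" "ccomp ?D U V W g f = compose (carrier U) g f" for L M N \<psi> \<phi> U V W g f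
    by (simp_all add: full_subcat_def Mod_qc_simps Mod_sl2_simps)
  have F [simp]: "fob ?F = \<Gamma> lam" "far ?F M N \<phi> = \<phi> UNIV" for M N :: "'v dmod" and \<phi>
    by (simp_all add: Gamma_functor_def)
  have triv: "\<exists>r \<phi>. trivialised lam M r \<phi>" if "M \<in> cob ?C" for M
    using Omod.ex_trivialised[OF Omod_I[OF assms]] that unfolding C by blast
  show "is_category ?C" by (rule is_category_full_subcat[OF is_category_Mod_qc])
  show "is_category ?D" by (rule is_category_full_subcat[OF is_category_Mod_sl2])
  have ob: "\<Gamma> lam M \<in> cob ?D" if M: "M \<in> cob ?C" for M
  proof -
    obtain r \<phi> where "trivialised lam M r \<phi>" using triv[OF M] by blast
    then interpret trivialised lam M r \<phi> .
    show ?thesis unfolding D using Gamma_rep Gamma_central Gamma_sum by blast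
  qed
  show "is_functor ?C ?D ?F"
    unfolding is_functor_def
    by (intro conjI ballI; simp add: ob Gamma_hom opens_UNIV global_sections_simps restrict_def)
  show "bij_betw (far ?F M N) (chom ?C M N) (chom ?D (fob ?F M) (fob ?F N))"
    if M: "M \<in> cob ?C" and N: "N \<in> cob ?C" for M N
  proof -
    obtain r \<phi> s \<psi> where t: "trivialised lam M r \<phi>" "trivialised lam N s \<psi>" using triv[OF M] triv[OF N] by blast
    have "D_module lam N" using N unfolding C by blast
    then have "inj_on (far ?F M N) (dmod_hom lam M N)"
      by (auto intro!: inj_onI trivialised.Gamma_faithful[OF t(1)])
    moreover have "f \<in> far ?F M N ` dmod_hom lam M N" if "f \<in> rep_hom (\<Gamma> lam M) (\<Gamma> lam N)" for f
      using Gamma_full[OF t that] by (auto simp: image_iff)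
    ultimately show ?thesis unfolding bij_betw_def using Gamma_hom by auto
  qed
  fix V :: "'v sl2rep" assume "V \<in> cob ?D"
  then have V: "sl2_rep V" "sum_of_irrep lam V" unfolding D by auto
  obtain M :: "'v dmod" and i where M: "D_module lam M" "O_coherent_on lam M UNIV"
    and i: "i \<in> rep_hom (\<Gamma> lam M) V" "bij_betw i (carrier (\<Gamma> lam M)) (carrier V)"
    using Gamma_essentially_surjective[OF assms V] by blast
  have MC: "M \<in> cob ?C" unfolding C using M by blast
  have "sl2_rep (\<Gamma> lam M)" using ob[OF MC] unfolding D by blast
  from is_iso_Mod_sl2I[OF this i] have "is_iso ?D (fob ?F M) V i" by simp
  then show "\<exists>M\<in>cob ?C. \<exists>i. is_iso ?D (fob ?F M) V i" using MC by blast
qed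

end
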